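(* Let $\mathbf{u}\in H^1_0(\Omega,\Sigma_k)$ be a minimizer of problem (P), let $\Lambda:=(\lambda_{2,1}(\{u_1>0\}),\dots,\lambda_{2,1}(\{u_k>0\}))$, and let $K\subset\Omega$ be compact. There exist $C>0$ and $r_0>0$ such that, for every $x_0\in Z(\mathbf{u})\cap K$ and every $r\in(0,r_0)$, $$\int_{B_r(x_0)}\Big(|\nabla\mathbf{u}|^2-2(\Lambda\cdot\mathbf{u})\Big)\,dx\le\int_{B_r(x_0)}\Big(|\nabla\mathbf{w}|^2-2(\Lambda\cdot\mathbf{w})\Big)\,dx+Cr^{2N+1}$$ for every $\mathbf{w}\in H^1(B_r(x_0),\Sigma_k)$ such that $\mathbf{w}=\mathbf{u}$ on $\partial B_r(x_0)$.
   Context: $N\ge 2$, $\Omega\subset\mathbb{R}^N$ is a bounded smooth domain, $k\in\mathbb{N}$, $k\ge1$. For an open non-empty set $\omega\subset\Omega$, $\lambda_{2,1}(\omega):=\inf\{\int_\omega|\nabla u|^2\,dx \mid u\in H^1_0(\omega),\ \|u\|_{L^1(\omega)}=1\}$. $\Sigma_k:=\{\xi\in\mathbb{R}^k\mid\sum_{i\ne j}\xi_i^2\xi_j^2=0\}$; for an open set $A$, $H^1(A,\Sigma_k)$ (resp. $H^1_0(A,\Sigma_k)$) is the set of $\mathbf{u}\in H^1(A,\mathbb{R}^k)$ (resp. $H^1_0(A,\mathbb{R}^k)$) with $\mathbf{u}(x)\in\Sigma_k$ for a.e. $x\in A$. Problem (P) is $$\inf\Big\{\int_\Omega|\nabla\mathbf{u}|^2\,dx\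 \Big|\ \mathbf{u}\in H^1_0(\Omega,\Sigma_k),\ \mathbf{u}\ge0,\ \|u_i\|_{L^1(\Omega)}=1\text{ for every }i=1,\dots,k\Big\},$$ where $|\nabla\mathbf{u}|^2=\sum_i|\nabla u_i|^2$ and $\mathbf{u}\ge0$ is meant componentwise; minimizers are identified with their continuous representatives (they are Lipschitz continuous in $\overline\Omega$). $Z(\mathbf{u}):=\{\mathbf{u}=0\}\cap\Omega$, and $\Lambda\cdot\mathbf{u}=\sum_i\Lambda_iu_i$. Equality on $\partial B_r(x_0)$ is in the sense of traces. *)

theory Defs
  imports "HOL-Analysis.Analysis"
begin

section \<open>Smooth functions, smooth domains\<close>

text \<open>\<open>Ck_on n S f\<close>: \<open>f\<close> is of class \<open>C^n\<close> on the open set \<open>S\<close>. Partial derivatives are the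
  derivatives along the vectors of \<^const>\<open>Basis\<close>.\<close>

fun Ck_on :: "nat \<Rightarrow> 'a::euclidean_space set \<Rightarrow> ('a \<Rightarrow> real) \<Rightarrow> bool" where
  "Ck_on 0 S f \<longleftrightarrow> continuous_on S f"
| "Ck_on (Suc n) S f \<longleftrightarrow>
     (\<forall>x\<in>S. f differentiable (at x)) \<and>
     (\<forall>i\<in>Basis. Ck_on n S (\<lambda>x. frechet_derivative f (at x) i))"

definition smooth :: "('a::euclidean_space \<Rightarrow> real) \<Rightarrow> bool" where
  "smooth f \<longleftrightarrow> (\<forall>n. Ck_on n UNIV f)"

definition test_functions :: "'a::euclidean_space set \<Rightarrow> ('a \<Rightarrow> real) set" where
  "test_functions A =
     {\<phi>. smooth \<phi> \<and> compact (closure {x. \<phi> x \<noteq> 0}) \<and> closure {x. \<phi> x \<noteq> 0} \<subseteq> A}"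

text \<open>Near each boundary point the domain is the strict epigraph, in direction \<open>e\<close>, of a smooth
  function of the orthogonal projection of \<open>x\<close> to the hyperplane perpendicular to \<open>e\<close>.\<close>

definition bounded_smooth_domain :: "'a::euclidean_space set \<Rightarrow> bool" where
  "bounded_smooth_domain \<Omega> \<longleftrightarrow>
     open \<Omega> \<and> connected \<Omega> \<and> bounded \<Omega> \<and> \<Omega> \<noteq> {} \<and>
     (\<forall>p\<in>frontier \<Omega>. \<exists>\<rho>>0. \<exists>e \<gamma>. norm e = 1 \<and> smooth \<gamma> \<and>
        \<Omega> \<inter> ball p \<rho> = {x \<in> ball p \<rho>. x \<bullet> e > \<gamma> (x - (x \<bullet> e) *\<^sub>R e)})"

section \<open>Sobolev spaces\<close>

definition locally_integrable_on ::
    "('a::euclidean_space \<Rightarrow> 'b::euclidean_space) \<Rightarrow> 'a set \<Rightarrow> bool" where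
  "locally_integrable_on f A \<longleftrightarrow> (\<forall>K. compact K \<and> K \<subseteq> A \<longrightarrow> integrable (lebesgue_on K) f)"

definition weak_gradient_on ::
    "'a::euclidean_space set \<Rightarrow> ('a \<Rightarrow> real) \<Rightarrow> ('a \<Rightarrow> 'a) \<Rightarrow> bool" where
  "weak_gradient_on A f g \<longleftrightarrow>
     locally_integrable_on f A \<and> locally_integrable_on g A \<and>
     (\<forall>\<phi>\<in>test_functions A. \<forall>i\<in>Basis.
        (LINT x|lebesgue_on A. f x * frechet_derivative \<phi> (at x) i) =
        - (LINT x|lebesgue_on A. (g x \<bullet> i) * \<phi> x))"

definition square_integrable_on ::
    "('a::euclidean_space \<Rightarrow> 'b::euclidean_space) \<Rightarrow> 'a set \<Rightarrow> bool" where
  "square_integrable_on f A \<longleftrightarrow>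
     f \<in> borel_measurable (lebesgue_on A) \<and> integrable (lebesgue_on A) (\<lambda>x. (norm (f x))\<^sup>2)"

text \<open>Elements of the Sobolev spaces are functions rather than classes; only their values on \<open>A\<close>
  matter. The weak gradient is unique up to a null subset of \<open>A\<close>, so the choice made by \<open>grad\<close> is
  immaterial under integrals over subsets of \<open>A\<close>.\<close>

definition grad :: "'a::euclidean_space set \<Rightarrow> ('a \<Rightarrow> real) \<Rightarrow> 'a \<Rightarrow> 'a" where
  "grad A f = (SOME g. weak_gradient_on A f g)"

definition H1 :: "'a::euclidean_space set \<Rightarrow> ('a \<Rightarrow> real) set" where
  "H1 A = {f. square_integrable_on f A \<and>
              (\<exists>g. weak_gradient_on A f g \<and> square_integrable_on g A)}"

definition H1_norm :: "'a::euclidean_space set \<Rightarrow> ('a \<Rightarrow> real) \<Rightarrow> real" where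
  "H1_norm A f =
     sqrt ((LINT x|lebesgue_on A. (f x)\<^sup>2) + (LINT x|lebesgue_on A. (norm (grad A f x))\<^sup>2))"

definition H10 :: "'a::euclidean_space set \<Rightarrow> ('a \<Rightarrow> real) set" where
  "H10 A = {f \<in> H1 A. \<exists>\<phi>. (\<forall>n. \<phi> n \<in> test_functions A) \<and>
                         (\<lambda>n. H1_norm A (\<lambda>x. \<phi> n x - f x)) \<longlonglongrightarrow> 0}"

section \<open>Traces on spheres\<close>

text \<open>Surface measure on \<open>\<partial>B\<^sub>r(x\<^sub>0)\<close>: the area of a set \<open>E\<close> is \<open>N/r\<close> times the volume of the cone
  over \<open>E\<close> with apex \<open>x\<^sub>0\<close>. It is a Borel measure on the whole space, concentrated on the sphere
  (\<open>sgn y = y / norm y\<close>; the centre of the ball is a null set).\<close>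

definition sphere_measure :: "'a::euclidean_space \<Rightarrow> real \<Rightarrow> 'a measure" where
  "sphere_measure x0 r =
     scale_measure (ennreal (real DIM('a) / r))
       (distr (lebesgue_on (ball x0 r)) borel (\<lambda>x. x0 + r *\<^sub>R sgn (x - x0)))"

text \<open>The trace operator is the continuous extension to \<open>H1\<close> of the restriction map
  \<open>\<phi> \<mapsto> \<phi>|\<^bsub>\<partial>B\<^esub>\<close>, with values in \<open>L\<^sup>2(\<partial>B)\<close>, from functions that are smooth up to the boundary.\<close>

definition has_trace ::
    "'a::euclidean_space \<Rightarrow> real \<Rightarrow> ('a \<Rightarrow> real) \<Rightarrow> ('a \<Rightarrow> real) \<Rightarrow> bool" where
  "has_trace x0 r f g \<longleftrightarrow>
     g \<in> borel_measurable (sphere_measure x0 r) \<and>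
     integrable (sphere_measure x0 r) (\<lambda>x. (g x)\<^sup>2) \<and>
     (\<exists>\<phi>. (\<forall>n. smooth (\<phi> n)) \<and>
          (\<lambda>n. H1_norm (ball x0 r) (\<lambda>x. \<phi> n x - f x)) \<longlonglongrightarrow> 0 \<and>
          (\<lambda>n. LINT x|sphere_measure x0 r. (\<phi> n x - g x)\<^sup>2) \<longlonglongrightarrow> 0)"

definition same_trace ::
    "'a::euclidean_space \<Rightarrow> real \<Rightarrow> ('a \<Rightarrow> real ^ 'k) \<Rightarrow> ('a \<Rightarrow> real ^ 'k) \<Rightarrow> bool" where
  "same_trace x0 r v w \<longleftrightarrow>
     (\<forall>i. \<exists>g. has_trace x0 r (\<lambda>x. v x $ i) g \<and> has_trace x0 r (\<lambda>x. w x $ i) g)"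

section \<open>The segregated minimization problem\<close>

definition Sigma_k :: "(real ^ 'k) set" where
  "Sigma_k = {\<xi>. (\<Sum>(i, j)\<in>{(i, j). i \<noteq> j}. (\<xi> $ i)\<^sup>2 * (\<xi> $ j)\<^sup>2) = 0}"

definition H1_Sigma :: "'a::euclidean_space set \<Rightarrow> ('a \<Rightarrow> real ^ 'k) set" where
  "H1_Sigma A = {u. (\<forall>i. (\<lambda>x. u x $ i) \<in> H1 A) \<and> (AE x in lebesgue_on A. u x \<in> Sigma_k)}"

definition H10_Sigma :: "'a::euclidean_space set \<Rightarrow> ('a \<Rightarrow> real ^ 'k) set" where
  "H10_Sigma A = {u. (\<forall>i. (\<lambda>x. u x $ i) \<in> H10 A) \<and> (AE x in lebesgue_on A. u x \<in> Sigma_k)}"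

definition grad_sq :: "'a::euclidean_space set \<Rightarrow> ('a \<Rightarrow> real ^ 'k) \<Rightarrow> 'a \<Rightarrow> real" where
  "grad_sq A u x = (\<Sum>i\<in>UNIV. (norm (grad A (\<lambda>y. u y $ i) x))\<^sup>2)"

definition lambda21 :: "'a::euclidean_space set \<Rightarrow> real" where
  "lambda21 \<omega> =
     Inf {LINT x|lebesgue_on \<omega>. (norm (grad \<omega> v x))\<^sup>2 |v.
            v \<in> H10 \<omega> \<and> (LINT x|lebesgue_on \<omega>. \<bar>v x\<bar>) = 1}"

definition admissible_P :: "'a::euclidean_space set \<Rightarrow> ('a \<Rightarrow> real ^ 'k) set" where
  "admissible_P \<Omega> =
     {u \<in> H10_Sigma \<Omega>. (\<forall>i. AE x in lebesgue_on \<Omega>. 0 \<le> u x $ i) \<and>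
                      (\<forall>i. (LINT x|lebesgue_on \<Omega>. \<bar>u x $ i\<bar>) = 1)}"

definition minimizer_P :: "'a::euclidean_space set \<Rightarrow> ('a \<Rightarrow> real ^ 'k) \<Rightarrow> bool" where
  "minimizer_P \<Omega> u \<longleftrightarrow>
     u \<in> admissible_P \<Omega> \<and>
     (\<forall>v\<in>(admissible_P \<Omega> :: ('a \<Rightarrow> real ^ 'k) set).
        (LINT x|lebesgue_on \<Omega>. grad_sq \<Omega> u x) \<le> (LINT x|lebesgue_on \<Omega>. grad_sq \<Omega> v x))"

definition zero_set :: "'a::euclidean_space set \<Rightarrow> ('a \<Rightarrow> real ^ 'k) \<Rightarrow> 'a set" where
  "zero_set \<Omega> u = {x \<in> \<Omega>. u x = 0}"

end

theory Submission
  imports Defs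
begin

text \<open>
  Let \<open>E\<^sub>i = \<integral>|\<nabla>u\<^sub>i|\<^sup>2\<close>, which is \<open>\<lambda>\<^sub>2\<^sub>,\<^sub>1({u\<^sub>i > 0})\<close>. Perturbing the minimizer gives the
  Euler--Lagrange equation \<open>-\<Delta>u\<^sub>i = E\<^sub>i\<close> on \<open>{u\<^sub>i > 0}\<close> and, on all of \<open>\<Omega>\<close>, \<open>-\<Delta>u\<^sub>i \<le> E\<^sub>i\<close> and
  \<open>-\<Delta>(u\<^sub>i - \<Sum>\<^bsub>j\<noteq>i\<^esub> u\<^sub>j) \<ge> -\<Sum>\<^sub>j E\<^sub>j\<close>.

  Given \<open>w\<close> with the trace of \<open>u\<close> on \<open>\<partial>B\<^sub>r\<close>, let \<open>W\<close> be \<open>w\<close> inside and \<open>u\<close> outside the ball, and let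
  \<open>\<phi>\<^sub>i \<ge> 0\<close> be test functions in \<open>{u\<^sub>i > 0}\<close> of mass 1, fixed once and for all and far from the ball. With
  \<open>\<delta>\<^sub>i = \<integral>\<^bsub>B\<^esub> (|w\<^sub>i| - u\<^sub>i)\<close>, the functions \<open>|W\<^sub>i - \<delta>\<^sub>i \<phi>\<^sub>i|\<close> have mass at least 1, and the Euler--Lagrange
  equation turns minimality into \<open>J(u) \<le> J(w) + C \<Sum> \<delta>\<^sub>i\<^sup>2\<close> for the localized functional \<open>J\<close>. By the
  Poincare inequality \<open>\<delta>\<^sub>i\<^sup>2 \<le> C r\<^bsup>N+2\<^esup> \<integral>\<^bsub>B\<^esub> |\<nabla>(w - u)|\<^sup>2\<close>, and if \<open>J(w) \<le> J(u)\<close> the last integral is at most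
  \<open>C (\<integral>\<^bsub>B\<^esub> |\<nabla>u|\<^sup>2 + r\<^bsup>N+2\<^esup>)\<close>. So it suffices that \<open>\<integral>\<^bsub>B\<^esub> |\<nabla>u|\<^sup>2 \<le> C r\<^bsup>N-1\<^esup>\<close>.

  By the Caccioppoli inequality this follows from \<open>|u(x\<^sub>0 + h)|\<^sup>2 \<le> C |h|\<close> at zeros \<open>x\<^sub>0\<close>; Lipschitz
  continuity is not needed. For that, \<open>d = \<Sum>\<^sub>i |u\<^sub>i(\<cdot> + h) - u\<^sub>i|\<close> satisfies \<open>\<Delta>d\<^sup>2 \<ge> -C\<close> by the inequalities
  above. The mean value inequality, the bound of \<open>d\<close> in \<open>L\<^sup>2\<close> by \<open>|h|\<close> times the gradient of \<open>u\<close>, and the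
  Caccioppoli inequality for the bounded function \<open>u\<close> give \<open>d(x\<^sub>0)\<^sup>2 \<le> C (|h|\<^sup>2 \<rho>\<^bsup>-2\<^esup> + \<rho>\<^sup>2)\<close>, where one takes
  \<open>\<rho> = |h|\<^bsup>1/2\<^esup>\<close>.

  Sobolev functions are handled as limits of test functions on the whole space (\<open>sobolev0\<close>). That \<open>w - u\<close>
  belongs to this space on the ball when the traces agree is shown by cutting off near the sphere.
\<close>

section \<open>Calculus of smooth functions\<close>

text \<open>The obstacle is that no equation holds across the zero set, where the components meet,
  so increments of u cannot be treated by linear theory. The remedy is geometric. The nonnegative
  part of Sigma_k is a star of half-lines and d is its path metric. The inequality for u_i controls
  one branch; the one for u_i minus the other components controls the line obtained by folding all
  other branches onto the negative half-axis. Together they bound the Laplacian of the squared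
  distance between two such maps from below, much as for harmonic maps into trees.

  The exponents fit as follows. If |u|^2 \<le> C r on a ball of radius comparable to r about a zero,
  Caccioppoli bounds the Dirichlet integral by C (r^(-2) r + r^(1/2)) r^N, hence by C r^(N-1) for
  small r, and the factor r^(N+2) in the estimate of \<delta>_i^2 yields r^(2N+1). So growth of
  order 1/2 at zeros is exactly what is required.

  The mass correction costs only \<delta>_i^2 because its linear effect on the energy is -2
  \<delta>_i E_i, by the Euler-Lagrange equation and the unit mass of \<phi>_i; this is the mass
  term already present in J.\<close>

definition gradient :: "('a::euclidean_space \<Rightarrow> real) \<Rightarrow> 'a \<Rightarrow> 'a" where
  "gradient f x = (\<Sum>i\<in>Basis. frechet_derivative f (at x) i *\<^sub>R i)"

text \<open>Any pointwise derivative may be supplied: uniqueness identifies it with the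
  \<open>frechet_derivative\<close> in the definition of \<open>Ck_on\<close>.\<close>

lemma Ck_on_SucI:
  assumes "\<And>x. (f has_derivative D x) (at x)"
    and "\<And>i. i \<in> Basis \<Longrightarrow> Ck_on n UNIV (\<lambda>x. D x i)"
  shows "Ck_on (Suc n) UNIV f"
proof -
  have "frechet_derivative f (at x) = D x" for x
    using assms(1) by (metis frechet_derivative_at)
  then show ?thesis
    using assms by (auto simp: differentiable_def)
qed

lemma Ck_on_Suc_derivative:
  assumes "Ck_on (Suc n) UNIV f"
  shows "(f has_derivative frechet_derivative f (at x)) (at x)"
  using assms frechet_derivative_works by auto

text \<open>Product and chain rules at order n+1 still contain undifferentiated factors, which enter
  the induction at order n.\<close>

lemma Ck_on_Suc_imp: "Ck_on (Suc n) UNIV f \<Longrightarrow> Ck_on n UNIV f"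
proof (induction n arbitrary: f)
  case 0
  then show ?case
    by (auto intro!: differentiable_imp_continuous_on simp: differentiable_on_def
        intro: differentiable_at_withinI)
next
  case (Suc n)
  then show ?case by simp
qed

lemma Ck_on_const: "Ck_on n UNIV (\<lambda>x::'a::euclidean_space. c)"
proof (induction n arbitrary: c)
  case (Suc n)
  show ?case by (rule Ck_on_SucI[where D="\<lambda>x h. 0"]) (auto simp: Suc)
qed auto

lemma Ck_on_inner: "Ck_on n UNIV (\<lambda>x::'a::euclidean_space. x \<bullet> v)"
proof (cases n)
  case (Suc m)
  show ?thesis unfolding Suc
    by (rule Ck_on_SucI[where D="\<lambda>x h. h \<bullet> v"])
      (auto simp: Ck_on_const intro!: derivative_eq_intros)
qed (auto intro!: continuous_intros)

lemma Ck_on_id_real: "Ck_on n UNIV (\<lambda>x::real. x)"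
  using Ck_on_inner[of n "1::real"] by simp

lemma Ck_on_add:
  "Ck_on n UNIV f \<Longrightarrow> Ck_on n UNIV g \<Longrightarrow> Ck_on n UNIV (\<lambda>x. f x + g x)"
proof (induction n arbitrary: f g)
  case (Suc n)
  show ?case
  proof (rule Ck_on_SucI)
    show "((\<lambda>x. f x + g x) has_derivative
            (\<lambda>h. frechet_derivative f (at x) h + frechet_derivative g (at x) h)) (at x)" for x
      by (intro has_derivative_add Ck_on_Suc_derivative[where n=n] Suc.prems)
    show "Ck_on n UNIV (\<lambda>x. frechet_derivative f (at x) i + frechet_derivative g (at x) i)"
      if "i \<in> Basis" for i
      by (intro Suc.IH) (use Suc.prems that in auto)
  qed
qed (auto intro!: continuous_intros)

lemma Ck_on_mult:
  "Ck_on n UNIV f \<Longrightarrow> Ck_on n UNIV g \<Longrightarrow> Ck_on n UNIV (\<lambda>x. f x * g x)"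
proof (induction n arbitrary: f g)
  case (Suc n)
  show ?case
  proof (rule Ck_on_SucI)
    show "((\<lambda>x. f x * g x) has_derivative
            (\<lambda>h. f x * frechet_derivative g (at x) h + frechet_derivative f (at x) h * g x)) (at x)" for x
      by (intro has_derivative_mult Ck_on_Suc_derivative[where n=n] Suc.prems)
    show "Ck_on n UNIV
           (\<lambda>x. f x * frechet_derivative g (at x) i + frechet_derivative f (at x) i * g x)"
      if "i \<in> Basis" for i
      by (intro Ck_on_add Suc.IH Ck_on_Suc_imp[OF Suc.prems(1)] Ck_on_Suc_imp[OF Suc.prems(2)])
        (use Suc.prems that in auto)
  qed
qed (auto intro!: continuous_intros)

lemma Ck_on_compose:
  fixes G :: "real \<Rightarrow> real"
  shows "Ck_on n UNIV G \<Longrightarrow> Ck_on n UNIV f \<Longrightarrow> Ck_on n UNIV (\<lambda>x. G (f x))"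
proof (induction n arbitrary: f G)
  case 0
  then show ?case using continuous_on_compose2[of UNIV G UNIV f] by auto
next
  case (Suc n)
  let ?G' = "\<lambda>t. frechet_derivative G (at t) 1"
  have G': "Ck_on n UNIV ?G'" using Suc.prems(1) by simp
  have lin: "frechet_derivative G (at t) s = s * ?G' t" for s t
    using linear_cmul[OF linear_frechet_derivative[of G "at t"], of s 1] Suc.prems(1)
    by auto
  show ?case
  proof (rule Ck_on_SucI)
    show "((\<lambda>x. G (f x)) has_derivative (\<lambda>h. frechet_derivative f (at x) h * ?G' (f x))) (at x)" for x
      using has_derivative_compose[OF Ck_on_Suc_derivative[OF Suc.prems(2)]
          Ck_on_Suc_derivative[OF Suc.prems(1), of "f x"]] by (subst (asm) lin) simp
    show "Ck_on n UNIV (\<lambda>x. frechet_derivative f (at x) i * ?G' (f x))" if "i \<in> Basis" for i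
      by (rule Ck_on_mult[OF _ Suc.IH[OF G' Ck_on_Suc_imp[OF Suc.prems(2)]]])
        (use Suc.prems that in auto)
  qed
qed

lemma Ck_on_affine:
  "Ck_on n UNIV f \<Longrightarrow> Ck_on n UNIV (\<lambda>x. f (a + c *\<^sub>R x))"
proof (induction n arbitrary: f)
  case 0
  then show ?case by (auto intro!: continuous_on_compose2[of UNIV f] continuous_intros)
next
  case (Suc n)
  have "linear (frechet_derivative f (at y))" for y
    using Suc.prems by (auto intro: linear_frechet_derivative)
  then have lin: "frechet_derivative f (at y) (c *\<^sub>R h) = c * frechet_derivative f (at y) h" for y h
    by (simp add: linear_cmul)
  show ?case
  proof (rule Ck_on_SucI)
    have "((\<lambda>x. a + c *\<^sub>R x) has_derivative (\<lambda>h. c *\<^sub>R h)) (at x)" for x :: 'a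
      by (auto intro!: derivative_eq_intros)
    from has_derivative_compose[OF this Ck_on_Suc_derivative[OF Suc.prems]]
    show "((\<lambda>x. f (a + c *\<^sub>R x)) has_derivative
        (\<lambda>h. c * frechet_derivative f (at (a + c *\<^sub>R x)) h)) (at x)" for x
      by (simp add: lin)
    show "Ck_on n UNIV (\<lambda>x. c * frechet_derivative f (at (a + c *\<^sub>R x)) i)" if "i \<in> Basis" for i
      by (rule Ck_on_mult[OF Ck_on_const Suc.IH]) (use Suc.prems that in auto)
  qed
qed

lemma Ck_on_realI:
  assumes "\<And>x. (G has_real_derivative G' x) (at x)" "Ck_on n UNIV G'"
  shows "Ck_on (Suc n) UNIV G"
  by (rule Ck_on_SucI[where D="\<lambda>x h. G' x * h"])
    (use assms in \<open>auto simp: has_field_derivative_def\<close>)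

lemma smooth_const [intro]: "smooth (\<lambda>x. c)"
  and smooth_inner [intro]: "smooth (\<lambda>x. x \<bullet> v)"
  and smooth_id_real [intro]: "smooth (\<lambda>x::real. x)"
  by (simp_all add: smooth_def Ck_on_const Ck_on_inner Ck_on_id_real)

lemma smooth_add [intro]: "smooth f \<Longrightarrow> smooth g \<Longrightarrow> smooth (\<lambda>x. f x + g x)"
  and smooth_mult [intro]: "smooth f \<Longrightarrow> smooth g \<Longrightarrow> smooth (\<lambda>x. f x * g x)"
  by (simp_all add: smooth_def Ck_on_add Ck_on_mult)

lemma smooth_diff [intro]: "smooth f \<Longrightarrow> smooth g \<Longrightarrow> smooth (\<lambda>x. f x - g x)"
  using smooth_add[OF _ smooth_mult[OF smooth_const[of "-1"]], of f g] by simp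

lemma smooth_sum [intro]: "(\<And>i. i \<in> I \<Longrightarrow> smooth (f i)) \<Longrightarrow> smooth (\<lambda>x. \<Sum>i\<in>I. f i x)"
  by (induction I rule: infinite_finite_induct) (auto intro!: smooth_add)

lemma smooth_power [intro]: "smooth f \<Longrightarrow> smooth (\<lambda>x. f x ^ n)"
  by (induction n) auto

lemma smooth_compose: "smooth G \<Longrightarrow> smooth f \<Longrightarrow> smooth (\<lambda>x. G (f x))" for G :: "real \<Rightarrow> real"
  by (simp add: smooth_def Ck_on_compose)

lemma smooth_affine: "smooth f \<Longrightarrow> smooth (\<lambda>x. f (a + c *\<^sub>R x))"
  by (simp add: smooth_def Ck_on_affine)

lemma smooth_partial: "smooth f \<Longrightarrow> i \<in> Basis \<Longrightarrow> smooth (\<lambda>x. frechet_derivative f (at x) i)"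
  unfolding smooth_def by (metis Ck_on.simps(2))

lemma smooth_continuous: "smooth f \<Longrightarrow> continuous_on S f"
  unfolding smooth_def by (metis Ck_on.simps(1) continuous_on_subset subset_UNIV)

lemma smooth_realI:
  assumes "\<And>x. (G has_real_derivative G' x) (at x)" "smooth G'"
  shows "smooth G"
  unfolding smooth_def
  by (metis assms Ck_on_Suc_imp Ck_on_realI smooth_def)

lemma smooth_norm_sq: "smooth (\<lambda>x::'a::euclidean_space. (norm x)\<^sup>2)"
proof -
  have "(\<lambda>x::'a. (norm x)\<^sup>2) = (\<lambda>x. \<Sum>i\<in>Basis. (x \<bullet> i)\<^sup>2)"
    by (rule ext, subst power2_norm_eq_inner, subst euclidean_inner, simp add: power2_eq_square)
  then show ?thesis by (auto intro!: smooth_sum smooth_power)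
qed

lemma smooth_has_derivative:
  assumes "smooth f"
  shows "(f has_derivative (\<lambda>h. gradient f x \<bullet> h)) (at x)"
proof -
  have "Ck_on (Suc 0) UNIV f" using assms by (simp only: smooth_def)
  then have d: "(f has_derivative frechet_derivative f (at x)) (at x)"
    by (rule Ck_on_Suc_derivative)
  have "frechet_derivative f (at x) h = gradient f x \<bullet> h" for h
  proof -
    have "frechet_derivative f (at x) h = frechet_derivative f (at x) (\<Sum>i\<in>Basis. (h \<bullet> i) *\<^sub>R i)"
      by (simp add: euclidean_representation)
    also have "\<dots> = (\<Sum>i\<in>Basis. (h \<bullet> i) * frechet_derivative f (at x) i)"
      using d has_derivative_linear[OF d] by (simp add: linear_sum linear_cmul)
    finally show ?thesis by (simp add: gradient_def inner_sum_left inner_commute[of h] mult.commute)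
  qed
  then have "frechet_derivative f (at x) = (\<lambda>h. gradient f x \<bullet> h)" by blast
  then show ?thesis using d by simp
qed

lemma gradient_eqI:
  assumes "(f has_derivative (\<lambda>h. v \<bullet> h)) (at x)"
  shows "gradient f x = v"
proof -
  have "frechet_derivative f (at x) = (\<lambda>h. v \<bullet> h)"
    using assms by (metis frechet_derivative_at)
  then show ?thesis unfolding gradient_def by (simp add: euclidean_representation)
qed

lemma frechet_derivative_eq_gradient:
  "smooth f \<Longrightarrow> frechet_derivative f (at x) h = gradient f x \<bullet> h"
  using smooth_has_derivative frechet_derivative_at by metis

lemma gradient_add: "smooth f \<Longrightarrow> smooth g \<Longrightarrow> gradient (\<lambda>x. f x + g x) x = gradient f x + gradient g x"
  by (rule gradient_eqI, rule has_derivative_eq_rhs[OF has_derivative_add])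
    (auto intro: smooth_has_derivative simp: inner_add_left)

lemma gradient_diff: "smooth f \<Longrightarrow> smooth g \<Longrightarrow> gradient (\<lambda>x. f x - g x) x = gradient f x - gradient g x"
  by (rule gradient_eqI, rule has_derivative_eq_rhs[OF has_derivative_diff])
    (auto intro: smooth_has_derivative simp: inner_diff_left)

lemma gradient_mult:
  "smooth f \<Longrightarrow> smooth g \<Longrightarrow> gradient (\<lambda>x. f x * g x) x = f x *\<^sub>R gradient g x + g x *\<^sub>R gradient f x"
  by (rule gradient_eqI, rule has_derivative_eq_rhs[OF has_derivative_mult])
    (auto intro: smooth_has_derivative simp: inner_add_left)

lemma gradient_const: "gradient (\<lambda>x. c) x = 0"
  by (rule gradient_eqI) (auto intro!: derivative_eq_intros)

lemma gradient_cmult: "smooth f \<Longrightarrow> gradient (\<lambda>x. c * f x) x = c *\<^sub>R gradient f x"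
  by (simp add: gradient_mult gradient_const smooth_const)

lemma gradient_compose:
  assumes "smooth f" "(G has_real_derivative G') (at (f x))"
  shows "gradient (\<lambda>x. G (f x)) x = G' *\<^sub>R gradient f x"
  using has_derivative_compose[OF smooth_has_derivative[OF assms(1)] assms(2)[unfolded has_field_derivative_def]]
  by (intro gradient_eqI) simp

lemma gradient_affine:
  assumes "smooth f"
  shows "gradient (\<lambda>x. f (a + c *\<^sub>R x)) x = c *\<^sub>R gradient f (a + c *\<^sub>R x)"
proof (rule gradient_eqI)
  have "((\<lambda>x. a + c *\<^sub>R x) has_derivative (\<lambda>h. c *\<^sub>R h)) (at x)"
    by (auto intro!: derivative_eq_intros)
  from has_derivative_compose[OF this smooth_has_derivative[OF assms]]
  show "((\<lambda>x. f (a + c *\<^sub>R x)) has_derivative (\<lambda>h. (c *\<^sub>R gradient f (a + c *\<^sub>R x)) \<bullet> h)) (at x)"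
    by simp
qed

lemma gradient_shift: "smooth f \<Longrightarrow> gradient (\<lambda>x. f (x + h)) x = gradient f (x + h)"
  using gradient_affine[of f h 1] by (simp add: add.commute)

lemma gradient_norm_sq: "gradient (\<lambda>x::'a::euclidean_space. (norm x)\<^sup>2) x = 2 *\<^sub>R x"
  by (rule gradient_eqI)
    (auto simp: power2_norm_eq_inner inner_commute intro!: derivative_eq_intros)

lemma smooth_gradient_continuous: "smooth f \<Longrightarrow> continuous_on S (gradient f)"
  unfolding gradient_def[abs_def]
  by (intro continuous_intros smooth_continuous smooth_partial)

lemma smooth_gradient_inner: "smooth f \<Longrightarrow> smooth (\<lambda>x. gradient f x \<bullet> v)"
proof -
  assume "smooth f"
  have "(\<lambda>x. gradient f x \<bullet> v) = (\<lambda>x. \<Sum>i\<in>Basis. frechet_derivative f (at x) i * (i \<bullet> v))"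
    by (simp add: gradient_def inner_sum_left)
  with \<open>smooth f\<close> show ?thesis
    by (auto intro!: smooth_sum smooth_mult smooth_partial)
qed

lemma smooth_borel_measurable: "smooth f \<Longrightarrow> f \<in> borel_measurable borel"
  by (intro borel_measurable_continuous_onI smooth_continuous)

lemma gradient_borel_measurable: "smooth f \<Longrightarrow> gradient f \<in> borel_measurable borel"
  by (intro borel_measurable_continuous_onI smooth_gradient_continuous)

subsection \<open>Special smooth functions of one variable\<close>

lemma has_real_derivative_tanh: "(tanh has_real_derivative (1 - (tanh x)\<^sup>2)) (at (x::real))"
  by (rule has_field_derivative_tanh[THEN DERIV_cong]) 
    (use DERIV_ident cosh_real_nonzero in auto)

text \<open>The derivative 1 - tanh^2 is a polynomial in tanh, so the induction on the order closes
  by itself. Scaled copies of tanh later approximate the sign function.\<close>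

lemma smooth_tanh: "smooth (tanh :: real \<Rightarrow> real)"
proof -
  have "Ck_on n UNIV (tanh :: real \<Rightarrow> real)" for n
  proof (induction n)
    case 0
    show ?case by (auto intro!: continuous_intros simp: cosh_real_nonzero)
  next
    case (Suc n)
    show ?case
    proof (rule Ck_on_realI[OF has_real_derivative_tanh])
      have "Ck_on n UNIV (\<lambda>x::real. 1 + (-1) * (tanh x * tanh x))"
        by (intro Ck_on_add Ck_on_mult Ck_on_const Suc)
      then show "Ck_on n UNIV (\<lambda>x::real. 1 - (tanh x)\<^sup>2)"
        by (simp add: power2_eq_square)
    qed
  qed
  then show ?thesis by (simp add: smooth_def)
qed

text \<open>The derivative of 1/D is -D' (1/D)^2, again built from 1/D and a smooth function, so
  each order reduces to the previous one.\<close>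

lemma smooth_inverse:
  fixes D :: "real \<Rightarrow> real"
  assumes D: "smooth D" and pos: "\<And>x. D x > 0"
  shows "smooth (\<lambda>x. inverse (D x))"
proof -
  let ?D' = "\<lambda>x. frechet_derivative D (at x) 1"
  have dD: "(D has_real_derivative ?D' x) (at x)" for x
    using smooth_has_derivative[OF D, of x]
    by (simp add: frechet_derivative_eq_gradient[OF D] has_field_derivative_def)
  have D': "Ck_on n UNIV ?D'" for n
    using smooth_partial[OF D, of 1] by (simp add: smooth_def)
  have "Ck_on n UNIV (\<lambda>x. inverse (D x))" for n
  proof (induction n)
    case 0
    show ?case using pos by (auto intro!: continuous_intros smooth_continuous[OF D] simp: less_imp_neq[symmetric])
  next
    case (Suc n)
    show ?case
    proof (rule Ck_on_realI)
      show "((\<lambda>x. inverse (D x)) has_real_derivative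
            -1 * ?D' x * (inverse (D x) * inverse (D x))) (at x)" for x
        using dD[of x] pos[of x] by (auto intro!: derivative_eq_intros)
      show "Ck_on n UNIV (\<lambda>x. -1 * ?D' x * (inverse (D x) * inverse (D x)))"
        by (intro Ck_on_mult Ck_on_const D' Suc)
    qed
  qed
  then show ?thesis by (simp add: smooth_def)
qed

text \<open>The function exp(-1/t) together with its quotients by powers of t. Derivatives of
  members are linear combinations of members, so smoothness of the whole family follows by one
  induction over the order.\<close>

definition flat :: "nat \<Rightarrow> real \<Rightarrow> real" where
  "flat m t = (if t > 0 then exp (- (1 / t)) / t ^ m else 0)"

text \<open>With s = 1/t, the single term s^(m+2)/(m+2)! of the exponential series is at most exp s.
  The two spare powers of t make the derivative at the origin vanish.\<close>

lemma flat_bound: "\<bar>flat m t\<bar> \<le> fact (m + 2) * t\<^sup>2"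
proof (cases "t > 0")
  case True
  define s where "s = 1 / t"
  have s: "s > 0" using True by (simp add: s_def)
  have "(\<Sum>n\<in>{m+2}. s ^ n /\<^sub>R fact n) \<le> (\<Sum>n. s ^ n /\<^sub>R fact n)"
    by (rule sum_le_suminf) (use s summable_exp_generic[of s] in auto)
  then have "s ^ (m + 2) / fact (m + 2) \<le> exp s"
    by (simp add: exp_def field_simps)
  then have "exp (-s) * s ^ (m + 2) \<le> fact (m + 2)"
    by (simp add: exp_minus field_simps del: fact_Suc)
  then have "exp (-s) * s ^ m \<le> fact (m + 2) * t\<^sup>2"
    using True by (simp add: s_def field_simps power2_eq_square del: fact_Suc)
  then show ?thesis using True by (simp add: flat_def s_def power_divide del: fact_Suc)
qed (simp add: flat_def)

lemma flat_has_derivative: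
  "(flat m has_real_derivative (- real m * flat (Suc m) t + flat (Suc (Suc m)) t)) (at t)"
proof -
  consider "t > 0" | "t < 0" | "t = 0" by linarith
  then show ?thesis
  proof cases
    case 1
    have "((\<lambda>t. exp (- (1 / t)) / t ^ m) has_real_derivative
        (- real m * flat (Suc m) t + flat (Suc (Suc m)) t)) (at t)"
    proof (cases m)
      case 0
      then show ?thesis using 1
        by (auto intro!: derivative_eq_intros simp: flat_def field_simps power2_eq_square)
    next
      case (Suc j)
      have h: "i \<noteq> 0 \<Longrightarrow> t * t ^ (i - Suc 0) = t ^ i" for i by (cases i) auto
      show ?thesis using 1 Suc
        by (auto intro!: derivative_eq_intros simp: flat_def field_simps power2_eq_square)
          (metis h)
    qed
    then show ?thesis
      by (rule DERIV_cong_ev[THEN iffD1, OF refl _ refl, rotated])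
        (use eventually_nhds_in_open[of "{0<..}" t] 1 in \<open>auto simp: flat_def elim!: eventually_mono\<close>)
  next
    case 2
    have "((\<lambda>t. 0) has_real_derivative 0) (at t)" by simp
    then have "(flat m has_real_derivative 0) (at t)"
      by (rule DERIV_cong_ev[THEN iffD1, OF refl _ refl, rotated])
        (use eventually_nhds_in_open[of "{..<0}" t] 2 in \<open>auto simp: flat_def elim!: eventually_mono\<close>)
    then show ?thesis using 2 by (simp add: flat_def)
  next
    case 3
    have "((\<lambda>h. flat m h / h) \<longlongrightarrow> 0) (at 0)"
    proof (rule Lim_null_comparison)
      show "\<forall>\<^sub>F h in at 0. norm (flat m h / h) \<le> fact (m + 2) * \<bar>h\<bar>"
        using eventually_at_filter[of "\<lambda>_. True"]
      proof -
        have "norm (flat m h / h) \<le> fact (m + 2) * \<bar>h\<bar>" if "h \<noteq> 0" for h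
          using flat_bound[of m h] that
          by (simp add: abs_if divide_simps power2_eq_square split: if_splits del: fact_Suc)
        then show ?thesis by (auto simp: eventually_at_filter simp del: fact_Suc)
      qed
      show "((\<lambda>h. fact (m + 2) * \<bar>h\<bar>) \<longlongrightarrow> (0::real)) (at 0)"
        by (auto intro!: tendsto_eq_intros simp del: fact_Suc)
    qed
    then have "(flat m has_real_derivative 0) (at 0)"
      by (simp add: DERIV_def flat_def)
    then show ?thesis using 3 by (simp add: flat_def)
  qed
qed

lemma smooth_flat: "smooth (flat m)"
proof -
  have "Ck_on n UNIV (flat m)" for n
  proof (induction n arbitrary: m)
    case 0
    show ?case
      by (auto intro!: continuous_at_imp_continuous_on DERIV_isCont flat_has_derivative)
  next
    case (Suc n)
    show ?case
      by (rule Ck_on_realI[OF flat_has_derivative]) (intro Ck_on_add Ck_on_mult Ck_on_const Suc)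
  qed
  then show ?thesis by (simp add: smooth_def)
qed

lemma flat_nonneg: "0 \<le> flat m t" and flat_pos: "t > 0 \<Longrightarrow> 0 < flat m t"
  and flat_zero: "t \<le> 0 \<Longrightarrow> flat m t = 0"
  by (auto simp: flat_def)

text \<open>The usual quotient passing from 0 to 1 on [0, 1]; t and 1 - t are never both
  nonpositive, which keeps the denominator positive.\<close>

definition smooth_step :: "real \<Rightarrow> real" where
  "smooth_step t = flat 0 t * inverse (flat 0 t + flat 0 (1 - t))"

lemma smooth_step_denominator: "flat 0 t + flat 0 (1 - t) > 0"
  using flat_nonneg[of 0] flat_pos[of t 0] flat_pos[of "1 - t" 0]
  by (cases "t > 0") (auto intro: add_pos_nonneg add_nonneg_pos)

lemma smooth_smooth_step: "smooth smooth_step"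
proof -
  have "smooth (\<lambda>t. flat 0 (1 - t))"
    using smooth_affine[OF smooth_flat, of 0 1 "-1"] by simp
  then show ?thesis unfolding smooth_step_def[abs_def]
    by (intro smooth_mult smooth_inverse smooth_add smooth_flat smooth_step_denominator)
qed

lemma smooth_step_0: "t \<le> 0 \<Longrightarrow> smooth_step t = 0"
  and smooth_step_1: "t \<ge> 1 \<Longrightarrow> smooth_step t = 1"
  and smooth_step_nonneg: "0 \<le> smooth_step t"
  and smooth_step_le_1: "smooth_step t \<le> 1"
proof -
  show "t \<le> 0 \<Longrightarrow> smooth_step t = 0" by (simp add: smooth_step_def flat_zero)
  show "t \<ge> 1 \<Longrightarrow> smooth_step t = 1"
    using smooth_step_denominator[of t] by (simp add: smooth_step_def flat_zero)
  show "0 \<le> smooth_step t" using smooth_step_denominator[of t] flat_nonneg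
    by (simp add: smooth_step_def)
  show "smooth_step t \<le> 1"
    using smooth_step_denominator[of t] flat_nonneg[of 0 "1 - t"]
    by (simp add: smooth_step_def field_simps)
qed

text \<open>The derivative is continuous and vanishes outside [0, 1], hence is bounded; B later
  measures the gradients of cutoffs near a sphere.\<close>

lemma smooth_step_derivative:
  obtains S' B where "\<And>t. (smooth_step has_real_derivative S' t) (at t)" "\<And>t. \<bar>S' t\<bar> \<le> B"
    "\<And>t. t < 0 \<or> t > 1 \<Longrightarrow> S' t = 0" "B > 0"
proof -
  define S' where "S' t = gradient smooth_step t" for t
  have d: "(smooth_step has_real_derivative S' t) (at t)" for t
    using smooth_has_derivative[OF smooth_smooth_step, of t]
    by (simp add: S'_def has_field_derivative_def)
  have z: "S' t = 0" if "t < 0 \<or> t > 1" for t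
    using that
  proof
    assume "t < 0"
    have "((\<lambda>_. 0) has_real_derivative 0) (at t)" by simp
    then have "(smooth_step has_real_derivative 0) (at t)"
      by (rule DERIV_cong_ev[THEN iffD1, OF refl _ refl, rotated])
        (use \<open>t < 0\<close> eventually_nhds_in_open[of "{..<0}" t] in \<open>auto simp: smooth_step_0 elim!: eventually_mono\<close>)
    then show ?thesis using d DERIV_unique by blast
  next
    assume "t > 1"
    have "((\<lambda>_. 1) has_real_derivative 0) (at t)" by simp
    then have "(smooth_step has_real_derivative 0) (at t)"
      by (rule DERIV_cong_ev[THEN iffD1, OF refl _ refl, rotated])
        (use \<open>t > 1\<close> eventually_nhds_in_open[of "{1<..}" t] in \<open>auto simp: smooth_step_1 elim!: eventually_mono\<close>)
    then show ?thesis using d DERIV_unique by blast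
  qed
  have "compact (S' ` {0..1})" unfolding S'_def[abs_def]
    by (intro compact_continuous_image smooth_gradient_continuous smooth_smooth_step) auto
  then obtain B where B: "\<And>t. t \<in> {0..1} \<Longrightarrow> \<bar>S' t\<bar> \<le> B"
    by (fastforce dest!: compact_imp_bounded simp: bounded_iff)
  have "\<bar>S' t\<bar> \<le> max B 1" for t using B[of t] z[of t] by (cases "t \<in> {0..1}") auto
  then show ?thesis using that[OF d _ z, of "max B 1"] by simp
qed

subsection \<open>Test functions\<close>

lemma test_functions_smooth: "\<phi> \<in> test_functions A \<Longrightarrow> smooth \<phi>"
  by (simp add: test_functions_def)

lemma test_functions_mono: "A \<subseteq> B \<Longrightarrow> \<phi> \<in> test_functions A \<Longrightarrow> \<phi> \<in> test_functions B"
  by (auto simp: test_functions_def)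

lemma test_functionsI:
  assumes "smooth \<phi>" "compact S" "S \<subseteq> A" "\<And>x. x \<notin> S \<Longrightarrow> \<phi> x = 0"
  shows "\<phi> \<in> test_functions A"
proof -
  have "closure {x. \<phi> x \<noteq> 0} \<subseteq> S"
    using assms by (intro closure_minimal) (auto intro: compact_imp_closed)
  moreover from this have "compact (closure {x. \<phi> x \<noteq> 0})"
    using compact_Int_closed[OF assms(2) closed_closure, of "{x. \<phi> x \<noteq> 0}"]
    by (simp only: inf.absorb2)
  ultimately show ?thesis using assms by (auto simp: test_functions_def)
qed

text \<open>Off its closed support the function vanishes on a neighbourhood, so its gradient
  vanishes too: one compact set serves both.\<close>

lemma test_functions_support:
  assumes "\<phi> \<in> test_functions A"
  obtains S where "compact S" "S \<subseteq> A" "\<And>x. x \<notin> S \<Longrightarrow> \<phi> x = 0" "\<And>x. x \<notin> S \<Longrightarrow> gradient \<phi> x = 0"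
proof -
  let ?S = "closure {x. \<phi> x \<noteq> 0}"
  have z: "\<phi> x = 0" if "x \<notin> ?S" for x using that closure_subset[of "{x. \<phi> x \<noteq> 0}"] by blast
  have "gradient \<phi> x = 0" if "x \<notin> ?S" for x
  proof (rule gradient_eqI)
    have d: "((\<lambda>_. 0) has_derivative (\<lambda>h. 0 \<bullet> h)) (at x)" by simp
    have o: "open (- ?S)" by (intro open_Compl closed_closure)
    have m: "x \<in> - ?S" using that by (simp only: Compl_iff not_False_eq_True)
    show "(\<phi> has_derivative (\<lambda>h. 0 \<bullet> h)) (at x)"
      by (rule has_derivative_transform_within_open[OF d o m], rule z[symmetric], rule ComplD)
  qed
  moreover have "compact ?S" "?S \<subseteq> A"
    using assms by (simp_all add: test_functions_def)
  ultimately show ?thesis using z by (intro that)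
qed

lemma test_functions_mult:
  assumes "\<phi> \<in> test_functions A" "smooth \<psi>"
  shows "(\<lambda>x. \<psi> x * \<phi> x) \<in> test_functions A"
proof -
  obtain S where "compact S" "S \<subseteq> A" "\<And>x. x \<notin> S \<Longrightarrow> \<phi> x = 0"
    using test_functions_support[OF assms(1)] by metis
  then show ?thesis
    using assms(2) test_functions_smooth[OF assms(1)] by (auto intro!: test_functionsI[of _ S])
qed

lemma test_functions_add:
  assumes "\<phi> \<in> test_functions A" "\<psi> \<in> test_functions A"
  shows "(\<lambda>x. \<phi> x + \<psi> x) \<in> test_functions A"
proof -
  obtain S T where "compact S" "S \<subseteq> A" "\<And>x. x \<notin> S \<Longrightarrow> \<phi> x = 0"
    "compact T" "T \<subseteq> A" "\<And>x. x \<notin> T \<Longrightarrow> \<psi> x = 0"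
    using test_functions_support[OF assms(1)] test_functions_support[OF assms(2)] by metis
  then show ?thesis
    using test_functions_smooth[OF assms(1)] test_functions_smooth[OF assms(2)]
    by (intro test_functionsI[of _ "S \<union> T"] smooth_add) auto
qed

lemma test_functions_compose:
  assumes "\<phi> \<in> test_functions A" "smooth G" "G 0 = 0"
  shows "(\<lambda>x. G (\<phi> x)) \<in> test_functions A"
proof -
  obtain S where "compact S" "S \<subseteq> A" "\<And>x. x \<notin> S \<Longrightarrow> \<phi> x = 0"
    using test_functions_support[OF assms(1)] by metis
  then show ?thesis
    using assms(3) smooth_compose[OF assms(2) test_functions_smooth[OF assms(1)]]
    by (intro test_functionsI[of _ S]) auto
qed

lemma test_functions_cmult: "\<phi> \<in> test_functions A \<Longrightarrow> (\<lambda>x. c * \<phi> x) \<in> test_functions A"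
  by (rule test_functions_mult) auto

lemma test_functions_zero: "(\<lambda>x. 0) \<in> test_functions A"
  by (rule test_functionsI[of _ "{}"]) auto

lemma test_functions_partial:
  assumes "\<phi> \<in> test_functions A"
  shows "(\<lambda>x. gradient \<phi> x \<bullet> v) \<in> test_functions A"
proof -
  obtain S where "compact S" "S \<subseteq> A" "\<And>x. x \<notin> S \<Longrightarrow> gradient \<phi> x = 0"
    using test_functions_support[OF assms] by metis
  then show ?thesis
    using smooth_gradient_inner[OF test_functions_smooth[OF assms(1)]]
    by (intro test_functionsI[of _ S]) auto
qed

lemma test_functions_affine:
  assumes "\<phi> \<in> test_functions A" "c \<noteq> 0" "\<And>x. a + c *\<^sub>R x \<in> A \<Longrightarrow> x \<in> B"
  shows "(\<lambda>x. \<phi> (a + c *\<^sub>R x)) \<in> test_functions B"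
proof -
  obtain S where S: "compact S" "S \<subseteq> A" "\<And>x. x \<notin> S \<Longrightarrow> \<phi> x = 0"
    using test_functions_support[OF assms(1)] by metis
  let ?T = "(\<lambda>y. (1 / c) *\<^sub>R (y - a)) ` S"
  have mem: "x \<in> ?T" if "a + c *\<^sub>R x \<in> S" for x
    using that assms(2) by (auto intro!: image_eqI[of _ _ "a + c *\<^sub>R x"])
  show ?thesis
  proof (rule test_functionsI[of _ ?T])
    show "compact ?T" by (intro compact_continuous_image continuous_intros S)
    show "?T \<subseteq> B" using S(2) assms(2,3) by auto
    show "\<phi> (a + c *\<^sub>R x) = 0" if "x \<notin> ?T" for x using S(3) mem that by blast
    show "smooth (\<lambda>x. \<phi> (a + c *\<^sub>R x))"
      by (intro smooth_affine test_functions_smooth[OF assms(1)])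
  qed
qed

lemma test_functions_shift:
  assumes "\<phi> \<in> test_functions A" "\<And>x. x + h \<in> A \<Longrightarrow> x \<in> B"
  shows "(\<lambda>x. \<phi> (x + h)) \<in> test_functions B"
  using test_functions_affine[OF assms(1), of 1 h B] assms(2) by (simp add: add.commute)

text \<open>The standard mollifier exp(-1/(1 - |y|^2)), not normalized.\<close>

definition bump :: "'a::euclidean_space \<Rightarrow> real" where
  "bump y = flat 0 (1 - (norm y)\<^sup>2)"

lemma smooth_bump: "smooth bump"
  unfolding bump_def[abs_def]
  by (intro smooth_compose[OF smooth_flat] smooth_diff smooth_const smooth_norm_sq)

lemma bump_nonneg: "0 \<le> bump y"
  by (simp add: bump_def flat_nonneg)

lemma bump_pos: "norm y < 1 \<Longrightarrow> 0 < bump y"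
  unfolding bump_def by (rule flat_pos) (simp add: abs_square_less_1)

lemma bump_zero: "norm y \<ge> 1 \<Longrightarrow> bump y = 0"
  unfolding bump_def by (rule flat_zero) (simp add: one_le_power)

text \<open>Finitely many bumps cover S. By compactness their sum is at least some c > 0 on S, and a
  smooth step applied to the sum divided by c levels it to 1 there.\<close>

lemma cutoff_exists:
  fixes S U :: "'a::euclidean_space set"
  assumes "compact S" "open U" "S \<subseteq> U"
  obtains \<zeta> where "\<zeta> \<in> test_functions U" "\<And>x. x \<in> S \<Longrightarrow> \<zeta> x = 1" "\<And>x. 0 \<le> \<zeta> x" "\<And>x. \<zeta> x \<le> 1"
proof -
  have "\<exists>r>0. cball p r \<subseteq> U" if "p \<in> S" for p
    using assms that open_contains_cball by blast
  then obtain r where r: "\<And>p. p \<in> S \<Longrightarrow> r p > 0" "\<And>p. p \<in> S \<Longrightarrow> cball p (r p) \<subseteq> U"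
    by metis
  have "S \<subseteq> (\<Union>p\<in>S. ball p (r p))" using r(1) by fastforce
  from compactE_image[OF assms(1) _ this]
  obtain P where P: "P \<subseteq> S" "finite P" "S \<subseteq> (\<Union>p\<in>P. ball p (r p))" by auto
  define b where "b p x = bump ((- (1 / r p)) *\<^sub>R p + (1 / r p) *\<^sub>R x)" for p x
  have b_eq: "b p x = bump ((1 / r p) *\<^sub>R (x - p))" for p x
    by (simp add: b_def algebra_simps)
  have b_pos: "b p x > 0" if "p \<in> P" "x \<in> ball p (r p)" for p x
    unfolding b_eq using that P(1) r(1)[of p]
    by (intro bump_pos) (auto simp: dist_norm norm_minus_commute divide_simps)
  have b_zero: "b p x = 0" if "p \<in> P" "x \<notin> cball p (r p)" for p x
    unfolding b_eq using that P(1) r(1)[of p]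
    by (intro bump_zero) (auto simp: dist_norm norm_minus_commute divide_simps)
  define B where "B x = (\<Sum>p\<in>P. b p x)" for x
  have sB: "smooth B" unfolding B_def[abs_def] b_def
    by (intro smooth_sum smooth_affine smooth_bump)
  have B_pos: "B x > 0" if "x \<in> S" for x
  proof -
    obtain p where p: "p \<in> P" "x \<in> ball p (r p)" using P(3) \<open>x \<in> S\<close> by blast
    show ?thesis unfolding B_def
      by (rule sum_pos2[OF P(2) p(1)]) (rule b_pos[OF p], simp add: b_def bump_nonneg)
  qed
  obtain c where c: "c > 0" "\<And>x. x \<in> S \<Longrightarrow> c \<le> B x"
  proof (cases "S = {}")
    case False
    then obtain y where "y \<in> S" "\<And>x. x \<in> S \<Longrightarrow> B y \<le> B x"
      using continuous_attains_inf[OF assms(1) False smooth_continuous[OF sB]] by metis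
    then show ?thesis using that[of "B y"] B_pos by auto
  qed (use that[of 1] in auto)
  define \<zeta> where "\<zeta> x = smooth_step ((1 / c) * B x)" for x
  have "\<zeta> \<in> test_functions U"
  proof (rule test_functionsI)
    show "smooth \<zeta>" unfolding \<zeta>_def[abs_def]
      by (intro smooth_compose[OF smooth_smooth_step] smooth_mult smooth_const sB)
    show "compact (\<Union>p\<in>P. cball p (r p))" using P(2) by auto
    show "(\<Union>p\<in>P. cball p (r p)) \<subseteq> U" using P(1) r(2) by auto
    show "\<zeta> x = 0" if "x \<notin> (\<Union>p\<in>P. cball p (r p))" for x
    proof -
      have "B x = 0" unfolding B_def using that b_zero by (intro sum.neutral) auto
      then show ?thesis by (simp add: \<zeta>_def smooth_step_0)
    qed
  qed
  moreover have "\<zeta> x = 1" if "x \<in> S" for x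
    unfolding \<zeta>_def using c that by (intro smooth_step_1) (simp add: field_simps)
  ultimately show ?thesis
    using that smooth_step_nonneg smooth_step_le_1 unfolding \<zeta>_def by metis
qed

section \<open>Square integrable functions\<close>

text \<open>Functions on a domain are treated as Borel functions on the whole space, extended by
  zero, so that one measure is used throughout; \<open>represents\<close> makes the passage to
  \<open>lebesgue_on\<close>.\<close>

definition L2 :: "('a::euclidean_space \<Rightarrow> 'b::euclidean_space) \<Rightarrow> bool" where
  "L2 f \<longleftrightarrow> f \<in> borel_measurable borel \<and> integrable lborel (\<lambda>x. (norm (f x))\<^sup>2)"

text \<open>Square integrability is demanded explicitly because the Bochner integral of a
  nonintegrable function is 0, so the vanishing of the integrals alone would say nothing.\<close>

definition L2_lim :: "(nat \<Rightarrow> 'a::euclidean_space \<Rightarrow> 'b::euclidean_space) \<Rightarrow> ('a \<Rightarrow> 'b) \<Rightarrow> bool" where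
  "L2_lim F f \<longleftrightarrow> (\<forall>n. L2 (F n)) \<and> L2 f \<and> (\<lambda>n. \<integral>x. (norm (F n x - f x))\<^sup>2 \<partial>lborel) \<longlonglongrightarrow> 0"

lemma L2_measurable: "L2 f \<Longrightarrow> f \<in> borel_measurable borel"
  by (simp add: L2_def)

lemma L2_integrable: "L2 f \<Longrightarrow> integrable lborel (\<lambda>x. (norm (f x))\<^sup>2)"
  by (simp add: L2_def)

lemma L2_bound:
  assumes "integrable lborel w" "f \<in> borel_measurable borel" "\<And>x. (norm (f x))\<^sup>2 \<le> w x"
  shows "L2 f"
  unfolding L2_def
proof
  have [measurable]: "f \<in> borel_measurable borel" by fact
  have nn: "(norm (norm (f x)))\<^sup>2 \<le> norm (w x)" for x
    using assms(3)[of x] by auto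
  show "integrable lborel (\<lambda>x. (norm (f x))\<^sup>2)"
    by (rule Bochner_Integration.integrable_bound[OF assms(1)]) (use nn in auto)
qed (fact assms)

lemma norm_add_sq_le: "(norm (a + b))\<^sup>2 \<le> 2 * (norm a)\<^sup>2 + 2 * (norm (b::'b::real_inner))\<^sup>2"
  and norm_diff_sq_le: "(norm (a - b))\<^sup>2 \<le> 2 * (norm a)\<^sup>2 + 2 * (norm (b::'b::real_inner))\<^sup>2"
proof -
  have "(norm (a + b))\<^sup>2 + (norm (a - b))\<^sup>2 = 2 * (norm a)\<^sup>2 + 2 * (norm b)\<^sup>2"
    by (simp add: power2_norm_eq_inner inner_simps)
  then show "(norm (a + b))\<^sup>2 \<le> 2 * (norm a)\<^sup>2 + 2 * (norm b)\<^sup>2"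
    "(norm (a - b))\<^sup>2 \<le> 2 * (norm a)\<^sup>2 + 2 * (norm b)\<^sup>2"
    using zero_le_power2[of "norm (a - b)"] zero_le_power2[of "norm (a + b)"] by linarith+
qed

lemma L2_add: "L2 f \<Longrightarrow> L2 g \<Longrightarrow> L2 (\<lambda>x. f x + g x)"
  by (rule L2_bound[of "\<lambda>x. 2 * (norm (f x))\<^sup>2 + 2 * (norm (g x))\<^sup>2"])
    (auto simp: L2_def norm_add_sq_le)

lemma L2_diff: "L2 f \<Longrightarrow> L2 g \<Longrightarrow> L2 (\<lambda>x. f x - g x)"
  by (rule L2_bound[of "\<lambda>x. 2 * (norm (f x))\<^sup>2 + 2 * (norm (g x))\<^sup>2"])
    (auto simp: L2_def norm_diff_sq_le)

lemma L2_mult_bounded: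
  assumes "L2 f" "h \<in> borel_measurable borel" "\<And>x. \<bar>h x\<bar> \<le> C"
  shows "L2 (\<lambda>x. h x *\<^sub>R f x)"
proof (rule L2_bound)
  show "integrable lborel (\<lambda>x. C\<^sup>2 * (norm (f x))\<^sup>2)" using assms(1) by (simp add: L2_def)
  show "(\<lambda>x. h x *\<^sub>R f x) \<in> borel_measurable borel"
    using assms(1,2) by (auto simp: L2_def)
  have "\<bar>h x\<bar>\<^sup>2 \<le> C\<^sup>2" for x using assms(3)[of x] by (intro power_mono) auto
  then show "(norm (h x *\<^sub>R f x))\<^sup>2 \<le> C\<^sup>2 * (norm (f x))\<^sup>2" for x
    by (simp add: power_mult_distrib mult_right_mono)
qed

lemma L2_scaleR: "L2 f \<Longrightarrow> L2 (\<lambda>x. c *\<^sub>R f x)"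
  by (rule L2_mult_bounded[where C="\<bar>c\<bar>"]) auto

lemma L2_cmult: "L2 f \<Longrightarrow> L2 (\<lambda>x. c * f x)" for f :: "'a::euclidean_space \<Rightarrow> real"
  using L2_scaleR[of f c] by simp

lemma L2_zero: "L2 (\<lambda>x. 0)"
  by (simp add: L2_def)

lemma L2_sum: "(\<And>i. i \<in> I \<Longrightarrow> L2 (f i)) \<Longrightarrow> L2 (\<lambda>x. \<Sum>i\<in>I. f i x)"
  by (induction I rule: infinite_finite_induct) (auto intro!: L2_add L2_zero)

lemma L2_norm: "L2 f \<Longrightarrow> L2 (\<lambda>x. norm (f x))"
  by (auto simp: L2_def)

lemma L2_inner_integrable:
  assumes "L2 f" "L2 g"
  shows "integrable lborel (\<lambda>x. f x \<bullet> g x)"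
proof (rule Bochner_Integration.integrable_bound)
  show "integrable lborel (\<lambda>x. (norm (f x))\<^sup>2 + (norm (g x))\<^sup>2)"
    using assms by (simp add: L2_def)
  show "(\<lambda>x. f x \<bullet> g x) \<in> borel_measurable lborel"
    using assms by (auto simp: L2_def)
  have "\<bar>a \<bullet> b\<bar> \<le> (norm a)\<^sup>2 + (norm b)\<^sup>2" for a b :: 'b
    using Cauchy_Schwarz_ineq2[of a b] sum_squares_bound[of "norm a" "norm b"]
      mult_nonneg_nonneg[OF norm_ge_zero[of a] norm_ge_zero[of b]] by linarith
  then show "AE x in lborel. norm (f x \<bullet> g x) \<le> norm ((norm (f x))\<^sup>2 + (norm (g x))\<^sup>2)"
    by simp
qed

lemma L2_mult_integrable:
  "L2 f \<Longrightarrow> L2 g \<Longrightarrow> integrable lborel (\<lambda>x. f x * g x)" for f g :: "'a::euclidean_space \<Rightarrow> real"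
  using L2_inner_integrable[of f g] by simp

text \<open>The integral of |f + t g|^2 is a nonnegative quadratic polynomial in t.\<close>

lemma L2_Cauchy_Schwarz:
  assumes "L2 f" "L2 g"
  shows "(LBINT x. f x \<bullet> g x)\<^sup>2 \<le> (LBINT x. (norm (f x))\<^sup>2) * (LBINT x. (norm (g x))\<^sup>2)"
    (is "?C\<^sup>2 \<le> ?A * ?B")
proof -
  have q: "0 \<le> ?A + 2 * t * ?C + t\<^sup>2 * ?B" for t
  proof -
    have "0 \<le> (LBINT x. (norm (f x + t *\<^sub>R g x))\<^sup>2)" by simp
    also have "\<dots> = (LBINT x. (norm (f x))\<^sup>2 + (2 * t) * (f x \<bullet> g x) + t\<^sup>2 * (norm (g x))\<^sup>2)"
      unfolding power2_norm_eq_inner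
      by (intro Bochner_Integration.integral_cong refl)
        (simp add: inner_simps inner_commute algebra_simps power2_eq_square)
    also have "\<dots> = ?A + 2 * t * ?C + t\<^sup>2 * ?B"
      using assms by (simp add: L2_integrable L2_inner_integrable)
    finally show ?thesis .
  qed
  show ?thesis
  proof (cases "?B = 0")
    case True
    have "?C = 0"
    proof (rule ccontr)
      assume "?C \<noteq> 0"
      \<comment> \<open>If the leading coefficient vanishes, this t gives the remaining affine
        function the value -1.\<close>
      then show False using q[of "- (?A + 1) / (2 * ?C)"] True by (simp add: field_simps)
    qed
    then show ?thesis using True by simp
  next
    case False
    have "?B > 0" using False by (simp add: order_less_le)
    then show ?thesis using q[of "- ?C / ?B"]
      by (simp add: field_simps power2_eq_square)
  qed
qed

lemma L2_Cauchy_Schwarz_abs: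
  assumes "L2 f" "L2 g"
  shows "\<bar>\<integral>x. f x \<bullet> g x \<partial>lborel\<bar> \<le> sqrt (LBINT x. (norm (f x))\<^sup>2) * sqrt (LBINT x. (norm (g x))\<^sup>2)"
  using real_sqrt_le_mono[OF L2_Cauchy_Schwarz[OF assms]] by (simp add: real_sqrt_mult)

lemma L2_limD:
  assumes "L2_lim F f"
  shows "L2 (F n)" "L2 f" "(\<lambda>n. \<integral>x. (norm (F n x - f x))\<^sup>2 \<partial>lborel) \<longlonglongrightarrow> 0"
  using assms by (auto simp: L2_lim_def)

lemma L2_limI:
  assumes "\<And>n. L2 (F n)" "L2 f" "\<And>n. (LBINT x. (norm (F n x - f x))\<^sup>2) \<le> e n" "e \<longlonglongrightarrow> 0"
  shows "L2_lim F f"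
  unfolding L2_lim_def using assms
  by (auto intro!: tendsto_sandwich[OF _ _ tendsto_const assms(4)])

lemma L2_lim_const: "L2 f \<Longrightarrow> L2_lim (\<lambda>n. f) f"
  by (simp add: L2_lim_def)

lemma L2_lim_subseq: "L2_lim F f \<Longrightarrow> strict_mono r \<Longrightarrow> L2_lim (\<lambda>n. F (r n)) f"
  unfolding L2_lim_def using LIMSEQ_subseq_LIMSEQ[of _ 0 r] by (force simp: o_def)

lemma L2_lim_add:
  assumes "L2_lim F f" "L2_lim G g"
  shows "L2_lim (\<lambda>n x. F n x + G n x) (\<lambda>x. f x + g x)"
proof (rule L2_limI)
  note F = L2_limD[OF assms(1)] and G = L2_limD[OF assms(2)]
  show "L2 (\<lambda>x. F n x + G n x)" "L2 (\<lambda>x. f x + g x)" for n using F G by (auto intro: L2_add)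
  show "(LBINT x. (norm (F n x + G n x - (f x + g x)))\<^sup>2)
      \<le> 2 * (LBINT x. (norm (F n x - f x))\<^sup>2) + 2 * (LBINT x. (norm (G n x - g x))\<^sup>2)" for n
  proof -
    have i: "integrable lborel (\<lambda>x. (norm (F n x - f x))\<^sup>2)" "integrable lborel (\<lambda>x. (norm (G n x - g x))\<^sup>2)"
      "integrable lborel (\<lambda>x. (norm (F n x + G n x - (f x + g x)))\<^sup>2)"
      using F(1)[of n] F(2) G(1)[of n] G(2) by (auto intro!: L2_integrable L2_add L2_diff)
    have "(LBINT x. (norm (F n x + G n x - (f x + g x)))\<^sup>2)
        \<le> (LBINT x. 2 * (norm (F n x - f x))\<^sup>2 + 2 * (norm (G n x - g x))\<^sup>2)"
    proof (rule integral_mono)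
      show "(norm (F n x + G n x - (f x + g x)))\<^sup>2 \<le> 2 * (norm (F n x - f x))\<^sup>2 + 2 * (norm (G n x - g x))\<^sup>2" for x
        using norm_add_sq_le[of "F n x - f x" "G n x - g x"] by (simp only: add_diff_add)
    qed (use i in auto)
    then show ?thesis using i by simp
  qed
  show "(\<lambda>n. 2 * (LBINT x. (norm (F n x - f x))\<^sup>2) + 2 * (LBINT x. (norm (G n x - g x))\<^sup>2)) \<longlonglongrightarrow> 0"
    using tendsto_add[OF tendsto_mult_left[OF F(3), of 2] tendsto_mult_left[OF G(3), of 2]] by simp
qed

lemma L2_lim_mult_bounded:
  assumes "L2_lim F f" "h \<in> borel_measurable borel" "\<And>x. \<bar>h x\<bar> \<le> C"
  shows "L2_lim (\<lambda>n x. h x *\<^sub>R F n x) (\<lambda>x. h x *\<^sub>R f x)"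
proof (rule L2_limI)
  note F = L2_limD[OF assms(1)]
  show "L2 (\<lambda>x. h x *\<^sub>R F n x)" "L2 (\<lambda>x. h x *\<^sub>R f x)" for n
    using F assms by (auto intro: L2_mult_bounded)
  have h2: "(h x)\<^sup>2 \<le> C\<^sup>2" for x using power_mono[of "\<bar>h x\<bar>" C 2] assms(3)[of x] by simp
  show "(LBINT x. (norm (h x *\<^sub>R F n x - h x *\<^sub>R f x))\<^sup>2)
      \<le> C\<^sup>2 * (LBINT x. (norm (F n x - f x))\<^sup>2)" for n
  proof -
    have d: "L2 (\<lambda>x. F n x - f x)" using F by (intro L2_diff) auto
    have "integrable lborel (\<lambda>x. (norm (h x *\<^sub>R (F n x - f x)))\<^sup>2)"
      by (intro L2_integrable L2_mult_bounded[OF d assms(2,3)])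
    then have "(LBINT x. (norm (h x *\<^sub>R (F n x - f x)))\<^sup>2)
      \<le> (LBINT x. C\<^sup>2 * (norm (F n x - f x))\<^sup>2)"
      using L2_integrable[OF d] h2 by (intro integral_mono) (auto simp: power_mult_distrib mult_right_mono)
    then show ?thesis by (simp add: scaleR_diff_right)
  qed
  show "(\<lambda>n. C\<^sup>2 * (LBINT x. (norm (F n x - f x))\<^sup>2)) \<longlonglongrightarrow> 0"
    using tendsto_mult_left[OF F(3), of "C\<^sup>2"] by simp
qed

lemma L2_lim_scaleR: "L2_lim F f \<Longrightarrow> L2_lim (\<lambda>n x. c *\<^sub>R F n x) (\<lambda>x. c *\<^sub>R f x)"
  by (rule L2_lim_mult_bounded[where C="\<bar>c\<bar>"]) auto

lemma L2_lim_cmult: "L2_lim F f \<Longrightarrow> L2_lim (\<lambda>n x. c * F n x) (\<lambda>x. c * f x)" for f :: "_ \<Rightarrow> real"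
  using L2_lim_scaleR[of F f c] by simp

lemma L2_lim_diff: "L2_lim F f \<Longrightarrow> L2_lim G g \<Longrightarrow> L2_lim (\<lambda>n x. F n x - G n x) (\<lambda>x. f x - g x)"
  using L2_lim_add[OF _ L2_lim_scaleR[of G g "-1"], of F f] by simp

lemma L2_lim_inner:
  assumes "L2_lim F f" "L2_lim G g"
  shows "(\<lambda>n. \<integral>x. F n x \<bullet> G n x \<partial>lborel) \<longlonglongrightarrow> (LBINT x. f x \<bullet> g x)"
proof -
  note F = L2_limD[OF assms(1)] and G = L2_limD[OF assms(2)]
  define a where "a n = sqrt (LBINT x. (norm (F n x - f x))\<^sup>2)" for n
  define b where "b n = sqrt (LBINT x. (norm (G n x - g x))\<^sup>2)" for n
  define A where "A = sqrt (LBINT x. (norm (f x))\<^sup>2)"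
  define B where "B = sqrt (LBINT x. (norm (g x))\<^sup>2)"
  have a: "a \<longlonglongrightarrow> 0" and b: "b \<longlonglongrightarrow> 0"
    using tendsto_real_sqrt[OF F(3)] tendsto_real_sqrt[OF G(3)] by (simp_all add: a_def[abs_def] b_def[abs_def])
  have bd: "\<bar>(LBINT x. F n x \<bullet> G n x) - (LBINT x. f x \<bullet> g x)\<bar> \<le> a n * b n + a n * B + A * b n" for n
  proof -
    have d: "L2 (\<lambda>x. F n x - f x)" "L2 (\<lambda>x. G n x - g x)" using F G by (auto intro: L2_diff)
    have "(LBINT x. F n x \<bullet> G n x) - (LBINT x. f x \<bullet> g x)
        = (LBINT x. F n x \<bullet> G n x - f x \<bullet> g x)"
      using F G by (subst Bochner_Integration.integral_diff) (auto intro: L2_inner_integrable)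
    \<comment> \<open>Expanding both factors about their limits leaves three terms, each tending to
      0 by Cauchy-Schwarz.\<close>
    also have "\<dots> = (LBINT x. (F n x - f x) \<bullet> (G n x - g x) + (F n x - f x) \<bullet> g x + f x \<bullet> (G n x - g x))"
      by (intro Bochner_Integration.integral_cong refl) (simp add: inner_simps)
    also have "\<dots> = (LBINT x. (F n x - f x) \<bullet> (G n x - g x)) + (LBINT x. (F n x - f x) \<bullet> g x)
        + (LBINT x. f x \<bullet> (G n x - g x))"
      using L2_inner_integrable[OF d] L2_inner_integrable[OF d(1) G(2)] L2_inner_integrable[OF F(2) d(2)]
      by (simp add: Bochner_Integration.integral_add)
    finally show ?thesis
      using L2_Cauchy_Schwarz_abs[OF d] L2_Cauchy_Schwarz_abs[OF d(1) G(2)] L2_Cauchy_Schwarz_abs[OF F(2) d(2)]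
      unfolding a_def b_def A_def B_def by linarith
  qed
  have "(\<lambda>n. a n * b n + a n * B + A * b n) \<longlonglongrightarrow> 0"
    using tendsto_add[OF tendsto_add[OF tendsto_mult[OF a b] tendsto_mult_right[OF a, of B]] tendsto_mult_left[OF b, of A]]
    by simp
  then have "(\<lambda>n. (LBINT x. F n x \<bullet> G n x) - (LBINT x. f x \<bullet> g x)) \<longlonglongrightarrow> 0"
    by (rule Lim_null_comparison[rotated]) (simp only: real_norm_def bd always_eventually simp_thms)
  then show ?thesis by (simp add: LIM_zero_iff)
qed

lemma L2_lim_integral_sq:
  "L2_lim F f \<Longrightarrow> (\<lambda>n. \<integral>x. (norm (F n x))\<^sup>2 \<partial>lborel) \<longlonglongrightarrow> (LBINT x. (norm (f x))\<^sup>2)"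
  using L2_lim_inner[of F f F f] by (simp add: power2_norm_eq_inner)

lemma L2_lim_AE_subseq:
  assumes "L2_lim F f"
  obtains r where "strict_mono r" "AE x in lborel. (\<lambda>n. F (r n) x) \<longlonglongrightarrow> f x"
proof -
  note F = L2_limD[OF assms]
  have "\<exists>r. strict_mono r \<and> (AE x in lborel. (\<lambda>n. (norm (F (r n) x - f x))\<^sup>2) \<longlonglongrightarrow> 0)"
    by (rule tendsto_L1_AE_subseq) (use F in \<open>auto intro!: L2_integrable L2_diff\<close>)
  then obtain r where r: "strict_mono r" "AE x in lborel. (\<lambda>n. (norm (F (r n) x - f x))\<^sup>2) \<longlonglongrightarrow> 0"
    by blast
  have "(\<lambda>n. F (r n) x) \<longlonglongrightarrow> f x" if "(\<lambda>n. (norm (F (r n) x - f x))\<^sup>2) \<longlonglongrightarrow> 0" for x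
    using tendsto_real_sqrt[OF that] by (simp add: tendsto_norm_zero_iff LIM_zero_iff)
  then have "AE x in lborel. (\<lambda>n. F (r n) x) \<longlonglongrightarrow> f x"
    using r(2) by (rule eventually_mono[rotated])
  then show ?thesis by (rule that[OF r(1)])
qed

lemma L2_lim_dominated:
  assumes "\<And>n. F n \<in> borel_measurable borel" "f \<in> borel_measurable borel" "L2 w"
    and "\<And>n x. norm (F n x) \<le> norm (w x)" "\<And>x. norm (f x) \<le> norm (w x)"
    and "AE x in lborel. (\<lambda>n. F n x) \<longlonglongrightarrow> f x"
  shows "L2_lim F f"
proof -
  have [measurable]: "F n \<in> borel_measurable borel" "f \<in> borel_measurable borel" for n by fact+
  have sq: "(norm a)\<^sup>2 \<le> (norm b)\<^sup>2" if "norm a \<le> norm b" for a :: 'b and b :: 'c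
    using that by (intro power_mono) auto
  have L: "L2 (F n)" "L2 f" for n
    using assms sq by (auto intro!: L2_bound[OF L2_integrable[OF assms(3)]])
  have "(\<lambda>n. \<integral>x. (norm (F n x - f x))\<^sup>2 \<partial>lborel) \<longlonglongrightarrow> (\<integral>x. 0 \<partial>(lborel :: 'a measure))"
  proof (rule integral_dominated_convergence)
    show "integrable lborel (\<lambda>x. 4 * (norm (w x))\<^sup>2)" using L2_integrable[OF assms(3)] by simp
    show "AE x in lborel. (\<lambda>n. (norm (F n x - f x))\<^sup>2) \<longlonglongrightarrow> 0"
      using assms(6)
    proof eventually_elim
      case (elim x)
      then have "(\<lambda>n. (norm (F n x - f x))\<^sup>2) \<longlonglongrightarrow> (norm (f x - f x))\<^sup>2"
        by (intro tendsto_intros)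
      then show ?case by simp
    qed
    show "AE x in lborel. norm ((norm (F n x - f x))\<^sup>2) \<le> 4 * (norm (w x))\<^sup>2" for n
    proof (rule AE_I2)
      fix x
      have "(norm (F n x - f x))\<^sup>2 \<le> 4 * (norm (w x))\<^sup>2"
        using norm_diff_sq_le[of "F n x" "f x"] sq[OF assms(4)[of n x]] sq[OF assms(5)[of x]] by linarith
      then show "norm ((norm (F n x - f x))\<^sup>2) \<le> 4 * (norm (w x))\<^sup>2" by simp
    qed
  qed auto
  then show ?thesis using L by (simp add: L2_lim_def)
qed

lemma L2_dist_triangle:
  assumes "L2 f" "L2 g" "L2 h"
  shows "(LBINT x. (norm (f x - h x))\<^sup>2)
    \<le> 2 * (LBINT x. (norm (f x - g x))\<^sup>2) + 2 * (LBINT x. (norm (g x - h x))\<^sup>2)"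
proof -
  have i: "integrable lborel (\<lambda>x. (norm (f x - g x))\<^sup>2)" "integrable lborel (\<lambda>x. (norm (g x - h x))\<^sup>2)"
    "integrable lborel (\<lambda>x. (norm (f x - h x))\<^sup>2)"
    using assms by (auto intro!: L2_integrable L2_diff)
  have "(LBINT x. (norm (f x - h x))\<^sup>2)
     \<le> (LBINT x. 2 * (norm (f x - g x))\<^sup>2 + 2 * (norm (g x - h x))\<^sup>2)"
  proof (rule integral_mono)
    show "(norm (f x - h x))\<^sup>2 \<le> 2 * (norm (f x - g x))\<^sup>2 + 2 * (norm (g x - h x))\<^sup>2" for x
      using norm_add_sq_le[of "f x - g x" "g x - h x"] by simp
  qed (use i in auto)
  then show ?thesis using i by simp
qed

lemma L2_cong_AE:
  assumes "L2 f" "g \<in> borel_measurable borel" "AE x in lborel. f x = g x"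
  shows "L2 g"
proof -
  have [measurable]: "f \<in> borel_measurable borel" "g \<in> borel_measurable borel"
    using assms by (auto simp: L2_def)
  have "integrable lborel (\<lambda>x. (norm (f x))\<^sup>2) \<longleftrightarrow> integrable lborel (\<lambda>x. (norm (g x))\<^sup>2)"
    by (rule integrable_cong_AE) (use assms(3) in \<open>auto elim: eventually_mono\<close>)
  then show ?thesis using assms by (simp add: L2_def)
qed

lemma L2_lim_cong_AE:
  assumes "L2_lim F f" "g \<in> borel_measurable borel" "AE x in lborel. f x = g x"
  shows "L2_lim F g"
proof -
  have [measurable]: "f \<in> borel_measurable borel" "g \<in> borel_measurable borel" "F n \<in> borel_measurable borel" for n
    using assms by (auto simp: L2_def L2_lim_def)
  have "(LBINT x. (norm (F n x - f x))\<^sup>2) = (LBINT x. (norm (F n x - g x))\<^sup>2)" for n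
    by (rule integral_cong_AE) (use assms(3) in \<open>auto elim: eventually_mono\<close>)
  then show ?thesis using assms L2_cong_AE[of f g] by (simp add: L2_lim_def)
qed

section \<open>Integration of test functions\<close>

lemma distr_shift: "distr lborel borel (\<lambda>x. x + h) = (lborel :: 'a::euclidean_space measure)"
  using lborel_distr_plus[of h] by (simp add: add.commute[of _ h])

lemma integral_shift:
  fixes f :: "'a::euclidean_space \<Rightarrow> 'b::{banach, second_countable_topology}"
  assumes "f \<in> borel_measurable borel"
  shows "(LBINT x. f (x + h)) = (LBINT x. f x)"
  using integral_distr[of "\<lambda>x. x + h" lborel borel f] assms by (simp add: distr_shift)

lemma integrable_shift:
  fixes f :: "'a::euclidean_space \<Rightarrow> 'b::{banach, second_countable_topology}"
  assumes "integrable lborel f"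
  shows "integrable lborel (\<lambda>x. f (x + h))"
  using integrable_distr[of "\<lambda>x. x + h" lborel borel f] assms by (simp add: distr_shift)

lemma AE_shift:
  assumes "AE x in (lborel :: 'a::euclidean_space measure). P x"
  shows "AE x in lborel. P (x + h)"
  by (rule AE_distrD[of "\<lambda>x. x + h" lborel borel P]) (simp, subst distr_shift, fact)

lemma nn_integral_shift:
  fixes f :: "'a::euclidean_space \<Rightarrow> ennreal"
  assumes "f \<in> borel_measurable borel"
  shows "(\<integral>\<^sup>+x. f (x + h) \<partial>lborel) = (\<integral>\<^sup>+x. f x \<partial>lborel)"
  using nn_integral_distr[of "\<lambda>x. x + h" lborel borel f] assms by (simp add: distr_shift)

lemma L2_shift: "L2 f \<Longrightarrow> L2 (\<lambda>x. f (x + h))"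
  unfolding L2_def by (auto intro: integrable_shift[of "\<lambda>x. (norm (f x))\<^sup>2"])

lemma L2_lim_shift:
  assumes "L2_lim F f"
  shows "L2_lim (\<lambda>n x. F n (x + h)) (\<lambda>x. f (x + h))"
proof -
  note F = L2_limD[OF assms]
  have [measurable]: "f \<in> borel_measurable borel" "F n \<in> borel_measurable borel" for n
    using F by (auto simp: L2_def)
  have "(LBINT x. (norm (F n (x + h) - f (x + h)))\<^sup>2) = (LBINT x. (norm (F n x - f x))\<^sup>2)" for n
    by (rule integral_shift[of "\<lambda>x. (norm (F n x - f x))\<^sup>2"]) measurable
  then show ?thesis using F by (simp add: L2_lim_def L2_shift)
qed

lemma integrable_compact_support:
  fixes f :: "'a::euclidean_space \<Rightarrow> 'b::euclidean_space"
  assumes "continuous_on UNIV f" "compact S" "\<And>x. x \<notin> S \<Longrightarrow> f x = 0"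
  shows "integrable lborel f"
proof -
  have "integrable lborel (\<lambda>x. indicator S x *\<^sub>R f x)"
    using assms(1,2) by (intro borel_integrable_compact) (auto intro: continuous_on_subset)
  also have "(\<lambda>x. indicator S x *\<^sub>R f x) = f"
    using assms(3) by (auto simp: indicator_def)
  finally show ?thesis .
qed

lemma bounded_compact_support:
  fixes f :: "'a::euclidean_space \<Rightarrow> 'b::euclidean_space"
  assumes "continuous_on UNIV f" "compact S" "\<And>x. x \<notin> S \<Longrightarrow> f x = 0"
  obtains B where "B > 0" "\<And>x. norm (f x) \<le> B"
proof -
  have "compact (f ` S)" using assms by (auto intro!: compact_continuous_image intro: continuous_on_subset)
  then obtain B where B: "\<And>x. x \<in> S \<Longrightarrow> norm (f x) \<le> B"
    by (fastforce dest!: compact_imp_bounded simp: bounded_iff)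
  have "norm (f x) \<le> max B 1" for x
  proof (cases "x \<in> S")
    case True
    then show ?thesis using B[of x] by linarith
  next
    case False
    then show ?thesis using assms(3)[of x] by simp
  qed
  then show ?thesis by (intro that[of "max B 1"]) auto
qed

lemma test_functions_bounded:
  assumes "\<phi> \<in> test_functions A"
  obtains B where "B > 0" "\<And>x. \<bar>\<phi> x\<bar> \<le> B" "\<And>x. norm (gradient \<phi> x) \<le> B"
proof -
  obtain S where S: "compact S" "\<And>x. x \<notin> S \<Longrightarrow> \<phi> x = 0" "\<And>x. x \<notin> S \<Longrightarrow> gradient \<phi> x = 0"
    using test_functions_support[OF assms] by metis
  note sm = test_functions_smooth[OF assms]
  obtain B1 where B1: "B1 > 0" "\<And>x. norm (\<phi> x) \<le> B1"
    using bounded_compact_support[OF smooth_continuous[OF sm] S(1,2)] by blast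
  obtain B2 where B2: "B2 > 0" "\<And>x. norm (gradient \<phi> x) \<le> B2"
    using bounded_compact_support[OF smooth_gradient_continuous[OF sm] S(1,3)] by blast
  show ?thesis
  proof (rule that)
    show "max B1 B2 > 0" using B1 by simp
    show "\<bar>\<phi> x\<bar> \<le> max B1 B2" for x using B1(2)[of x] by simp
    show "norm (gradient \<phi> x) \<le> max B1 B2" for x using B2(2)[of x] by simp
  qed
qed

lemma test_functions_integrable: "\<phi> \<in> test_functions A \<Longrightarrow> integrable lborel \<phi>"
  by (meson integrable_compact_support smooth_continuous test_functions_smooth test_functions_support)

lemma L2_compact_support:
  fixes f :: "'a::euclidean_space \<Rightarrow> 'b::euclidean_space"
  assumes "continuous_on UNIV f" "compact S" "\<And>x. x \<notin> S \<Longrightarrow> f x = 0"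
  shows "L2 f"
  unfolding L2_def
proof
  show "f \<in> borel_measurable borel" by (intro borel_measurable_continuous_onI assms)
  show "integrable lborel (\<lambda>x. (norm (f x))\<^sup>2)"
    by (rule integrable_compact_support[OF _ assms(2)]) (auto intro!: continuous_intros assms(1) simp: assms(3))
qed

lemma L2_test: "\<phi> \<in> test_functions A \<Longrightarrow> L2 \<phi>"
  by (meson L2_compact_support smooth_continuous test_functions_smooth test_functions_support)

lemma L2_gradient_test: "\<phi> \<in> test_functions A \<Longrightarrow> L2 (gradient \<phi>)"
  by (meson L2_compact_support smooth_gradient_continuous test_functions_smooth test_functions_support)

text \<open>Difference quotients integrate to zero by translation invariance and converge to the
  directional derivative, uniformly bounded and supported in a fixed ball.\<close>

lemma integral_gradient_test:
  fixes \<phi> :: "'a::euclidean_space \<Rightarrow> real"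
  assumes "\<phi> \<in> test_functions A"
  shows "(LBINT x. gradient \<phi> x \<bullet> e) = 0"
proof -
  obtain S where S: "compact S" "\<And>x. x \<notin> S \<Longrightarrow> \<phi> x = 0"
    using test_functions_support[OF assms] by metis
  note sm = test_functions_smooth[OF assms]
  obtain R where R: "\<And>x. x \<in> S \<Longrightarrow> norm x \<le> R"
    using S(1) compact_imp_bounded bounded_iff by metis
  obtain B where B: "B > 0" "\<And>x. norm (gradient \<phi> x) \<le> B"
    using test_functions_bounded[OF assms] by metis
  have [measurable]: "\<phi> \<in> borel_measurable borel" "gradient \<phi> \<in> borel_measurable borel"
    using sm smooth_borel_measurable gradient_borel_measurable by auto
  define t :: "nat \<Rightarrow> real" where "t n = inverse (real (Suc n))" for n
  have t: "t n > 0" "t n \<le> 1" for n by (auto simp: t_def field_simps)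
  have t0: "t \<longlonglongrightarrow> 0" unfolding t_def[abs_def] by (rule LIMSEQ_inverse_real_of_nat)
  define D where "D n x = (\<phi> (x + t n *\<^sub>R e) - \<phi> x) / t n" for n x
  have int0: "(LBINT x. D n x) = 0" for n
  proof -
    have i: "integrable lborel \<phi>" by (rule test_functions_integrable[OF assms])
    have "(LBINT x. \<phi> (x + t n *\<^sub>R e) - \<phi> x) = 0"
      using i integrable_shift[OF i] by (simp add: integral_shift)
    then show ?thesis by (simp add: D_def)
  qed
  have lip: "\<bar>\<phi> x - \<phi> y\<bar> \<le> B * norm (x - y)" for x y
  proof -
    have "norm (\<phi> x - \<phi> y) \<le> B * norm (x - y)"
    proof (rule differentiable_bound[of UNIV])
      show "onorm (\<lambda>h. gradient \<phi> x \<bullet> h) \<le> B" for x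
      proof (rule onorm_bound)
        show "norm (gradient \<phi> x \<bullet> h) \<le> B * norm h" for h
          using Cauchy_Schwarz_ineq2[of "gradient \<phi> x" h] mult_right_mono[OF B(2)[of x] norm_ge_zero[of h]]
          by simp
      qed (use B in simp)
    qed (auto intro: smooth_has_derivative[OF sm])
    then show ?thesis by simp
  qed
  have "(\<lambda>n. \<integral>x. D n x \<partial>lborel) \<longlonglongrightarrow> (LBINT x. gradient \<phi> x \<bullet> e)"
  proof (rule integral_dominated_convergence)
    show "(\<lambda>x. gradient \<phi> x \<bullet> e) \<in> borel_measurable lborel" by measurable
    show "D n \<in> borel_measurable lborel" for n unfolding D_def by measurable
    \<comment> \<open>The step lengths are at most 1, so all shifted supports lie in this ball; the
      height is the Lipschitz constant times |e|.\<close>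
    show "integrable lborel (\<lambda>x. B * norm e * indicator (cball 0 (R + norm e)) x :: real)"
      by (intro integrable_mult_right integrable_real_indicator) (auto intro: emeasure_bounded_finite[OF bounded_cball, unfolded infinity_ennreal_def])
    show "AE x in lborel. (\<lambda>n. D n x) \<longlonglongrightarrow> gradient \<phi> x \<bullet> e"
    proof (rule AE_I2)
      fix x
      have "((\<lambda>s. \<phi> (x + s *\<^sub>R e)) has_real_derivative (gradient \<phi> x \<bullet> e)) (at 0)"
      proof -
        have "((\<lambda>s. x + s *\<^sub>R e) has_derivative (\<lambda>s. s *\<^sub>R e)) (at 0)"
          by (auto intro!: derivative_eq_intros)
        from has_derivative_compose[OF this, of \<phi> "\<lambda>h. gradient \<phi> x \<bullet> h"] smooth_has_derivative[OF sm, of x]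
        show ?thesis by (simp add: has_field_derivative_def mult_commute_abs)
      qed
      then have "((\<lambda>s. (\<phi> (x + s *\<^sub>R e) - \<phi> x) / s) \<longlongrightarrow> gradient \<phi> x \<bullet> e) (at 0)"
        by (simp add: DERIV_def)
      moreover have "filterlim t (at 0) sequentially"
        using t0 t(1) by (simp add: filterlim_at less_imp_neq[symmetric])
      ultimately show "(\<lambda>n. D n x) \<longlonglongrightarrow> gradient \<phi> x \<bullet> e"
        unfolding D_def by (rule filterlim_compose)
    qed
    show "AE x in lborel. norm (D n x) \<le> B * norm e * indicator (cball 0 (R + norm e)) x" for n
    proof (rule AE_I2)
      fix x
      show "norm (D n x) \<le> B * norm e * indicator (cball 0 (R + norm e)) x"
      proof (cases "x \<in> cball 0 (R + norm e)")
        case True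
        have "\<bar>\<phi> (x + t n *\<^sub>R e) - \<phi> x\<bar> \<le> t n * (B * norm e)"
          using lip[of "x + t n *\<^sub>R e" x] t(1)[of n] by (simp add: mult_ac)
        then show ?thesis using True t(1)[of n] by (simp add: D_def abs_divide divide_le_eq mult.commute)
      next
        case False
        have "x \<notin> S" using False R[of x] norm_ge_zero[of e] by auto
        moreover have "x + t n *\<^sub>R e \<notin> S"
        proof
          assume "x + t n *\<^sub>R e \<in> S"
          then have "norm (x + t n *\<^sub>R e) \<le> R" by (rule R)
          moreover have "norm (t n *\<^sub>R e) \<le> norm e" using t[of n] by (simp add: mult_left_le_one_le)
          moreover have "norm x \<le> norm (x + t n *\<^sub>R e) + norm (t n *\<^sub>R e)"
            using norm_triangle_ineq4[of "x + t n *\<^sub>R e" "t n *\<^sub>R e"] by simp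
          ultimately show False using False by simp
        qed
        ultimately show ?thesis using S(2) B(1) by (simp add: D_def)
      qed
    qed
  qed
  then show ?thesis using int0 by (simp add: LIMSEQ_const_iff)
qed

lemma integral_by_parts_test:
  fixes \<phi> \<psi> :: "'a::euclidean_space \<Rightarrow> real"
  assumes "\<phi> \<in> test_functions A" "smooth \<psi>"
  shows "(LBINT x. \<psi> x * (gradient \<phi> x \<bullet> e)) = - (LBINT x. \<phi> x * (gradient \<psi> x \<bullet> e))"
proof -
  note sm = test_functions_smooth[OF assms(1)]
  obtain S where S: "compact S" "\<And>x. x \<notin> S \<Longrightarrow> \<phi> x = 0" "\<And>x. x \<notin> S \<Longrightarrow> gradient \<phi> x = 0"
    using test_functions_support[OF assms(1)] by metis
  have i1: "integrable lborel (\<lambda>x. \<psi> x * (gradient \<phi> x \<bullet> e))"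
    by (rule integrable_compact_support[OF _ S(1)])
      (auto intro!: continuous_intros smooth_continuous[OF assms(2)] smooth_gradient_continuous[OF sm] simp: S(3))
  have i2: "integrable lborel (\<lambda>x. \<phi> x * (gradient \<psi> x \<bullet> e))"
    by (rule integrable_compact_support[OF _ S(1)])
      (auto intro!: continuous_intros smooth_continuous[OF sm] smooth_gradient_continuous[OF assms(2)] simp: S(2))
  have "(LBINT x. \<psi> x * (gradient \<phi> x \<bullet> e)) + (LBINT x. \<phi> x * (gradient \<psi> x \<bullet> e))
      = (LBINT x. gradient (\<lambda>x. \<psi> x * \<phi> x) x \<bullet> e)"
    using i1 i2 by (simp add: gradient_mult[OF assms(2) sm] inner_add_left flip: Bochner_Integration.integral_add)
  also have "\<dots> = 0" by (rule integral_gradient_test[OF test_functions_mult[OF assms]])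
  finally show ?thesis by simp
qed

subsection \<open>The fundamental lemma of the calculus of variations\<close>

text \<open>Smooth cutoffs that equal 1 on S and whose supports shrink to S converge to the
  indicator of S.\<close>

lemma integral_compact_eq_0:
  fixes f :: "'a::euclidean_space \<Rightarrow> real"
  assumes "open A" and [measurable]: "f \<in> borel_measurable borel"
    and int: "\<And>K. compact K \<Longrightarrow> K \<subseteq> A \<Longrightarrow> integrable lborel (\<lambda>x. indicator K x * f x)"
    and zero: "\<And>\<phi>. \<phi> \<in> test_functions A \<Longrightarrow> (LBINT x. f x * \<phi> x) = 0"
    and S: "compact S" "S \<subseteq> A"
  shows "(LBINT x. indicator S x * f x) = 0"
proof (cases "S = {}")
  case False
  obtain \<zeta> where \<zeta>: "\<zeta> \<in> test_functions A" "\<And>x. x \<in> S \<Longrightarrow> \<zeta> x = 1"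
    using cutoff_exists[OF S(1) assms(1) S(2)] by metis
  obtain K where K: "compact K" "K \<subseteq> A" "\<And>x. x \<notin> K \<Longrightarrow> \<zeta> x = 0"
    using test_functions_support[OF \<zeta>(1)] by metis
  \<comment> \<open>The condition \<open>\<zeta> x > 0\<close> keeps all the neighbourhoods inside
    one compact set K, on which f is integrable; this provides the dominating function.\<close>
  define U where "U n = {x. \<zeta> x > 0} \<inter> {x. infdist x S < inverse (real (Suc n))}" for n
  have U: "open (U n)" "S \<subseteq> U n" for n
  proof -
    show "open (U n)" unfolding U_def
      by (intro open_Int open_Collect_less continuous_intros smooth_continuous test_functions_smooth[OF \<zeta>(1)])
    show "S \<subseteq> U n" using \<zeta>(2) by (auto simp: U_def)
  qed
  have "\<exists>\<eta>. \<eta> \<in> test_functions (U n) \<and> (\<forall>x\<in>S. \<eta> x = 1) \<and> (\<forall>x. 0 \<le> \<eta> x) \<and> (\<forall>x. \<eta> x \<le> 1)" for n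
    using cutoff_exists[OF S(1) U] by metis
  then obtain \<eta> where \<eta>: "\<And>n. \<eta> n \<in> test_functions (U n)" "\<And>n x. x \<in> S \<Longrightarrow> \<eta> n x = 1"
    "\<And>n x. 0 \<le> \<eta> n x" "\<And>n x. \<eta> n x \<le> 1" by metis
  have \<eta>0: "\<eta> n x = 0" if "x \<notin> U n" for n x
    using test_functions_support[OF \<eta>(1)[of n]] that by (metis in_mono)
  have UK: "U n \<subseteq> K" for n
  proof
    fix x assume "x \<in> U n"
    then have "\<zeta> x \<noteq> 0" by (auto simp: U_def)
    then show "x \<in> K" using K(3) by blast
  qed
  have "U n \<subseteq> A" for n using UK K(2) by blast
  then have \<eta>A: "\<eta> n \<in> test_functions A" for n using \<eta>(1) test_functions_mono by blast
  have [measurable]: "\<eta> n \<in> borel_measurable borel" for n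
    by (intro smooth_borel_measurable test_functions_smooth[OF \<eta>(1)])
  have [measurable]: "S \<in> sets borel" using S(1) by (simp add: borel_compact)
  have "(\<lambda>n. \<integral>x. f x * \<eta> n x \<partial>lborel) \<longlonglongrightarrow> (LBINT x. indicator S x * f x)"
  proof (rule integral_dominated_convergence)
    show "integrable lborel (\<lambda>x. \<bar>indicator K x * f x\<bar>)" using int[OF K(1,2)] by simp
    show "AE x in lborel. (\<lambda>n. f x * \<eta> n x) \<longlonglongrightarrow> indicator S x * f x"
    proof (rule AE_I2)
      fix x
      show "(\<lambda>n. f x * \<eta> n x) \<longlonglongrightarrow> indicator S x * f x"
      proof (cases "x \<in> S")
        case True
        then show ?thesis using \<eta>(2) by simp
      next
        case False
        then have "infdist x S > 0"
          using S(1) \<open>S \<noteq> {}\<close> by (metis compact_imp_closed in_closed_iff_infdist_zero infdist_nonneg order_le_less)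
        then have "eventually (\<lambda>n. inverse (real (Suc n)) < infdist x S) sequentially"
          using LIMSEQ_inverse_real_of_nat by (simp add: order_tendstoD(2))
        then have "eventually (\<lambda>n. f x * \<eta> n x = 0) sequentially"
        proof eventually_elim
          case (elim n)
          then have "x \<notin> U n" by (auto simp: U_def)
          then show ?case using \<eta>0 by simp
        qed
        then show ?thesis using False by (simp add: tendsto_eventually)
      qed
    qed
    show "AE x in lborel. norm (f x * \<eta> n x) \<le> \<bar>indicator K x * f x\<bar>" for n
    proof (rule AE_I2)
      fix x
      show "norm (f x * \<eta> n x) \<le> \<bar>indicator K x * f x\<bar>"
      proof (cases "x \<in> K")
        case True
        then show ?thesis using \<eta>(3,4)[of n x] by (simp add: abs_mult mult_left_le)
      next
        case False
        then have "x \<notin> U n" using UK by blast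
        then show ?thesis using \<eta>0 by simp
      qed
    qed
  qed measurable
  then show ?thesis using zero[OF \<eta>A] by (simp add: LIMSEQ_const_iff)
qed simp

text \<open>Up to a null set, {f > 0} is a countable union of compact sets; on each of them f is
  positive with zero integral, so each is null. The lower bound on f comes from applying the same to
  -f.\<close>

lemma AE_eq_0_of_compact:
  fixes f :: "'a::euclidean_space \<Rightarrow> real"
  assumes "open A" and [measurable]: "f \<in> borel_measurable borel"
    and int: "\<And>K. compact K \<Longrightarrow> K \<subseteq> A \<Longrightarrow> integrable lborel (\<lambda>x. indicator K x * f x)"
    and zero: "\<And>K. compact K \<Longrightarrow> K \<subseteq> A \<Longrightarrow> (LBINT x. indicator K x * f x) = 0"
  shows "AE x in lborel. x \<in> A \<longrightarrow> f x \<le> 0"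
proof -
  let ?P = "A \<inter> {x. f x > 0}"
  have meas: "?P \<in> sets borel" using assms(1) by measurable
  have "?P \<in> sets lebesgue" using meas by simp
  then obtain C T where CT: "fsigma C" "T \<in> null_sets lebesgue" "C \<union> T = ?P"
    by (rule lebesgue_set_almost_fsigma)
  have "C \<in> null_sets lebesgue"
  proof -
    obtain F :: "nat \<Rightarrow> 'a set" where "range F \<subseteq> Collect compact" and C: "C = (\<Union>n. F n)"
      using CT(1) unfolding fsigma_Union_compact by blast
    then have F: "compact (F n)" "C = (\<Union>n. F n)" for n by auto
    have "F n \<in> null_sets lborel" for n
    proof -
      have [measurable]: "F n \<in> sets borel" using F(1) by (simp add: borel_compact)
      have sub: "F n \<subseteq> A" "\<And>x. x \<in> F n \<Longrightarrow> f x > 0" using F(2) CT(3) by blast+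
      have "AE x in lborel. indicator (F n) x * f x = 0"
        using zero[OF F(1) sub(1)] int[OF F(1) sub(1)] sub(2)
        by (subst (asm) integral_nonneg_eq_0_iff_AE) (auto simp: indicator_def less_imp_le)
      then have "AE x in lborel. x \<notin> F n"
        by eventually_elim (use sub(2) in \<open>force simp: indicator_def\<close>)
      then show ?thesis by (subst AE_iff_null_sets) auto
    qed
    then have "C \<in> null_sets lborel" unfolding F(2) by (intro null_sets_UN) auto
    then show ?thesis using null_sets_completionI by blast
  qed
  with CT(2) have "?P \<in> null_sets lebesgue" using CT(3) null_sets.Un by metis
  then have "?P \<in> null_sets lborel" using meas
    by (auto simp: null_sets_def)
  then have "AE x in lborel. x \<notin> ?P" by (rule AE_not_in)
  then show ?thesis by eventually_elim auto
qed

lemma AE_eq_0_of_test: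
  fixes f :: "'a::euclidean_space \<Rightarrow> real"
  assumes "open A" and [measurable]: "f \<in> borel_measurable borel"
    and int: "\<And>K. compact K \<Longrightarrow> K \<subseteq> A \<Longrightarrow> integrable lborel (\<lambda>x. indicator K x * f x)"
    and zero: "\<And>\<phi>. \<phi> \<in> test_functions A \<Longrightarrow> (LBINT x. f x * \<phi> x) = 0"
  shows "AE x in lborel. x \<in> A \<longrightarrow> f x = 0"
proof -
  note z = integral_compact_eq_0[OF assms]
  have "AE x in lborel. x \<in> A \<longrightarrow> f x \<le> 0"
    by (rule AE_eq_0_of_compact[OF assms(1,2) int z])
  moreover have "AE x in lborel. x \<in> A \<longrightarrow> - f x \<le> 0"
    by (rule AE_eq_0_of_compact[OF assms(1)]) (use int z in auto)
  ultimately show ?thesis by eventually_elim auto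
qed

lemma L2_norm_bound:
  assumes "L2 f" "g \<in> borel_measurable borel" "\<And>x. norm (g x) \<le> C * norm (f x)"
  shows "L2 g"
proof (rule L2_bound[OF _ assms(2)])
  show "integrable lborel (\<lambda>x. C\<^sup>2 * (norm (f x))\<^sup>2)" using L2_integrable[OF assms(1)] by simp
  show "(norm (g x))\<^sup>2 \<le> C\<^sup>2 * (norm (f x))\<^sup>2" for x
    using power_mono[OF assms(3)[of x] norm_ge_zero, of 2] by (simp add: power_mult_distrib)
qed

lemma L2_lim_bound:
  assumes "L2_lim F f" "\<And>n. L2 (G n)" "L2 g"
    and le: "\<And>n x. norm (G n x - g x) \<le> C * norm (F n x - f x)"
  shows "L2_lim G g"
proof (rule L2_limI[OF assms(2,3)])
  note F = L2_limD[OF assms(1)]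
  show "(LBINT x. (norm (G n x - g x))\<^sup>2) \<le> C\<^sup>2 * (LBINT x. (norm (F n x - f x))\<^sup>2)" for n
  proof -
    have "(LBINT x. (norm (G n x - g x))\<^sup>2) \<le> (LBINT x. C\<^sup>2 * (norm (F n x - f x))\<^sup>2)"
    proof (rule integral_mono)
      show "integrable lborel (\<lambda>x. (norm (G n x - g x))\<^sup>2)"
        by (intro L2_integrable L2_diff assms)
      have "integrable lborel (\<lambda>x. (norm (F n x - f x))\<^sup>2)"
        by (intro L2_integrable L2_diff F)
      then show "integrable lborel (\<lambda>x. C\<^sup>2 * (norm (F n x - f x))\<^sup>2)" by simp
      show "(norm (G n x - g x))\<^sup>2 \<le> C\<^sup>2 * (norm (F n x - f x))\<^sup>2" for x
        using power_mono[OF le[of n x] norm_ge_zero, of 2] by (simp add: power_mult_distrib)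
    qed
    then show ?thesis by simp
  qed
  show "(\<lambda>n. C\<^sup>2 * (LBINT x. (norm (F n x - f x))\<^sup>2)) \<longlonglongrightarrow> 0"
    using tendsto_mult_left[OF F(3), of "C\<^sup>2"] by simp
qed

section \<open>The Sobolev space of functions vanishing on the boundary\<close>

text \<open>Pairs of a function and its gradient, both extended by zero to the whole space.\<close>

definition sobolev0 :: "'a::euclidean_space set \<Rightarrow> ('a \<Rightarrow> real) \<Rightarrow> ('a \<Rightarrow> 'a) \<Rightarrow> bool" where
  "sobolev0 A f g \<longleftrightarrow>
     (\<exists>\<phi>. (\<forall>n. \<phi> n \<in> test_functions A) \<and> L2_lim \<phi> f \<and> L2_lim (\<lambda>n. gradient (\<phi> n)) g)"

lemma sobolev0_L2: "sobolev0 A f g \<Longrightarrow> L2 f" "sobolev0 A f g \<Longrightarrow> L2 g"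
  by (auto simp: sobolev0_def L2_lim_def)

lemma sobolev0_measurable:
  "sobolev0 A f g \<Longrightarrow> f \<in> borel_measurable borel" "sobolev0 A f g \<Longrightarrow> g \<in> borel_measurable borel"
  by (auto dest: sobolev0_L2 L2_measurable)

lemma sobolev0E:
  assumes "sobolev0 A f g"
  obtains \<phi> where "\<And>n. \<phi> n \<in> test_functions A" "L2_lim \<phi> f" "L2_lim (\<lambda>n. gradient (\<phi> n)) g"
    "AE x in lborel. (\<lambda>n. \<phi> n x) \<longlonglongrightarrow> f x" "AE x in lborel. (\<lambda>n. gradient (\<phi> n) x) \<longlonglongrightarrow> g x"
proof -
  obtain \<phi> where \<phi>: "\<And>n. \<phi> n \<in> test_functions A" "L2_lim \<phi> f" "L2_lim (\<lambda>n. gradient (\<phi> n)) g"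
    using assms unfolding sobolev0_def by blast
  obtain r where r: "strict_mono r" "AE x in lborel. (\<lambda>n. \<phi> (r n) x) \<longlonglongrightarrow> f x"
    using L2_lim_AE_subseq[OF \<phi>(2)] by blast
  obtain s where s: "strict_mono s" "AE x in lborel. (\<lambda>n. gradient (\<phi> (r (s n))) x) \<longlonglongrightarrow> g x"
    using L2_lim_AE_subseq[OF L2_lim_subseq[OF \<phi>(3) r(1)]] by blast
  have f': "AE x in lborel. (\<lambda>n. \<phi> (r (s n)) x) \<longlonglongrightarrow> f x"
    using r(2)
  proof eventually_elim
    case (elim x)
    show ?case using LIMSEQ_subseq_LIMSEQ[OF elim s(1)] by (simp add: o_def)
  qed
  show ?thesis
    by (rule that[of "\<lambda>n. \<phi> (r (s n))"])
      (use \<phi>(1) s(2) f' L2_lim_subseq[OF L2_lim_subseq[OF \<phi>(2) r(1)] s(1)]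
        L2_lim_subseq[OF L2_lim_subseq[OF \<phi>(3) r(1)] s(1)] in auto)
qed

lemma sobolev0_test: "\<phi> \<in> test_functions A \<Longrightarrow> sobolev0 A \<phi> (gradient \<phi>)"
  unfolding sobolev0_def
  by (rule exI[of _ "\<lambda>n. \<phi>"]) (simp add: L2_lim_const L2_test L2_gradient_test)

lemma sobolev0_zero: "sobolev0 A (\<lambda>x. 0) (\<lambda>x. 0)"
proof -
  have "gradient (\<lambda>x::'a. 0) = (\<lambda>x. 0)" using gradient_const by blast
  then show ?thesis using sobolev0_test[OF test_functions_zero[of A]] by simp
qed

lemma sobolev0_mono: "sobolev0 A f g \<Longrightarrow> A \<subseteq> B \<Longrightarrow> sobolev0 B f g"
  unfolding sobolev0_def by (meson test_functions_mono)

lemma sobolev0_add: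
  assumes "sobolev0 A f g" "sobolev0 A f' g'"
  shows "sobolev0 A (\<lambda>x. f x + f' x) (\<lambda>x. g x + g' x)"
proof -
  obtain \<phi> where \<phi>: "\<And>n. \<phi> n \<in> test_functions A" "L2_lim \<phi> f" "L2_lim (\<lambda>n. gradient (\<phi> n)) g"
    using assms(1) unfolding sobolev0_def by blast
  obtain \<psi> where \<psi>: "\<And>n. \<psi> n \<in> test_functions A" "L2_lim \<psi> f'" "L2_lim (\<lambda>n. gradient (\<psi> n)) g'"
    using assms(2) unfolding sobolev0_def by blast
  have "(\<lambda>n. gradient (\<lambda>x. \<phi> n x + \<psi> n x)) = (\<lambda>n x. gradient (\<phi> n) x + gradient (\<psi> n) x)"
    by (intro ext gradient_add test_functions_smooth[OF \<phi>(1)] test_functions_smooth[OF \<psi>(1)])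
  then show ?thesis unfolding sobolev0_def
    by (intro exI[of _ "\<lambda>n x. \<phi> n x + \<psi> n x"])
      (simp add: L2_lim_add \<phi> \<psi> test_functions_add)
qed

lemma sobolev0_cmult:
  assumes "sobolev0 A f g"
  shows "sobolev0 A (\<lambda>x. c * f x) (\<lambda>x. c *\<^sub>R g x)"
proof -
  obtain \<phi> where \<phi>: "\<And>n. \<phi> n \<in> test_functions A" "L2_lim \<phi> f" "L2_lim (\<lambda>n. gradient (\<phi> n)) g"
    using assms(1) unfolding sobolev0_def by blast
  have "(\<lambda>n. gradient (\<lambda>x. c * \<phi> n x)) = (\<lambda>n x. c *\<^sub>R gradient (\<phi> n) x)"
    by (intro ext gradient_cmult test_functions_smooth[OF \<phi>(1)])
  then show ?thesis unfolding sobolev0_def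
    by (intro exI[of _ "\<lambda>n x. c * \<phi> n x"])
      (simp add: L2_lim_scaleR L2_lim_cmult \<phi> test_functions_cmult)
qed

lemma sobolev0_diff:
  "sobolev0 A f g \<Longrightarrow> sobolev0 A f' g' \<Longrightarrow> sobolev0 A (\<lambda>x. f x - f' x) (\<lambda>x. g x - g' x)"
  using sobolev0_add[OF _ sobolev0_cmult[of A f' g' "-1"], of f g] by simp

lemma sobolev0_sum:
  "(\<And>i. i \<in> I \<Longrightarrow> sobolev0 A (f i) (g i)) \<Longrightarrow> sobolev0 A (\<lambda>x. \<Sum>i\<in>I. f i x) (\<lambda>x. \<Sum>i\<in>I. g i x)"
  by (induction I rule: infinite_finite_induct) (auto intro!: sobolev0_add sobolev0_zero)

lemma sobolev0_shift:
  assumes "sobolev0 A f g" "\<And>x. x + h \<in> A \<Longrightarrow> x \<in> B"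
  shows "sobolev0 B (\<lambda>x. f (x + h)) (\<lambda>x. g (x + h))"
proof -
  obtain \<phi> where \<phi>: "\<And>n. \<phi> n \<in> test_functions A" "L2_lim \<phi> f" "L2_lim (\<lambda>n. gradient (\<phi> n)) g"
    using assms(1) unfolding sobolev0_def by blast
  have "(\<lambda>n. gradient (\<lambda>x. \<phi> n (x + h))) = (\<lambda>n x. gradient (\<phi> n) (x + h))"
    by (intro ext gradient_shift test_functions_smooth[OF \<phi>(1)])
  moreover have "(\<lambda>x. \<phi> n (x + h)) \<in> test_functions B" for n
    by (rule test_functions_shift[OF \<phi>(1) assms(2)])
  ultimately show ?thesis unfolding sobolev0_def
    using L2_lim_shift[OF \<phi>(2)] L2_lim_shift[OF \<phi>(3)]
    by (intro exI[of _ "\<lambda>n x. \<phi> n (x + h)"]) simp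
qed

lemma sobolev0_cong_AE:
  assumes "sobolev0 A f g" "f' \<in> borel_measurable borel" "g' \<in> borel_measurable borel"
    "AE x in lborel. f x = f' x" "AE x in lborel. g x = g' x"
  shows "sobolev0 A f' g'"
proof -
  obtain \<phi> where \<phi>: "\<And>n. \<phi> n \<in> test_functions A" "L2_lim \<phi> f" "L2_lim (\<lambda>n. gradient (\<phi> n)) g"
    using assms(1) unfolding sobolev0_def by blast
  show ?thesis unfolding sobolev0_def
    by (intro exI[of _ \<phi>] conjI allI \<phi>(1) L2_lim_cong_AE[OF \<phi>(2) assms(2,4)] L2_lim_cong_AE[OF \<phi>(3) assms(3,5)])
qed

text \<open>Each member is replaced by a test function with squared error at most 1/(n+1). This
  closedness extends the chain rule from smooth compositions to truncations and absolute
  values.\<close>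

lemma sobolev0_closed:
  assumes S: "\<And>n. sobolev0 A (F n) (G n)" and f: "L2_lim F f" and g: "L2_lim G g"
  shows "sobolev0 A f g"
proof -
  have "\<exists>\<phi>. \<phi> \<in> test_functions A \<and> (LBINT x. (norm (\<phi> x - F n x))\<^sup>2) \<le> inverse (real (Suc n))
     \<and> (LBINT x. (norm (gradient \<phi> x - G n x))\<^sup>2) \<le> inverse (real (Suc n))" for n
  proof -
    obtain \<phi> where \<phi>: "\<And>m. \<phi> m \<in> test_functions A" "L2_lim \<phi> (F n)" "L2_lim (\<lambda>m. gradient (\<phi> m)) (G n)"
      using S unfolding sobolev0_def by blast
    have "eventually (\<lambda>m. (LBINT x. (norm (\<phi> m x - F n x))\<^sup>2) < inverse (real (Suc n)) \<and>
      (LBINT x. (norm (gradient (\<phi> m) x - G n x))\<^sup>2) < inverse (real (Suc n))) sequentially"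
      by (intro eventually_conj order_tendstoD(2)[OF L2_limD(3)[OF \<phi>(2)]] order_tendstoD(2)[OF L2_limD(3)[OF \<phi>(3)]]) auto
    then obtain m where "(LBINT x. (norm (\<phi> m x - F n x))\<^sup>2) < inverse (real (Suc n))"
      "(LBINT x. (norm (gradient (\<phi> m) x - G n x))\<^sup>2) < inverse (real (Suc n))"
      by (auto simp: eventually_sequentially)
    then show ?thesis using \<phi>(1) by (intro exI[of _ "\<phi> m"]) auto
  qed
  then have "\<exists>\<phi>. \<forall>n. \<phi> n \<in> test_functions A \<and> (LBINT x. (norm (\<phi> n x - F n x))\<^sup>2) \<le> inverse (real (Suc n))
     \<and> (LBINT x. (norm (gradient (\<phi> n) x - G n x))\<^sup>2) \<le> inverse (real (Suc n))"
    by (intro choice allI)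
  then obtain \<phi> where \<phi>: "\<And>n. \<phi> n \<in> test_functions A"
    "\<And>n. (LBINT x. (norm (\<phi> n x - F n x))\<^sup>2) \<le> inverse (real (Suc n))"
    "\<And>n. (LBINT x. (norm (gradient (\<phi> n) x - G n x))\<^sup>2) \<le> inverse (real (Suc n))" by blast
  have t: "(\<lambda>n. 2 * inverse (real (Suc n)) + 2 * e n) \<longlonglongrightarrow> 0" if "e \<longlonglongrightarrow> 0" for e
    using tendsto_add[OF tendsto_mult_left[OF LIMSEQ_inverse_real_of_nat, of 2] tendsto_mult_left[OF that, of 2]]
    by simp
  have "L2_lim \<phi> f"
  proof (rule L2_limI[OF _ L2_limD(2)[OF f] _ t[OF L2_limD(3)[OF f]]])
    show "L2 (\<phi> n)" for n by (rule L2_test[OF \<phi>(1)])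
    show "(LBINT x. (norm (\<phi> n x - f x))\<^sup>2)
      \<le> 2 * inverse (real (Suc n)) + 2 * (LBINT x. (norm (F n x - f x))\<^sup>2)" for n
      using L2_dist_triangle[OF L2_test[OF \<phi>(1)] L2_limD(1)[OF f] L2_limD(2)[OF f], of n n] \<phi>(2)[of n] by linarith
  qed
  moreover have "L2_lim (\<lambda>n. gradient (\<phi> n)) g"
  proof (rule L2_limI[OF _ L2_limD(2)[OF g] _ t[OF L2_limD(3)[OF g]]])
    show "L2 (gradient (\<phi> n))" for n by (rule L2_gradient_test[OF \<phi>(1)])
    show "(LBINT x. (norm (gradient (\<phi> n) x - g x))\<^sup>2)
      \<le> 2 * inverse (real (Suc n)) + 2 * (LBINT x. (norm (G n x - g x))\<^sup>2)" for n
      using L2_dist_triangle[OF L2_gradient_test[OF \<phi>(1)] L2_limD(1)[OF g] L2_limD(2)[OF g], of n n] \<phi>(3)[of n]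
      by linarith
  qed
  ultimately show ?thesis using \<phi>(1) unfolding sobolev0_def by blast
qed

lemma sobolev0_AE_outside:
  assumes "sobolev0 A f g"
  shows "AE x in lborel. x \<notin> A \<longrightarrow> f x = 0 \<and> g x = 0"
proof -
  obtain \<phi> where \<phi>: "\<And>n. \<phi> n \<in> test_functions A" and "L2_lim \<phi> f" "L2_lim (\<lambda>n. gradient (\<phi> n)) g"
    and lim: "AE x in lborel. (\<lambda>n. \<phi> n x) \<longlonglongrightarrow> f x" "AE x in lborel. (\<lambda>n. gradient (\<phi> n) x) \<longlonglongrightarrow> g x"
    by (rule sobolev0E[OF assms]) (rule that)
  have z: "\<phi> n x = 0" "gradient (\<phi> n) x = 0" if "x \<notin> A" for n x
    using test_functions_support[OF \<phi>(1)[of n]] that by (metis subsetD)+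
  show ?thesis using lim
    by eventually_elim (auto simp: z LIMSEQ_const_iff)
qed

lemma test_functions_mult_Int:
  assumes "\<phi> \<in> test_functions A" "\<psi> \<in> test_functions B"
  shows "(\<lambda>x. \<psi> x * \<phi> x) \<in> test_functions (A \<inter> B)"
proof -
  obtain S T where ST: "compact S" "S \<subseteq> A" "\<And>x. x \<notin> S \<Longrightarrow> \<phi> x = 0"
    "compact T" "T \<subseteq> B" "\<And>x. x \<notin> T \<Longrightarrow> \<psi> x = 0"
    using test_functions_support[OF assms(1)] test_functions_support[OF assms(2)] by metis
  show ?thesis
    by (intro test_functionsI[of _ "S \<inter> T"] smooth_mult test_functions_smooth[OF assms(1)]
        test_functions_smooth[OF assms(2)]) (use ST in auto)
qed

lemma sobolev0_mult_test:
  assumes "sobolev0 A f g" "\<zeta> \<in> test_functions B"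
  shows "sobolev0 (A \<inter> B) (\<lambda>x. \<zeta> x * f x) (\<lambda>x. \<zeta> x *\<^sub>R g x + f x *\<^sub>R gradient \<zeta> x)"
proof -
  obtain \<phi> where \<phi>: "\<And>n. \<phi> n \<in> test_functions A" "L2_lim \<phi> f" "L2_lim (\<lambda>n. gradient (\<phi> n)) g"
    using assms(1) unfolding sobolev0_def by blast
  note sm = test_functions_smooth[OF assms(2)]
  obtain C where C: "\<And>x. \<bar>\<zeta> x\<bar> \<le> C" "\<And>x. norm (gradient \<zeta> x) \<le> C"
    using test_functions_bounded[OF assms(2)] by metis
  have [measurable]: "\<zeta> \<in> borel_measurable borel" "gradient \<zeta> \<in> borel_measurable borel"
    using sm smooth_borel_measurable gradient_borel_measurable by auto
  have "L2_lim (\<lambda>n x. \<zeta> x *\<^sub>R \<phi> n x) (\<lambda>x. \<zeta> x *\<^sub>R f x)"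
    by (rule L2_lim_mult_bounded[OF \<phi>(2) _ C(1)]) measurable
  moreover have "L2_lim (\<lambda>n x. \<phi> n x *\<^sub>R gradient \<zeta> x) (\<lambda>x. f x *\<^sub>R gradient \<zeta> x)"
  proof -
    have L: "L2 (\<lambda>x. h x *\<^sub>R gradient \<zeta> x)" if "L2 h" for h :: "'a \<Rightarrow> real"
    proof (rule L2_norm_bound[OF that])
      have [measurable]: "h \<in> borel_measurable borel" by (rule L2_measurable[OF that])
      show "(\<lambda>x. h x *\<^sub>R gradient \<zeta> x) \<in> borel_measurable borel" by measurable
      show "norm (h x *\<^sub>R gradient \<zeta> x) \<le> C * norm (h x)" for x
        using mult_left_mono[OF C(2)[of x], of "\<bar>h x\<bar>"] by (simp add: mult.commute)
    qed
    show ?thesis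
    proof (rule L2_lim_bound[OF \<phi>(2)])
      show "norm (\<phi> n x *\<^sub>R gradient \<zeta> x - f x *\<^sub>R gradient \<zeta> x) \<le> C * norm (\<phi> n x - f x)" for n x
        using mult_left_mono[OF C(2)[of x], of "\<bar>\<phi> n x - f x\<bar>"]
        by (simp add: mult.commute flip: scaleR_diff_left)
    qed (use L L2_limD[OF \<phi>(2)] in auto)
  qed
  moreover have "L2_lim (\<lambda>n x. \<zeta> x *\<^sub>R gradient (\<phi> n) x) (\<lambda>x. \<zeta> x *\<^sub>R g x)"
    by (rule L2_lim_mult_bounded[OF \<phi>(3) _ C(1)]) measurable
  moreover have "(\<lambda>n. gradient (\<lambda>x. \<zeta> x * \<phi> n x)) = (\<lambda>n x. \<zeta> x *\<^sub>R gradient (\<phi> n) x + \<phi> n x *\<^sub>R gradient \<zeta> x)"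
    by (intro ext gradient_mult sm test_functions_smooth[OF \<phi>(1)])
  ultimately show ?thesis unfolding sobolev0_def
    by (intro exI[of _ "\<lambda>n x. \<zeta> x * \<phi> n x"]) (simp add: test_functions_mult_Int[OF \<phi>(1) assms(2)] L2_lim_add)
qed


lemma sobolev0_by_parts:
  assumes "sobolev0 A f g" "\<psi> \<in> test_functions B"
  shows "(LBINT x. f x * (gradient \<psi> x \<bullet> e)) = - (LBINT x. (g x \<bullet> e) * \<psi> x)"
proof -
  obtain \<phi> where \<phi>: "\<And>n. \<phi> n \<in> test_functions A" "L2_lim \<phi> f" "L2_lim (\<lambda>n. gradient (\<phi> n)) g"
    using assms(1) unfolding sobolev0_def by blast
  have ibp: "(LBINT x. \<phi> n x * (gradient \<psi> x \<bullet> e)) = - (LBINT x. gradient (\<phi> n) x \<bullet> (\<psi> x *\<^sub>R e))" for n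
    using integral_by_parts_test[OF assms(2) test_functions_smooth[OF \<phi>(1)[of n]], of e]
    by (simp add: mult.commute)
  have L: "L2 (\<lambda>x. \<psi> x *\<^sub>R e)"
  proof (rule L2_norm_bound[OF L2_test[OF assms(2)]])
    show "(\<lambda>x. \<psi> x *\<^sub>R e) \<in> borel_measurable borel"
      using smooth_borel_measurable[OF test_functions_smooth[OF assms(2)]] by measurable
    show "norm (\<psi> x *\<^sub>R e) \<le> norm e * norm (\<psi> x)" for x by (simp add: mult.commute)
  qed
  have "(\<lambda>n. \<integral>x. \<phi> n x \<bullet> (gradient \<psi> x \<bullet> e) \<partial>lborel) \<longlonglongrightarrow> (LBINT x. f x \<bullet> (gradient \<psi> x \<bullet> e))"
    by (rule L2_lim_inner[OF \<phi>(2) L2_lim_const[OF L2_test[OF test_functions_partial[OF assms(2)]]]])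
  moreover have "(\<lambda>n. - (LBINT x. gradient (\<phi> n) x \<bullet> (\<psi> x *\<^sub>R e))) \<longlonglongrightarrow> - (LBINT x. g x \<bullet> (\<psi> x *\<^sub>R e))"
    by (intro tendsto_minus L2_lim_inner[OF \<phi>(3) L2_lim_const[OF L]])
  ultimately show ?thesis using ibp LIMSEQ_unique by (fastforce simp: mult.commute)
qed

lemma integrable_L2_compact:
  fixes f :: "'a::euclidean_space \<Rightarrow> real"
  assumes "L2 f" "compact K"
  shows "integrable lborel (\<lambda>x. indicator K x * f x)"
proof (rule L2_mult_integrable[OF _ assms(1)])
  have [measurable]: "K \<in> sets borel" using assms(2) by (simp add: borel_compact)
  have "emeasure lborel K < \<infinity>" by (intro emeasure_bounded_finite compact_imp_bounded assms(2))
  then show "L2 (indicator K :: 'a \<Rightarrow> real)"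
    by (auto simp: L2_def power2_eq_square indicator_inter_arith[symmetric])
qed

text \<open>Integration by parts against test functions of U involves f on U only, so the gradient
  is a local quantity; for U the whole space this is uniqueness of the second component of the
  pair.\<close>

lemma sobolev0_gradient_unique:
  assumes f: "sobolev0 A f g" and f': "sobolev0 B f' g'" and U: "open U"
    and eq: "AE x in lborel. x \<in> U \<longrightarrow> f x = f' x"
  shows "AE x in lborel. x \<in> U \<longrightarrow> g x = g' x"
proof -
  have [measurable]: "f \<in> borel_measurable borel" "f' \<in> borel_measurable borel"
    "g \<in> borel_measurable borel" "g' \<in> borel_measurable borel"
    using f f' by (auto dest: sobolev0_measurable)
  have "AE x in lborel. x \<in> U \<longrightarrow> (g x - g' x) \<bullet> i = 0" for i
  proof (rule AE_eq_0_of_test[OF U])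
    have "L2 (\<lambda>x. norm i *\<^sub>R (g x - g' x))" by (intro L2_scaleR L2_diff sobolev0_L2[OF f] sobolev0_L2[OF f'])
    then have L: "L2 (\<lambda>x. (g x - g' x) \<bullet> i)"
      by (rule L2_norm_bound[where C=1])
        (use Cauchy_Schwarz_ineq2[of "g x - g' x" i for x] in \<open>auto simp: mult.commute\<close>)
    then show "integrable lborel (\<lambda>x. indicator K x * ((g x - g' x) \<bullet> i))" if "compact K" for K
      using integrable_L2_compact that by blast
    fix \<phi> assume \<phi>: "\<phi> \<in> test_functions U"
    obtain S where S: "S \<subseteq> U" "\<And>x. x \<notin> S \<Longrightarrow> gradient \<phi> x = 0" using test_functions_support[OF \<phi>] by metis
    have [measurable]: "gradient \<phi> \<in> borel_measurable borel"
      by (rule gradient_borel_measurable[OF test_functions_smooth[OF \<phi>]])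
    have d: "sobolev0 (A \<union> B) (\<lambda>x. f x - f' x) (\<lambda>x. g x - g' x)"
      by (intro sobolev0_diff sobolev0_mono[OF f] sobolev0_mono[OF f']) auto
    have "(LBINT x. ((g x - g' x) \<bullet> i) * \<phi> x) = - (LBINT x. (f x - f' x) * (gradient \<phi> x \<bullet> i))"
      using sobolev0_by_parts[OF d \<phi>, of i] by simp
    also have "(LBINT x. (f x - f' x) * (gradient \<phi> x \<bullet> i)) = (\<integral>x. 0 \<partial>(lborel :: 'a measure))"
    proof (rule integral_cong_AE)
      show "AE x in lborel. (f x - f' x) * (gradient \<phi> x \<bullet> i) = 0"
        using eq
      proof eventually_elim
        case (elim x)
        then show ?case using S(1) S(2)[of x] by (cases "x \<in> S") auto
      qed
    qed measurable
    finally show "(LBINT x. ((g x - g' x) \<bullet> i) * \<phi> x) = 0" by simp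
  qed measurable
  then have "AE x in lborel. \<forall>i\<in>Basis. x \<in> U \<longrightarrow> (g x - g' x) \<bullet> i = 0"
    by (intro AE_finite_allI) auto
  then show ?thesis
  proof eventually_elim
    case (elim x)
    show ?case
    proof
      assume "x \<in> U"
      with elim have "(g x - g' x) \<bullet> i = 0" if "i \<in> Basis" for i using that by blast
      then have "g x - g' x = 0" by (rule euclidean_eqI[where y=0, unfolded inner_zero_left])
      then show "g x = g' x" by simp
    qed
  qed
qed

subsection \<open>Chain rule and truncations\<close>

lemma real_lipschitz_of_derivative:
  fixes G G' :: "real \<Rightarrow> real"
  assumes "\<And>t. (G has_real_derivative G' t) (at t)" "\<And>t. \<bar>G' t\<bar> \<le> C"
  shows "\<bar>G s - G t\<bar> \<le> C * \<bar>s - t\<bar>"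
  using field_differentiable_bound[of UNIV G G' C s t] assms by (simp add: abs_minus_commute)

text \<open>In the product of G'(\<phi>_n) and the gradient of \<phi>_n both factors vary. It is
  compared with G'(\<phi>_n) g, where a bounded factor multiplies an L2 error, and then dominated
  convergence along an almost everywhere convergent subsequence replaces G'(\<phi>_n) by
  G'(f).\<close>

lemma sobolev0_compose:
  assumes f: "sobolev0 A f g" and G: "smooth G" "G 0 = 0"
    and G': "\<And>t. (G has_real_derivative G' t) (at t)" "\<And>t. \<bar>G' t\<bar> \<le> C"
  shows "sobolev0 A (\<lambda>x. G (f x)) (\<lambda>x. G' (f x) *\<^sub>R g x)"
proof -
  obtain \<phi> where \<phi>: "\<And>n. \<phi> n \<in> test_functions A" "L2_lim \<phi> f" "L2_lim (\<lambda>n. gradient (\<phi> n)) g"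
    "AE x in lborel. (\<lambda>n. \<phi> n x) \<longlonglongrightarrow> f x" and "AE x in lborel. (\<lambda>n. gradient (\<phi> n) x) \<longlonglongrightarrow> g x"
    by (rule sobolev0E[OF f]) (rule that)
  have lip: "\<bar>G s - G t\<bar> \<le> C * \<bar>s - t\<bar>" for s t
    by (rule real_lipschitz_of_derivative[OF G'])
  have C0: "C \<ge> 0" using G'(2)[of 0] by linarith
  have "G' = (\<lambda>t. gradient G t \<bullet> 1)"
    using DERIV_unique[OF G'(1)] smooth_has_derivative[OF G(1)]
    by (auto simp: has_field_derivative_def)
  then have cG': "continuous_on UNIV G'"
    by (simp add: smooth_gradient_continuous[OF G(1)])
  have [measurable]: "G \<in> borel_measurable borel" "G' \<in> borel_measurable borel"
    "f \<in> borel_measurable borel" "g \<in> borel_measurable borel"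
    "\<phi> n \<in> borel_measurable borel" "gradient (\<phi> n) \<in> borel_measurable borel" for n
    using smooth_borel_measurable[OF G(1)] borel_measurable_continuous_onI[OF cG'] sobolev0_measurable[OF f]
      smooth_borel_measurable[OF test_functions_smooth[OF \<phi>(1)]]
      gradient_borel_measurable[OF test_functions_smooth[OF \<phi>(1)]] by auto
  have L: "L2 (\<lambda>x. G (h x))" if "L2 h" for h :: "'a \<Rightarrow> real"
  proof (rule L2_norm_bound[OF that])
    have [measurable]: "h \<in> borel_measurable borel" by (rule L2_measurable[OF that])
    show "(\<lambda>x. G (h x)) \<in> borel_measurable borel" by measurable
    show "norm (G (h x)) \<le> C * norm (h x)" for x using lip[of "h x" 0] G(2) by simp
  qed
  have "L2_lim (\<lambda>n x. G (\<phi> n x)) (\<lambda>x. G (f x))"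
    by (rule L2_lim_bound[OF \<phi>(2), where C=C]) (use L lip L2_limD[OF \<phi>(2)] in auto)
  moreover have "L2_lim (\<lambda>n x. G' (\<phi> n x) *\<^sub>R gradient (\<phi> n) x) (\<lambda>x. G' (f x) *\<^sub>R g x)"
  proof -
    have L': "L2 (\<lambda>x. G' (h x) *\<^sub>R v x)" if "L2 v" "h \<in> borel_measurable borel" for h and v :: "'a \<Rightarrow> 'a"
      using that(2) by (intro L2_mult_bounded[OF that(1), where C=C] G'(2)) measurable
    have "L2_lim (\<lambda>n x. G' (\<phi> n x) *\<^sub>R gradient (\<phi> n) x - G' (\<phi> n x) *\<^sub>R g x) (\<lambda>x. g x - g x)"
    proof (rule L2_lim_bound[OF L2_lim_diff[OF \<phi>(3) L2_lim_const[OF sobolev0_L2(2)[OF f]]], where C=C])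
      show "L2 (\<lambda>x. G' (\<phi> n x) *\<^sub>R gradient (\<phi> n) x - G' (\<phi> n x) *\<^sub>R g x)" for n
        by (intro L2_diff L' L2_gradient_test[OF \<phi>(1)] sobolev0_L2(2)[OF f]) measurable
      show "norm (G' (\<phi> n x) *\<^sub>R gradient (\<phi> n) x - G' (\<phi> n x) *\<^sub>R g x - (g x - g x))
         \<le> C * norm (gradient (\<phi> n) x - g x - (g x - g x))" for n x
        using mult_right_mono[OF G'(2)[of "\<phi> n x"] norm_ge_zero[of "gradient (\<phi> n) x - g x"]]
        by (simp flip: scaleR_diff_right)
    qed (simp add: L2_zero)
    moreover have "L2_lim (\<lambda>n x. G' (\<phi> n x) *\<^sub>R g x) (\<lambda>x. G' (f x) *\<^sub>R g x)"
    proof (rule L2_lim_dominated[where w="\<lambda>x. C *\<^sub>R g x"])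
      show "L2 (\<lambda>x. C *\<^sub>R g x)" by (intro L2_scaleR sobolev0_L2(2)[OF f])
      show "norm (G' (\<phi> n x) *\<^sub>R g x) \<le> norm (C *\<^sub>R g x)" for n x
        using mult_right_mono[OF G'(2)[of "\<phi> n x"] norm_ge_zero[of "g x"]] C0 by simp
      show "norm (G' (f x) *\<^sub>R g x) \<le> norm (C *\<^sub>R g x)" for x
        using mult_right_mono[OF G'(2)[of "f x"] norm_ge_zero[of "g x"]] C0 by simp
      show "AE x in lborel. (\<lambda>n. G' (\<phi> n x) *\<^sub>R g x) \<longlonglongrightarrow> G' (f x) *\<^sub>R g x"
        using \<phi>(4)
      proof eventually_elim
        case (elim x)
        have "isCont G' (f x)" using cG' by (simp add: continuous_on_eq_continuous_at)
        from isCont_tendsto_compose[OF this elim] show ?case by (rule tendsto_scaleR[OF _ tendsto_const])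
      qed
    qed measurable
    ultimately have "L2_lim (\<lambda>n x. (G' (\<phi> n x) *\<^sub>R gradient (\<phi> n) x - G' (\<phi> n x) *\<^sub>R g x) + G' (\<phi> n x) *\<^sub>R g x)
       (\<lambda>x. (g x - g x) + G' (f x) *\<^sub>R g x)" by (rule L2_lim_add)
    then show ?thesis by simp
  qed
  moreover have "(\<lambda>n. gradient (\<lambda>x. G (\<phi> n x))) = (\<lambda>n x. G' (\<phi> n x) *\<^sub>R gradient (\<phi> n) x)"
    by (intro ext gradient_compose test_functions_smooth[OF \<phi>(1)] G')
  ultimately show ?thesis unfolding sobolev0_def
    by (intro exI[of _ "\<lambda>n x. G (\<phi> n x)"]) (simp add: test_functions_compose[OF \<phi>(1) G])
qed

text \<open>The common Lipschitz constant C provides the dominating functions C f and C g, so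
  pointwise convergence of G_n and of its derivative is enough and the limit H may have
  corners.\<close>

lemma sobolev0_compose_limit:
  fixes G :: "nat \<Rightarrow> real \<Rightarrow> real"
  assumes f: "sobolev0 A f g" and G: "\<And>n. smooth (G n)" "\<And>n. G n 0 = 0"
    and G': "\<And>n t. (G n has_real_derivative G' n t) (at t)" "\<And>n t. \<bar>G' n t\<bar> \<le> C"
    and lim: "\<And>t. (\<lambda>n. G n t) \<longlonglongrightarrow> H t" "\<And>t. (\<lambda>n. G' n t) \<longlonglongrightarrow> H' t"
    and [measurable]: "H \<in> borel_measurable borel" "H' \<in> borel_measurable borel"
  shows "sobolev0 A (\<lambda>x. H (f x)) (\<lambda>x. H' (f x) *\<^sub>R g x)"
proof (rule sobolev0_closed)
  have C0: "C \<ge> 0" using G'(2)[of 0 0] by linarith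
  have S: "sobolev0 A (\<lambda>x. G n (f x)) (\<lambda>x. G' n (f x) *\<^sub>R g x)" for n
    by (rule sobolev0_compose[OF f G G'])
  then show "sobolev0 A (\<lambda>x. G n (f x)) (\<lambda>x. G' n (f x) *\<^sub>R g x)" for n .
  have [measurable]: "f \<in> borel_measurable borel" "g \<in> borel_measurable borel"
    using sobolev0_measurable[OF f] by auto
  have Gb: "\<bar>G n t\<bar> \<le> C * \<bar>t\<bar>" for n t
    using real_lipschitz_of_derivative[OF G', of n t 0] G(2) by simp
  have Hb: "\<bar>H t\<bar> \<le> C * \<bar>t\<bar>" for t
    by (rule LIMSEQ_le_const2[OF tendsto_rabs[OF lim(1)]]) (use Gb in auto)
  have Hb': "\<bar>H' t\<bar> \<le> C" for t
    by (rule LIMSEQ_le_const2[OF tendsto_rabs[OF lim(2)]]) (use G'(2) in auto)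
  show "L2_lim (\<lambda>n x. G n (f x)) (\<lambda>x. H (f x))"
  proof (rule L2_lim_dominated[where w="\<lambda>x. C * f x"])
    show "L2 (\<lambda>x. C * f x)" by (intro L2_cmult sobolev0_L2(1)[OF f])
    show "norm (G n (f x)) \<le> norm (C * f x)" "norm (H (f x)) \<le> norm (C * f x)" for n x
      using Gb[of n "f x"] Hb[of "f x"] C0 by (auto simp: abs_mult)
    show "(\<lambda>x. G n (f x)) \<in> borel_measurable borel" for n by (rule sobolev0_measurable(1)[OF S])
  qed (use lim in auto)
  show "L2_lim (\<lambda>n x. G' n (f x) *\<^sub>R g x) (\<lambda>x. H' (f x) *\<^sub>R g x)"
  proof (rule L2_lim_dominated[where w="\<lambda>x. C *\<^sub>R g x"])
    show "L2 (\<lambda>x. C *\<^sub>R g x)" by (intro L2_scaleR sobolev0_L2(2)[OF f])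
    show "norm (G' n (f x) *\<^sub>R g x) \<le> norm (C *\<^sub>R g x)" "norm (H' (f x) *\<^sub>R g x) \<le> norm (C *\<^sub>R g x)" for n x
      using mult_right_mono[OF G'(2)[of n "f x"] norm_ge_zero[of "g x"]]
        mult_right_mono[OF Hb'[of "f x"] norm_ge_zero[of "g x"]] C0 by auto
    show "(\<lambda>x. G' n (f x) *\<^sub>R g x) \<in> borel_measurable borel" for n by (rule sobolev0_measurable(2)[OF S])
  qed (use lim in \<open>auto intro!: tendsto_intros\<close>)
qed

lemma has_real_derivative_tanh_scaled:
  "((\<lambda>t. tanh (c * t)) has_real_derivative c * (1 - (tanh (c * t))\<^sup>2)) (at t)"
proof -
  have "((\<lambda>t. tanh (c * t)) has_real_derivative (1 - (tanh (c * t))\<^sup>2) * (c * 1)) (at t)"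
    by (rule DERIV_chain2[OF has_real_derivative_tanh DERIV_cmult[OF DERIV_ident]])
  then show ?thesis by (rule DERIV_cong) simp
qed

lemma tendsto_tanh_sgn: "(\<lambda>n. tanh (real (Suc n) * t)) \<longlonglongrightarrow> sgn t"
proof -
  have inf: "filterlim (\<lambda>n. real (Suc n) * t) at_top sequentially" if "t > 0" for t
    using filterlim_tendsto_pos_mult_at_top[OF tendsto_const that
        filterlim_compose[OF filterlim_real_sequentially filterlim_Suc]]
    by (simp add: mult.commute)
  have pos: "(\<lambda>n. tanh (real (Suc n) * t)) \<longlonglongrightarrow> 1" if "t > 0" for t
    by (rule filterlim_compose[OF tanh_real_at_top inf[OF that]])
  consider "t > 0" | "t = 0" | "t < 0" by linarith
  then show ?thesis
  proof cases
    case 3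
    then show ?thesis using tendsto_minus[OF pos[of "- t"]] by simp
  qed (use pos in auto)
qed

lemma abs_tanh_le_1: "\<bar>tanh (t::real)\<bar> \<le> 1"
  using tanh_real_bounds[of t] by (auto simp: abs_le_iff)

text \<open>As n grows, the functions tanh(n (t - c))/n tend to 0 while their derivatives tend to
  the indicator of the point c. In the limit the zero function acquires the gradient equal to g on
  {f = c} and 0 elsewhere, which must therefore vanish.\<close>

lemma sobolev0_gradient_level:
  assumes f: "sobolev0 A f g"
  shows "AE x in lborel. f x = c \<longrightarrow> g x = 0"
proof -
  \<comment> \<open>The added constant makes the function vanish at 0, so that composition preserves
    compact supports.\<close>
  let ?G = "\<lambda>n t. inverse (real (Suc n)) * (tanh (real (Suc n) * (t - c)) + tanh (real (Suc n) * c))"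
  let ?H = "\<lambda>t::real. if t = c then 1 else (0::real)"
  have sm: "smooth (?G n)" for n
    using smooth_affine[OF smooth_tanh, of "- real (Suc n) * c" "real (Suc n)"]
    by (intro smooth_mult smooth_add smooth_const) (simp add: algebra_simps del: of_nat_Suc)
  have d: "(?G n has_real_derivative 1 - (tanh (real (Suc n) * (t - c)))\<^sup>2) (at t)" for n t
  proof -
    have "((\<lambda>t. tanh (real (Suc n) * (t - c))) has_real_derivative
        real (Suc n) * (1 - (tanh (real (Suc n) * (t - c)))\<^sup>2) * (1 - 0)) (at t)"
      by (rule DERIV_chain2[OF has_real_derivative_tanh_scaled]) (intro derivative_intros)
    from DERIV_cmult[OF DERIV_add[OF this DERIV_const], of "inverse (real (Suc n))"]
    show ?thesis by (rule DERIV_cong) (simp add: mult.assoc[symmetric] del: of_nat_Suc)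
  qed
  have "sobolev0 A (\<lambda>x. 0) (\<lambda>x. ?H (f x) *\<^sub>R g x)"
  proof (rule sobolev0_compose_limit[OF f sm _ d, where C=1 and H="\<lambda>_. 0"])
    show "?G n 0 = 0" for n by simp
    show "\<bar>1 - (tanh (real (Suc n) * (t - c)))\<^sup>2\<bar> \<le> 1" for n t
      using abs_square_le_1[of "tanh (real (Suc n) * (t - c))"] abs_tanh_le_1[of "real (Suc n) * (t - c)"]
      by (simp add: abs_le_iff del: of_nat_Suc)
    show "(\<lambda>n. ?G n t) \<longlonglongrightarrow> 0" for t
      using tendsto_mult[OF LIMSEQ_inverse_real_of_nat tendsto_add[OF tendsto_tanh_sgn[of "t - c"] tendsto_tanh_sgn[of c]]]
      by simp
    show "(\<lambda>n. 1 - (tanh (real (Suc n) * (t - c)))\<^sup>2) \<longlonglongrightarrow> ?H t" for t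
      using tendsto_diff[OF tendsto_const tendsto_power[OF tendsto_tanh_sgn[of "t - c"], of 2], of 1]
      by (cases "t > c"; cases "t = c") (simp_all add: sgn_if)
  qed auto
  from sobolev0_gradient_unique[OF this sobolev0_zero[of A] open_UNIV]
  have "AE x in lborel. ?H (f x) *\<^sub>R g x = 0" by simp
  then show ?thesis by eventually_elim auto
qed

text \<open>The primitive of tanh((n+1) t) that vanishes at 0; it lies below the absolute value by
  at most ln 2/(n+1).\<close>

definition smooth_abs :: "nat \<Rightarrow> real \<Rightarrow> real" where
  "smooth_abs n t = inverse (real (Suc n)) * ln (cosh (real (Suc n) * t))"

lemma smooth_abs_0: "smooth_abs n 0 = 0"
  by (simp add: smooth_abs_def)

lemma smooth_abs_has_derivative: "(smooth_abs n has_real_derivative tanh (real (Suc n) * t)) (at t)"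
  unfolding smooth_abs_def[abs_def]
  by (rule derivative_eq_intros refl | simp add: tanh_def cosh_real_pos)+

lemma smooth_smooth_abs: "smooth (smooth_abs n)"
  by (rule smooth_realI[OF smooth_abs_has_derivative])
    (use smooth_affine[OF smooth_tanh, of 0 "real (Suc n)"] in simp)

lemma tendsto_smooth_abs: "(\<lambda>n. smooth_abs n t) \<longlonglongrightarrow> \<bar>t\<bar>"
proof (rule tendsto_sandwich)
  have lower: "\<bar>s\<bar> - ln 2 \<le> ln (cosh s)" for s :: real
  proof -
    have "exp \<bar>s\<bar> / 2 \<le> cosh s" by (auto simp: cosh_def abs_if)
    then have "ln (exp \<bar>s\<bar> / 2) \<le> ln (cosh s)" by (subst ln_le_cancel_iff) (auto simp: cosh_real_pos)
    then show ?thesis by (simp add: ln_div)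
  qed
  have upper: "ln (cosh s) \<le> \<bar>s\<bar>" for s :: real
  proof -
    have "cosh s \<le> exp \<bar>s\<bar>" by (auto simp: cosh_def abs_if)
    then have "ln (cosh s) \<le> ln (exp \<bar>s\<bar>)" by (subst ln_le_cancel_iff) (auto simp: cosh_real_pos)
    then show ?thesis by simp
  qed
  show "\<forall>\<^sub>F n in sequentially. \<bar>t\<bar> - inverse (real (Suc n)) * ln 2 \<le> smooth_abs n t"
  proof (rule always_eventually, rule allI)
    fix n
    show "\<bar>t\<bar> - inverse (real (Suc n)) * ln 2 \<le> smooth_abs n t"
      using mult_left_mono[OF lower[of "real (Suc n) * t"], of "inverse (real (Suc n))"]
      by (simp add: smooth_abs_def abs_mult right_diff_distrib mult.assoc[symmetric] del: of_nat_Suc)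
  qed
  show "\<forall>\<^sub>F n in sequentially. smooth_abs n t \<le> \<bar>t\<bar>"
  proof (rule always_eventually, rule allI)
    fix n
    show "smooth_abs n t \<le> \<bar>t\<bar>"
      using mult_left_mono[OF upper[of "real (Suc n) * t"], of "inverse (real (Suc n))"]
      by (simp add: smooth_abs_def abs_mult mult.assoc[symmetric] del: of_nat_Suc)
  qed
  show "(\<lambda>n. \<bar>t\<bar> - inverse (real (Suc n)) * ln 2) \<longlonglongrightarrow> \<bar>t\<bar>"
    using tendsto_diff[OF tendsto_const tendsto_mult_right[OF LIMSEQ_inverse_real_of_nat, of "ln 2"], of "\<bar>t\<bar>"]
    by simp
qed simp

lemma sobolev0_abs:
  assumes f: "sobolev0 A f g"
  shows "sobolev0 A (\<lambda>x. \<bar>f x\<bar>) (\<lambda>x. sgn (f x) *\<^sub>R g x)"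
  by (rule sobolev0_compose_limit[OF f smooth_smooth_abs smooth_abs_0 smooth_abs_has_derivative
        abs_tanh_le_1 tendsto_smooth_abs tendsto_tanh_sgn]) auto

text \<open>For \<epsilon> \<ge> 0 the truncation equals (|f - \<epsilon>| - \<epsilon> + f)/2. The
  limiting gradient carries a factor 1/2 on the level set f = \<epsilon>, which is harmless because
  the gradient vanishes almost everywhere there.\<close>

lemma sobolev0_threshold:
  assumes f: "sobolev0 A f g" and "\<epsilon> \<ge> 0"
  shows "sobolev0 A (\<lambda>x. max (f x - \<epsilon>) 0) (\<lambda>x. if f x > \<epsilon> then g x else 0)"
proof (rule sobolev0_cong_AE)
  let ?G = "\<lambda>n t. (1/2) * (smooth_abs n (t - \<epsilon>) - smooth_abs n (- \<epsilon>) + t)"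
  let ?G' = "\<lambda>n t. (1/2) * (tanh (real (Suc n) * (t - \<epsilon>)) + 1)"
  have [measurable]: "f \<in> borel_measurable borel" "g \<in> borel_measurable borel"
    using sobolev0_measurable[OF f] by auto
  have d: "(?G n has_real_derivative ?G' n t) (at t)" for n t
  proof -
    have "((\<lambda>t. smooth_abs n (t - \<epsilon>)) has_real_derivative tanh (real (Suc n) * (t - \<epsilon>)) * (1 - 0)) (at t)"
      by (rule DERIV_chain2[OF smooth_abs_has_derivative]) (intro derivative_intros)
    from DERIV_cmult[OF DERIV_add[OF DERIV_diff[OF this DERIV_const] DERIV_ident], of "1/2"]
    show ?thesis by (rule DERIV_cong) simp
  qed
  have sm: "smooth (?G n)" for n
    using smooth_affine[OF smooth_smooth_abs[of n], of "- \<epsilon>" 1]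
    by (intro smooth_mult smooth_add smooth_diff smooth_const smooth_id_real) simp
  show "sobolev0 A (\<lambda>x. (1/2) * (\<bar>f x - \<epsilon>\<bar> - \<bar>- \<epsilon>\<bar> + f x)) (\<lambda>x. ((1/2) * (sgn (f x - \<epsilon>) + 1)) *\<^sub>R g x)"
  proof (rule sobolev0_compose_limit[OF f sm _ d, where C=1])
    show "\<bar>?G' n t\<bar> \<le> 1" for n t
      using abs_tanh_le_1[of "real (Suc n) * (t - \<epsilon>)"] by (simp add: abs_le_iff del: of_nat_Suc)
    show "(\<lambda>n. ?G n t) \<longlonglongrightarrow> (1/2) * (\<bar>t - \<epsilon>\<bar> - \<bar>- \<epsilon>\<bar> + t)" for t
      by (intro tendsto_mult_left tendsto_add tendsto_diff tendsto_smooth_abs tendsto_const)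
    show "(\<lambda>n. ?G' n t) \<longlonglongrightarrow> (1/2) * (sgn (t - \<epsilon>) + 1)" for t
      by (intro tendsto_mult_left tendsto_add tendsto_tanh_sgn tendsto_const)
  qed auto
  show "(\<lambda>x. max (f x - \<epsilon>) 0) \<in> borel_measurable borel" by measurable
  show "(\<lambda>x. if f x > \<epsilon> then g x else 0) \<in> borel_measurable borel" by measurable
  show "AE x in lborel. 1 / 2 * (\<bar>f x - \<epsilon>\<bar> - \<bar>- \<epsilon>\<bar> + f x) = max (f x - \<epsilon>) 0"
    using assms(2) by (auto simp: max_def)
  show "AE x in lborel. ((1/2) * (sgn (f x - \<epsilon>) + 1)) *\<^sub>R g x = (if f x > \<epsilon> then g x else 0)"
    using sobolev0_gradient_level[OF f, of \<epsilon>]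
    by eventually_elim (auto simp: sgn_if)
qed

lemma sobolev0_pos_part:
  assumes f: "sobolev0 A f g"
  shows "sobolev0 A (\<lambda>x. max (f x) 0) (\<lambda>x. if f x > 0 then g x else 0)"
  using sobolev0_threshold[OF f, of 0] by simp

subsection \<open>Integral identities and inequalities\<close>

definition laplacian :: "('a::euclidean_space \<Rightarrow> real) \<Rightarrow> 'a \<Rightarrow> real" where
  "laplacian f x = (\<Sum>i\<in>Basis. gradient (\<lambda>y. gradient f y \<bullet> i) x \<bullet> i)"

text \<open>The square of f is in general only integrable, so the product rule is applied to test
  functions and passed to the limit as a pairing of two L2-convergent sequences.\<close>

lemma sobolev0_square_by_parts:
  assumes f: "sobolev0 A f g" and \<zeta>: "\<zeta> \<in> test_functions B"
  shows "(LBINT x. (f x)\<^sup>2 * (gradient \<zeta> x \<bullet> e)) = - 2 * (LBINT x. f x * (g x \<bullet> e) * \<zeta> x)"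
proof -
  obtain \<phi> where \<phi>: "\<And>n. \<phi> n \<in> test_functions A" "L2_lim \<phi> f" "L2_lim (\<lambda>n. gradient (\<phi> n)) g"
    using f unfolding sobolev0_def by blast
  note sm = test_functions_smooth[OF \<phi>(1)] and smz = test_functions_smooth[OF \<zeta>]
  obtain C where C: "C > 0" "\<And>x. \<bar>\<zeta> x\<bar> \<le> C" "\<And>x. norm (gradient \<zeta> x) \<le> C"
    using test_functions_bounded[OF \<zeta>] by metis
  have [measurable]: "\<zeta> \<in> borel_measurable borel" "gradient \<zeta> \<in> borel_measurable borel"
    using smz smooth_borel_measurable gradient_borel_measurable by auto
  have b: "\<bar>gradient \<zeta> x \<bullet> e\<bar> \<le> C * norm e" for x
    using Cauchy_Schwarz_ineq2[of "gradient \<zeta> x" e] mult_right_mono[OF C(3)[of x] norm_ge_zero[of e]]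
    by linarith
  have "(\<lambda>n. \<integral>x. \<phi> n x \<bullet> ((gradient \<zeta> x \<bullet> e) *\<^sub>R \<phi> n x) \<partial>lborel)
      \<longlonglongrightarrow> (LBINT x. f x \<bullet> ((gradient \<zeta> x \<bullet> e) *\<^sub>R f x))"
    by (intro L2_lim_inner \<phi> L2_lim_mult_bounded[OF \<phi>(2) _ b]) measurable
  then have 1: "(\<lambda>n. \<integral>x. (\<phi> n x)\<^sup>2 * (gradient \<zeta> x \<bullet> e) \<partial>lborel)
      \<longlonglongrightarrow> (LBINT x. (f x)\<^sup>2 * (gradient \<zeta> x \<bullet> e))"
    by (simp add: power2_eq_square mult_ac)
  have L: "L2 (\<lambda>x. (\<zeta> x * h x) *\<^sub>R e)" if "L2 h" for h :: "'a \<Rightarrow> real"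
  proof (rule L2_norm_bound[OF that, where C="C * norm e"])
    have [measurable]: "h \<in> borel_measurable borel" by (rule L2_measurable[OF that])
    show "(\<lambda>x. (\<zeta> x * h x) *\<^sub>R e) \<in> borel_measurable borel" by measurable
    show "norm ((\<zeta> x * h x) *\<^sub>R e) \<le> C * norm e * norm (h x)" for x
      using mult_right_mono[OF C(2)[of x], of "\<bar>h x\<bar> * norm e"] by (simp add: abs_mult mult_ac)
  qed
  have "L2_lim (\<lambda>n x. (\<zeta> x * \<phi> n x) *\<^sub>R e) (\<lambda>x. (\<zeta> x * f x) *\<^sub>R e)"
  proof (rule L2_lim_bound[OF \<phi>(2), where C="C * norm e"])
    show "norm ((\<zeta> x * \<phi> n x) *\<^sub>R e - (\<zeta> x * f x) *\<^sub>R e) \<le> C * norm e * norm (\<phi> n x - f x)" for n x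
      using mult_right_mono[OF C(2)[of x], of "\<bar>\<phi> n x - f x\<bar> * norm e"]
      by (simp add: abs_mult mult_ac flip: scaleR_diff_left right_diff_distrib)
  qed (use L L2_limD[OF \<phi>(2)] in auto)
  from L2_lim_inner[OF \<phi>(3) this]
  have 2: "(\<lambda>n. - 2 * (LBINT x. gradient (\<phi> n) x \<bullet> ((\<zeta> x * \<phi> n x) *\<^sub>R e)))
      \<longlonglongrightarrow> - 2 * (LBINT x. g x \<bullet> ((\<zeta> x * f x) *\<^sub>R e))"
    by (rule tendsto_mult_left)
  have "(LBINT x. (\<phi> n x)\<^sup>2 * (gradient \<zeta> x \<bullet> e)) = - 2 * (LBINT x. gradient (\<phi> n) x \<bullet> ((\<zeta> x * \<phi> n x) *\<^sub>R e))" for n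
  proof -
    have "(LBINT x. (\<phi> n x * \<phi> n x) * (gradient \<zeta> x \<bullet> e))
        = - (LBINT x. \<zeta> x * (gradient (\<lambda>x. \<phi> n x * \<phi> n x) x \<bullet> e))"
      by (intro integral_by_parts_test[OF \<zeta>] smooth_mult sm)
    also have "(LBINT x. \<zeta> x * (gradient (\<lambda>x. \<phi> n x * \<phi> n x) x \<bullet> e))
        = (LBINT x. 2 * (gradient (\<phi> n) x \<bullet> ((\<zeta> x * \<phi> n x) *\<^sub>R e)))"
      by (simp add: gradient_mult[OF sm sm] inner_add_left algebra_simps)
    finally show ?thesis by (simp add: power2_eq_square)
  qed
  with 1 2 have "(LBINT x. (f x)\<^sup>2 * (gradient \<zeta> x \<bullet> e)) = - 2 * (LBINT x. g x \<bullet> ((\<zeta> x * f x) *\<^sub>R e))"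
    using LIMSEQ_unique by simp
  then show ?thesis by (simp add: mult_ac)
qed

lemma L2_triple_integrable:
  assumes "L2 f" "L2 g" "h \<in> borel_measurable borel" "\<And>x. norm (h x) \<le> C"
  shows "integrable lborel (\<lambda>x. f x * (g x \<bullet> h x))"
proof (rule L2_mult_integrable[OF assms(1)], rule L2_norm_bound[OF assms(2)])
  show "(\<lambda>x. g x \<bullet> h x) \<in> borel_measurable borel" using assms(2,3) by (auto dest: L2_measurable)
  show "norm (g x \<bullet> h x) \<le> C * norm (g x)" for x
    using Cauchy_Schwarz_ineq2[of "g x" "h x"] mult_left_mono[OF assms(4)[of x] norm_ge_zero[of "g x"]]
    by (simp add: mult.commute)
qed

lemma sobolev0_square_laplacian:
  assumes f: "sobolev0 A f g" and \<psi>: "\<psi> \<in> test_functions B"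
  shows "(LBINT x. (f x)\<^sup>2 * laplacian \<psi> x) = - 2 * (LBINT x. f x * (g x \<bullet> gradient \<psi> x))"
proof -
  note sm = test_functions_smooth[OF \<psi>]
  have \<zeta>: "(\<lambda>y. gradient \<psi> y \<bullet> i) \<in> test_functions B" for i
    by (rule test_functions_partial[OF \<psi>])
  obtain C where C: "\<And>x. norm (gradient \<psi> x) \<le> C" using test_functions_bounded[OF \<psi>] by metis
  have [measurable]: "gradient \<psi> \<in> borel_measurable borel" by (rule gradient_borel_measurable[OF sm])
  have i1: "integrable lborel (\<lambda>x. (f x)\<^sup>2 * (gradient (\<lambda>y. gradient \<psi> y \<bullet> i) x \<bullet> i))" for i
  proof -
    obtain C' where C': "\<And>x. norm (gradient (\<lambda>y. gradient \<psi> y \<bullet> i) x) \<le> C'"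
      using test_functions_bounded[OF \<zeta>] by metis
    have [measurable]: "gradient (\<lambda>y. gradient \<psi> y \<bullet> i) \<in> borel_measurable borel"
      by (rule gradient_borel_measurable[OF smooth_gradient_inner[OF sm]])
    have "integrable lborel (\<lambda>x. f x * ((gradient (\<lambda>y. gradient \<psi> y \<bullet> i) x \<bullet> i) *\<^sub>R f x))"
    proof (rule L2_mult_integrable[OF sobolev0_L2(1)[OF f]], rule L2_mult_bounded[OF sobolev0_L2(1)[OF f]])
      show "\<bar>gradient (\<lambda>y. gradient \<psi> y \<bullet> i) x \<bullet> i\<bar> \<le> C' * norm i" for x
        using Cauchy_Schwarz_ineq2[of "gradient (\<lambda>y. gradient \<psi> y \<bullet> i) x" i]
          mult_right_mono[OF C'[of x] norm_ge_zero[of i]] by linarith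
    qed measurable
    then show ?thesis by (simp add: power2_eq_square mult_ac)
  qed
  have i2: "integrable lborel (\<lambda>x. f x * (g x \<bullet> i) * (gradient \<psi> x \<bullet> i))" for i
  proof -
    have "integrable lborel (\<lambda>x. f x * (g x \<bullet> ((gradient \<psi> x \<bullet> i) *\<^sub>R i)))"
    proof (rule L2_triple_integrable[OF sobolev0_L2[OF f]])
      show "norm ((gradient \<psi> x \<bullet> i) *\<^sub>R i) \<le> C * norm i * norm i" for x
        using Cauchy_Schwarz_ineq2[of "gradient \<psi> x" i] mult_right_mono[OF C[of x] norm_ge_zero[of i]]
        by (simp add: mult_right_mono)
    qed measurable
    then show ?thesis by (simp add: mult_ac)
  qed
  have "(LBINT x. (f x)\<^sup>2 * laplacian \<psi> x)
      = (\<Sum>i\<in>Basis. \<integral>x. (f x)\<^sup>2 * (gradient (\<lambda>y. gradient \<psi> y \<bullet> i) x \<bullet> i) \<partial>lborel)"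
    unfolding laplacian_def sum_distrib_left by (intro Bochner_Integration.integral_sum i1)
  also have "\<dots> = (\<Sum>i\<in>Basis. - 2 * (LBINT x. f x * (g x \<bullet> i) * (gradient \<psi> x \<bullet> i)))"
    by (intro sum.cong refl sobolev0_square_by_parts[OF f \<zeta>])
  also have "\<dots> = - 2 * (LBINT x. (\<Sum>i\<in>Basis. f x * (g x \<bullet> i) * (gradient \<psi> x \<bullet> i)))"
    using i2 by (simp add: sum_distrib_left sum_negf Bochner_Integration.integral_sum)
  also have "\<dots> = - 2 * (LBINT x. f x * (g x \<bullet> gradient \<psi> x))"
    by (simp add: euclidean_inner[of "g x" "gradient \<psi> x" for x] sum_distrib_left mult.assoc)
  finally show ?thesis .
qed

text \<open>The linear function (x - x0) \<bullet> e has derivative 1 in direction e and is at most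
  r in absolute value on the ball. Integrating \<phi>^2 times that derivative by parts moves the
  derivative to \<phi>^2.\<close>

lemma poincare_test:
  fixes x0 :: "'a::euclidean_space"
  assumes \<phi>: "\<phi> \<in> test_functions (ball x0 r)" and r: "r > 0"
  shows "(LBINT x. (\<phi> x)\<^sup>2) \<le> 4 * r\<^sup>2 * (LBINT x. (norm (gradient \<phi> x))\<^sup>2)"
proof -
  obtain e :: 'a where e: "e \<in> Basis" using nonempty_Basis by blast
  note sm = test_functions_smooth[OF \<phi>]
  define \<psi> where "\<psi> x = (x - x0) \<bullet> e" for x
  have sm\<psi>: "smooth \<psi>" unfolding \<psi>_def[abs_def] inner_diff_left by (intro smooth_diff smooth_inner smooth_const)
  have g\<psi>: "gradient \<psi> x = e" for x
    by (rule gradient_eqI) (auto simp: \<psi>_def[abs_def] inner_diff_left inner_commute intro!: derivative_eq_intros)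
  obtain S where S: "S \<subseteq> ball x0 r" "\<And>x. x \<notin> S \<Longrightarrow> \<phi> x = 0" using test_functions_support[OF \<phi>] by metis
  have [measurable]: "\<phi> \<in> borel_measurable borel" "gradient \<phi> \<in> borel_measurable borel" "\<psi> \<in> borel_measurable borel"
    using sm sm\<psi> smooth_borel_measurable gradient_borel_measurable by auto
  define a where "a = sqrt (LBINT x. (norm (\<phi> x))\<^sup>2)"
  define b where "b = sqrt (LBINT x. (norm (gradient \<phi> x))\<^sup>2)"
  have sq: "(\<lambda>x. \<phi> x * \<phi> x) \<in> test_functions (ball x0 r)" by (rule test_functions_mult[OF \<phi> sm])
  have bd: "norm ((\<psi> x * \<phi> x) *\<^sub>R e) \<le> r * norm (\<phi> x)" for x
  proof (cases "x \<in> S")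
    case True
    then have "norm (x - x0) < r" using S(1) by (auto simp: dist_norm norm_minus_commute)
    then have "\<bar>\<psi> x\<bar> \<le> r" unfolding \<psi>_def using Cauchy_Schwarz_ineq2[of "x - x0" e] e by simp
    then have "\<bar>\<psi> x\<bar> * \<bar>\<phi> x\<bar> \<le> r * \<bar>\<phi> x\<bar>" by (rule mult_right_mono) simp
    then show ?thesis using e by (simp add: abs_mult)
  next
    case False
    then show ?thesis using S(2) by simp
  qed
  have L: "L2 (\<lambda>x. (\<psi> x * \<phi> x) *\<^sub>R e)"
    by (rule L2_norm_bound[OF L2_test[OF \<phi>] _ bd]) measurable
  have "a\<^sup>2 = (LBINT x. (\<phi> x * \<phi> x) * (gradient \<psi> x \<bullet> e))"
    using e by (simp add: a_def g\<psi> power2_eq_square[of "\<phi> x" for x] inner_Basis)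
  also have "\<dots> = - (LBINT x. \<psi> x * (gradient (\<lambda>x. \<phi> x * \<phi> x) x \<bullet> e))"
    using integral_by_parts_test[OF sq sm\<psi>, of e] by simp
  also have "(LBINT x. \<psi> x * (gradient (\<lambda>x. \<phi> x * \<phi> x) x \<bullet> e))
      = 2 * (LBINT x. gradient \<phi> x \<bullet> ((\<psi> x * \<phi> x) *\<^sub>R e))"
    by (simp add: gradient_mult[OF sm sm] inner_add_left algebra_simps flip: Bochner_Integration.integral_mult_right_zero)
  finally have "a\<^sup>2 \<le> 2 * \<bar>\<integral>x. gradient \<phi> x \<bullet> ((\<psi> x * \<phi> x) *\<^sub>R e) \<partial>lborel\<bar>" by simp
  also have "\<dots> \<le> 2 * (b * sqrt (LBINT x. (norm ((\<psi> x * \<phi> x) *\<^sub>R e))\<^sup>2))"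
    using L2_Cauchy_Schwarz_abs[OF L2_gradient_test[OF \<phi>] L] by (simp add: b_def)
  finally have le: "a\<^sup>2 \<le> 2 * (b * sqrt (LBINT x. (norm ((\<psi> x * \<phi> x) *\<^sub>R e))\<^sup>2))" .
  have "sqrt (LBINT x. (norm ((\<psi> x * \<phi> x) *\<^sub>R e))\<^sup>2) \<le> r * a"
  proof -
    have "(LBINT x. (norm ((\<psi> x * \<phi> x) *\<^sub>R e))\<^sup>2) \<le> (LBINT x. r\<^sup>2 * (norm (\<phi> x))\<^sup>2)"
    proof (rule integral_mono[OF L2_integrable[OF L]])
      show "integrable lborel (\<lambda>x. r\<^sup>2 * (norm (\<phi> x))\<^sup>2)" using L2_integrable[OF L2_test[OF \<phi>]] by simp
      show "(norm ((\<psi> x * \<phi> x) *\<^sub>R e))\<^sup>2 \<le> r\<^sup>2 * (norm (\<phi> x))\<^sup>2" for x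
        using power_mono[OF bd[of x] norm_ge_zero, of 2] by (simp only: power_mult_distrib)
    qed
    then have "sqrt (LBINT x. (norm ((\<psi> x * \<phi> x) *\<^sub>R e))\<^sup>2) \<le> sqrt (r\<^sup>2 * (LBINT x. (norm (\<phi> x))\<^sup>2))"
      by (intro real_sqrt_le_mono) simp
    then show ?thesis using r by (simp add: real_sqrt_mult a_def)
  qed
  moreover have ab: "a \<ge> 0" "b \<ge> 0" by (simp_all add: a_def b_def)
  ultimately have "a\<^sup>2 \<le> 2 * (b * (r * a))"
    using le mult_left_mono[of _ "r * a" b] by fastforce
  with ab have "a \<le> 2 * r * b"
    by (cases "a = 0") (use r in \<open>auto simp: power2_eq_square mult_ac\<close>)
  then have "a\<^sup>2 \<le> (2 * r * b)\<^sup>2" using ab(1) by (rule power_mono)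
  then show ?thesis by (simp add: a_def b_def power_mult_distrib)
qed

lemma sobolev0_poincare:
  assumes f: "sobolev0 (ball x0 r) f g" and r: "r > 0"
  shows "(LBINT x. (f x)\<^sup>2) \<le> 4 * r\<^sup>2 * (LBINT x. (norm (g x))\<^sup>2)"
proof -
  obtain \<phi> where \<phi>: "\<And>n. \<phi> n \<in> test_functions (ball x0 r)" "L2_lim \<phi> f" "L2_lim (\<lambda>n. gradient (\<phi> n)) g"
    using f unfolding sobolev0_def by blast
  have 1: "(\<lambda>n. \<integral>x. (\<phi> n x)\<^sup>2 \<partial>lborel) \<longlonglongrightarrow> (LBINT x. (f x)\<^sup>2)"
    using L2_lim_integral_sq[OF \<phi>(2)] by simp
  have 2: "(\<lambda>n. 4 * r\<^sup>2 * (LBINT x. (norm (gradient (\<phi> n) x))\<^sup>2)) \<longlonglongrightarrow> 4 * r\<^sup>2 * (LBINT x. (norm (g x))\<^sup>2)"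
    by (intro tendsto_mult_left L2_lim_integral_sq[OF \<phi>(3)])
  show ?thesis
    by (rule LIMSEQ_le[OF 1 2]) (use poincare_test[OF \<phi>(1) r] in blast)
qed

text \<open>Jensen's inequality along the segment from \<open>x\<close> to \<open>x + h\<close>.\<close>

lemma test_increment_sq_le:
  fixes \<phi> :: "'a::euclidean_space \<Rightarrow> real"
  assumes sm: "smooth \<phi>"
  shows "ennreal ((\<phi> (x + h) - \<phi> x)\<^sup>2)
    \<le> (\<integral>\<^sup>+t. indicator {0..1} t * ennreal ((norm h)\<^sup>2 * (norm (gradient \<phi> (x + t *\<^sub>R h)))\<^sup>2) \<partial>lborel)"
proof -
  define a where "a t = gradient \<phi> (x + t *\<^sub>R h) \<bullet> h" for t
  have ca: "continuous_on S a" for S unfolding a_def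
    by (intro continuous_intros continuous_on_compose2[OF smooth_gradient_continuous[OF sm, of UNIV]]) auto
  have ia: "integrable lborel (\<lambda>t. indicator {0..1::real} t *\<^sub>R a t)"
    "integrable lborel (\<lambda>t. indicator {0..1::real} t *\<^sub>R (a t)\<^sup>2)"
    by (intro borel_integrable_compact continuous_intros ca compact_Icc)+
  have ii: "integrable lborel (\<lambda>t. indicator {0..1::real} t :: real)"
    by (intro integrable_real_indicator) auto
  define D where "D = \<phi> (x + h) - \<phi> x"
  have D: "(LBINT t. indicator {0..1} t *\<^sub>R a t) = D"
  proof -
    have "(LBINT t. indicator {0..1} t *\<^sub>R a t) = \<phi> (x + 1 *\<^sub>R h) - \<phi> (x + 0 *\<^sub>R h)"
    proof (rule integral_FTC_atLeastAtMost)
      fix t :: real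
      have "((\<lambda>s. x + s *\<^sub>R h) has_derivative (\<lambda>s. s *\<^sub>R h)) (at t)"
        by (auto intro!: derivative_eq_intros)
      from has_derivative_compose[OF this smooth_has_derivative[OF sm]]
      have "((\<lambda>s. \<phi> (x + s *\<^sub>R h)) has_derivative (\<lambda>s. s *\<^sub>R a t)) (at t)"
        by (simp add: a_def)
      then show "((\<lambda>s. \<phi> (x + s *\<^sub>R h)) has_vector_derivative a t) (at t within {0..1})"
        unfolding has_vector_derivative_def by (rule has_derivative_at_withinI)
    qed (simp_all add: ca)
    then show ?thesis by (simp add: D_def)
  qed
  \<comment> \<open>Jensen's inequality appears as the nonnegativity of the variance of
    \<open>a\<close> on the unit interval.\<close>
  have "0 \<le> (LBINT t. indicator {0..1} t *\<^sub>R (a t - D)\<^sup>2)" by simp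
  also have "\<dots> = (LBINT t. indicator {0..1} t *\<^sub>R (a t)\<^sup>2 - 2 * D * (indicator {0..1} t *\<^sub>R a t) + D\<^sup>2 * indicator {0..1} t)"
    by (intro Bochner_Integration.integral_cong refl) (simp add: power2_eq_square algebra_simps)
  also have "\<dots> = (LBINT t. indicator {0..1} t *\<^sub>R (a t)\<^sup>2) - 2 * D * D + D\<^sup>2 * 1"
  proof -
    have "(LBINT t. indicator {0..1::real} t) = (1::real)" by simp
    then show ?thesis
      using ia ii D by (simp add: Bochner_Integration.integral_add Bochner_Integration.integral_diff)
  qed
  finally have "D\<^sup>2 \<le> (LBINT t. indicator {0..1} t *\<^sub>R (a t)\<^sup>2)" by (simp add: power2_eq_square)
  then have "ennreal (D\<^sup>2) \<le> ennreal (LBINT t. indicator {0..1} t *\<^sub>R (a t)\<^sup>2)"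
    by (rule ennreal_leI)
  also have "\<dots> = (\<integral>\<^sup>+t. ennreal (indicator {0..1} t *\<^sub>R (a t)\<^sup>2) \<partial>lborel)"
    by (rule nn_integral_eq_integral[symmetric, OF ia(2)]) simp
  also have "\<dots> \<le> (\<integral>\<^sup>+t. indicator {0..1} t * ennreal ((norm h)\<^sup>2 * (norm (gradient \<phi> (x + t *\<^sub>R h)))\<^sup>2) \<partial>lborel)"
  proof (rule nn_integral_mono)
    fix t :: real
    have "(a t)\<^sup>2 \<le> (norm h)\<^sup>2 * (norm (gradient \<phi> (x + t *\<^sub>R h)))\<^sup>2"
      using Cauchy_Schwarz_ineq[of "gradient \<phi> (x + t *\<^sub>R h)" h]
      by (simp add: a_def power2_norm_eq_inner mult.commute)
    then show "ennreal (indicator {0..1} t *\<^sub>R (a t)\<^sup>2)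
      \<le> indicator {0..1} t * ennreal ((norm h)\<^sup>2 * (norm (gradient \<phi> (x + t *\<^sub>R h)))\<^sup>2)"
      by (auto simp: indicator_def intro: ennreal_leI)
  qed
  finally show ?thesis by (simp add: D_def)
qed

text \<open>Tonelli exchanges the segment parameter t with x; for each t in [0, 1] the translation
  by t h maps the small ball into the enlarged one.\<close>

lemma test_increment_integral_le:
  fixes \<phi> :: "'a::euclidean_space \<Rightarrow> real"
  assumes sm: "smooth \<phi>"
  shows "(\<integral>\<^sup>+x. indicator (ball x0 \<rho>) x * ennreal ((\<phi> (x + h) - \<phi> x)\<^sup>2) \<partial>lborel)
    \<le> (\<integral>\<^sup>+x. indicator (ball x0 (\<rho> + norm h)) x * ennreal ((norm h)\<^sup>2 * (norm (gradient \<phi> x))\<^sup>2) \<partial>lborel)"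
proof -
  let ?b = "\<lambda>y. ennreal ((norm h)\<^sup>2 * (norm (gradient \<phi> y))\<^sup>2)"
  let ?B = "ball x0 \<rho>" and ?B' = "ball x0 (\<rho> + norm h)"
  have [measurable]: "gradient \<phi> \<in> borel_measurable borel" by (rule gradient_borel_measurable[OF sm])
  have [measurable]: "(\<lambda>p::real \<times> 'a. gradient \<phi> (snd p + fst p *\<^sub>R h)) \<in> borel_measurable borel"
    "(\<lambda>p::real \<times> 'a. fst p) \<in> borel_measurable borel" "(\<lambda>p::real \<times> 'a. snd p) \<in> borel_measurable borel"
    by (intro borel_measurable_continuous_onI continuous_on_compose2[OF smooth_gradient_continuous[OF sm, of UNIV]]
        continuous_intros subset_UNIV)+
  have [measurable]: "?B \<in> sets borel" "?B' \<in> sets borel" by simp_all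
  have "open {p::real \<times> 'a. snd p \<in> ball x0 \<rho>}"
    unfolding mem_ball by (intro open_Collect_less continuous_intros)
  then have [measurable]: "Measurable.pred borel (\<lambda>p::real \<times> 'a. snd p \<in> ball x0 \<rho>)"
    by (simp add: pred_def)
  have "(\<integral>\<^sup>+x. indicator ?B x * ennreal ((\<phi> (x + h) - \<phi> x)\<^sup>2) \<partial>lborel)
     \<le> (\<integral>\<^sup>+x. indicator ?B x * (\<integral>\<^sup>+t. indicator {0..1} t * ?b (x + t *\<^sub>R h) \<partial>lborel) \<partial>lborel)"
    by (intro nn_integral_mono mult_left_mono test_increment_sq_le[OF sm]) simp
  also have "\<dots> = (\<integral>\<^sup>+x. (\<integral>\<^sup>+t. indicator ?B x * (indicator {0..1} t * ?b (x + t *\<^sub>R h)) \<partial>lborel) \<partial>lborel)"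
    by (intro nn_integral_cong nn_integral_cmult[symmetric]) measurable
  also have "\<dots> = (\<integral>\<^sup>+t. (\<integral>\<^sup>+x. indicator ?B x * (indicator {0..1} t * ?b (x + t *\<^sub>R h)) \<partial>lborel) \<partial>lborel)"
    by (rule lborel_pair.Fubini') (unfold lborel_prod case_prod_beta', measurable)
  also have "\<dots> \<le> (\<integral>\<^sup>+t. indicator {0..1::real} t * (\<integral>\<^sup>+x. indicator ?B' x * ?b x \<partial>lborel) \<partial>lborel)"
  proof (rule nn_integral_mono)
    fix t :: real
    show "(\<integral>\<^sup>+x. indicator ?B x * (indicator {0..1} t * ?b (x + t *\<^sub>R h)) \<partial>lborel)
       \<le> indicator {0..1::real} t * (\<integral>\<^sup>+x. indicator ?B' x * ?b x \<partial>lborel)"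
    proof (cases "t \<in> {0..1}")
      case True
      have sub: "x + t *\<^sub>R h \<in> ?B'" if "x \<in> ?B" for x
      proof -
        have "dist x0 (x + t *\<^sub>R h) \<le> dist x0 x + norm (t *\<^sub>R h)"
          using dist_triangle[of x0 "x + t *\<^sub>R h" x] by (simp add: dist_norm)
        also have "norm (t *\<^sub>R h) \<le> norm h" using True by (simp add: mult_left_le_one_le)
        finally show ?thesis using that by simp
      qed
      have "(\<integral>\<^sup>+x. indicator ?B x * ?b (x + t *\<^sub>R h) \<partial>lborel)
        \<le> (\<integral>\<^sup>+x. indicator ?B' (x + t *\<^sub>R h) * ?b (x + t *\<^sub>R h) \<partial>lborel)"
        by (intro nn_integral_mono) (use sub in \<open>auto simp: indicator_def\<close>)
      also have "\<dots> = (\<integral>\<^sup>+x. indicator ?B' x * ?b x \<partial>lborel)"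
        by (rule nn_integral_shift[of "\<lambda>x. indicator ?B' x * ?b x"]) measurable
      finally show ?thesis using True by simp
    qed simp
  qed
  also have "\<dots> = (\<integral>\<^sup>+x. indicator ?B' x * ?b x \<partial>lborel)"
    by (simp add: nn_integral_multc)
  finally show ?thesis .
qed

lemma L2_indicator: "L2 f \<Longrightarrow> B \<in> sets borel \<Longrightarrow> L2 (\<lambda>x. indicator B x *\<^sub>R f x)"
  by (rule L2_mult_bounded[where C=1]) (auto simp: indicator_def)

lemma L2_lim_indicator: "L2_lim F f \<Longrightarrow> B \<in> sets borel \<Longrightarrow> L2_lim (\<lambda>n x. indicator B x *\<^sub>R F n x) (\<lambda>x. indicator B x *\<^sub>R f x)"
  by (rule L2_lim_mult_bounded[where C=1]) (auto simp: indicator_def)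

lemma norm_indicator_sq: "(norm (indicator B x *\<^sub>R v))\<^sup>2 = indicator B x * (norm v)\<^sup>2"
  by (auto simp: indicator_def)

lemma sobolev0_increment:
  assumes f: "sobolev0 A f g"
  shows "(LBINT x. indicator (ball x0 \<rho>) x * (f (x + h) - f x)\<^sup>2)
    \<le> (norm h)\<^sup>2 * (LBINT x. indicator (ball x0 (\<rho> + norm h)) x * (norm (g x))\<^sup>2)"
proof -
  obtain \<phi> where \<phi>: "\<And>n. \<phi> n \<in> test_functions A" "L2_lim \<phi> f" "L2_lim (\<lambda>n. gradient (\<phi> n)) g"
    using f unfolding sobolev0_def by blast
  let ?B = "ball x0 \<rho>" and ?B' = "ball x0 (\<rho> + norm h)"
  have "L2_lim (\<lambda>n x. indicator ?B x *\<^sub>R (\<phi> n (x + h) - \<phi> n x)) (\<lambda>x. indicator ?B x *\<^sub>R (f (x + h) - f x))"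
    by (intro L2_lim_indicator L2_lim_diff L2_lim_shift \<phi>(2)) simp
  from L2_lim_integral_sq[OF this]
  have 1: "(\<lambda>n. \<integral>x. indicator ?B x * (\<phi> n (x + h) - \<phi> n x)\<^sup>2 \<partial>lborel) \<longlonglongrightarrow> (LBINT x. indicator ?B x * (f (x + h) - f x)\<^sup>2)"
    unfolding norm_indicator_sq by simp
  have "L2_lim (\<lambda>n x. indicator ?B' x *\<^sub>R gradient (\<phi> n) x) (\<lambda>x. indicator ?B' x *\<^sub>R g x)"
    by (intro L2_lim_indicator \<phi>(3)) simp
  from tendsto_mult_left[OF L2_lim_integral_sq[OF this], of "(norm h)\<^sup>2"]
  have 2: "(\<lambda>n. (norm h)\<^sup>2 * (LBINT x. indicator ?B' x * (norm (gradient (\<phi> n) x))\<^sup>2))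
     \<longlonglongrightarrow> (norm h)\<^sup>2 * (LBINT x. indicator ?B' x * (norm (g x))\<^sup>2)"
    unfolding norm_indicator_sq .
  have le: "(LBINT x. indicator ?B x * (\<phi> n (x + h) - \<phi> n x)\<^sup>2)
    \<le> (norm h)\<^sup>2 * (LBINT x. indicator ?B' x * (norm (gradient (\<phi> n) x))\<^sup>2)" for n
  proof -
    have "L2 (\<lambda>x. indicator ?B x *\<^sub>R (\<phi> n (x + h) - \<phi> n x))"
      by (intro L2_indicator L2_diff L2_shift L2_test[OF \<phi>(1)]) simp
    from L2_integrable[OF this]
    have i1: "integrable lborel (\<lambda>x. indicator ?B x * (\<phi> n (x + h) - \<phi> n x)\<^sup>2)"
      unfolding norm_indicator_sq by simp
    have "L2 (\<lambda>x. indicator ?B' x *\<^sub>R gradient (\<phi> n) x)"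
      by (intro L2_indicator L2_gradient_test[OF \<phi>(1)]) simp
    from L2_integrable[OF this]
    have i2: "integrable lborel (\<lambda>x. (norm h)\<^sup>2 * (indicator ?B' x * (norm (gradient (\<phi> n) x))\<^sup>2))"
      unfolding norm_indicator_sq by simp
    have "ennreal (LBINT x. indicator ?B x * (\<phi> n (x + h) - \<phi> n x)\<^sup>2)
        = (\<integral>\<^sup>+x. ennreal (indicator ?B x * (\<phi> n (x + h) - \<phi> n x)\<^sup>2) \<partial>lborel)"
      by (rule nn_integral_eq_integral[symmetric, OF i1]) simp
    also have "\<dots> = (\<integral>\<^sup>+x. indicator ?B x * ennreal ((\<phi> n (x + h) - \<phi> n x)\<^sup>2) \<partial>lborel)"
      by (intro nn_integral_cong) (auto simp: indicator_def)
    also have "\<dots> \<le> (\<integral>\<^sup>+x. indicator ?B' x * ennreal ((norm h)\<^sup>2 * (norm (gradient (\<phi> n) x))\<^sup>2) \<partial>lborel)"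
      by (rule test_increment_integral_le[OF test_functions_smooth[OF \<phi>(1)]])
    also have "\<dots> = (\<integral>\<^sup>+x. ennreal ((norm h)\<^sup>2 * (indicator ?B' x * (norm (gradient (\<phi> n) x))\<^sup>2)) \<partial>lborel)"
      by (intro nn_integral_cong) (auto simp: indicator_def)
    also have "\<dots> = ennreal (LBINT x. (norm h)\<^sup>2 * (indicator ?B' x * (norm (gradient (\<phi> n) x))\<^sup>2))"
      by (rule nn_integral_eq_integral[OF i2]) simp
    finally have "(LBINT x. indicator ?B x * (\<phi> n (x + h) - \<phi> n x)\<^sup>2)
       \<le> (LBINT x. (norm h)\<^sup>2 * (indicator ?B' x * (norm (gradient (\<phi> n) x))\<^sup>2))"
      by (subst (asm) ennreal_le_iff) (auto intro!: Bochner_Integration.integral_nonneg)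
    then show ?thesis by simp
  qed
  show ?thesis by (rule LIMSEQ_le[OF 1 2]) (use le in blast)
qed

section \<open>Functions supported in smaller sets, and integrability\<close>

lemma sobolev0_cong_fun:
  assumes "sobolev0 A f g" "f' \<in> borel_measurable borel" "AE x in lborel. f x = f' x"
  shows "sobolev0 A f' g"
  by (rule sobolev0_cong_AE[OF assms(1,2) sobolev0_measurable(2)[OF assms(1)] assms(3)]) simp

text \<open>A cutoff equal to 1 on S leaves f unchanged but turns its approximants into test
  functions of U; uniqueness of the gradient disposes of the extra product-rule term.\<close>

lemma sobolev0_compact_support:
  assumes f: "sobolev0 A f g" and S: "compact S" "open U" "S \<subseteq> U" and z: "\<And>x. x \<notin> S \<Longrightarrow> f x = 0"
  shows "sobolev0 (A \<inter> U) f g"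
proof -
  obtain \<zeta> where \<zeta>: "\<zeta> \<in> test_functions U" "\<And>x. x \<in> S \<Longrightarrow> \<zeta> x = 1"
    using cutoff_exists[OF S] by metis
  have eq: "(\<lambda>x. \<zeta> x * f x) = f"
  proof
    fix x show "\<zeta> x * f x = f x" using \<zeta>(2)[of x] z[of x] by (cases "x \<in> S") auto
  qed
  have s: "sobolev0 (A \<inter> U) f (\<lambda>x. \<zeta> x *\<^sub>R g x + f x *\<^sub>R gradient \<zeta> x)"
    using sobolev0_mult_test[OF f \<zeta>(1)] unfolding eq .
  show ?thesis
  proof (rule sobolev0_cong_AE[OF s])
    show "AE x in lborel. \<zeta> x *\<^sub>R g x + f x *\<^sub>R gradient \<zeta> x = g x"
      using sobolev0_gradient_unique[OF s f open_UNIV] by simp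
  qed (use sobolev0_measurable[OF f] in auto)
qed

text \<open>This will make u_i a competitor for \<open>lambda21\<close> on its own positivity set.
  The approximants (min(f, \<phi>_n^+) - \<epsilon>_n)^+ vanish off the points of a compact support
  set of \<phi>_n at which f \<ge> \<epsilon>_n, and by continuity these form a compact subset of {f
  > 0}.\<close>

lemma sobolev0_positivity_set:
  assumes \<Omega>: "open \<Omega>" and f: "sobolev0 \<Omega> f g" and cont: "continuous_on \<Omega> f"
    and nonneg: "\<And>x. 0 \<le> f x"
  shows "sobolev0 {x \<in> \<Omega>. f x > 0} f g"
proof -
  let ?\<omega> = "{x \<in> \<Omega>. f x > 0}"
  have \<omega>: "open ?\<omega>"
    using continuous_open_preimage[OF cont \<Omega>, of "{0<..}"] by (simp add: vimage_def Int_def)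
  obtain \<phi> where \<phi>: "\<And>n. \<phi> n \<in> test_functions \<Omega>" "L2_lim \<phi> f" "L2_lim (\<lambda>n. gradient (\<phi> n)) g"
    and lim: "AE x in lborel. (\<lambda>n. \<phi> n x) \<longlonglongrightarrow> f x" and "AE x in lborel. (\<lambda>n. gradient (\<phi> n) x) \<longlonglongrightarrow> g x"
    by (rule sobolev0E[OF f]) (rule that)
  define \<epsilon> where "\<epsilon> n = inverse (real (Suc n))" for n
  have \<epsilon>: "\<epsilon> n > 0" for n by (simp add: \<epsilon>_def)
  \<comment> \<open>The minimum of f and \<phi>_n^+, written with positive parts so that the rule
    for positive parts also yields its gradient.\<close>
  define a where "a n x = f x - max (f x - max (\<phi> n x) 0) 0" for n x
  define F where "F n x = max (a n x - \<epsilon> n) 0" for n x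
  define G where "G n x = (if a n x > \<epsilon> n then g x - (if f x - max (\<phi> n x) 0 > 0 then g x -
      (if \<phi> n x > 0 then gradient (\<phi> n) x else 0) else 0) else 0)" for n x
  have a_min: "a n x = min (f x) (max (\<phi> n x) 0)" for n x by (auto simp: a_def)
  have S1: "sobolev0 \<Omega> (F n) (G n)" for n
    unfolding F_def[abs_def] G_def[abs_def] a_def
    by (intro sobolev0_threshold sobolev0_diff sobolev0_pos_part f sobolev0_test \<phi>(1) less_imp_le[OF \<epsilon>])
  have S2: "sobolev0 ?\<omega> (F n) (G n)" for n
  proof -
    obtain S where S: "compact S" "S \<subseteq> \<Omega>" "\<And>x. x \<notin> S \<Longrightarrow> \<phi> n x = 0"
      using test_functions_support[OF \<phi>(1)[of n]] by metis
    let ?K = "{x \<in> S. \<epsilon> n \<le> f x}"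
    have "closedin (top_of_set S) ?K"
      using continuous_closedin_preimage[OF continuous_on_subset[OF cont S(2)], of "{\<epsilon> n..}"]
      by (simp add: vimage_def Int_def)
    then have "compact ?K" using closedin_compact[OF S(1)] by blast
    moreover have "?K \<subseteq> ?\<omega>"
      using S(2) less_le_trans[OF \<epsilon>[of n]] by auto
    moreover have "F n x = 0" if "x \<notin> ?K" for x
    proof (cases "x \<in> S")
      case True
      then show ?thesis using that by (simp add: F_def a_min)
    next
      case False
      then show ?thesis using S(3)[of x] \<epsilon>[of n] nonneg[of x] by (simp add: F_def a_min)
    qed
    ultimately have "sobolev0 (\<Omega> \<inter> ?\<omega>) (F n) (G n)"
      by (intro sobolev0_compact_support[OF S1 _ \<omega>])
    then show ?thesis by (rule sobolev0_mono) auto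
  qed
  have [measurable]: "f \<in> borel_measurable borel" "g \<in> borel_measurable borel"
    "\<phi> n \<in> borel_measurable borel" "gradient (\<phi> n) \<in> borel_measurable borel" for n
    using sobolev0_measurable[OF f] smooth_borel_measurable[OF test_functions_smooth[OF \<phi>(1)]]
      gradient_borel_measurable[OF test_functions_smooth[OF \<phi>(1)]] by auto
  have a_meas [measurable]: "a n \<in> borel_measurable borel" for n unfolding a_def[abs_def] by measurable
  have G_meas: "G n \<in> borel_measurable borel" for n by (rule sobolev0_measurable(2)[OF S1])
  have \<epsilon>0: "\<epsilon> \<longlonglongrightarrow> 0" unfolding \<epsilon>_def[abs_def] by (rule LIMSEQ_inverse_real_of_nat)
  have a_lim: "(\<lambda>n. a n x - \<epsilon> n) \<longlonglongrightarrow> f x" if "(\<lambda>n. \<phi> n x) \<longlonglongrightarrow> f x" for x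
    using tendsto_diff[OF tendsto_min[OF tendsto_const tendsto_max[OF that tendsto_const[of 0]], of "f x"] \<epsilon>0] nonneg[of x]
    unfolding a_min by simp
  have "L2_lim F f"
  proof (rule L2_lim_dominated[OF _ _ sobolev0_L2(1)[OF f]])
    show "F n \<in> borel_measurable borel" for n by (rule sobolev0_measurable(1)[OF S1])
    show "norm (F n x) \<le> norm (f x)" for n x
      using nonneg[of x] \<epsilon>[of n] by (auto simp: F_def a_min min_def max_def)
    show "AE x in lborel. (\<lambda>n. F n x) \<longlonglongrightarrow> f x"
      using lim
    proof eventually_elim
      case (elim x)
      show ?case unfolding F_def
        using tendsto_max[OF a_lim[OF elim] tendsto_const[of 0]] nonneg[of x] by simp
    qed
  qed auto
  moreover have "L2_lim G g"
  proof -
    have "L2_lim (\<lambda>n x. if a n x > \<epsilon> n then g x else 0) g"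
    proof (rule L2_lim_dominated[OF _ _ sobolev0_L2(2)[OF f]])
      show "AE x in lborel. (\<lambda>n. if a n x > \<epsilon> n then g x else 0) \<longlonglongrightarrow> g x"
        using lim sobolev0_gradient_level[OF f, of 0]
      proof eventually_elim
        case (elim x)
        show ?case
        proof (cases "f x = 0")
          case False
          then have "f x > 0" using nonneg[of x] by simp
          then have "\<forall>\<^sub>F n in sequentially. a n x - \<epsilon> n > 0"
            using order_tendstoD(1)[OF a_lim[OF elim(1)], of 0] by simp
          then have "\<forall>\<^sub>F n in sequentially. (if a n x > \<epsilon> n then g x else 0) = g x"
            by eventually_elim auto
          then show ?thesis by (rule tendsto_eventually)
        qed (use elim in \<open>simp cong: if_cong\<close>)
      qed
    qed auto
    \<comment> \<open>Since \<phi>_n > 0 wherever a_n > \<epsilon>_n, this difference is at each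
      point either 0 or \<open>gradient (\<phi> n) x - g x\<close>.\<close>
    moreover have "L2_lim (\<lambda>n x. G n x - (if a n x > \<epsilon> n then g x else 0)) (\<lambda>x. 0)"
    proof (rule L2_lim_bound[OF \<phi>(3), where C=1])
      show "norm (G n x - (if a n x > \<epsilon> n then g x else 0) - 0) \<le> 1 * norm (gradient (\<phi> n) x - g x)" for n x
      proof (cases "a n x > \<epsilon> n")
        case True
        then have "\<phi> n x > 0" using \<epsilon>[of n] by (auto simp: a_min)
        then show ?thesis using True by (simp add: G_def norm_minus_commute)
      qed (simp add: G_def)
      have "L2 (\<lambda>x. if a n x > \<epsilon> n then g x else 0)" for n
        by (rule L2_norm_bound[OF sobolev0_L2(2)[OF f], where C=1]) auto
      then show "L2 (\<lambda>x. G n x - (if a n x > \<epsilon> n then g x else 0))" for n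
        by (intro L2_diff sobolev0_L2(2)[OF S1])
    qed (rule L2_zero)
    ultimately have "L2_lim (\<lambda>n x. (if a n x > \<epsilon> n then g x else 0) + (G n x - (if a n x > \<epsilon> n then g x else 0))) (\<lambda>x. g x + 0)"
      by (rule L2_lim_add)
    then show ?thesis by simp
  qed
  ultimately show ?thesis by (rule sobolev0_closed[OF S2])
qed

lemma sobolev0_integrable:
  assumes "bounded \<Omega>" "sobolev0 \<Omega> f g"
  shows "integrable lborel f"
proof -
  let ?K = "closure \<Omega>"
  have "compact ?K" using assms(1) by (simp add: compact_closure)
  then have K: "integrable lborel (\<lambda>x. indicator ?K x * f x)"
    by (intro integrable_L2_compact sobolev0_L2(1)[OF assms(2)])
  have [measurable]: "f \<in> borel_measurable borel" by (rule sobolev0_measurable(1)[OF assms(2)])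
  have "integrable lborel (\<lambda>x. indicator ?K x * f x) \<longleftrightarrow> integrable lborel f"
  proof (rule integrable_cong_AE)
    show "AE x in lborel. indicator ?K x * f x = f x"
      using sobolev0_AE_outside[OF assms(2)]
    proof eventually_elim
      case (elim x)
      then show ?case using closure_subset[of \<Omega>] by (auto simp: indicator_def)
    qed
  qed auto
  then show ?thesis using K by simp
qed

text \<open>Extracts a first variation: t * c stands for the second-order remainder after division
  by t.\<close>

lemma le_of_perturbation:
  fixes a b c t0 :: real
  assumes "t0 > 0" "\<And>t. 0 < t \<Longrightarrow> t < t0 \<Longrightarrow> a \<le> b + t * c"
  shows "a \<le> b"
proof (rule tendsto_lowerbound)
  show "((\<lambda>t. b + t * c) \<longlongrightarrow> b) (at_right 0)"
    by (auto intro!: tendsto_eq_intros)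
  show "\<forall>\<^sub>F t in at_right 0. a \<le> b + t * c"
    unfolding eventually_at_right_field using assms by blast
qed simp

lemma integral_norm_add_sq:
  assumes "L2 f" "L2 g"
  shows "(LBINT x. (norm (f x + t *\<^sub>R g x))\<^sup>2)
    = (LBINT x. (norm (f x))\<^sup>2) + 2 * t * (LBINT x. f x \<bullet> g x) + t\<^sup>2 * (LBINT x. (norm (g x))\<^sup>2)"
proof -
  have "(LBINT x. (norm (f x + t *\<^sub>R g x))\<^sup>2)
     = (LBINT x. (norm (f x))\<^sup>2 + (2 * t) * (f x \<bullet> g x) + t\<^sup>2 * (norm (g x))\<^sup>2)"
    unfolding power2_norm_eq_inner
    by (intro Bochner_Integration.integral_cong refl)
      (simp add: inner_simps inner_commute algebra_simps power2_eq_square)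
  also have "\<dots> = (LBINT x. (norm (f x))\<^sup>2) + 2 * t * (LBINT x. f x \<bullet> g x) + t\<^sup>2 * (LBINT x. (norm (g x))\<^sup>2)"
    using assms by (simp add: L2_integrable L2_inner_integrable)
  finally show ?thesis .
qed

section \<open>Segregated minimizers\<close>

text \<open>Signs, segregation and vanishing outside hold at every point, as befits a continuous
  representative; competitors satisfy their constraints only almost everywhere, which is what
  truncations and limits provide.\<close>

locale segregated_minimizer =
  fixes \<Omega> :: "'a::euclidean_space set"
    and u :: "'b::finite \<Rightarrow> 'a \<Rightarrow> real" and g :: "'b \<Rightarrow> 'a \<Rightarrow> 'a"
  assumes open_\<Omega>: "open \<Omega>" and bounded_\<Omega>: "bounded \<Omega>"
    and sobolev: "\<And>i. sobolev0 \<Omega> (u i) (g i)"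
    and cont: "\<And>i. continuous_on \<Omega> (u i)"
    and nonneg: "\<And>i x. 0 \<le> u i x"
    and outside: "\<And>i x. x \<notin> \<Omega> \<Longrightarrow> u i x = 0"
    and segregated: "\<And>i j x. i \<noteq> j \<Longrightarrow> u i x = 0 \<or> u j x = 0"
    and mass: "\<And>i. (LBINT x. u i x) = 1"
    and minimal: "\<And>(v :: 'b \<Rightarrow> 'a \<Rightarrow> real) h. (\<And>i. sobolev0 \<Omega> (v i) (h i)) \<Longrightarrow> (\<And>i. AE x in lborel. 0 \<le> v i x) \<Longrightarrow>
       (\<And>i j. i \<noteq> j \<Longrightarrow> AE x in lborel. v i x = 0 \<or> v j x = 0) \<Longrightarrow>
       (\<And>i. (LBINT x. v i x) = 1) \<Longrightarrow>
       (\<Sum>i\<in>UNIV. \<integral>x. (norm (g i x))\<^sup>2 \<partial>lborel) \<le> (\<Sum>i\<in>UNIV. \<integral>x. (norm (h i x))\<^sup>2 \<partial>lborel)"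
begin

definition energy :: "'b \<Rightarrow> real" where
  "energy i = (LBINT x. (norm (g i x))\<^sup>2)"

text \<open>Folds the star of half-lines onto a line: branch i becomes the positive half-axis and
  all other branches the negative one.\<close>

definition hat :: "'b \<Rightarrow> 'a \<Rightarrow> real" where
  "hat i x = u i x - (\<Sum>j\<in>UNIV - {i}. u j x)"

definition ghat :: "'b \<Rightarrow> 'a \<Rightarrow> 'a" where
  "ghat i x = g i x - (\<Sum>j\<in>UNIV - {i}. g j x)"

lemma energy_nonneg: "0 \<le> energy i"
  by (simp add: energy_def)

lemma sobolev_hat: "sobolev0 \<Omega> (hat i) (ghat i)"
  unfolding hat_def[abs_def] ghat_def[abs_def] by (intro sobolev0_diff sobolev sobolev0_sum)

lemma AE_gradient_zero: "AE x in lborel. \<forall>i. u i x = 0 \<longrightarrow> g i x = 0"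
proof -
  have "AE x in lborel. \<forall>i\<in>UNIV. u i x = 0 \<longrightarrow> g i x = 0"
    by (intro AE_finite_allI sobolev0_gradient_level[OF sobolev]) simp
  then show ?thesis by simp
qed

text \<open>Division by the mass makes a segregated competitor admissible. The normalized energy
  decreases as the mass grows, so a lower bound m i for the mass suffices.\<close>

lemma minimal_scaled:
  fixes v :: "'b \<Rightarrow> 'a \<Rightarrow> real"
  assumes v: "\<And>i. sobolev0 \<Omega> (v i) (h i)" "\<And>i. AE x in lborel. 0 \<le> v i x"
    "\<And>i j. i \<noteq> j \<Longrightarrow> AE x in lborel. v i x = 0 \<or> v j x = 0"
    and m: "\<And>i. 0 < m i" "\<And>i. m i \<le> (LBINT x. v i x)"
  shows "(\<Sum>i\<in>UNIV. energy i) \<le> (\<Sum>i\<in>UNIV. (LBINT x. (norm (h i x))\<^sup>2) / (m i)\<^sup>2)"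
proof -
  define M where "M i = (LBINT x. v i x)" for i
  have M: "M i > 0" "m i \<le> M i" for i using m[of i] by (auto simp: M_def)
  have "(\<Sum>i\<in>UNIV. \<integral>x. (norm (g i x))\<^sup>2 \<partial>lborel)
     \<le> (\<Sum>i\<in>UNIV. \<integral>x. (norm ((1 / M i) *\<^sub>R h i x))\<^sup>2 \<partial>lborel)"
  proof (rule minimal[of "\<lambda>i x. (1 / M i) * v i x" "\<lambda>i x. (1 / M i) *\<^sub>R h i x"])
    show "sobolev0 \<Omega> (\<lambda>x. (1 / M i) * v i x) (\<lambda>x. (1 / M i) *\<^sub>R h i x)" for i
      by (intro sobolev0_cmult v)
    show "AE x in lborel. 0 \<le> 1 / M i * v i x" for i
      using v(2)[of i] M(1)[of i] by (auto elim!: eventually_mono)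
    show "AE x in lborel. 1 / M i * v i x = 0 \<or> 1 / M j * v j x = 0" if "i \<noteq> j" for i j
      using v(3)[OF that] by (auto elim!: eventually_mono)
    show "(LBINT x. 1 / M i * v i x) = 1" for i
      using M(1)[of i] by (simp add: M_def)
  qed
  also have "\<dots> = (\<Sum>i\<in>UNIV. (LBINT x. (norm (h i x))\<^sup>2) / (M i)\<^sup>2)"
    by (simp add: power_mult_distrib power_divide)
  also have "\<dots> \<le> (\<Sum>i\<in>UNIV. (LBINT x. (norm (h i x))\<^sup>2) / (m i)\<^sup>2)"
    using M m(1) by (intro sum_mono divide_left_mono power_mono mult_pos_pos zero_less_power)
      (auto intro: less_imp_le)
  finally show ?thesis by (simp add: energy_def)
qed

text \<open>When only u_i is replaced, the energies of the other components cancel.\<close>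

lemma minimal_single:
  assumes v: "sobolev0 \<Omega> v h" "AE x in lborel. 0 \<le> v x"
    "\<And>j. j \<noteq> i \<Longrightarrow> AE x in lborel. v x = 0 \<or> u j x = 0"
    and m: "0 < m" "m \<le> (LBINT x. v x)"
  shows "energy i * m\<^sup>2 \<le> (LBINT x. (norm (h x))\<^sup>2)"
proof -
  have "(\<Sum>j\<in>UNIV. energy j) \<le> (\<Sum>j\<in>UNIV. (LBINT x. (norm ((g(i := h)) j x))\<^sup>2) / ((\<lambda>_. 1)(i := m)) j ^ 2)"
  proof (rule minimal_scaled)
    show "sobolev0 \<Omega> ((u(i := v)) j) ((g(i := h)) j)" for j using v(1) sobolev by simp
    show "AE x in lborel. 0 \<le> (u(i := v)) j x" for j using v(2) nonneg by simp
    show "AE x in lborel. (u(i := v)) j x = 0 \<or> (u(i := v)) l x = 0" if "j \<noteq> l" for j l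
    proof (cases "j = i")
      case True
      then show ?thesis using v(3)[of l] that by auto
    next
      case False
      then show ?thesis using v(3)[of j] segregated[OF that] that
        by (cases "l = i") (auto simp: disj_commute)
    qed
    show "0 < ((\<lambda>_. 1)(i := m)) j" for j using m by simp
    show "((\<lambda>_. 1)(i := m)) j \<le> (LBINT x. (u(i := v)) j x)" for j using m mass by simp
  qed
  then have "energy i + (\<Sum>j\<in>UNIV - {i}. energy j)
     \<le> (LBINT x. (norm (h x))\<^sup>2) / m\<^sup>2 + (\<Sum>j\<in>UNIV - {i}. energy j)"
    by (simp add: sum.remove[of UNIV i] energy_def)
  then show ?thesis using m(1) by (simp add: field_simps)
qed

text \<open>The competitor is (u_i - t T)^+. Shrinking u_i preserves segregation, truncation does
  not raise the Dirichlet integral of u_i - t T, and the mass drops by at most t times that of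
  T.\<close>

lemma subsolution:
  assumes T: "sobolev0 \<Omega> T G" "AE x in lborel. 0 \<le> T x"
  shows "(LBINT x. g i x \<bullet> G x) \<le> energy i * (LBINT x. T x)"
proof -
  define \<tau> where "\<tau> = (LBINT x. T x)"
  have \<tau>: "\<tau> \<ge> 0" unfolding \<tau>_def by (rule integral_nonneg_AE[OF T(2)])
  have iT: "integrable lborel T" and iu: "integrable lborel (u i)"
    using sobolev0_integrable[OF bounded_\<Omega>] T(1) sobolev by auto
  define \<Gamma> where "\<Gamma> = (LBINT x. (norm (G x))\<^sup>2)"
  \<comment> \<open>The bound on t keeps 1 - t \<tau>, the lower bound for the mass,
    positive.\<close>
  have pert: "(LBINT x. g i x \<bullet> G x) \<le> energy i * \<tau> + t * (\<Gamma> / 2)" if t: "0 < t" "t < 1 / (1 + \<tau>)" for t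
  proof -
    have "t * (1 + \<tau>) < 1" using t \<tau> by (simp add: field_simps)
    then have m: "1 - t * \<tau> > 0" using t by (simp add: algebra_simps)
    let ?d = "\<lambda>x. u i x - t * T x" and ?D = "\<lambda>x. g i x - t *\<^sub>R G x"
    have d: "sobolev0 \<Omega> ?d ?D" by (intro sobolev0_diff sobolev sobolev0_cmult T(1))
    note p = sobolev0_pos_part[OF d]
    have "1 - t * \<tau> = (LBINT x. ?d x)" using iT iu mass by (simp add: \<tau>_def)
    also have "\<dots> \<le> (LBINT x. max (?d x) 0)"
      by (intro integral_mono sobolev0_integrable[OF bounded_\<Omega> d] sobolev0_integrable[OF bounded_\<Omega> p]) simp
    finally have m2: "1 - t * \<tau> \<le> (LBINT x. max (?d x) 0)" .
    have "energy i * (1 - t * \<tau>)\<^sup>2 \<le> (LBINT x. (norm (if ?d x > 0 then ?D x else 0))\<^sup>2)"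
    proof (rule minimal_single[OF p _ _ m m2])
      show "AE x in lborel. max (?d x) 0 = 0 \<or> u j x = 0" if "j \<noteq> i" for j
        using T(2)
      proof eventually_elim
        case (elim x)
        then show ?case using segregated[OF that, of x] t(1) by (auto simp: max_def)
      qed
    qed simp
    also have "\<dots> \<le> (LBINT x. (norm (?D x))\<^sup>2)"
      by (rule integral_mono[OF L2_integrable[OF sobolev0_L2(2)[OF p]] L2_integrable[OF sobolev0_L2(2)[OF d]]]) simp
    also have "\<dots> = energy i - 2 * t * (LBINT x. g i x \<bullet> G x) + t\<^sup>2 * \<Gamma>"
      using integral_norm_add_sq[OF sobolev0_L2(2)[OF sobolev[of i]] sobolev0_L2(2)[OF T(1)], of "- t"]
      by (simp add: energy_def \<Gamma>_def)
    finally have "energy i * (1 - t * \<tau>)\<^sup>2 \<le> energy i - 2 * t * (LBINT x. g i x \<bullet> G x) + t\<^sup>2 * \<Gamma>" .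
    moreover have "energy i * (1 - 2 * t * \<tau>) \<le> energy i * (1 - t * \<tau>)\<^sup>2"
      by (intro mult_left_mono energy_nonneg)
        (use zero_le_power2[of "t * \<tau>"] in \<open>simp add: power2_eq_square algebra_simps\<close>)
    ultimately have "t * (2 * (LBINT x. g i x \<bullet> G x)) \<le> t * (2 * energy i * \<tau> + t * \<Gamma>)"
      by (simp add: power2_eq_square algebra_simps)
    then show ?thesis using t(1) by simp
  qed
  show ?thesis unfolding \<tau>_def[symmetric]
    by (rule le_of_perturbation[of "1 / (1 + \<tau>)"], use \<tau> in simp, rule pert)
qed

text \<open>The reverse inequality uses u_i + t T, which stays segregated because T vanishes
  wherever u_i does.\<close>

lemma euler_lagrange:
  assumes T: "sobolev0 \<Omega> T G" "AE x in lborel. 0 \<le> T x" and z: "AE x in lborel. u i x = 0 \<longrightarrow> T x = 0"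
  shows "(LBINT x. g i x \<bullet> G x) = energy i * (LBINT x. T x)"
proof (rule antisym[OF subsolution[OF T]])
  define \<tau> where "\<tau> = (LBINT x. T x)"
  have \<tau>: "\<tau> \<ge> 0" unfolding \<tau>_def by (rule integral_nonneg_AE[OF T(2)])
  have iT: "integrable lborel T" and iu: "integrable lborel (u i)"
    using sobolev0_integrable[OF bounded_\<Omega>] T(1) sobolev by auto
  define \<Gamma> where "\<Gamma> = (LBINT x. (norm (G x))\<^sup>2)"
  have pert: "energy i * \<tau> \<le> (LBINT x. g i x \<bullet> G x) + t * (\<Gamma> / 2)" if t: "0 < t" "t < 1" for t
  proof -
    have "energy i * (1 + t * \<tau>)\<^sup>2 \<le> (LBINT x. (norm (g i x + t *\<^sub>R G x))\<^sup>2)"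
    proof (rule minimal_single)
      show "sobolev0 \<Omega> (\<lambda>x. u i x + t * T x) (\<lambda>x. g i x + t *\<^sub>R G x)"
        by (intro sobolev0_add sobolev sobolev0_cmult T(1))
      show "AE x in lborel. 0 \<le> u i x + t * T x"
        using T(2) by eventually_elim (use nonneg t(1) in simp)
      show "AE x in lborel. u i x + t * T x = 0 \<or> u j x = 0" if "j \<noteq> i" for j
        using z
      proof eventually_elim
        case (elim x)
        then show ?case using segregated[OF that, of x] by auto
      qed
      show "0 < 1 + t * \<tau>" using t \<tau> by (simp add: add_pos_nonneg)
      show "1 + t * \<tau> \<le> (LBINT x. u i x + t * T x)" using iT iu mass by (simp add: \<tau>_def)
    qed
    also have "\<dots> = energy i + 2 * t * (LBINT x. g i x \<bullet> G x) + t\<^sup>2 * \<Gamma>"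
      using integral_norm_add_sq[OF sobolev0_L2(2)[OF sobolev[of i]] sobolev0_L2(2)[OF T(1)], of t]
      by (simp add: energy_def \<Gamma>_def)
    finally have "energy i * (1 + t * \<tau>)\<^sup>2 \<le> energy i + 2 * t * (LBINT x. g i x \<bullet> G x) + t\<^sup>2 * \<Gamma>" .
    moreover have "energy i * (1 + 2 * t * \<tau>) \<le> energy i * (1 + t * \<tau>)\<^sup>2"
      by (intro mult_left_mono energy_nonneg)
        (use zero_le_power2[of "t * \<tau>"] in \<open>simp add: power2_eq_square algebra_simps\<close>)
    ultimately have "t * (2 * energy i * \<tau>) \<le> t * (2 * (LBINT x. g i x \<bullet> G x) + t * \<Gamma>)"
      by (simp add: power2_eq_square algebra_simps)
    then show ?thesis using t(1) by simp
  qed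
  show "energy i * (LBINT x. T x) \<le> (LBINT x. g i x \<bullet> G x)" unfolding \<tau>_def[symmetric]
    by (rule le_of_perturbation[of 1], simp, rule pert)
qed

text \<open>The function |v| may replace u_i, since it lives where u_i > 0 and hence where the other
  components vanish. This is the lower bound in the identification of \<open>energy\<close> with
  \<open>lambda21\<close>.\<close>

lemma energy_le:
  assumes v: "sobolev0 {x \<in> \<Omega>. u i x > 0} v h" "(LBINT x. \<bar>v x\<bar>) = 1"
  shows "energy i \<le> (LBINT x. (norm (h x))\<^sup>2)"
proof -
  have v\<Omega>: "sobolev0 \<Omega> v h" by (rule sobolev0_mono[OF v(1)]) auto
  note a = sobolev0_abs[OF v\<Omega>]
  have "energy i * 1\<^sup>2 \<le> (LBINT x. (norm (sgn (v x) *\<^sub>R h x))\<^sup>2)"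
  proof (rule minimal_single[OF a])
    show "AE x in lborel. \<bar>v x\<bar> = 0 \<or> u j x = 0" if "j \<noteq> i" for j
      using sobolev0_AE_outside[OF v(1)]
      by eventually_elim (use segregated[OF that] outside in fastforce)
  qed (use v in auto)
  also have "\<dots> \<le> (LBINT x. (norm (h x))\<^sup>2)"
    by (rule integral_mono[OF L2_integrable[OF sobolev0_L2(2)[OF a]] L2_integrable[OF sobolev0_L2(2)[OF v\<Omega>]]])
      (auto simp: sgn_if)
  finally show ?thesis by simp
qed

lemma sobolev_positivity_set: "sobolev0 {x \<in> \<Omega>. u i x > 0} (u i) (g i)"
  by (rule sobolev0_positivity_set[OF open_\<Omega> sobolev cont nonneg])

section \<open>The folded components and their differential inequality\<close>

lemma hat_eq: "u i x > 0 \<Longrightarrow> hat i x = u i x"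
  and hat_eq': "j \<noteq> i \<Longrightarrow> u j x > 0 \<Longrightarrow> hat i x = - u j x"
proof -
  have z: "u l x = 0" if "u j x > 0" "l \<noteq> j" for l j
    using segregated[of l j x] that by auto
  show "u i x > 0 \<Longrightarrow> hat i x = u i x"
    unfolding hat_def using z by (simp add: sum.neutral)
  show "hat i x = - u j x" if "j \<noteq> i" "u j x > 0"
  proof -
    have "(\<Sum>l\<in>UNIV - {i}. u l x) = (\<Sum>l\<in>{j}. u l x)"
      by (rule sum.mono_neutral_right) (use that z in auto)
    then show ?thesis unfolding hat_def using z[OF that(2), of i] that by simp
  qed
qed

lemma ghat_eq: "(\<And>l. u l x = 0 \<longrightarrow> g l x = 0) \<Longrightarrow> u i x > 0 \<Longrightarrow> ghat i x = g i x"
  and ghat_eq': "(\<And>l. u l x = 0 \<longrightarrow> g l x = 0) \<Longrightarrow> j \<noteq> i \<Longrightarrow> u j x > 0 \<Longrightarrow> ghat i x = - g j x"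
proof -
  assume g0: "\<And>l. u l x = 0 \<longrightarrow> g l x = 0"
  have z: "g l x = 0" if "u j x > 0" "l \<noteq> j" for l j
    using segregated[of l j x] that g0 by auto
  show "u i x > 0 \<Longrightarrow> ghat i x = g i x"
    unfolding ghat_def using z by (simp add: sum.neutral)
  show "ghat i x = - g j x" if "j \<noteq> i" "u j x > 0"
  proof -
    have "(\<Sum>l\<in>UNIV - {i}. g l x) = (\<Sum>l\<in>{j}. g l x)"
      by (rule sum.mono_neutral_right) (use that z in auto)
    then show ?thesis unfolding ghat_def using z[OF that(2), of i] that by simp
  qed
qed

text \<open>At almost every point at most one of the gradients is nonzero, so folding changes its
  sign at most and not its length.\<close>

lemma AE_norm_ghat: "AE x in lborel. (norm (ghat i x))\<^sup>2 = (\<Sum>j\<in>UNIV. (norm (g j x))\<^sup>2)"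
  using AE_gradient_zero
proof eventually_elim
  case (elim x)
  show ?case
  proof (cases "\<exists>j. u j x > 0")
    case True
    then obtain j where j: "u j x > 0" by blast
    have "(norm (ghat i x))\<^sup>2 = (norm (g j x))\<^sup>2"
      using ghat_eq[of x i] ghat_eq'[of x j i] elim j by (cases "j = i") auto
    moreover have "(\<Sum>l\<in>UNIV. (norm (g l x))\<^sup>2) = (\<Sum>l\<in>{j}. (norm (g l x))\<^sup>2)"
      by (rule sum.mono_neutral_right) (use j segregated elim in force)+
    ultimately show ?thesis by simp
  next
    case False
    then have "u j x = 0" for j using nonneg[of j x] by (simp add: not_less antisym)
    then have "g j x = 0" for j using elim by blast
    then show ?thesis by (simp add: ghat_def)
  qed
qed

lemma integral_norm_ghat: "(LBINT x. (norm (ghat i x))\<^sup>2) = (\<Sum>j\<in>UNIV. energy j)"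
proof -
  have [measurable]: "g j \<in> borel_measurable borel" "ghat j \<in> borel_measurable borel" for j
    using sobolev0_measurable(2) sobolev sobolev_hat by blast+
  have "(LBINT x. (norm (ghat i x))\<^sup>2) = (LBINT x. (\<Sum>j\<in>UNIV. (norm (g j x))\<^sup>2))"
    by (rule integral_cong_AE[OF _ _ AE_norm_ghat]) measurable
  also have "\<dots> = (\<Sum>j\<in>UNIV. energy j)" unfolding energy_def
    by (intro Bochner_Integration.integral_sum L2_integrable sobolev0_L2(2)[OF sobolev])
  finally show ?thesis .
qed

text \<open>The competitor moves mass from the other densities to \<open>u\<^sub>i\<close>; its total gradient is that of
  \<open>hat i + t T\<close>.\<close>

lemma hat_supersolution:
  assumes T: "sobolev0 \<Omega> T G" "AE x in lborel. 0 \<le> T x"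
  shows "- (LBINT x. ghat i x \<bullet> G x) \<le> (\<Sum>j\<in>UNIV. energy j) * (LBINT x. T x)"
proof -
  define \<tau> where "\<tau> = (LBINT x. T x)"
  have \<tau>: "\<tau> \<ge> 0" unfolding \<tau>_def by (rule integral_nonneg_AE[OF T(2)])
  have iT: "integrable lborel T" and iu: "integrable lborel (u j)" for j
    using sobolev0_integrable[OF bounded_\<Omega>] T(1) sobolev by auto
  define \<Gamma> where "\<Gamma> = (LBINT x. (norm (G x))\<^sup>2)"
  define E where "E = (\<Sum>j\<in>UNIV. energy j)"
  have E: "E \<ge> 0" unfolding E_def by (intro sum_nonneg energy_nonneg)
  have pert: "- (LBINT x. ghat i x \<bullet> G x) \<le> E * \<tau> + t * (\<Gamma> / 2)" if t: "0 < t" "t < 1 / (1 + \<tau>)" for t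
  proof -
    have "t * (1 + \<tau>) < 1" using t \<tau> by (simp add: field_simps)
    then have m: "1 - t * \<tau> > 0" using t by (simp add: algebra_simps)
    define d where "d j x = (if j = i then hat i x + t * T x else u j x - t * T x)" for j x
    define D where "D j x = (if j = i then ghat i x + t *\<^sub>R G x else g j x - t *\<^sub>R G x)" for j x
    have d: "sobolev0 \<Omega> (d j) (D j)" for j
      unfolding d_def[abs_def] D_def[abs_def]
      by (cases "j = i") (simp_all, (intro sobolev0_add sobolev0_diff sobolev0_cmult sobolev_hat sobolev T(1))+)
    note p = sobolev0_pos_part[OF d]
    \<comment> \<open>At most one competitor is positive at a point: if u_j > t T \<ge> 0 for some j
      \<noteq> i, then hat i = -u_j and hat i + t T < 0.\<close>
    have pos: "AE x in lborel. \<forall>j l. j \<noteq> l \<longrightarrow> max (d j x) 0 = 0 \<or> max (d l x) 0 = 0"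
      using T(2)
    proof eventually_elim
      case (elim x)
      have tT: "t * T x \<ge> 0" using elim t by simp
      have *: "\<not> (d i x > 0 \<and> d j x > 0)" if "j \<noteq> i" for j
      proof
        assume "d i x > 0 \<and> d j x > 0"
        then have "hat i x + t * T x > 0" "u j x > t * T x" using that by (auto simp: d_def)
        moreover from this have "hat i x = - u j x" using hat_eq'[OF that, of x] tT by simp
        ultimately show False by simp
      qed
      have **: "\<not> (d l x > 0 \<and> d j x > 0)" if "j \<noteq> i" "l \<noteq> i" "j \<noteq> l" for j l
        using segregated[OF that(3), of x] that tT by (auto simp: d_def)
      show ?case
      proof (intro allI impI)
        fix j l :: 'b assume "j \<noteq> l"
        then have "\<not> (d j x > 0 \<and> d l x > 0)" using *[of j] *[of l] **[of j l] by metis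
        then show "max (d j x) 0 = 0 \<or> max (d l x) 0 = 0" by (auto simp: max_def)
      qed
    qed
    have m2: "1 - t * \<tau> \<le> (LBINT x. max (d j x) 0)" for j
    proof (cases "j = i")
      case True
      have "1 - t * \<tau> \<le> (LBINT x. u i x)" using mass \<tau> t by simp
      also have "\<dots> \<le> (LBINT x. max (d i x) 0)"
      proof (rule integral_mono_AE[OF iu sobolev0_integrable[OF bounded_\<Omega> p]])
        \<comment> \<open>Component i loses no mass, because hat i = u_i wherever u_i > 0.\<close>
        show "AE x in lborel. u i x \<le> max (d i x) 0"
          using T(2)
        proof eventually_elim
          case (elim x)
          then have "t * T x \<ge> 0" using t by simp
          then show ?case using hat_eq[of i x] nonneg[of i x] by (cases "u i x > 0") (auto simp: d_def max_def)
        qed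
      qed
      finally show ?thesis using True by simp
    next
      case False
      then have "1 - t * \<tau> = (LBINT x. d j x)" using iT iu mass by (simp add: \<tau>_def d_def)
      also have "\<dots> \<le> (LBINT x. max (d j x) 0)"
        by (intro integral_mono sobolev0_integrable[OF bounded_\<Omega> d] sobolev0_integrable[OF bounded_\<Omega> p]) simp
      finally show ?thesis .
    qed
    let ?H = "\<lambda>j x. if d j x > 0 then D j x else 0"
    have "E \<le> (\<Sum>j\<in>UNIV. (LBINT x. (norm (?H j x))\<^sup>2) / (1 - t * \<tau>)\<^sup>2)"
      unfolding E_def
    proof (rule minimal_scaled[OF p _ _ m m2])
      show "AE x in lborel. max (d j x) 0 = 0 \<or> max (d l x) 0 = 0" if "j \<noteq> l" for j l
        using pos by eventually_elim (use that in blast)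
    qed simp
    also have "\<dots> = (\<Sum>j\<in>UNIV. (LBINT x. (norm (?H j x))\<^sup>2)) / (1 - t * \<tau>)\<^sup>2"
      by (rule sum_divide_distrib[symmetric])
    finally have "E * (1 - t * \<tau>)\<^sup>2 \<le> (\<Sum>j\<in>UNIV. (LBINT x. (norm (?H j x))\<^sup>2))"
      using m by (simp add: field_simps)
    also have "\<dots> = (LBINT x. (\<Sum>j\<in>UNIV. (norm (?H j x))\<^sup>2))"
      by (intro Bochner_Integration.integral_sum[symmetric] L2_integrable sobolev0_L2(2)[OF p])
    also have "\<dots> \<le> (LBINT x. (norm (ghat i x + t *\<^sub>R G x))\<^sup>2)"
    proof (rule integral_mono_AE)
      show "integrable lborel (\<lambda>x. \<Sum>j\<in>UNIV. (norm (?H j x))\<^sup>2)"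
        by (intro Bochner_Integration.integrable_sum L2_integrable sobolev0_L2(2)[OF p])
      show "integrable lborel (\<lambda>x. (norm (ghat i x + t *\<^sub>R G x))\<^sup>2)"
        by (intro L2_integrable L2_add L2_scaleR sobolev0_L2(2)[OF sobolev_hat] sobolev0_L2(2)[OF T(1)])
      show "AE x in lborel. (\<Sum>j\<in>UNIV. (norm (?H j x))\<^sup>2) \<le> (norm (ghat i x + t *\<^sub>R G x))\<^sup>2"
        using pos AE_gradient_zero T(2)
      proof eventually_elim
        case (elim x)
        show ?case
        proof (cases "\<exists>j. d j x > 0")
          case True
          then obtain j where j: "d j x > 0" by blast
          have "(\<Sum>l\<in>UNIV. (norm (?H l x))\<^sup>2) = (\<Sum>l\<in>{j}. (norm (?H l x))\<^sup>2)"
          proof (rule sum.mono_neutral_right)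
            show "\<forall>l\<in>UNIV - {j}. (norm (?H l x))\<^sup>2 = 0"
            proof
              fix l assume "l \<in> UNIV - {j}"
              then have "l \<noteq> j" by simp
              then have "max (d l x) 0 = 0" using elim(1)[rule_format, of l j] j by (simp add: max_def)
              then show "(norm (?H l x))\<^sup>2 = 0" by (auto simp: max_def split: if_splits)
            qed
          qed auto
          also have "\<dots> = (norm (D j x))\<^sup>2" using j by simp
          \<comment> \<open>If the positive component has index j \<noteq> i, then hat i = -u_j
            there and the two gradients differ only in sign.\<close>
          also have "\<dots> = (norm (ghat i x + t *\<^sub>R G x))\<^sup>2"
          proof (cases "j = i")
            case False
            have "t * T x \<ge> 0" using elim(3) t by simp
            then have "u j x > 0" using j False by (simp add: d_def)
            then have "ghat i x = - g j x" using ghat_eq'[of x j i] elim(2) False by blast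
            then have "ghat i x + t *\<^sub>R G x = - D j x" using False by (simp add: D_def)
            then show ?thesis by (simp only: norm_minus_cancel)
          qed (simp add: D_def)
          finally show ?thesis by simp
        qed simp
      qed
    qed
    also have "\<dots> = E + 2 * t * (LBINT x. ghat i x \<bullet> G x) + t\<^sup>2 * \<Gamma>"
      using integral_norm_add_sq[OF sobolev0_L2(2)[OF sobolev_hat[of i]] sobolev0_L2(2)[OF T(1)], of t]
      by (simp add: integral_norm_ghat E_def \<Gamma>_def)
    finally have "E * (1 - t * \<tau>)\<^sup>2 \<le> E + 2 * t * (LBINT x. ghat i x \<bullet> G x) + t\<^sup>2 * \<Gamma>" .
    moreover have "E * (1 - 2 * t * \<tau>) \<le> E * (1 - t * \<tau>)\<^sup>2"
      by (intro mult_left_mono E)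
        (use zero_le_power2[of "t * \<tau>"] in \<open>simp add: power2_eq_square algebra_simps\<close>)
    ultimately have "t * (- 2 * (LBINT x. ghat i x \<bullet> G x)) \<le> t * (2 * E * \<tau> + t * \<Gamma>)"
      by (simp add: power2_eq_square algebra_simps)
    then have "- 2 * (LBINT x. ghat i x \<bullet> G x) \<le> 2 * E * \<tau> + t * \<Gamma>"
      using t(1) by (simp only: mult_le_cancel_left_pos)
    then show ?thesis by simp
  qed
  show ?thesis unfolding \<tau>_def[symmetric] E_def[symmetric]
    by (rule le_of_perturbation[of "1 / (1 + \<tau>)"], use \<tau> in simp, rule pert)
qed

end

section \<open>A mean value inequality\<close>

lemma integral_affine:
  fixes f :: "'a::euclidean_space \<Rightarrow> real"
  assumes [measurable]: "f \<in> borel_measurable borel" and c: "c > 0"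
  shows "(LBINT x. f x) = c ^ DIM('a) * (LBINT x. f (t + c *\<^sub>R x))"
proof -
  have "(LBINT x. f x) = (\<integral>x. f x \<partial>density (distr lborel borel (\<lambda>x. t + c *\<^sub>R x)) (\<lambda>_. \<bar>c\<bar> ^ DIM('a)))"
    using lborel_affine[of c t] c by simp
  also have "\<dots> = (\<integral>x. (\<bar>c\<bar> ^ DIM('a)) *\<^sub>R f x \<partial>distr lborel borel (\<lambda>x. t + c *\<^sub>R x))"
    by (subst integral_density) auto
  also have "\<dots> = (LBINT x. (\<bar>c\<bar> ^ DIM('a)) *\<^sub>R f (t + c *\<^sub>R x))"
    by (subst integral_distr) auto
  finally show ?thesis using c by simp
qed

lemma integral_scaled:
  fixes f :: "'a::euclidean_space \<Rightarrow> real"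
  assumes "f \<in> borel_measurable borel" "s > 0"
  shows "(LBINT x. f ((1 / s) *\<^sub>R (x - x0))) = s ^ DIM('a) * (LBINT x. f x)"
proof -
  have "(LBINT x. f ((1 / s) *\<^sub>R (x - x0)))
      = s ^ DIM('a) * (LBINT x. f ((1 / s) *\<^sub>R ((x0 + s *\<^sub>R x) - x0)))"
    using assms by (intro integral_affine) auto
  then show ?thesis using assms(2) by simp
qed

section \<open>Scaling and a radial averaging kernel\<close>

lemma smooth_scaled: "smooth f \<Longrightarrow> smooth (\<lambda>x. f ((1 / s) *\<^sub>R (x - x0)))"
  using smooth_affine[of f "- (1 / s) *\<^sub>R x0" "1 / s"] by (simp add: algebra_simps)

lemma gradient_scaled:
  "smooth f \<Longrightarrow> gradient (\<lambda>x. f ((1 / s) *\<^sub>R (x - x0))) x = (1 / s) *\<^sub>R gradient f ((1 / s) *\<^sub>R (x - x0))"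
  using gradient_affine[of f "- (1 / s) *\<^sub>R x0" "1 / s"] by (simp add: algebra_simps)

lemma laplacian_scaled:
  assumes f: "smooth f"
  shows "laplacian (\<lambda>x. f ((1 / s) *\<^sub>R (x - x0))) x = laplacian f ((1 / s) *\<^sub>R (x - x0)) / s\<^sup>2"
proof -
  have "gradient (\<lambda>y. gradient (\<lambda>x. f ((1 / s) *\<^sub>R (x - x0))) y \<bullet> i) x
      = (1 / s) *\<^sub>R (1 / s) *\<^sub>R gradient (\<lambda>y. gradient f y \<bullet> i) ((1 / s) *\<^sub>R (x - x0))" for i
  proof -
    have sm: "smooth (\<lambda>y. gradient f y \<bullet> i)" by (rule smooth_gradient_inner[OF f])
    have "gradient (\<lambda>y. (1 / s) * (gradient f ((1 / s) *\<^sub>R (y - x0)) \<bullet> i)) x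
      = (1 / s) *\<^sub>R gradient (\<lambda>y. gradient f ((1 / s) *\<^sub>R (y - x0)) \<bullet> i) x"
      by (rule gradient_cmult[OF smooth_scaled[OF sm]])
    then show ?thesis by (simp add: gradient_scaled[OF f] gradient_scaled[OF sm])
  qed
  then show ?thesis
    by (simp add: laplacian_def sum_divide_distrib power2_eq_square)
qed

text \<open>Determined by gradient bump y = - bump_kernel y y: the factor 2 comes from |y|^2, and
  \<open>flat 2\<close> is the derivative of \<open>flat 0\<close>.\<close>

definition bump_kernel :: "'a::euclidean_space \<Rightarrow> real" where
  "bump_kernel y = 2 * flat 2 (1 - (norm y)\<^sup>2)"

lemma smooth_bump_kernel: "smooth bump_kernel"
  unfolding bump_kernel_def[abs_def]
  by (intro smooth_mult smooth_compose[OF smooth_flat] smooth_diff smooth_const smooth_norm_sq)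

lemma bump_kernel_nonneg: "0 \<le> bump_kernel y"
  by (simp add: bump_kernel_def flat_nonneg)

lemma bump_kernel_zero: "norm y \<ge> 1 \<Longrightarrow> bump_kernel y = 0"
  unfolding bump_kernel_def using flat_zero[of "1 - (norm y)\<^sup>2" 2] by (simp add: one_le_power)

lemma bump_kernel_pos: "norm y < 1 \<Longrightarrow> 0 < bump_kernel y"
  unfolding bump_kernel_def using flat_pos[of "1 - (norm y)\<^sup>2" 2] by (simp add: abs_square_less_1)

lemma gradient_bump: "gradient bump y = - bump_kernel y *\<^sub>R y"
proof -
  have "gradient (\<lambda>y::'a. (1::real) - (norm y)\<^sup>2) y = - 2 *\<^sub>R y"
    by (simp add: gradient_diff smooth_const smooth_norm_sq gradient_const gradient_norm_sq)
  moreover have "smooth (\<lambda>y::'a. (1::real) - (norm y)\<^sup>2)" by (intro smooth_diff smooth_const smooth_norm_sq)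
  moreover have "(flat 0 has_real_derivative flat 2 (1 - (norm y)\<^sup>2)) (at (1 - (norm y)\<^sup>2))"
    using flat_has_derivative[of 0] by (simp add: numeral_2_eq_2)
  ultimately have "gradient (\<lambda>y. flat 0 (1 - (norm y)\<^sup>2)) y = flat 2 (1 - (norm y)\<^sup>2) *\<^sub>R (- 2 *\<^sub>R y)"
    using gradient_compose by metis
  then show ?thesis by (simp add: bump_def[abs_def] bump_kernel_def)
qed

text \<open>The right-hand side is minus the divergence of \<open>bump_kernel y *\<^sub>R y\<close>,
  the form in which it reappears as a derivative with respect to scale.\<close>

lemma laplacian_bump:
  "laplacian bump (y::'a::euclidean_space) = - (real DIM('a) * bump_kernel y + gradient bump_kernel y \<bullet> y)"
proof -
  have "gradient (\<lambda>y::'a. gradient bump y \<bullet> i) y \<bullet> i = - bump_kernel y - (gradient bump_kernel y \<bullet> i) * (y \<bullet> i)"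
    if "i \<in> Basis" for i
  proof -
    have gi: "gradient (\<lambda>y::'a. y \<bullet> i) y = i" for y
      by (rule gradient_eqI) (auto simp: inner_commute intro!: derivative_eq_intros)
    have sm: "smooth (\<lambda>y::'a. (-1) * bump_kernel y)" by (intro smooth_mult smooth_const smooth_bump_kernel)
    have "gradient (\<lambda>y::'a. ((-1) * bump_kernel y) * (y \<bullet> i)) y
        = ((-1) * bump_kernel y) *\<^sub>R gradient (\<lambda>y. y \<bullet> i) y + (y \<bullet> i) *\<^sub>R gradient (\<lambda>y. (-1) * bump_kernel y) y"
      by (rule gradient_mult[OF sm smooth_inner])
    also have "\<dots> = ((-1) * bump_kernel y) *\<^sub>R i + (y \<bullet> i) *\<^sub>R ((-1) *\<^sub>R gradient bump_kernel y)"
      by (simp only: gi gradient_cmult[OF smooth_bump_kernel])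
    also have "(\<lambda>y::'a. ((-1) * bump_kernel y) * (y \<bullet> i)) = (\<lambda>y. gradient bump y \<bullet> i)"
      by (simp add: gradient_bump)
    finally have "gradient (\<lambda>y. gradient bump y \<bullet> i) y = ((-1) * bump_kernel y) *\<^sub>R i + (y \<bullet> i) *\<^sub>R ((-1) *\<^sub>R gradient bump_kernel y)" .
    then show ?thesis using that by (simp only:) (simp add: inner_diff_left mult.commute)
  qed
  then have "laplacian bump y = (\<Sum>i\<in>Basis. - bump_kernel y - (gradient bump_kernel y \<bullet> i) * (y \<bullet> i))"
    by (simp add: laplacian_def)
  also have "\<dots> = - (real DIM('a) * bump_kernel y + gradient bump_kernel y \<bullet> y)"
    by (simp add: sum_subtractf euclidean_inner[of "gradient bump_kernel y" y] sum_negf)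
  finally show ?thesis .
qed

lemma bump_test: "bump \<in> test_functions UNIV" and bump_kernel_test: "bump_kernel \<in> test_functions UNIV"
  by (rule test_functionsI[of _ "cball 0 1"]; use smooth_bump smooth_bump_kernel in \<open>auto simp: bump_zero bump_kernel_zero\<close>)+

lemma bump_scaled_zero: "s > 0 \<Longrightarrow> x \<notin> ball x0 s \<Longrightarrow> bump ((1 / s) *\<^sub>R (x - x0)) = 0"
  and bump_kernel_scaled_zero: "s > 0 \<Longrightarrow> x \<notin> ball x0 s \<Longrightarrow> bump_kernel ((1 / s) *\<^sub>R (x - x0)) = 0"
  by (auto intro!: bump_zero bump_kernel_zero simp: dist_norm norm_minus_commute)

lemma bump_scaled_test:
  assumes "s > 0" "cball x0 s \<subseteq> A"
  shows "(\<lambda>x. bump ((1 / s) *\<^sub>R (x - x0))) \<in> test_functions A"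
proof (rule test_functionsI[OF smooth_scaled[OF smooth_bump] compact_cball assms(2)])
  fix x assume "x \<notin> cball x0 s"
  then show "bump ((1 / s) *\<^sub>R (x - x0)) = 0" by (intro bump_scaled_zero assms(1)) simp
qed

lemma laplacian_bump_continuous: "continuous_on S (laplacian bump)"
  unfolding laplacian_bump[abs_def]
  by (intro continuous_intros smooth_continuous[OF smooth_bump_kernel] smooth_gradient_continuous[OF smooth_bump_kernel])

lemma laplacian_bump_zero:
  fixes y :: "'a::euclidean_space"
  assumes "norm y \<ge> 1"
  shows "laplacian bump y = 0"
proof -
  have "1 - (norm y)\<^sup>2 \<le> 0" using assms by (simp add: one_le_power)
  then have "(flat 2 has_real_derivative 0) (at (1 - (norm y)\<^sup>2))"
    using flat_has_derivative[of 2 "1 - (norm y)\<^sup>2"] by (simp add: flat_zero)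
  moreover have "smooth (\<lambda>y::'a. (1::real) - (norm y)\<^sup>2)" by (intro smooth_diff smooth_const smooth_norm_sq)
  ultimately have "gradient (\<lambda>y. flat 2 (1 - (norm y)\<^sup>2)) y = 0 *\<^sub>R gradient (\<lambda>y. 1 - (norm y)\<^sup>2) y"
    using gradient_compose by blast
  moreover have "smooth (\<lambda>y::'a. flat 2 (1 - (norm y)\<^sup>2))"
    by (intro smooth_compose[OF smooth_flat] smooth_diff smooth_const smooth_norm_sq)
  ultimately have "gradient bump_kernel y = 0"
    by (simp add: bump_kernel_def[abs_def] gradient_cmult)
  then show ?thesis using bump_kernel_zero[OF assms] by (simp add: laplacian_bump)
qed

text \<open>The key to the mean value inequality: a change of scale alters the averaging kernel by a
  multiple of the Laplacian of the bump, so monotonicity in the radius follows from testing with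
  bumps, without spherical means.\<close>

lemma bump_kernel_scaled_has_derivative:
  fixes x :: "'a::euclidean_space"
  assumes s: "s > 0"
  shows "((\<lambda>s. bump_kernel ((1 / s) *\<^sub>R x) / s ^ DIM('a)) has_real_derivative
    laplacian bump ((1 / s) *\<^sub>R x) / s ^ (DIM('a) + 1)) (at s)"
proof -
  let ?N = "DIM('a)" and ?z = "(1 / s) *\<^sub>R x"
  have N: "?N > 0" by simp
  then obtain M where M: "?N = Suc M" using gr0_implies_Suc by blast
  have "((\<lambda>s. (1 / s) *\<^sub>R x) has_derivative (\<lambda>h. (- h / s\<^sup>2) *\<^sub>R x)) (at s)"
    using s by (auto intro!: derivative_eq_intros simp: power2_eq_square)
  from has_derivative_compose[OF this smooth_has_derivative[OF smooth_bump_kernel]]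
  have k: "((\<lambda>s. bump_kernel ((1 / s) *\<^sub>R x)) has_real_derivative - (gradient bump_kernel ?z \<bullet> ?z) / s) (at s)"
    unfolding has_field_derivative_def
    by (rule has_derivative_eq_rhs) (auto simp: power2_eq_square)
  have p: "((\<lambda>s. s ^ ?N) has_real_derivative real ?N * s ^ M) (at s)"
    using DERIV_pow[of ?N s] M by simp
  have "((\<lambda>s. bump_kernel ((1 / s) *\<^sub>R x) / s ^ ?N) has_real_derivative
     (- (gradient bump_kernel ?z \<bullet> ?z) / s * s ^ ?N - bump_kernel ?z * (real ?N * s ^ M)) / (s ^ ?N * s ^ ?N)) (at s)"
    by (rule DERIV_divide[OF k p]) (use s in simp)
  then show ?thesis
    by (rule DERIV_cong) (use s in \<open>simp add: laplacian_bump M field_simps\<close>)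
qed

text \<open>The kernel average F(s) has derivative at least -C \<kappa> s, so F(s) + C \<kappa>
  s^2/2 is nondecreasing; by continuity F(s) tends to f(x0) times the integral of the kernel as s
  tends to 0.\<close>

lemma mean_value_inequality:
  fixes f :: "'a::euclidean_space \<Rightarrow> real"
  assumes R: "R > 0" and C: "C \<ge> 0"
    and cont: "continuous_on (cbox (x0 - R *\<^sub>R One) (x0 + R *\<^sub>R One)) f"
    and meas: "f \<in> borel_measurable borel"
    and lap: "\<And>s. 0 < s \<Longrightarrow> s \<le> R \<Longrightarrow>
      - C * (LBINT x. bump ((1 / s) *\<^sub>R (x - x0)))
        \<le> (LBINT x. f x * laplacian (\<lambda>x. bump ((1 / s) *\<^sub>R (x - x0))) x)"
  shows "f x0 * (LBINT y. bump_kernel (y::'a))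
    \<le> (LBINT x. f x * bump_kernel ((1 / R) *\<^sub>R (x - x0))) / R ^ DIM('a)
      + C * (LBINT y. bump (y::'a)) * R\<^sup>2 / 2"
proof -
  \<comment> \<open>The cube contains all balls of radius s \<le> R about x0 and is the fixed domain
    for differentiation under the integral in s.\<close>
  let ?N = "DIM('a)" and ?Q = "cbox (x0 - R *\<^sub>R One) (x0 + R *\<^sub>R One)"
  define \<kappa> where "\<kappa> = (LBINT y. bump (y::'a))"
  define I where "I = (LBINT y. bump_kernel (y::'a))"
  have [measurable]: "f \<in> borel_measurable borel" "bump_kernel \<in> borel_measurable borel" "bump \<in> borel_measurable borel"
    "laplacian bump \<in> borel_measurable borel"
    using meas smooth_borel_measurable[OF smooth_bump_kernel] smooth_borel_measurable[OF smooth_bump]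
      borel_measurable_continuous_onI[OF laplacian_bump_continuous] by auto
  have \<kappa>: "\<kappa> \<ge> 0" unfolding \<kappa>_def by (simp add: bump_nonneg)
  have ballQ: "ball x0 s \<subseteq> ?Q" if "s \<le> R" for s
  proof
    fix x assume "x \<in> ball x0 s"
    then have "\<bar>(x - x0) \<bullet> i\<bar> \<le> R" if "i \<in> Basis" for i
      using Basis_le_norm[OF that, of "x - x0"] \<open>s \<le> R\<close> by (simp add: dist_norm norm_minus_commute)
    then show "x \<in> ?Q" by (simp add: mem_box inner_diff_left inner_add_left abs_le_iff algebra_simps)
  qed
  have HK: "(LBINT x. f x * k x) = integral ?Q (\<lambda>x. f x * k x)"
    if k: "continuous_on UNIV k" "\<And>x. x \<notin> ball x0 s \<Longrightarrow> k x = 0" "s \<le> R" for k and s :: real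
  proof -
    have "set_integrable lborel ?Q (\<lambda>x. f x * k x)"
      unfolding set_integrable_def
      by (intro borel_integrable_compact compact_cbox continuous_intros cont continuous_on_subset[OF k(1)]) simp
    from set_borel_integral_eq_integral(2)[OF this]
    have "(LBINT x. indicator ?Q x *\<^sub>R (f x * k x)) = integral ?Q (\<lambda>x. f x * k x)"
      by (simp add: set_lebesgue_integral_def)
    moreover have "(\<lambda>x. indicator ?Q x *\<^sub>R (f x * k x)) = (\<lambda>x. f x * k x)"
    proof
      fix x
      show "indicator ?Q x *\<^sub>R (f x * k x) = f x * k x"
      proof (cases "x \<in> ?Q")
        case False
        then have "x \<notin> ball x0 s" using ballQ[OF k(3)] by blast
        then show ?thesis using k(2) by simp
      qed simp
    qed
    ultimately show ?thesis by simp
  qed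
  define X where "X s x = bump_kernel ((1 / s) *\<^sub>R (x - x0)) / s ^ ?N" for s x
  define X' where "X' s x = laplacian bump ((1 / s) *\<^sub>R (x - x0)) / s ^ (?N + 1)" for s x
  define F where "F s = integral ?Q (\<lambda>x. f x * X s x)" for s
  have cX: "continuous_on S (X s)" if "s > 0" for s S
    unfolding X_def[abs_def]
    by (intro continuous_intros continuous_on_compose2[OF smooth_continuous[OF smooth_bump_kernel, of UNIV]]) (use that in auto)
  have dF: "(F has_real_derivative integral ?Q (\<lambda>x. f x * X' s x)) (at s)" if "s > 0" for s
  proof -
    have "((\<lambda>s. integral ?Q (\<lambda>x. f x * X s x)) has_field_derivative integral ?Q (\<lambda>x. f x * X' s x)) (at s within {0<..})"
    proof (rule leibniz_rule_field_derivative)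
      show "((\<lambda>s. f x * X s x) has_field_derivative f x * X' s x) (at s within {0<..})" if "s \<in> {0<..}" for s x
        unfolding X_def X'_def
        by (intro has_field_derivative_at_within[OF DERIV_cmult] bump_kernel_scaled_has_derivative) (use that in simp)
      show "(\<lambda>x. f x * X s x) integrable_on ?Q" if "s \<in> {0<..}" for s
        by (intro integrable_continuous continuous_intros cont cX) (use that in simp)
      show "continuous_on ({0<..} \<times> ?Q) (\<lambda>(s, x). f x * X' s x)"
        unfolding X'_def split_beta
        by (intro continuous_intros continuous_on_compose2[OF cont] continuous_on_compose2[OF laplacian_bump_continuous[of UNIV]]) auto
    qed (use that in auto)
    then show ?thesis using that by (simp add: F_def[abs_def] at_within_open[of s "{0<..}"])
  qed
  have F'_ge: "integral ?Q (\<lambda>x. f x * X' s x) \<ge> - C * \<kappa> * s" if s: "0 < s" "s \<le> R" for s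
  proof -
    have z: "laplacian bump ((1 / s) *\<^sub>R (x - x0)) = 0" if "x \<notin> ball x0 s" for x
      by (rule laplacian_bump_zero) (use that s in \<open>auto simp: dist_norm norm_minus_commute\<close>)
    have "integral ?Q (\<lambda>x. f x * X' s x) = (LBINT x. f x * X' s x)"
      unfolding X'_def
      by (rule HK[OF _ _ s(2), symmetric])
        (use s z in \<open>auto intro!: continuous_intros continuous_on_compose2[OF laplacian_bump_continuous[of UNIV]]\<close>)
    \<comment> \<open>Scaling the Laplacian yields s^2 against the s^(N+1) in X', leaving s/s^N; as
      the dilated bump integrates to s^N \<kappa>, the resulting bound is linear in s.\<close>
    also have "\<dots> = (LBINT x. f x * laplacian (\<lambda>x. bump ((1 / s) *\<^sub>R (x - x0))) x) * (s / s ^ ?N)"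
      unfolding X'_def laplacian_scaled[OF smooth_bump]
      by (subst Bochner_Integration.integral_mult_left_zero[symmetric])
        (use s in \<open>simp add: field_simps power2_eq_square\<close>)
    also have "\<dots> \<ge> (- C * (LBINT x. bump ((1 / s) *\<^sub>R (x - x0)))) * (s / s ^ ?N)"
      by (intro mult_right_mono lap s) (use s in simp)
    also have "(LBINT x. bump ((1 / s) *\<^sub>R (x - x0))) = s ^ ?N * \<kappa>"
      unfolding \<kappa>_def by (rule integral_scaled) (use s in auto)
    finally show ?thesis using s by simp
  qed
  have mono: "F s + C * \<kappa> * s\<^sup>2 / 2 \<le> F R + C * \<kappa> * R\<^sup>2 / 2" if s: "0 < s" "s \<le> R" for s
  proof (rule DERIV_nonneg_imp_nondecreasing[OF s(2)])
    fix t assume t: "s \<le> t" "t \<le> R"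
    have "((\<lambda>t. F t + C * \<kappa> * t\<^sup>2 / 2) has_real_derivative integral ?Q (\<lambda>x. f x * X' t x) + C * \<kappa> * t) (at t)"
      using dF[of t] s t by (auto intro!: derivative_eq_intros)
    moreover have "integral ?Q (\<lambda>x. f x * X' t x) + C * \<kappa> * t \<ge> 0" using F'_ge[of t] s t by simp
    ultimately show "\<exists>y. ((\<lambda>t. F t + C * \<kappa> * t\<^sup>2 / 2) has_real_derivative y) (at t) \<and> 0 \<le> y" by blast
  qed
  have F_eq: "F s = (LBINT x. f x * X s x)" if s: "0 < s" "s \<le> R" for s
    unfolding F_def
  proof (rule HK[OF cX[OF s(1)] _ s(2), symmetric])
    fix x assume "x \<notin> ball x0 s"
    from bump_kernel_scaled_zero[OF s(1) this] show "X s x = 0" by (simp add: X_def)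
  qed
  have IX: "(LBINT x. X s x) = I" if "s > 0" for s
    unfolding X_def I_def using integral_scaled[of bump_kernel s x0] that by simp
  have iX: "integrable lborel (X s)" if "s > 0" for s
  proof (rule integrable_compact_support[OF cX[OF that] compact_cball])
    fix x assume "x \<notin> cball x0 s"
    then have "x \<notin> ball x0 s" by simp
    from bump_kernel_scaled_zero[OF that this] show "X s x = 0" by (simp add: X_def)
  qed
  have x0Q: "x0 \<in> ?Q" using ballQ[of R] R by auto
  have I0: "I \<ge> 0" unfolding I_def by (simp add: bump_kernel_nonneg)
  have "f x0 * I \<le> F R + C * \<kappa> * R\<^sup>2 / 2 + \<epsilon> * I" if \<epsilon>: "\<epsilon> > 0" for \<epsilon>
  proof -
    obtain \<delta> where \<delta>: "\<delta> > 0" "\<And>x. x \<in> ?Q \<Longrightarrow> dist x x0 < \<delta> \<Longrightarrow> dist (f x) (f x0) < \<epsilon>"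
      using cont x0Q \<epsilon> unfolding continuous_on_iff by metis
    define s where "s = min \<delta> R"
    have s: "0 < s" "s \<le> R" "s \<le> \<delta>" using \<delta> R by (auto simp: s_def)
    have "(f x0 - \<epsilon>) * I = (LBINT x. (f x0 - \<epsilon>) * X s x)" by (simp add: IX s)
    also have "\<dots> \<le> (LBINT x. f x * X s x)"
    proof (rule integral_mono)
      show "integrable lborel (\<lambda>x. (f x0 - \<epsilon>) * X s x)" using iX[OF s(1)] by simp
      have "integrable lborel (\<lambda>x. indicator ?Q x *\<^sub>R (f x * X s x))"
        by (intro borel_integrable_compact compact_cbox continuous_intros cont cX s)
      moreover have "(\<lambda>x. indicator ?Q x *\<^sub>R (f x * X s x)) = (\<lambda>x. f x * X s x)"
      proof
        fix x
        show "indicator ?Q x *\<^sub>R (f x * X s x) = f x * X s x"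
        proof (cases "x \<in> ?Q")
          case False
          then have "x \<notin> ball x0 s" using ballQ[OF s(2)] by blast
          from bump_kernel_scaled_zero[OF s(1) this] show ?thesis by (simp add: X_def)
        qed simp
      qed
      ultimately show "integrable lborel (\<lambda>x. f x * X s x)" by simp
      fix x
      show "(f x0 - \<epsilon>) * X s x \<le> f x * X s x"
      proof (cases "x \<in> ball x0 s")
        case True
        then have "dist (f x) (f x0) < \<epsilon>" using \<delta>(2)[of x] ballQ[OF s(2)] s(3) by (auto simp: dist_commute)
        then have "f x0 - \<epsilon> \<le> f x" by (simp add: dist_real_def)
        moreover have "X s x \<ge> 0" using s by (simp add: X_def bump_kernel_nonneg)
        ultimately show ?thesis by (rule mult_right_mono)
      next
        case False
        from bump_kernel_scaled_zero[OF s(1) this] show ?thesis by (simp add: X_def)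
      qed
    qed
    also have "\<dots> = F s" using F_eq s by simp
    also have "\<dots> \<le> F R + C * \<kappa> * R\<^sup>2 / 2" using mono[OF s(1,2)] C \<kappa> by (smt (verit) mult_nonneg_nonneg zero_le_power2 divide_nonneg_nonneg)
    finally show ?thesis by (simp add: algebra_simps)
  qed
  then have "f x0 * I \<le> F R + C * \<kappa> * R\<^sup>2 / 2"
    by (intro le_of_perturbation[of 1 "f x0 * I" "F R + C * \<kappa> * R\<^sup>2 / 2" I]) auto
  also have "F R = (LBINT x. f x * bump_kernel ((1 / R) *\<^sub>R (x - x0))) / R ^ ?N"
    using F_eq[of R] R by (simp add: X_def)
  finally show ?thesis by (simp add: I_def \<kappa>_def)
qed

section \<open>Regularity at the zero set\<close>

text \<open>Testing the inequality for \<open>u\<^sub>l\<close> and for \<open>v\<^sub>l - \<Sum>v\<^sub>j\<close> with \<open>\<psi> (u\<^sub>l - v\<^sub>l)\<^sup>+\<close>: where that function does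
  not vanish, \<open>u\<^sub>l - (v\<^sub>l - \<Sum>v\<^sub>j)\<close> is the \<open>\<ell>\<^sup>1\<close> distance of \<open>u\<close> and \<open>v\<close>.\<close>

lemma segregated_half_inequality:
  fixes u v :: "'b::finite \<Rightarrow> 'a::euclidean_space \<Rightarrow> real"
  assumes u: "\<And>i. sobolev0 UNIV (u i) (g i)" "\<And>i x. 0 \<le> u i x" "\<And>i j x. i \<noteq> j \<Longrightarrow> u i x = 0 \<or> u j x = 0"
    and v: "\<And>i. sobolev0 UNIV (v i) (k i)" "\<And>i x. 0 \<le> v i x"
    and sub: "\<And>T G. sobolev0 U T G \<Longrightarrow> AE x in lborel. 0 \<le> T x \<Longrightarrow>
      (LBINT x. g l x \<bullet> G x) \<le> c * (LBINT x. T x)"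
    and super: "\<And>T G. sobolev0 U T G \<Longrightarrow> AE x in lborel. 0 \<le> T x \<Longrightarrow>
      - (LBINT x. (k l x - (\<Sum>j\<in>UNIV - {l}. k j x)) \<bullet> G x) \<le> c * (LBINT x. T x)"
    and \<psi>: "\<psi> \<in> test_functions U" "\<And>x. 0 \<le> \<psi> x"
  shows "(LBINT x. (\<Sum>j\<in>UNIV. sgn (u j x - v j x) *\<^sub>R (g j x - k j x)) \<bullet>
      (\<psi> x *\<^sub>R (if u l x - v l x > 0 then g l x - k l x else 0) + max (u l x - v l x) 0 *\<^sub>R gradient \<psi> x))
    \<le> 2 * c * (LBINT x. \<psi> x * max (u l x - v l x) 0)"
proof -
  define T where "T x = \<psi> x * max (u l x - v l x) 0" for x
  define G where "G x = \<psi> x *\<^sub>R (if u l x - v l x > 0 then g l x - k l x else 0) + max (u l x - v l x) 0 *\<^sub>R gradient \<psi> x" for x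
  define kh where "kh x = k l x - (\<Sum>j\<in>UNIV - {l}. k j x)" for x
  define D where "D x = (\<Sum>j\<in>UNIV. sgn (u j x - v j x) *\<^sub>R (g j x - k j x))" for x
  have TG: "sobolev0 U T G"
    using sobolev0_mult_test[OF sobolev0_pos_part[OF sobolev0_diff[OF u(1)[of l] v(1)[of l]]] \<psi>(1)]
    by (simp add: T_def[abs_def] G_def[abs_def])
  have T0: "AE x in lborel. 0 \<le> T x" using \<psi>(2) by (simp add: T_def)
  have Lk: "L2 kh" unfolding kh_def[abs_def] by (intro L2_diff L2_sum sobolev0_L2(2)[OF v(1)])
  have Lg: "L2 (g l)" and LG: "L2 G" using u(1) TG sobolev0_L2(2) by blast+
  have LD: "L2 D" unfolding D_def[abs_def]
    by (intro L2_sum sobolev0_L2(2)[OF sobolev0_abs[OF sobolev0_diff[OF u(1) v(1)]]])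
  have "AE x in lborel. \<forall>i\<in>UNIV. u i x = 0 \<longrightarrow> g i x = 0" "AE x in lborel. \<forall>i\<in>UNIV. v i x = 0 \<longrightarrow> k i x = 0"
    by (intro AE_finite_allI sobolev0_gradient_level[OF u(1)] sobolev0_gradient_level[OF v(1)]; simp)+
  then have eq: "AE x in lborel. D x \<bullet> G x = (g l x - kh x) \<bullet> G x"
  proof eventually_elim
    case (elim x)
    show ?case
    proof (cases "u l x - v l x > 0")
      case True
      then have ul: "u l x > 0" using v(2)[of l x] by simp
      \<comment> \<open>Where u_l > v_l \<ge> 0 segregation forces u_j = 0, so either v_j > 0 and
        the sign is -1, or v_j and its gradient vanish.\<close>
      have "sgn (u j x - v j x) *\<^sub>R (g j x - k j x) = k j x" if "j \<noteq> l" for j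
      proof -
        have "u j x = 0" using u(3)[OF that, of x] ul by auto
        moreover from this have "g j x = 0" using elim(1) by blast
        ultimately show ?thesis using v(2)[of j x] elim(2) by (cases "v j x = 0") (auto simp: sgn_if)
      qed
      then have "D x = (g l x - k l x) + (\<Sum>j\<in>UNIV - {l}. k j x)"
        unfolding D_def using True by (simp add: sum.remove[of UNIV l])
      then have "D x = g l x - kh x" by (simp add: kh_def)
      then show ?thesis by simp
    next
      case False
      then have "G x = 0" by (simp add: G_def)
      then show ?thesis by simp
    qed
  qed
  have [measurable]: "D \<in> borel_measurable borel" "G \<in> borel_measurable borel" "kh \<in> borel_measurable borel"
    "g l \<in> borel_measurable borel"
    using LD LG Lk Lg by (auto dest: L2_measurable)
  have "(LBINT x. D x \<bullet> G x) = (LBINT x. (g l x - kh x) \<bullet> G x)"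
    by (rule integral_cong_AE[OF _ _ eq]) measurable
  also have "\<dots> = (LBINT x. g l x \<bullet> G x) - (LBINT x. kh x \<bullet> G x)"
    using L2_inner_integrable[OF Lg LG] L2_inner_integrable[OF Lk LG] by (simp add: inner_diff_left)
  also have "\<dots> \<le> 2 * c * (LBINT x. T x)"
    using sub[OF TG T0] super[OF TG T0] unfolding kh_def by simp
  finally show ?thesis unfolding D_def T_def G_def .
qed

lemma integrable_test_mult:
  assumes "\<psi> \<in> test_functions A" "integrable lborel (f :: 'a::euclidean_space \<Rightarrow> real)"
  shows "integrable lborel (\<lambda>x. \<psi> x * f x)"
proof -
  obtain C where C: "C > 0" "\<And>x. \<bar>\<psi> x\<bar> \<le> C" using test_functions_bounded[OF assms(1)] by metis
  have [measurable]: "\<psi> \<in> borel_measurable borel"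
    by (rule smooth_borel_measurable[OF test_functions_smooth[OF assms(1)]])
  show ?thesis
  proof (rule Bochner_Integration.integrable_bound)
    show "integrable lborel (\<lambda>x. C * f x)" using assms(2) by simp
    show "(\<lambda>x. \<psi> x * f x) \<in> borel_measurable lborel" using assms(2) by simp
    show "AE x in lborel. norm (\<psi> x * f x) \<le> norm (C * f x)"
      using C by (auto simp: abs_mult intro!: mult_right_mono)
  qed
qed

context segregated_minimizer
begin

section \<open>The distance between the minimizer and its translates\<close>

definition total_energy :: real where
  "total_energy = (\<Sum>i\<in>UNIV. energy i)"

text \<open>Between nonnegative points of Sigma_k the l^1 distance is the length of the shortest
  path inside Sigma_k, which passes through 0 when the branches differ.\<close>

definition increment :: "'a \<Rightarrow> 'a \<Rightarrow> real" where
  "increment h x = (\<Sum>i\<in>UNIV. \<bar>u i (x + h) - u i x\<bar>)"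

lemma energy_le_total: "energy i \<le> total_energy"
  unfolding total_energy_def by (rule member_le_sum) (auto intro: energy_nonneg)

lemma total_energy_nonneg: "0 \<le> total_energy"
  unfolding total_energy_def by (intro sum_nonneg energy_nonneg)

lemma sobolev_UNIV: "sobolev0 UNIV (u i) (g i)"
  by (rule sobolev0_mono[OF sobolev]) simp

lemma sobolev_shift: "sobolev0 UNIV (\<lambda>x. u i (x + h)) (\<lambda>x. g i (x + h))"
  by (rule sobolev0_shift[OF sobolev_UNIV]) simp

text \<open>Translation carries the inequalities to the shifted domain. The constant
  \<open>total_energy\<close> is common to all indices and to both kinds of inequality.\<close>

lemma subsolution_shift:
  assumes T: "sobolev0 {x. x + h \<in> \<Omega>} T G" "AE x in lborel. 0 \<le> T x"
  shows "(LBINT x. g i (x + h) \<bullet> G x) \<le> total_energy * (LBINT x. T x)"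
    and "- (LBINT x. ghat i (x + h) \<bullet> G x) \<le> total_energy * (LBINT x. T x)"
proof -
  have S: "sobolev0 \<Omega> (\<lambda>x. T (x + (- h))) (\<lambda>x. G (x + (- h)))"
    by (rule sobolev0_shift[OF T(1)]) simp
  have S0: "AE x in lborel. 0 \<le> T (x + (- h))" by (rule AE_shift[OF T(2)])
  have [measurable]: "T \<in> borel_measurable borel" "G \<in> borel_measurable borel" "g i \<in> borel_measurable borel"
    "ghat i \<in> borel_measurable borel"
    using sobolev0_measurable T(1) sobolev sobolev_hat by blast+
  have 1: "(LBINT x. T (x + (- h))) = (LBINT x. T x)" by (rule integral_shift) simp
  have 2: "(LBINT x. w (x + h) \<bullet> G x) = (LBINT x. w x \<bullet> G (x + (- h)))"
    if [measurable]: "w \<in> borel_measurable borel" for w :: "'a \<Rightarrow> 'a"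
    using integral_shift[of "\<lambda>x. w x \<bullet> G (x + (- h))" h] by simp
  have nn: "0 \<le> (LBINT x. T x)" by (rule integral_nonneg_AE[OF T(2)])
  have "(LBINT x. g i (x + h) \<bullet> G x) \<le> energy i * (LBINT x. T x)"
    using subsolution[OF S S0, of i] 1 2[of "g i"] by simp
  also have "\<dots> \<le> total_energy * (LBINT x. T x)" by (intro mult_right_mono energy_le_total nn)
  finally show "(LBINT x. g i (x + h) \<bullet> G x) \<le> total_energy * (LBINT x. T x)" .
  show "- (LBINT x. ghat i (x + h) \<bullet> G x) \<le> total_energy * (LBINT x. T x)"
    using hat_supersolution[OF S S0, of i] 1 2[of "ghat i"] by (simp add: total_energy_def)
qed

text \<open>The half inequality is summed over l for the pairs (u, v) and (v, u), where v is the
  translate; the test functions then add up to \<psi> times the distance. This yields the constant 2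
  total_energy, and passing to the square of the distance doubles it.\<close>

lemma increment_laplacian:
  assumes \<psi>: "\<psi> \<in> test_functions (\<Omega> \<inter> {x. x + h \<in> \<Omega>})" "\<And>x. 0 \<le> \<psi> x"
  shows "- (4 * total_energy) * (LBINT x. \<psi> x * increment h x)
    \<le> (LBINT x. (increment h x)\<^sup>2 * laplacian \<psi> x)"
proof -
  let ?U = "\<Omega> \<inter> {x. x + h \<in> \<Omega>}"
  define v where "v i x = u i (x + h)" for i x
  define k where "k i x = g i (x + h)" for i x
  define D where "D x = (\<Sum>j\<in>UNIV. sgn (u j x - v j x) *\<^sub>R (g j x - k j x))" for x
  have sv: "sobolev0 UNIV (v i) (k i)" for i unfolding v_def[abs_def] k_def[abs_def] by (rule sobolev_shift)
  have D': "D x = (\<Sum>j\<in>UNIV. sgn (v j x - u j x) *\<^sub>R (k j x - g j x))" for x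
    unfolding D_def by (intro sum.cong refl) (auto simp: sgn_if algebra_simps)
  have dD: "sobolev0 UNIV (increment h) D"
  proof -
    have "sobolev0 UNIV (\<lambda>x. \<Sum>i\<in>UNIV. \<bar>u i x - v i x\<bar>) D"
      unfolding D_def[abs_def] by (intro sobolev0_sum sobolev0_abs sobolev0_diff sobolev_UNIV sv)
    then show ?thesis by (simp add: increment_def[abs_def] v_def abs_minus_commute)
  qed
  define P where "P l x = max (u l x - v l x) 0" for l x
  define Q where "Q l x = max (v l x - u l x) 0" for l x
  define GP where "GP l x = \<psi> x *\<^sub>R (if u l x - v l x > 0 then g l x - k l x else 0) + P l x *\<^sub>R gradient \<psi> x" for l x
  define GQ where "GQ l x = \<psi> x *\<^sub>R (if v l x - u l x > 0 then k l x - g l x else 0) + Q l x *\<^sub>R gradient \<psi> x" for l x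
  have sP: "sobolev0 UNIV (P l) (\<lambda>x. if u l x - v l x > 0 then g l x - k l x else 0)"
    and sQ: "sobolev0 UNIV (Q l) (\<lambda>x. if v l x - u l x > 0 then k l x - g l x else 0)" for l
    unfolding P_def[abs_def] Q_def[abs_def] by (intro sobolev0_pos_part sobolev0_diff sobolev_UNIV sv)+
  have sGP: "sobolev0 ?U (\<lambda>x. \<psi> x * P l x) (GP l)" and sGQ: "sobolev0 ?U (\<lambda>x. \<psi> x * Q l x) (GQ l)" for l
    using sobolev0_mult_test[OF sP \<psi>(1)] sobolev0_mult_test[OF sQ \<psi>(1)]
    by (simp_all add: GP_def[abs_def] GQ_def[abs_def])
  have bU: "bounded ?U" using bounded_\<Omega> by (rule bounded_subset) auto
  have subu: "(LBINT x. g l x \<bullet> G x) \<le> total_energy * (LBINT x. T x)"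
    and supu: "- (LBINT x. ghat l x \<bullet> G x) \<le> total_energy * (LBINT x. T x)"
    if "sobolev0 ?U T G" "AE x in lborel. 0 \<le> T x" for T G l
  proof -
    have "sobolev0 {x. x + 0 \<in> \<Omega>} T G" by (rule sobolev0_mono[OF that(1)]) auto
    from subsolution_shift[OF this that(2), of l]
    show "(LBINT x. g l x \<bullet> G x) \<le> total_energy * (LBINT x. T x)"
      "- (LBINT x. ghat l x \<bullet> G x) \<le> total_energy * (LBINT x. T x)" by simp_all
  qed
  have subv: "(LBINT x. k l x \<bullet> G x) \<le> total_energy * (LBINT x. T x)"
    and supv: "- (LBINT x. ghat l (x + h) \<bullet> G x) \<le> total_energy * (LBINT x. T x)"
    if "sobolev0 ?U T G" "AE x in lborel. 0 \<le> T x" for T G l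
  proof -
    have "sobolev0 {x. x + h \<in> \<Omega>} T G" by (rule sobolev0_mono[OF that(1)]) auto
    from subsolution_shift[OF this that(2), of l]
    show "(LBINT x. k l x \<bullet> G x) \<le> total_energy * (LBINT x. T x)"
      "- (LBINT x. ghat l (x + h) \<bullet> G x) \<le> total_energy * (LBINT x. T x)"
      unfolding k_def by simp_all
  qed
  have halfP: "(LBINT x. D x \<bullet> GP l x) \<le> 2 * total_energy * (LBINT x. \<psi> x * P l x)" for l
    unfolding D_def GP_def P_def
  proof (rule segregated_half_inequality[OF sobolev_UNIV nonneg segregated sv _ subu _ \<psi>])
    show "0 \<le> v i x" for i x using nonneg by (simp add: v_def)
    show "- (LBINT x. (k l x - (\<Sum>j\<in>UNIV - {l}. k j x)) \<bullet> G x) \<le> total_energy * (LBINT x. T x)"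
      if "sobolev0 ?U T G" "AE x in lborel. 0 \<le> T x" for T G
      using supv[OF that, of l] by (simp add: ghat_def k_def)
  qed
  have halfQ: "(LBINT x. D x \<bullet> GQ l x) \<le> 2 * total_energy * (LBINT x. \<psi> x * Q l x)" for l
    unfolding D' GQ_def Q_def
  proof (rule segregated_half_inequality[OF sv _ _ sobolev_UNIV nonneg subv _ \<psi>])
    show "0 \<le> v i x" for i x using nonneg by (simp add: v_def)
    show "v i x = 0 \<or> v j x = 0" if "i \<noteq> j" for i j x using segregated[OF that] by (simp add: v_def)
    show "- (LBINT x. (g l x - (\<Sum>j\<in>UNIV - {l}. g j x)) \<bullet> G x) \<le> total_energy * (LBINT x. T x)"
      if "sobolev0 ?U T G" "AE x in lborel. 0 \<le> T x" for T G
      using supu[OF that, of l] by (simp add: ghat_def)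
  qed
  have sumT: "(\<Sum>l\<in>UNIV. \<psi> x * P l x + \<psi> x * Q l x) = \<psi> x * increment h x" for x
    unfolding increment_def sum_distrib_left
    by (intro sum.cong refl) (auto simp: P_def Q_def v_def max_def abs_if algebra_simps)
  have sumG: "(\<Sum>l\<in>UNIV. GP l x + GQ l x) = \<psi> x *\<^sub>R D x + increment h x *\<^sub>R gradient \<psi> x" for x
    unfolding increment_def D_def scaleR_sum_left scaleR_sum_right sum.distrib[symmetric]
    by (intro sum.cong refl) (auto simp: GP_def GQ_def P_def Q_def v_def max_def abs_if sgn_if algebra_simps)
  have LD: "L2 D" and Ld: "L2 (increment h)" using sobolev0_L2[OF dD] by auto
  have LG: "L2 (GP l)" "L2 (GQ l)" for l using sobolev0_L2(2) sGP sGQ by blast+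
  have iT: "integrable lborel (\<lambda>x. \<psi> x * P l x)" "integrable lborel (\<lambda>x. \<psi> x * Q l x)" for l
    using sobolev0_integrable[OF bU] sGP sGQ by blast+
  obtain C where C: "C > 0" "\<And>x. \<bar>\<psi> x\<bar> \<le> C" "\<And>x. norm (gradient \<psi> x) \<le> C"
    using test_functions_bounded[OF \<psi>(1)] by metis
  have [measurable]: "gradient \<psi> \<in> borel_measurable borel"
    by (rule gradient_borel_measurable[OF test_functions_smooth[OF \<psi>(1)]])
  have i1: "integrable lborel (\<lambda>x. increment h x * (D x \<bullet> gradient \<psi> x))"
    by (rule L2_triple_integrable[OF Ld LD _ C(3)]) measurable
  have i2: "integrable lborel (\<lambda>x. \<psi> x * (norm (D x))\<^sup>2)"
    by (rule integrable_test_mult[OF \<psi>(1) L2_integrable[OF LD]])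
  \<comment> \<open>The gradient of \<psi> times the distance has two parts; the one producing
    \<psi> |D|^2 is nonnegative and is given away.\<close>
  have "(LBINT x. increment h x * (D x \<bullet> gradient \<psi> x))
      \<le> (LBINT x. increment h x * (D x \<bullet> gradient \<psi> x)) + (LBINT x. \<psi> x * (norm (D x))\<^sup>2)"
    using \<psi>(2) by simp
  also have "\<dots> = (LBINT x. (\<Sum>l\<in>UNIV. D x \<bullet> GP l x + D x \<bullet> GQ l x))"
  proof -
    have "(\<Sum>l\<in>UNIV. D x \<bullet> GP l x + D x \<bullet> GQ l x) = increment h x * (D x \<bullet> gradient \<psi> x) + \<psi> x * (norm (D x))\<^sup>2" for x
    proof -
      have "(\<Sum>l\<in>UNIV. D x \<bullet> GP l x + D x \<bullet> GQ l x) = D x \<bullet> (\<Sum>l\<in>UNIV. GP l x + GQ l x)"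
        by (simp add: inner_sum_right inner_add_right)
      then show ?thesis by (simp add: sumG inner_add_right power2_norm_eq_inner)
    qed
    then show ?thesis using i1 i2 by simp
  qed
  also have "\<dots> = (\<Sum>l\<in>UNIV. (LBINT x. D x \<bullet> GP l x) + (LBINT x. D x \<bullet> GQ l x))"
    using L2_inner_integrable[OF LD LG(1)] L2_inner_integrable[OF LD LG(2)]
    by (simp add: Bochner_Integration.integral_sum)
  also have "\<dots> \<le> (\<Sum>l\<in>UNIV. 2 * total_energy * (LBINT x. \<psi> x * P l x) + 2 * total_energy * (LBINT x. \<psi> x * Q l x))"
    by (intro sum_mono add_mono halfP halfQ)
  also have "\<dots> = 2 * total_energy * (LBINT x. (\<Sum>l\<in>UNIV. \<psi> x * P l x + \<psi> x * Q l x))"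
    using iT by (simp add: Bochner_Integration.integral_sum sum_distrib_left distrib_left)
  also have "\<dots> = 2 * total_energy * (LBINT x. \<psi> x * increment h x)" by (simp only: sumT)
  finally have "(LBINT x. increment h x * (D x \<bullet> gradient \<psi> x)) \<le> 2 * total_energy * (LBINT x. \<psi> x * increment h x)" .
  then show ?thesis using sobolev0_square_laplacian[OF dD \<psi>(1)] by simp
qed

end

section \<open>The Caccioppoli inequality and growth at zeros\<close>

lemma integral_ball_le:
  fixes f :: "'a::euclidean_space \<Rightarrow> real"
  assumes "r > 0" "m \<ge> 0" "\<And>x. x \<in> ball x0 r \<Longrightarrow> f x \<le> m" "\<And>x. x \<notin> ball x0 r \<Longrightarrow> f x \<le> 0"
  shows "(LBINT x. f x) \<le> m * (unit_ball_vol (DIM('a)) * r ^ DIM('a))"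
proof (cases "integrable lborel f")
  case True
  have i: "integrable lborel (\<lambda>x. m * indicator (ball x0 r) x)"
    by (intro integrable_mult_right integrable_real_indicator) (auto simp: emeasure_ball assms(1) less_imp_le)
  have "(LBINT x. f x) \<le> (LBINT x. m * indicator (ball x0 r) x)"
    by (rule integral_mono[OF True i]) (use assms(3,4) in \<open>auto simp: indicator_def\<close>)
  also have "\<dots> = m * (unit_ball_vol (DIM('a)) * r ^ DIM('a))"
    using assms(1) by (simp add: content_ball)
  finally show ?thesis .
next
  \<comment> \<open>A nonintegrable function has integral 0 by convention, and the right-hand side
    is nonnegative.\<close>
  case False
  then show ?thesis using assms(1,2) by (simp add: not_integrable_integral_eq)
qed

lemma L2_indicator_integrable:
  assumes "L2 f" "B \<in> sets borel"
  shows "integrable lborel (\<lambda>x. indicator B x * (norm (f x))\<^sup>2)"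
  using L2_integrable[OF L2_indicator[OF assms]] unfolding norm_indicator_sq .

lemma bump_le_1: "bump y \<le> 1"
  by (auto simp: bump_def flat_def)

lemma bump_lower: "norm y \<le> 1/2 \<Longrightarrow> exp (- (4/3)) \<le> bump y"
proof -
  assume "norm y \<le> 1/2"
  then have "(norm y)\<^sup>2 \<le> (1/2)\<^sup>2" by (intro power_mono) auto
  then have t: "1 - (norm y)\<^sup>2 \<ge> 3/4" by (simp add: power2_eq_square)
  then have "1 / (1 - (norm y)\<^sup>2) \<le> 4/3" by (simp add: divide_simps)
  then show ?thesis using t by (simp add: bump_def flat_def)
qed

context segregated_minimizer
begin

text \<open>Caccioppoli inequality. The subsolution property is tested with \<psi> u_i for a bump
  \<psi> of radius 2 r, and the mixed term is integrated by parts once more, so that only the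
  Laplacian of \<psi>, of size r^(-2), appears. The factor r^2 on the left avoids negative
  powers.\<close>

lemma energy_on_ball_le:
  "\<exists>C>0. \<forall>i x0 r m. 0 < r \<longrightarrow> cball x0 (2 * r) \<subseteq> \<Omega> \<longrightarrow> 0 \<le> m \<longrightarrow>
      (\<forall>x\<in>ball x0 (2 * r). u i x \<le> m) \<longrightarrow>
      r\<^sup>2 * (LBINT x. indicator (ball x0 r) x * (norm (g i x))\<^sup>2) \<le> C * (m\<^sup>2 + m * r\<^sup>2) * r ^ DIM('a)"
proof -
  obtain L where L: "L > 0" "\<And>y::'a. norm (laplacian bump y) \<le> L"
    using bounded_compact_support[OF laplacian_bump_continuous, of "cball 0 1"] laplacian_bump_zero
    by (metis compact_cball mem_cball_0 linear)
  let ?b = "exp (- (4/3)) :: real" and ?N = "DIM('a)"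
  define \<omega> where "\<omega> = unit_ball_vol (DIM('a)) * 2 ^ ?N"
  have \<omega>: "\<omega> > 0" unfolding \<omega>_def by simp
  \<comment> \<open>Here \<open>?b\<close> bounds the bump from below on the inner ball; the first
    term of the numerator accounts for the source term of the inequality and the second for the
    Laplacian of the cutoff.\<close>
  define C where "C = (total_energy * \<omega> + L * \<omega> + 1) / ?b"
  have "C > 0" unfolding C_def using total_energy_nonneg L(1) \<omega> by (auto intro!: divide_pos_pos add_nonneg_pos add_nonneg_nonneg)
  moreover have "r\<^sup>2 * (LBINT x. indicator (ball x0 r) x * (norm (g i x))\<^sup>2) \<le> C * (m\<^sup>2 + m * r\<^sup>2) * r ^ ?N"
    if r: "0 < r" and sub: "cball x0 (2 * r) \<subseteq> \<Omega>" and m: "0 \<le> m"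
      and um: "\<And>x. x \<in> ball x0 (2 * r) \<Longrightarrow> u i x \<le> m" for i x0 r m
  proof -
    define \<psi> where "\<psi> x = bump ((1 / (2 * r)) *\<^sub>R (x - x0))" for x
    have \<psi>: "\<psi> \<in> test_functions \<Omega>" unfolding \<psi>_def[abs_def] by (rule bump_scaled_test) (use r sub in auto)
    have \<psi>0: "\<psi> x \<ge> 0" for x by (simp add: \<psi>_def bump_nonneg)
    have \<psi>z: "\<psi> x = 0" if "x \<notin> ball x0 (2 * r)" for x
      unfolding \<psi>_def by (rule bump_scaled_zero) (use r that in auto)
    define G where "G x = \<psi> x *\<^sub>R g i x + u i x *\<^sub>R gradient \<psi> x" for x
    have T: "sobolev0 \<Omega> (\<lambda>x. \<psi> x * u i x) G"
      using sobolev0_mult_test[OF sobolev[of i] \<psi>] by (simp add: G_def[abs_def])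
    obtain B where B: "\<And>x. norm (gradient \<psi> x) \<le> B" using test_functions_bounded[OF \<psi>] by metis
    have [measurable]: "gradient \<psi> \<in> borel_measurable borel" "\<psi> \<in> borel_measurable borel" "g i \<in> borel_measurable borel"
      using gradient_borel_measurable smooth_borel_measurable test_functions_smooth[OF \<psi>] sobolev0_measurable(2)[OF sobolev] by auto
    note Lg = sobolev0_L2(2)[OF sobolev[of i]] and Lu = sobolev0_L2(1)[OF sobolev[of i]]
    have i1: "integrable lborel (\<lambda>x. u i x * (g i x \<bullet> gradient \<psi> x))"
      by (rule L2_triple_integrable[OF Lu Lg _ B]) measurable
    have i2: "integrable lborel (\<lambda>x. \<psi> x * (norm (g i x))\<^sup>2)"
      by (rule integrable_test_mult[OF \<psi> L2_integrable[OF Lg]])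
    have "(LBINT x. \<psi> x * (norm (g i x))\<^sup>2) + (LBINT x. u i x * (g i x \<bullet> gradient \<psi> x)) = (LBINT x. g i x \<bullet> G x)"
      using i1 i2 by (simp add: G_def inner_add_right power2_norm_eq_inner)
    also have "\<dots> \<le> energy i * (LBINT x. \<psi> x * u i x)"
      by (rule subsolution[OF T]) (simp add: \<psi>0 nonneg)
    also have "\<dots> \<le> total_energy * (LBINT x. \<psi> x * u i x)"
      by (intro mult_right_mono energy_le_total) (simp add: \<psi>0 nonneg)
    also have "\<dots> \<le> total_energy * (m * (unit_ball_vol ?N * (2 * r) ^ ?N))"
    proof (intro mult_left_mono total_energy_nonneg integral_ball_le[where ?x0.0=x0])
      show "\<psi> x * u i x \<le> m" if "x \<in> ball x0 (2 * r)" for x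
        using mult_mono[OF bump_le_1 um[OF that] _ nonneg] by (simp add: \<psi>_def)
      show "\<psi> x * u i x \<le> 0" if "x \<notin> ball x0 (2 * r)" for x using \<psi>z[OF that] by simp
    qed (use r m in auto)
    finally have 1: "(LBINT x. \<psi> x * (norm (g i x))\<^sup>2) + (LBINT x. u i x * (g i x \<bullet> gradient \<psi> x))
      \<le> total_energy * m * \<omega> * r ^ ?N" by (simp add: \<omega>_def power_mult_distrib mult_ac)
    have "(LBINT x. (u i x)\<^sup>2 * laplacian \<psi> x) \<le> (m\<^sup>2 * (L / (2 * r)\<^sup>2)) * (unit_ball_vol ?N * (2 * r) ^ ?N)"
    proof (rule integral_ball_le[where ?x0.0=x0])
      show "(u i x)\<^sup>2 * laplacian \<psi> x \<le> m\<^sup>2 * (L / (2 * r)\<^sup>2)" if "x \<in> ball x0 (2 * r)" for x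
      proof -
        have "(u i x)\<^sup>2 * laplacian \<psi> x \<le> (u i x)\<^sup>2 * (L / (2 * r)\<^sup>2)"
          unfolding \<psi>_def laplacian_scaled[OF smooth_bump]
          using L(2)[of "(1 / (2 * r)) *\<^sub>R (x - x0)"] by (intro mult_left_mono divide_right_mono) auto
        also have "\<dots> \<le> m\<^sup>2 * (L / (2 * r)\<^sup>2)"
          using um[OF that] nonneg[of i x] L(1) by (intro mult_right_mono power_mono) auto
        finally show ?thesis .
      qed
      show "(u i x)\<^sup>2 * laplacian \<psi> x \<le> 0" if "x \<notin> ball x0 (2 * r)" for x
      proof -
        have "norm ((1 / (2 * r)) *\<^sub>R (x - x0)) \<ge> 1" using that r by (simp add: dist_norm norm_minus_commute)
        then show ?thesis unfolding \<psi>_def laplacian_scaled[OF smooth_bump] by (simp add: laplacian_bump_zero)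
      qed
    qed (use r L in auto)
    then have 2: "(LBINT x. (u i x)\<^sup>2 * laplacian \<psi> x) \<le> m\<^sup>2 * L / (4 * r\<^sup>2) * \<omega> * r ^ ?N"
      by (simp add: \<omega>_def power_mult_distrib mult_ac)
    have "?b * (LBINT x. indicator (ball x0 r) x * (norm (g i x))\<^sup>2) \<le> (LBINT x. \<psi> x * (norm (g i x))\<^sup>2)"
    proof -
      have i3: "integrable lborel (\<lambda>x. indicator (ball x0 r) x * (norm (g i x))\<^sup>2)"
        by (rule L2_indicator_integrable[OF Lg]) simp
      have "(LBINT x. ?b * (indicator (ball x0 r) x * (norm (g i x))\<^sup>2)) \<le> (LBINT x. \<psi> x * (norm (g i x))\<^sup>2)"
      proof (rule integral_mono[OF _ i2])
        show "integrable lborel (\<lambda>x. ?b * (indicator (ball x0 r) x * (norm (g i x))\<^sup>2))" using i3 by simp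
        show "?b * (indicator (ball x0 r) x * (norm (g i x))\<^sup>2) \<le> \<psi> x * (norm (g i x))\<^sup>2" for x
        proof (cases "x \<in> ball x0 r")
          case True
          then have "norm ((1 / (2 * r)) *\<^sub>R (x - x0)) \<le> 1/2" using r by (simp add: dist_norm norm_minus_commute)
          from bump_lower[OF this] show ?thesis using True by (auto simp: \<psi>_def intro!: mult_right_mono)
        qed (simp add: \<psi>0)
      qed
      then show ?thesis by simp
    qed
    also have "\<dots> \<le> total_energy * m * \<omega> * r ^ ?N + (1/2) * (m\<^sup>2 * L / (4 * r\<^sup>2) * \<omega> * r ^ ?N)"
      using 1 2 sobolev0_square_laplacian[OF sobolev[of i] \<psi>] by simp
    finally have "r\<^sup>2 * (?b * (LBINT x. indicator (ball x0 r) x * (norm (g i x))\<^sup>2))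
      \<le> r\<^sup>2 * (total_energy * m * \<omega> * r ^ ?N + (1/2) * (m\<^sup>2 * L / (4 * r\<^sup>2) * \<omega> * r ^ ?N))"
      by (rule mult_left_mono) simp
    also have "\<dots> = (total_energy * \<omega> * (m * r\<^sup>2) + (L * \<omega> / 8) * m\<^sup>2) * r ^ ?N"
      using r by (simp add: field_simps)
    also have "\<dots> \<le> ((total_energy * \<omega> + L * \<omega> + 1) * (m * r\<^sup>2) + (total_energy * \<omega> + L * \<omega> + 1) * m\<^sup>2) * r ^ ?N"
      using total_energy_nonneg L(1) \<omega> m r
      by (intro mult_right_mono add_mono) (auto intro!: add_nonneg_nonneg)
    finally show ?thesis by (simp add: C_def field_simps)
  qed
  ultimately show ?thesis by blast
qed

text \<open>The difference-quotient bound for each component; Cauchy-Schwarz over the indices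
  produces the factor CARD('b).\<close>

lemma increment_integral_le:
  "(LBINT x. indicator (ball x0 \<rho>) x * (increment h x)\<^sup>2)
    \<le> real CARD('b) * (norm h)\<^sup>2 * (\<Sum>i\<in>UNIV. \<integral>x. indicator (ball x0 (\<rho> + norm h)) x * (norm (g i x))\<^sup>2 \<partial>lborel)"
proof -
  have Lu: "L2 (\<lambda>x. u i (x + h) - u i x)" for i
    by (intro L2_diff L2_shift sobolev0_L2(1)[OF sobolev])
  have ii: "integrable lborel (\<lambda>x. indicator (ball x0 \<rho>) x * (u i (x + h) - u i x)\<^sup>2)" for i
    using L2_indicator_integrable[OF Lu, of "ball x0 \<rho>"] by simp
  have Li: "L2 (increment h)" unfolding increment_def[abs_def]
    by (intro L2_sum) (use L2_norm[OF Lu] in simp)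
  have "(LBINT x. indicator (ball x0 \<rho>) x * (increment h x)\<^sup>2)
     \<le> (LBINT x. (\<Sum>i\<in>UNIV. real CARD('b) * (indicator (ball x0 \<rho>) x * (u i (x + h) - u i x)\<^sup>2)))"
  proof (rule integral_mono)
    show "integrable lborel (\<lambda>x. indicator (ball x0 \<rho>) x * (increment h x)\<^sup>2)"
      using L2_indicator_integrable[OF Li, of "ball x0 \<rho>"] by simp
    show "integrable lborel (\<lambda>x. \<Sum>i\<in>UNIV. real CARD('b) * (indicator (ball x0 \<rho>) x * (u i (x + h) - u i x)\<^sup>2))"
      by (intro Bochner_Integration.integrable_sum integrable_mult_right ii)
    fix x
    have "(increment h x)\<^sup>2 \<le> (\<Sum>i\<in>UNIV. \<bar>u i (x + h) - u i x\<bar>\<^sup>2) * real CARD('b)"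
      unfolding increment_def by (rule sum_squared_le_sum_of_squares)
    then have "indicator (ball x0 \<rho>) x * (increment h x)\<^sup>2
      \<le> indicator (ball x0 \<rho>) x * ((\<Sum>i\<in>UNIV. \<bar>u i (x + h) - u i x\<bar>\<^sup>2) * real CARD('b))"
      by (rule mult_left_mono) simp
    then show "indicator (ball x0 \<rho>) x * (increment h x)\<^sup>2
      \<le> (\<Sum>i\<in>UNIV. real CARD('b) * (indicator (ball x0 \<rho>) x * (u i (x + h) - u i x)\<^sup>2))"
      by (simp add: sum_distrib_left sum_distrib_right mult_ac)
  qed
  also have "\<dots> = (\<Sum>i\<in>UNIV. real CARD('b) * (LBINT x. indicator (ball x0 \<rho>) x * (u i (x + h) - u i x)\<^sup>2))"
    using ii by (simp add: Bochner_Integration.integral_sum)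
  also have "\<dots> \<le> (\<Sum>i\<in>UNIV. real CARD('b) * ((norm h)\<^sup>2 * (LBINT x. indicator (ball x0 (\<rho> + norm h)) x * (norm (g i x))\<^sup>2)))"
    by (intro sum_mono mult_left_mono sobolev0_increment[OF sobolev]) simp
  finally show ?thesis by (simp add: sum_distrib_left mult_ac)
qed

text \<open>The distance between u and its translate is evaluated at a zero, where it equals the sum
  of the values u_i(x0 + h). The local bound M on u comes from continuity on a compact neighbourhood
  of K.\<close>

lemma holder_at_zero:
  assumes K: "compact K" "K \<subseteq> \<Omega>"
  shows "\<exists>C>0. \<exists>r0>0. \<forall>x0\<in>K. \<forall>h. (\<forall>i. u i x0 = 0) \<longrightarrow> norm h < r0 \<longrightarrow>
    (\<Sum>i\<in>UNIV. u i (x0 + h))\<^sup>2 \<le> C * norm h"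
proof -
  let ?N = "DIM('a)"
  obtain \<delta>0 where \<delta>0: "\<delta>0 > 0" "(\<Union>x\<in>K. cball x \<delta>0) \<subseteq> \<Omega>"
    using compact_subset_open_imp_cball_epsilon_subset[OF K(1) open_\<Omega> K(2)] .
  define \<delta> where "\<delta> = min \<delta>0 1"
  have \<delta>: "\<delta> > 0" "\<delta> \<le> 1" using \<delta>0 by (auto simp: \<delta>_def)
  have sub: "cball x \<delta> \<subseteq> \<Omega>" if "x \<in> K" for x
    using \<delta>0(2) that by (fastforce simp: \<delta>_def)
  define K' where "K' = {x + y |x y. x \<in> K \<and> y \<in> cball 0 \<delta>}"
  have K': "compact K'" unfolding K'_def by (rule compact_sums[OF K(1) compact_cball])
  have K'_mem: "y \<in> K'" if "x \<in> K" "dist x y \<le> \<delta>" for x y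
    unfolding K'_def using that
    by (intro CollectI exI[of _ x] exI[of _ "y - x"]) (auto simp: dist_norm norm_minus_commute)
  have K'\<Omega>: "K' \<subseteq> \<Omega>"
  proof
    fix z assume "z \<in> K'"
    then obtain x y where xy: "z = x + y" "x \<in> K" "y \<in> cball 0 \<delta>" unfolding K'_def by blast
    then have "z \<in> cball x \<delta>" by (simp add: dist_norm)
    then show "z \<in> \<Omega>" using sub xy by blast
  qed
  have "continuous_on K' (\<lambda>x. \<Sum>i\<in>UNIV. u i x)"
    by (intro continuous_intros continuous_on_subset[OF cont K'\<Omega>])
  then have "compact ((\<lambda>x. \<Sum>i\<in>UNIV. u i x) ` K')" by (rule compact_continuous_image[OF _ K'])
  then obtain M0 where M0: "\<And>x. x \<in> K' \<Longrightarrow> norm (\<Sum>i\<in>UNIV. u i x) \<le> M0"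
    by (fastforce dest!: compact_imp_bounded simp: bounded_iff)
  define M where "M = max M0 1"
  have M: "M > 0" "(\<Sum>i\<in>UNIV. u i x) \<le> M" if "x \<in> K'" for x
    using M0[OF that] by (auto simp: M_def)
  have M_pos: "M \<ge> 1" by (simp add: M_def)
  have uM: "u i x \<le> M" if "x \<in> K'" for i x
    using member_le_sum[of i UNIV "\<lambda>i. u i x"] nonneg M(2)[OF that] by simp
  obtain Cc where Cc: "Cc > 0" "\<forall>i x0 r m. 0 < r \<longrightarrow> cball x0 (2 * r) \<subseteq> \<Omega> \<longrightarrow> 0 \<le> m \<longrightarrow>
      (\<forall>x\<in>ball x0 (2 * r). u i x \<le> m) \<longrightarrow>
      r\<^sup>2 * (LBINT x. indicator (ball x0 r) x * (norm (g i x))\<^sup>2) \<le> Cc * (m\<^sup>2 + m * r\<^sup>2) * r ^ DIM('a)"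
    using energy_on_ball_le by blast
  obtain B where B: "B > 0" "\<And>y::'a. \<bar>bump_kernel y\<bar> \<le> B"
    using test_functions_bounded[OF bump_kernel_test] by metis
  define I where "I = (LBINT y. bump_kernel (y::'a))"
  define \<kappa> where "\<kappa> = (LBINT y. bump (y::'a))"
  have \<kappa>: "\<kappa> \<ge> 0" unfolding \<kappa>_def by (simp add: bump_nonneg)
  have I: "I > 0"
  proof -
    have "I \<noteq> 0"
    proof
      assume "I = 0"
      then have "AE y::'a in lborel. bump_kernel y = 0"
        unfolding I_def by (subst (asm) integral_nonneg_eq_0_iff_AE)
          (auto simp: bump_kernel_nonneg test_functions_integrable[OF bump_kernel_test])
      then have "AE y::'a in lborel. y \<notin> ball 0 1"
        by eventually_elim (use bump_kernel_pos in force)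
      then have "ball (0::'a) 1 \<in> null_sets lborel" by (subst AE_iff_null_sets) auto
      then have "emeasure lborel (ball (0::'a) 1) = 0" by auto
      then show False using unit_ball_vol_pos[of "real DIM('a)"] by (simp add: emeasure_ball)
    qed
    moreover have "I \<ge> 0" unfolding I_def by (simp add: bump_kernel_nonneg)
    ultimately show ?thesis by simp
  qed
  \<comment> \<open>One factor CARD('b) is due to Cauchy-Schwarz over the components, the other to
    summing their energies.\<close>
  define C1 where "C1 = real CARD('b) * (real CARD('b) * (Cc * (M\<^sup>2 + M * 4) * 2 ^ ?N))"
  define C where "C = (B * C1 + 8 * total_energy * M * \<kappa> / 2 + 1) / I"
  \<comment> \<open>With \<rho> = |h|^(1/2) this says (N + 5) \<rho> < \<delta>: the cube of
    half-side \<rho> lies within N \<rho> of x0, the shift by h adds at most \<rho>, and the energy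
    estimate on the ball of radius 2 \<rho> uses the one of radius 4 \<rho>.\<close>
  define r0 where "r0 = (\<delta> / (real ?N + 5))\<^sup>2"
  have C1: "C1 \<ge> 0" unfolding C1_def using Cc M_pos by simp
  have "C > 0" unfolding C_def
    using B(1) C1 I total_energy_nonneg M_pos \<kappa> by (intro divide_pos_pos add_nonneg_pos add_nonneg_nonneg) auto
  moreover have "r0 > 0" unfolding r0_def using \<delta> by (simp add: add_nonneg_pos)
  moreover have "(\<Sum>i\<in>UNIV. u i (x0 + h))\<^sup>2 \<le> C * norm h"
    if x0: "x0 \<in> K" and z: "\<And>i. u i x0 = 0" and h: "norm h < r0" for x0 h
  proof (cases "h = 0")
    case True
    then show ?thesis using z by simp
  next
    case False
    define \<rho> where "\<rho> = sqrt (norm h)"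
    have \<rho>: "\<rho> > 0" "\<rho>\<^sup>2 = norm h" using False by (auto simp: \<rho>_def)
    have "\<rho> < \<delta> / (real ?N + 5)"
      unfolding \<rho>_def using h \<delta> by (intro real_less_lsqrt) (auto simp: r0_def)
    then have \<rho>\<delta>: "(real ?N + 5) * \<rho> < \<delta>" by (simp add: field_simps)
    have N0: "0 \<le> real ?N * \<rho>" using \<rho> by simp
    have \<rho>1: "\<rho> \<le> 1" "5 * \<rho> \<le> \<delta>" "real ?N * \<rho> + \<rho> \<le> \<delta>"
      using \<rho>\<delta> \<rho>(1) N0 \<delta> unfolding distrib_right by linarith+
    have h\<rho>: "norm h \<le> \<rho>" using \<rho> \<rho>1(1) by (simp flip: \<rho>(2) add: power2_eq_square mult_left_le)
    let ?Q = "cbox (x0 - \<rho> *\<^sub>R One) (x0 + \<rho> *\<^sub>R One)"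
    have Q: "dist x0 x \<le> real ?N * \<rho>" if "x \<in> ?Q" for x
    proof -
      have "norm (x - x0) \<le> (\<Sum>i\<in>Basis. \<bar>(x - x0) \<bullet> i\<bar>)" by (rule norm_le_l1)
      also have "\<dots> \<le> (\<Sum>i\<in>(Basis::'a set). \<rho>)"
      proof (rule sum_mono)
        fix i :: 'a assume "i \<in> Basis"
        then have "(x0 - \<rho> *\<^sub>R One) \<bullet> i \<le> x \<bullet> i" "x \<bullet> i \<le> (x0 + \<rho> *\<^sub>R One) \<bullet> i"
          using \<open>x \<in> ?Q\<close> unfolding mem_box by blast+
        then show "\<bar>(x - x0) \<bullet> i\<bar> \<le> \<rho>"
          using \<open>i \<in> Basis\<close> by (simp add: inner_diff_left inner_add_left abs_le_iff)
      qed
      finally show ?thesis by (simp add: dist_norm norm_minus_commute)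
    qed
    have near: "x \<in> K'" "x + h \<in> K'" if "dist x0 x \<le> real ?N * \<rho> \<or> dist x0 x \<le> \<rho>" for x
    proof -
      have d: "dist x0 x + \<rho> \<le> \<delta>" using that \<rho>1 \<rho> N0 by auto
      then show "x \<in> K'" using \<rho> by (intro K'_mem[OF x0]) auto
      have "dist x0 (x + h) \<le> dist x0 x + norm h"
        using dist_triangle[of x0 "x + h" x] by (simp add: dist_norm)
      then show "x + h \<in> K'" using d h\<rho> by (intro K'_mem[OF x0]) auto
    qed
    have cu: "continuous_on ?Q (\<lambda>x. u i x)" "continuous_on ?Q (\<lambda>x. u i (x + h))" for i
      using near(1)[OF disjI1[OF Q]] near(2)[OF disjI1[OF Q]] K'\<Omega>
      by (auto intro!: continuous_on_subset[OF cont] continuous_on_compose2[OF cont] continuous_intros)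
    have [measurable]: "u i \<in> borel_measurable borel" for i by (rule sobolev0_measurable(1)[OF sobolev])
    have mv: "(increment h x0)\<^sup>2 * I
      \<le> (LBINT x. (increment h x)\<^sup>2 * bump_kernel ((1 / \<rho>) *\<^sub>R (x - x0))) / \<rho> ^ ?N
        + (8 * total_energy * M) * \<kappa> * \<rho>\<^sup>2 / 2"
      unfolding I_def \<kappa>_def
    proof (rule mean_value_inequality[OF \<rho>(1)])
      \<comment> \<open>The 8 arises as 4 times 2: the Laplacian bound has 4 total_energy, and the
        distance is at most 2 M on the balls in question.\<close>
      show "0 \<le> 8 * total_energy * M" using total_energy_nonneg M_pos by simp
      show "continuous_on ?Q (\<lambda>x. (increment h x)\<^sup>2)"
        unfolding increment_def by (intro continuous_intros cu)
      show "(\<lambda>x. (increment h x)\<^sup>2) \<in> borel_measurable borel" unfolding increment_def by measurable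
      fix s :: real assume s: "0 < s" "s \<le> \<rho>"
      let ?\<psi> = "\<lambda>x. bump ((1 / s) *\<^sub>R (x - x0))"
      have U: "cball x0 s \<subseteq> \<Omega> \<inter> {x. x + h \<in> \<Omega>}" using near s K'\<Omega> by auto
      note \<psi> = bump_scaled_test[OF s(1) U]
      have bi: "integrable lborel ?\<psi>" by (rule test_functions_integrable[OF \<psi>])
      have le: "?\<psi> x * increment h x \<le> 2 * M * ?\<psi> x" for x
      proof (cases "x \<in> ball x0 s")
        case True
        then have "x \<in> K'" "x + h \<in> K'" using near[of x] s by auto
        then have "(\<Sum>i\<in>UNIV. u i (x + h)) + (\<Sum>i\<in>UNIV. u i x) \<le> 2 * M" using M(2)[of x] M(2)[of "x + h"] by simp
        moreover have "increment h x \<le> (\<Sum>i\<in>UNIV. u i (x + h)) + (\<Sum>i\<in>UNIV. u i x)"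
          unfolding increment_def sum.distrib[symmetric]
        proof (rule sum_mono)
          fix i show "\<bar>u i (x + h) - u i x\<bar> \<le> u i (x + h) + u i x"
            using nonneg[of i x] nonneg[of i "x + h"] by (simp add: abs_le_iff)
        qed
        ultimately have "increment h x \<le> 2 * M" by simp
        from mult_left_mono[OF this bump_nonneg[of "(1 / s) *\<^sub>R (x - x0)"]] show ?thesis
          by (simp only: mult.commute[of "2 * M"])
      next
        case False
        from bump_scaled_zero[OF s(1) this] show ?thesis by simp
      qed
      have "(LBINT x. ?\<psi> x * increment h x) \<le> (LBINT x. 2 * M * ?\<psi> x)"
        by (rule integral_mono_AE') (use le bi M_pos in \<open>auto intro!: mult_nonneg_nonneg AE_I2 bump_nonneg\<close>)
      then have "4 * total_energy * (LBINT x. ?\<psi> x * increment h x) \<le> 4 * total_energy * (2 * M * (LBINT x. ?\<psi> x))"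
        by (intro mult_left_mono) (use total_energy_nonneg in auto)
      from le_imp_neg_le[OF this]
      have "- (8 * total_energy * M) * (LBINT x. ?\<psi> x) \<le> - (4 * total_energy) * (LBINT x. ?\<psi> x * increment h x)"
        by simp
      also have "\<dots> \<le> (LBINT x. (increment h x)\<^sup>2 * laplacian ?\<psi> x)"
        by (rule increment_laplacian[OF \<psi> bump_nonneg])
      finally show "- (8 * total_energy * M) * (LBINT x. ?\<psi> x) \<le> (LBINT x. (increment h x)\<^sup>2 * laplacian ?\<psi> x)" .
    qed
    have e: "(LBINT x. indicator (ball x0 (\<rho> + norm h)) x * (norm (g i x))\<^sup>2) \<le> Cc * (M\<^sup>2 + M * 4) * 2 ^ ?N * \<rho> ^ ?N / \<rho>\<^sup>2" for i
    proof -
      have Lg: "L2 (g i)" by (rule sobolev0_L2(2)[OF sobolev])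
      have ib: "integrable lborel (\<lambda>x. indicator (ball x0 s) x * (norm (g i x))\<^sup>2)" for s
        by (rule L2_indicator_integrable[OF Lg]) simp
      have "(LBINT x. indicator (ball x0 (\<rho> + norm h)) x * (norm (g i x))\<^sup>2)
          \<le> (LBINT x. indicator (ball x0 (2 * \<rho>)) x * (norm (g i x))\<^sup>2)"
        by (rule integral_mono[OF ib ib]) (use h\<rho> in \<open>auto simp: indicator_def\<close>)
      moreover have "(2 * \<rho>)\<^sup>2 * (LBINT x. indicator (ball x0 (2 * \<rho>)) x * (norm (g i x))\<^sup>2)
        \<le> Cc * (M\<^sup>2 + M * (2 * \<rho>)\<^sup>2) * (2 * \<rho>) ^ ?N"
      proof (rule Cc(2)[rule_format])
        show "cball x0 (2 * (2 * \<rho>)) \<subseteq> \<Omega>" using sub[OF x0] \<rho>1 \<rho> by (auto simp: subset_iff)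
        show "u i x \<le> M" if "x \<in> ball x0 (2 * (2 * \<rho>))" for x
          using that \<rho>1 \<rho> by (intro uM K'_mem[OF x0]) auto
      qed (use \<rho> M_pos in auto)
      moreover have "Cc * (M\<^sup>2 + M * (2 * \<rho>)\<^sup>2) * (2 * \<rho>) ^ ?N \<le> Cc * (M\<^sup>2 + M * 4) * (2 * \<rho>) ^ ?N"
      proof -
        have "\<rho>\<^sup>2 \<le> 1" using \<rho>(1) \<rho>1(1) by (simp add: power_le_one)
        then have "(2 * \<rho>)\<^sup>2 \<le> 4" by (simp add: power_mult_distrib)
        then show ?thesis using Cc(1) M_pos \<rho> by (intro mult_right_mono mult_left_mono add_left_mono) auto
      qed
      moreover have "\<rho>\<^sup>2 * X \<le> (2 * \<rho>)\<^sup>2 * X" if "X \<ge> 0" for X using that \<rho> by (simp add: power_mult_distrib)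
      moreover have "0 \<le> (LBINT x. indicator (ball x0 (2 * \<rho>)) x * (norm (g i x))\<^sup>2)" by simp
      ultimately have "\<rho>\<^sup>2 * (LBINT x. indicator (ball x0 (2 * \<rho>)) x * (norm (g i x))\<^sup>2) \<le> Cc * (M\<^sup>2 + M * 4) * (2 * \<rho>) ^ ?N"
        by (meson order_trans)
      then have "(LBINT x. indicator (ball x0 (2 * \<rho>)) x * (norm (g i x))\<^sup>2) \<le> Cc * (M\<^sup>2 + M * 4) * 2 ^ ?N * \<rho> ^ ?N / \<rho>\<^sup>2"
        using \<rho>(1) by (simp add: field_simps power_mult_distrib)
      with \<open>(LBINT x. indicator (ball x0 (\<rho> + norm h)) x * (norm (g i x))\<^sup>2) \<le> _\<close> show ?thesis by linarith
    qed
    have Li: "L2 (increment h)" unfolding increment_def[abs_def]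
      by (intro L2_sum) (use L2_norm[OF L2_diff[OF L2_shift[OF sobolev0_L2(1)[OF sobolev]] sobolev0_L2(1)[OF sobolev]]] in simp)
    have ii: "integrable lborel (\<lambda>x. indicator (ball x0 \<rho>) x * (increment h x)\<^sup>2)"
      using L2_indicator_integrable[OF Li, of "ball x0 \<rho>"] by simp
    have "(LBINT x. (increment h x)\<^sup>2 * bump_kernel ((1 / \<rho>) *\<^sub>R (x - x0)))
      \<le> (LBINT x. B * (indicator (ball x0 \<rho>) x * (increment h x)\<^sup>2))"
    proof (rule integral_mono_AE')
      show "integrable lborel (\<lambda>x. B * (indicator (ball x0 \<rho>) x * (increment h x)\<^sup>2))" using ii by simp
      show "AE x in lborel. (increment h x)\<^sup>2 * bump_kernel ((1 / \<rho>) *\<^sub>R (x - x0)) \<le> B * (indicator (ball x0 \<rho>) x * (increment h x)\<^sup>2)"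
      proof (rule AE_I2)
        fix x
        show "(increment h x)\<^sup>2 * bump_kernel ((1 / \<rho>) *\<^sub>R (x - x0)) \<le> B * (indicator (ball x0 \<rho>) x * (increment h x)\<^sup>2)"
        proof (cases "x \<in> ball x0 \<rho>")
          case True
          have "bump_kernel ((1 / \<rho>) *\<^sub>R (x - x0)) \<le> B" using B(2)[of "(1 / \<rho>) *\<^sub>R (x - x0)"] by simp
          from mult_left_mono[OF this, of "(increment h x)\<^sup>2"] show ?thesis using True by (simp add: mult.commute)
        next
          case False
          from bump_kernel_scaled_zero[OF \<rho>(1) this] show ?thesis using False by simp
        qed
      qed
      show "AE x in lborel. 0 \<le> B * (indicator (ball x0 \<rho>) x * (increment h x)\<^sup>2)"
        using B(1) by simp
    qed
    also have "\<dots> = B * (LBINT x. indicator (ball x0 \<rho>) x * (increment h x)\<^sup>2)" by simp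
    also have "\<dots> \<le> B * (real CARD('b) * (norm h)\<^sup>2 * (\<Sum>i\<in>(UNIV::'b set). Cc * (M\<^sup>2 + M * 4) * 2 ^ ?N * \<rho> ^ ?N / \<rho>\<^sup>2))"
      by (intro mult_left_mono order_trans[OF increment_integral_le] sum_mono e) (use B(1) in auto)
    also have "\<dots> = B * C1 * ((norm h)\<^sup>2 / \<rho>\<^sup>2) * \<rho> ^ ?N"
      by (simp add: C1_def mult_ac)
    \<comment> \<open>The choice of \<rho> makes this term and the remainder \<rho>^2 of the mean
      value inequality both equal to |h| up to constants.\<close>
    also have "(norm h)\<^sup>2 / \<rho>\<^sup>2 = norm h" unfolding \<rho>(2) using False by (simp add: power2_eq_square)
    finally have "(LBINT x. (increment h x)\<^sup>2 * bump_kernel ((1 / \<rho>) *\<^sub>R (x - x0))) / \<rho> ^ ?N \<le> B * C1 * norm h"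
      using \<rho>(1) by (simp add: pos_divide_le_eq)
    with mv have "(increment h x0)\<^sup>2 * I \<le> (B * C1 + 8 * total_energy * M * \<kappa> / 2) * norm h"
      unfolding \<rho>(2) by (simp add: algebra_simps)
    also have "\<dots> \<le> (B * C1 + 8 * total_energy * M * \<kappa> / 2 + 1) * norm h"
      by (intro mult_right_mono) auto
    finally have "(increment h x0)\<^sup>2 \<le> C * norm h" unfolding C_def using I by (simp add: field_simps)
    moreover have "increment h x0 = (\<Sum>i\<in>UNIV. u i (x0 + h))" unfolding increment_def using z nonneg by simp
    ultimately show ?thesis by simp
  qed
  ultimately show ?thesis by blast
qed

text \<open>Growth at the zero supplies a bound m with m^2 = 2 C r on the doubled ball. In the
  Caccioppoli inequality both m^2 and m r^2 are then at most of order r.\<close>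

lemma energy_decay_at_zero:
  assumes K: "compact K" "K \<subseteq> \<Omega>"
  shows "\<exists>C>0. \<exists>r0>0. \<forall>x0\<in>K. \<forall>r i. (\<forall>i. u i x0 = 0) \<longrightarrow> 0 < r \<longrightarrow> r < r0 \<longrightarrow>
       r\<^sup>2 * (LBINT x. indicator (ball x0 r) x * (norm (g i x))\<^sup>2) \<le> C * r ^ (DIM('a) + 1)"
proof -
  let ?N = "DIM('a)"
  obtain C r1 where C: "C > 0" "r1 > 0"
    "\<forall>x0\<in>K. \<forall>h. (\<forall>i. u i x0 = 0) \<longrightarrow> norm h < r1 \<longrightarrow> (\<Sum>i\<in>UNIV. u i (x0 + h))\<^sup>2 \<le> C * norm h"
    using holder_at_zero[OF K] by blast
  obtain \<delta> where \<delta>: "\<delta> > 0" "(\<Union>x\<in>K. cball x \<delta>) \<subseteq> \<Omega>"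
    using compact_subset_open_imp_cball_epsilon_subset[OF K(1) open_\<Omega> K(2)] .
  obtain Cc where Cc: "Cc > 0" "\<forall>i x0 r m. 0 < r \<longrightarrow> cball x0 (2 * r) \<subseteq> \<Omega> \<longrightarrow> 0 \<le> m \<longrightarrow>
      (\<forall>x\<in>ball x0 (2 * r). u i x \<le> m) \<longrightarrow>
      r\<^sup>2 * (LBINT x. indicator (ball x0 r) x * (norm (g i x))\<^sup>2) \<le> Cc * (m\<^sup>2 + m * r\<^sup>2) * r ^ DIM('a)"
    using energy_on_ball_le by blast
  define r0 where "r0 = min 1 (min (r1 / 2) (\<delta> / 2))"
  define C' where "C' = Cc * (2 * C + (1 + 2 * C))"
  have "C' > 0" using C(1) Cc(1) by (simp add: C'_def)
  moreover have "r0 > 0" using C(2) \<delta>(1) by (simp add: r0_def)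
  moreover have "r\<^sup>2 * (LBINT x. indicator (ball x0 r) x * (norm (g i x))\<^sup>2) \<le> C' * r ^ (?N + 1)"
    if x0: "x0 \<in> K" and z: "\<And>i. u i x0 = 0" and r: "0 < r" "r < r0" for x0 r i
  proof -
    have r': "r \<le> 1" "2 * r < r1" "2 * r \<le> \<delta>" using r by (auto simp: r0_def)
    define m where "m = sqrt (C * (2 * r))"
    have m: "m \<ge> 0" "m\<^sup>2 = 2 * C * r" using C(1) r by (auto simp: m_def)
    have "r\<^sup>2 * (LBINT x. indicator (ball x0 r) x * (norm (g i x))\<^sup>2) \<le> Cc * (m\<^sup>2 + m * r\<^sup>2) * r ^ ?N"
    proof (rule Cc(2)[rule_format, OF r(1) _ m(1)])
      show "cball x0 (2 * r) \<subseteq> \<Omega>" using \<delta>(2) x0 r' by (fastforce simp: subset_iff)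
      fix x assume x: "x \<in> ball x0 (2 * r)"
      then have n: "norm (x - x0) < 2 * r" by (simp add: dist_norm norm_minus_commute)
      have "(u i x)\<^sup>2 \<le> (\<Sum>i\<in>UNIV. u i x)\<^sup>2"
        using member_le_sum[of i UNIV "\<lambda>i. u i x"] nonneg by (intro power_mono) auto
      also have "\<dots> \<le> C * norm (x - x0)" using C(3)[rule_format, OF x0 z, of "x - x0"] n r' by simp
      also have "\<dots> \<le> C * (2 * r)" using n C(1) by (intro mult_left_mono) auto
      finally show "u i x \<le> m" unfolding m_def by (rule real_le_rsqrt)
    qed
    also have "\<dots> \<le> Cc * (2 * C * r + (1 + 2 * C) * r) * r ^ ?N"
    proof -
      have "m * r\<^sup>2 \<le> (1 + m\<^sup>2) * r"
      proof (intro mult_mono)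
        show "m \<le> 1 + m\<^sup>2" using sum_squares_bound[of m 1] m(1) zero_le_power2[of m] by (simp; linarith)
        show "r\<^sup>2 \<le> r" using r r' by (simp add: power2_eq_square mult_left_le)
      qed (use r in auto)
      also have "\<dots> \<le> (1 + 2 * C) * r"
        using r r' C(1) m(2) by (intro mult_right_mono) (auto simp: mult_left_le)
      finally show ?thesis using Cc(1) m(2) r by (intro mult_right_mono mult_left_mono) auto
    qed
    also have "\<dots> = C' * r ^ (?N + 1)" by (simp add: C'_def algebra_simps)
    finally show ?thesis .
  qed
  ultimately show ?thesis by blast
qed

end

section \<open>Borel representatives\<close>

text \<open>Links a function that matters only on A, up to null sets and integrated over
  \<open>lebesgue_on A\<close>, to a Borel function on the whole space integrated over
  \<open>lborel\<close>.\<close>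

definition represents ::
    "'a::euclidean_space set \<Rightarrow> ('a \<Rightarrow> 'b::euclidean_space) \<Rightarrow> ('a \<Rightarrow> 'b) \<Rightarrow> bool" where
  "represents A f F \<longleftrightarrow> f \<in> borel_measurable borel \<and> (AE x in lborel. f x = (if x \<in> A then F x else 0))"

lemma represents_AE: "represents A f F \<Longrightarrow> AE x in lborel. x \<in> A \<longrightarrow> F x = f x"
  by (auto simp: represents_def elim!: eventually_mono)

lemma represents_outside: "represents A f F \<Longrightarrow> AE x in lborel. x \<notin> A \<longrightarrow> f x = 0"
  by (auto simp: represents_def elim!: eventually_mono)

lemma representsI:
  "f \<in> borel_measurable borel \<Longrightarrow> (AE x in lborel. x \<in> A \<longrightarrow> F x = f x) \<Longrightarrow>
    (AE x in lborel. x \<notin> A \<longrightarrow> f x = 0) \<Longrightarrow> represents A f F"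
  unfolding represents_def by (auto elim: eventually_elim2)

lemma represents_measurable:
  assumes "A \<in> sets borel" "represents A f F"
  shows "F \<in> borel_measurable (lebesgue_on A)"
proof -
  have "f \<in> borel_measurable lborel" using assms(2) by (simp add: represents_def)
  then have "f \<in> borel_measurable lebesgue" by (rule measurable_completion)
  moreover have "AE x in lebesgue. f x = (if x \<in> A then F x else 0)"
    using assms(2) by (auto simp: represents_def intro: AE_completion)
  ultimately have "(\<lambda>x. if x \<in> A then F x else 0) \<in> borel_measurable lebesgue"
    by (rule borel_measurable_AE)
  then show ?thesis by (rule borel_measurable_if_D)
qed

lemma represents_integrable_integral:
  assumes A: "A \<in> sets borel" and f: "represents A f F"
  shows "integrable (lebesgue_on A) F \<longleftrightarrow> integrable lborel f"
    and "(LINT x|lebesgue_on A. F x) = (LBINT x. f x)"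
proof -
  have A': "A \<in> sets lebesgue" using A by simp
  have m: "(\<lambda>x. if x \<in> A then F x else 0) \<in> borel_measurable lebesgue"
    by (rule borel_measurable_if_I[OF represents_measurable[OF A f] A'])
  have fb: "f \<in> borel_measurable lborel" using f by (simp add: represents_def)
  then have f': "f \<in> borel_measurable lebesgue" by (rule measurable_completion)
  have ae: "AE x in lebesgue. (if x \<in> A then F x else 0) = f x"
    using f by (auto simp: represents_def intro!: AE_completion elim!: eventually_mono)
  have "integrable (lebesgue_on A) F \<longleftrightarrow> integrable lebesgue (\<lambda>x. if x \<in> A then F x else 0)"
    using Lebesgue_Measure.integrable_restrict_UNIV[OF A'] by blast
  also have "\<dots> \<longleftrightarrow> integrable lebesgue f" by (rule integrable_cong_AE[OF m f' ae])
  also have "\<dots> \<longleftrightarrow> integrable lborel f" by (rule integrable_completion[OF fb])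
  finally show "integrable (lebesgue_on A) F \<longleftrightarrow> integrable lborel f" .
  have "(LINT x|lebesgue_on A. F x) = (LINT x|lebesgue. (if x \<in> A then F x else 0))"
    using Lebesgue_Measure.integral_restrict_UNIV[OF A', of F] by simp
  also have "\<dots> = (LINT x|lebesgue. f x)" by (rule integral_cong_AE[OF m f' ae])
  also have "\<dots> = (LBINT x. f x)" by (rule integral_completion[OF fb])
  finally show "(LINT x|lebesgue_on A. F x) = (LBINT x. f x)" .
qed

lemma borel_version:
  fixes F :: "'a::euclidean_space \<Rightarrow> 'b::euclidean_space"
  assumes "F \<in> borel_measurable lebesgue"
  obtains f where "f \<in> borel_measurable borel" "AE x in lborel. F x = f x"
proof -
  have "\<exists>f\<in>borel_measurable lborel. AE x in lborel. F x \<bullet> i = f x" for i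
    by (rule completion_ex_borel_measurable_real) (use assms in measurable)
  then obtain c where c: "\<And>i. c i \<in> borel_measurable lborel" "\<And>i. AE x in lborel. F x \<bullet> i = c i x"
    by metis
  have "AE x in lborel. \<forall>i\<in>Basis. F x \<bullet> i = c i x" by (intro AE_finite_allI c) simp
  then have "AE x in lborel. F x = (\<Sum>i\<in>Basis. c i x *\<^sub>R i)"
  proof eventually_elim
    case (elim x)
    have "F x = (\<Sum>i\<in>Basis. (F x \<bullet> i) *\<^sub>R i)" by (rule euclidean_representation[symmetric])
    also have "\<dots> = (\<Sum>i\<in>Basis. c i x *\<^sub>R i)" by (intro sum.cong refl) (use elim in simp)
    finally show ?case .
  qed
  moreover have "(\<lambda>x. \<Sum>i\<in>Basis. c i x *\<^sub>R i) \<in> borel_measurable borel" using c(1) by simp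
  ultimately show ?thesis using that by blast
qed

lemma represents_exists:
  fixes F :: "'a::euclidean_space \<Rightarrow> 'b::euclidean_space"
  assumes "A \<in> sets borel" "F \<in> borel_measurable (lebesgue_on A)"
  obtains f where "represents A f F"
proof -
  have "A \<in> sets lebesgue" using assms(1) by simp
  from borel_measurable_if_I[OF assms(2) this]
  obtain f where "f \<in> borel_measurable borel" "AE x in lborel. (if x \<in> A then F x else 0) = f x"
    by (rule borel_version)
  then have "represents A f F" by (auto simp: represents_def elim!: eventually_mono)
  then show ?thesis by (rule that)
qed

lemma square_integrable_on_iff_L2:
  assumes "A \<in> sets borel" "represents A f F"
  shows "square_integrable_on F A \<longleftrightarrow> L2 f"
proof -
  have "represents A (\<lambda>x. (norm (f x))\<^sup>2) (\<lambda>x. (norm (F x))\<^sup>2)"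
    using assms(2) by (auto simp: represents_def elim!: eventually_mono)
  from represents_integrable_integral(1)[OF assms(1) this] show ?thesis
    using assms by (auto simp: square_integrable_on_def L2_def represents_def dest: represents_measurable)
qed

lemma represents_indicator:
  assumes "f \<in> borel_measurable borel" "A \<in> sets borel" "AE x in lborel. x \<in> A \<longrightarrow> F x = f x"
  shows "represents A (\<lambda>x. indicator A x *\<^sub>R f x) F"
proof (rule representsI)
  show "(\<lambda>x. indicator A x *\<^sub>R f x) \<in> borel_measurable borel" using assms(1,2) by measurable
  show "AE x in lborel. x \<in> A \<longrightarrow> F x = indicator A x *\<^sub>R f x"
    using assms(3) by eventually_elim auto
qed simp

lemma integrable_L2_compact_vec:
  fixes f :: "'a::euclidean_space \<Rightarrow> 'b::euclidean_space"
  assumes "L2 f" "compact K"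
  shows "integrable lborel (\<lambda>x. indicator K x *\<^sub>R f x)"
proof (rule Bochner_Integration.integrable_bound)
  show "integrable lborel (\<lambda>x. indicator K x * norm (f x))"
    by (rule integrable_L2_compact[OF L2_norm[OF assms(1)] assms(2)])
  have [measurable]: "K \<in> sets borel" "f \<in> borel_measurable borel"
    using assms by (auto simp: borel_compact L2_def)
  show "(\<lambda>x. indicator K x *\<^sub>R f x) \<in> borel_measurable lborel" by measurable
qed auto

section \<open>Weak gradients\<close>

lemma locally_integrable_L2:
  fixes F :: "'a::euclidean_space \<Rightarrow> 'b::euclidean_space"
  assumes "L2 f" "AE x in lborel. x \<in> A \<longrightarrow> F x = f x"
  shows "locally_integrable_on F A"
  unfolding locally_integrable_on_def
proof (intro allI impI)
  fix K assume K: "compact K \<and> K \<subseteq> A"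
  then have Kb: "K \<in> sets borel" by (simp add: borel_compact)
  have "represents K (\<lambda>x. indicator K x *\<^sub>R f x) F"
    by (rule represents_indicator[OF L2_measurable[OF assms(1)] Kb])
      (use assms(2) K in \<open>auto elim!: eventually_mono\<close>)
  then show "integrable (lebesgue_on K) F"
    using represents_integrable_integral(1)[OF Kb] integrable_L2_compact_vec[OF assms(1)] K by blast
qed

lemma locally_integrable_continuous:
  fixes F :: "'a::euclidean_space \<Rightarrow> 'b::euclidean_space"
  assumes "continuous_on UNIV F"
  shows "locally_integrable_on F A"
  unfolding locally_integrable_on_def
proof (intro allI impI)
  fix K assume K: "compact K \<and> K \<subseteq> A"
  then have Kb: "K \<in> sets borel" by (simp add: borel_compact)
  have "represents K (\<lambda>x. indicator K x *\<^sub>R F x) F"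
    by (rule represents_indicator[OF borel_measurable_continuous_onI[OF assms] Kb]) simp
  moreover have "integrable lborel (\<lambda>x. indicator K x *\<^sub>R F x)"
    using K assms by (intro borel_integrable_compact) (auto intro: continuous_on_subset)
  ultimately show "integrable (lebesgue_on K) F"
    using represents_integrable_integral(1)[OF Kb] by blast
qed

text \<open>The open set is exhausted by compact sets, and the truncations to them are measurable
  and converge pointwise.\<close>

lemma locally_integrable_measurable:
  fixes F :: "'a::euclidean_space \<Rightarrow> 'b::euclidean_space"
  assumes "open A" "locally_integrable_on F A"
  shows "F \<in> borel_measurable (lebesgue_on A)"
proof -
  obtain C where C: "\<And>n. compact (C n)" "\<And>n. C n \<subseteq> A" "\<And>n. C n \<subseteq> interior (C (Suc n))" "\<Union>(range C) = A"
    using open_Union_compact_subsets[OF assms(1)] by metis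
  have "(\<lambda>x. if x \<in> A then F x else 0) \<in> borel_measurable lebesgue"
  proof (rule borel_measurable_LIMSEQ_metric)
    fix n
    have "C n \<in> sets lebesgue" using C(1)[of n] by (simp add: borel_compact)
    moreover have "integrable (lebesgue_on (C n)) F"
      using assms(2) C(1,2) by (auto simp: locally_integrable_on_def)
    ultimately show "(\<lambda>x. if x \<in> C n then F x else 0) \<in> borel_measurable lebesgue"
      by (intro borel_measurable_if_I) auto
  next
    fix x
    show "(\<lambda>n. if x \<in> C n then F x else 0) \<longlonglongrightarrow> (if x \<in> A then F x else 0)"
    proof (cases "x \<in> A")
      case True
      then obtain m where m: "x \<in> C m" using C(4) by blast
      have mono: "mono C" by (rule incseq_SucI) (use C(3) interior_subset in blast)
      have "\<forall>\<^sub>F n in sequentially. (if x \<in> C n then F x else 0) = F x"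
        unfolding eventually_sequentially using m monoD[OF mono] by (intro exI[of _ m]) auto
      then show ?thesis using True by (simp add: tendsto_eventually)
    next
      case False
      then have "x \<notin> C n" for n using C(2) by blast
      then show ?thesis using False by simp
    qed
  qed
  then show ?thesis by (rule borel_measurable_if_D)
qed

lemma weak_gradient_on_smooth:
  assumes "smooth \<phi>" "open A"
  shows "weak_gradient_on A \<phi> (gradient \<phi>)"
  unfolding weak_gradient_on_def
proof (intro conjI ballI)
  show "locally_integrable_on \<phi> A" "locally_integrable_on (gradient \<phi>) A"
    by (intro locally_integrable_continuous smooth_continuous smooth_gradient_continuous assms)+
  fix \<psi> and i :: 'a assume \<psi>: "\<psi> \<in> test_functions A" and i: "i \<in> Basis"
  note sm = test_functions_smooth[OF \<psi>]
  have z: "\<psi> x = 0" "gradient \<psi> x = 0" if "x \<notin> A" for x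
    using test_functions_support[OF \<psi>] that by (metis subsetD)+
  have [measurable]: "\<phi> \<in> borel_measurable borel" "gradient \<phi> \<in> borel_measurable borel"
    "\<psi> \<in> borel_measurable borel" "gradient \<psi> \<in> borel_measurable borel"
    by (intro smooth_borel_measurable gradient_borel_measurable assms sm)+
  have A: "A \<in> sets borel" using assms(2) by simp
  have 1: "represents A (\<lambda>x. \<phi> x * (gradient \<psi> x \<bullet> i)) (\<lambda>x. \<phi> x * frechet_derivative \<psi> (at x) i)"
    by (rule representsI) (auto simp: frechet_derivative_eq_gradient[OF sm] z)
  have 2: "represents A (\<lambda>x. (gradient \<phi> x \<bullet> i) * \<psi> x) (\<lambda>x. (gradient \<phi> x \<bullet> i) * \<psi> x)"
    by (rule representsI) (auto simp: z)
  show "(LINT x|lebesgue_on A. \<phi> x * frechet_derivative \<psi> (at x) i) = - (LINT x|lebesgue_on A. gradient \<phi> x \<bullet> i * \<psi> x)"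
    unfolding represents_integrable_integral(2)[OF A 1] represents_integrable_integral(2)[OF A 2]
    using integral_by_parts_test[OF \<psi> assms(1), of i] by (simp add: mult.commute)
qed

lemma weak_gradient_on_sobolev0:
  assumes A: "open A" and f: "sobolev0 B f g" and eq: "AE x in lborel. x \<in> A \<longrightarrow> F x = f x"
  shows "weak_gradient_on A F g"
  unfolding weak_gradient_on_def
proof (intro conjI ballI)
  show "locally_integrable_on F A" by (rule locally_integrable_L2[OF sobolev0_L2(1)[OF f] eq])
  show "locally_integrable_on g A" by (rule locally_integrable_L2[OF sobolev0_L2(2)[OF f]]) simp
  fix \<psi> and i :: 'a assume \<psi>: "\<psi> \<in> test_functions A" and i: "i \<in> Basis"
  note sm = test_functions_smooth[OF \<psi>]
  have z: "\<psi> x = 0" "gradient \<psi> x = 0" if "x \<notin> A" for x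
    using test_functions_support[OF \<psi>] that by (metis subsetD)+
  have [measurable]: "f \<in> borel_measurable borel" "g \<in> borel_measurable borel"
    "\<psi> \<in> borel_measurable borel" "gradient \<psi> \<in> borel_measurable borel"
    by (intro smooth_borel_measurable gradient_borel_measurable sm sobolev0_measurable[OF f])+
  have Ab: "A \<in> sets borel" using A by simp
  have 1: "represents A (\<lambda>x. f x * (gradient \<psi> x \<bullet> i)) (\<lambda>x. F x * frechet_derivative \<psi> (at x) i)"
  proof (rule representsI)
    show "AE x in lborel. x \<in> A \<longrightarrow> F x * frechet_derivative \<psi> (at x) i = f x * (gradient \<psi> x \<bullet> i)"
      using eq by eventually_elim (simp add: frechet_derivative_eq_gradient[OF sm])
    show "AE x in lborel. x \<notin> A \<longrightarrow> f x * (gradient \<psi> x \<bullet> i) = 0" by (auto simp: z)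
  qed measurable
  have 2: "represents A (\<lambda>x. (g x \<bullet> i) * \<psi> x) (\<lambda>x. (g x \<bullet> i) * \<psi> x)"
    by (rule representsI) (auto simp: z)
  show "(LINT x|lebesgue_on A. F x * frechet_derivative \<psi> (at x) i) = - (LINT x|lebesgue_on A. g x \<bullet> i * \<psi> x)"
    unfolding represents_integrable_integral(2)[OF Ab 1] represents_integrable_integral(2)[OF Ab 2]
    by (rule sobolev0_by_parts[OF f \<psi>])
qed

lemma integrable_locally_times_bounded:
  fixes F h :: "'a::euclidean_space \<Rightarrow> real"
  assumes A: "open A" and F: "locally_integrable_on F A"
    and h: "h \<in> borel_measurable borel" "\<And>x. \<bar>h x\<bar> \<le> C" and S: "compact S" "S \<subseteq> A" "\<And>x. x \<notin> S \<Longrightarrow> h x = 0"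
  shows "integrable (lebesgue_on A) (\<lambda>x. F x * h x)"
proof -
  have Sb: "S \<in> sets borel" "A \<in> sets borel" using S(1) A by (simp_all add: borel_compact)
  have iS: "integrable (lebesgue_on S) F" using F S by (simp add: locally_integrable_on_def)
  then obtain f where f: "represents S f F"
    using represents_exists[OF Sb(1)] borel_measurable_integrable by blast
  have [measurable]: "f \<in> borel_measurable borel" "h \<in> borel_measurable borel" using f h by (auto simp: represents_def)
  have i: "integrable lborel f" using represents_integrable_integral(1)[OF Sb(1) f] iS by blast
  have "represents A (\<lambda>x. f x * h x) (\<lambda>x. F x * h x)"
  proof (rule representsI)
    show "AE x in lborel. x \<in> A \<longrightarrow> F x * h x = f x * h x"
      using represents_AE[OF f] by eventually_elim (use S(3) in auto)
    show "AE x in lborel. x \<notin> A \<longrightarrow> f x * h x = 0" using S by (auto simp: subset_iff)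
  qed measurable
  moreover have "integrable lborel (\<lambda>x. f x * h x)"
  proof (rule Bochner_Integration.integrable_bound)
    show "integrable lborel (\<lambda>x. C * f x)" using i by simp
    have C: "0 \<le> C" using h(2)[of undefined] by linarith
    show "AE x in lborel. norm (f x * h x) \<le> norm (C * f x)"
      using mult_right_mono[OF h(2) abs_ge_zero] C by (auto simp: abs_mult mult.commute)
  qed measurable
  ultimately show ?thesis using represents_integrable_integral(1)[OF Sb(2)] by blast
qed

lemma weak_gradient_on_integrable:
  assumes A: "open A" and w: "weak_gradient_on A F G" and \<psi>: "\<psi> \<in> test_functions A"
  shows "integrable (lebesgue_on A) (\<lambda>x. F x * frechet_derivative \<psi> (at x) i)"
    and "integrable (lebesgue_on A) (\<lambda>x. (G x \<bullet> i) * \<psi> x)"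
proof -
  note sm = test_functions_smooth[OF \<psi>]
  obtain S where S: "compact S" "S \<subseteq> A" "\<And>x. x \<notin> S \<Longrightarrow> \<psi> x = 0" "\<And>x. x \<notin> S \<Longrightarrow> gradient \<psi> x = 0"
    using test_functions_support[OF \<psi>] by metis
  obtain C where C: "C > 0" "\<And>x. \<bar>\<psi> x\<bar> \<le> C" "\<And>x. norm (gradient \<psi> x) \<le> C"
    using test_functions_bounded[OF \<psi>] by metis
  have [measurable]: "\<psi> \<in> borel_measurable borel" "gradient \<psi> \<in> borel_measurable borel"
    by (intro smooth_borel_measurable gradient_borel_measurable sm)+
  have "\<bar>gradient \<psi> x \<bullet> i\<bar> \<le> C * norm i" for x
    using Cauchy_Schwarz_ineq2[of "gradient \<psi> x" i] mult_right_mono[OF C(3)[of x] norm_ge_zero[of i]] by linarith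
  then show "integrable (lebesgue_on A) (\<lambda>x. F x * frechet_derivative \<psi> (at x) i)"
    unfolding frechet_derivative_eq_gradient[OF sm] using w
    by (intro integrable_locally_times_bounded[OF A _ _ _ S(1,2), where C="C * norm i"])
      (auto simp: weak_gradient_on_def S)
  have "locally_integrable_on (\<lambda>x. G x \<bullet> i) A"
    using w by (auto simp: weak_gradient_on_def locally_integrable_on_def)
  then show "integrable (lebesgue_on A) (\<lambda>x. (G x \<bullet> i) * \<psi> x)"
    by (intro integrable_locally_times_bounded[OF A _ _ C(2) S(1,2)]) (auto simp: S)
qed

lemma weak_gradient_on_diff:
  assumes A: "open A" and w: "weak_gradient_on A F G" "weak_gradient_on A F' G'"
  shows "weak_gradient_on A (\<lambda>x. F x - F' x) (\<lambda>x. G x - G' x)"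
  unfolding weak_gradient_on_def
proof (intro conjI ballI)
  show "locally_integrable_on (\<lambda>x. F x - F' x) A" "locally_integrable_on (\<lambda>x. G x - G' x) A"
    using w by (auto simp: weak_gradient_on_def locally_integrable_on_def)
  fix \<psi> and i :: 'a assume \<psi>: "\<psi> \<in> test_functions A" and i: "i \<in> Basis"
  note I = weak_gradient_on_integrable[OF A w(1) \<psi>, of i] weak_gradient_on_integrable[OF A w(2) \<psi>, of i]
  have "(LINT x|lebesgue_on A. F x * frechet_derivative \<psi> (at x) i) = - (LINT x|lebesgue_on A. (G x \<bullet> i) * \<psi> x)"
    "(LINT x|lebesgue_on A. F' x * frechet_derivative \<psi> (at x) i) = - (LINT x|lebesgue_on A. (G' x \<bullet> i) * \<psi> x)"
    using w \<psi> i by (auto simp: weak_gradient_on_def)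
  with I show "(LINT x|lebesgue_on A. (F x - F' x) * frechet_derivative \<psi> (at x) i)
    = - (LINT x|lebesgue_on A. ((G x - G' x) \<bullet> i) * \<psi> x)"
    by (simp add: left_diff_distrib inner_diff_left)
qed

lemma weak_gradient_on_unique:
  assumes A: "open A" and w: "weak_gradient_on A F G" "weak_gradient_on A F G'"
  shows "AE x in lborel. x \<in> A \<longrightarrow> G x = G' x"
proof -
  define H where "H x = G x - G' x" for x
  have wH: "weak_gradient_on A (\<lambda>x. 0) H"
    using weak_gradient_on_diff[OF A w] by (simp add: H_def[abs_def])
  have Ab: "A \<in> sets borel" using A by simp
  have li: "locally_integrable_on H A" using wH by (simp add: weak_gradient_on_def)
  obtain h where h: "represents A h H"
    using represents_exists[OF Ab locally_integrable_measurable[OF A li]] by blast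
  have [measurable]: "h \<in> borel_measurable borel" using h by (simp add: represents_def)
  have "AE x in lborel. x \<in> A \<longrightarrow> h x \<bullet> i = 0" if i: "i \<in> Basis" for i
  proof (rule AE_eq_0_of_test[OF A])
    show "(\<lambda>x. h x \<bullet> i) \<in> borel_measurable borel" by measurable
    show "integrable lborel (\<lambda>x. indicator K x * (h x \<bullet> i))" if K: "compact K" "K \<subseteq> A" for K
    proof -
      have Kb: "K \<in> sets borel" using K by (simp add: borel_compact)
      have "represents K (\<lambda>x. indicator K x *\<^sub>R h x) H"
        by (rule represents_indicator) (use Kb represents_AE[OF h] K in \<open>auto elim!: eventually_mono\<close>)
      moreover have "integrable (lebesgue_on K) H" using li K by (simp add: locally_integrable_on_def)
      ultimately have "integrable lborel (\<lambda>x. indicator K x *\<^sub>R h x)"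
        using represents_integrable_integral(1)[OF Kb] by blast
      then have "integrable lborel (\<lambda>x. (indicator K x *\<^sub>R h x) \<bullet> i)" by (rule integrable_inner_left)
      then show ?thesis by simp
    qed
    fix \<psi> assume \<psi>: "\<psi> \<in> test_functions A"
    have [measurable]: "\<psi> \<in> borel_measurable borel"
      by (rule smooth_borel_measurable[OF test_functions_smooth[OF \<psi>]])
    have "represents A (\<lambda>x. (h x \<bullet> i) * \<psi> x) (\<lambda>x. (H x \<bullet> i) * \<psi> x)"
    proof (rule representsI)
      show "AE x in lborel. x \<in> A \<longrightarrow> (H x \<bullet> i) * \<psi> x = (h x \<bullet> i) * \<psi> x"
        using represents_AE[OF h] by eventually_elim auto
      show "AE x in lborel. x \<notin> A \<longrightarrow> (h x \<bullet> i) * \<psi> x = 0"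
        using represents_outside[OF h] by eventually_elim auto
    qed measurable
    from represents_integrable_integral(2)[OF Ab this]
    show "(LBINT x. (h x \<bullet> i) * \<psi> x) = 0"
      using wH \<psi> i by (simp add: weak_gradient_on_def)
  qed
  then have "AE x in lborel. \<forall>i\<in>Basis. x \<in> A \<longrightarrow> h x \<bullet> i = 0" by (intro AE_finite_allI) auto
  then show ?thesis using represents_AE[OF h]
  proof eventually_elim
    case (elim x)
    show ?case
    proof
      assume "x \<in> A"
      then have "h x \<bullet> i = 0" if "i \<in> Basis" for i using elim(1) that by blast
      then have "h x = 0" by (rule euclidean_eqI[where y=0, unfolded inner_zero_left])
      then show "G x = G' x" using elim(2) \<open>x \<in> A\<close> by (simp add: H_def)
    qed
  qed
qed

text \<open>This makes the arbitrary choice in \<open>grad\<close> computable: every explicit weak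
  gradient agrees with it almost everywhere on A.\<close>

lemma grad_unique:
  assumes "open A" "weak_gradient_on A F G"
  shows "AE x in lborel. x \<in> A \<longrightarrow> grad A F x = G x"
proof -
  have "weak_gradient_on A F (grad A F)" unfolding grad_def by (rule someI[of _ G]) (rule assms(2))
  then show ?thesis by (rule weak_gradient_on_unique[OF assms(1) _ assms(2)])
qed

lemma grad_sobolev0:
  assumes "open A" "sobolev0 B f g" "AE x in lborel. x \<in> A \<longrightarrow> F x = f x"
  shows "AE x in lborel. x \<in> A \<longrightarrow> grad A F x = g x"
  by (rule grad_unique[OF assms(1) weak_gradient_on_sobolev0[OF assms]])

section \<open>The Sobolev norm in terms of Borel representatives\<close>

lemma H1_norm_smooth_diff:
  assumes A: "open A" and w: "weak_gradient_on A F G" and f: "represents A f F" and g: "represents A g G"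
    and \<phi>: "smooth \<phi>"
  shows "H1_norm A (\<lambda>x. \<phi> x - F x) = sqrt ((LBINT x. (norm (indicator A x *\<^sub>R \<phi> x - f x))\<^sup>2)
    + (LBINT x. (norm (indicator A x *\<^sub>R gradient \<phi> x - g x))\<^sup>2))"
proof -
  have Ab: "A \<in> sets borel" using A by simp
  have [measurable]: "f \<in> borel_measurable borel" "g \<in> borel_measurable borel"
    "\<phi> \<in> borel_measurable borel" "gradient \<phi> \<in> borel_measurable borel" "A \<in> sets borel"
    using f g Ab smooth_borel_measurable[OF \<phi>] gradient_borel_measurable[OF \<phi>] by (auto simp: represents_def)
  have 1: "represents A (\<lambda>x. (norm (indicator A x *\<^sub>R \<phi> x - f x))\<^sup>2) (\<lambda>x. (\<phi> x - F x)\<^sup>2)"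
  proof (rule representsI)
    show "AE x in lborel. x \<in> A \<longrightarrow> (\<phi> x - F x)\<^sup>2 = (norm (indicator A x *\<^sub>R \<phi> x - f x))\<^sup>2"
      using represents_AE[OF f] by eventually_elim auto
    show "AE x in lborel. x \<notin> A \<longrightarrow> (norm (indicator A x *\<^sub>R \<phi> x - f x))\<^sup>2 = 0"
      using represents_outside[OF f] by eventually_elim auto
  qed measurable
  have 2: "represents A (\<lambda>x. (norm (indicator A x *\<^sub>R gradient \<phi> x - g x))\<^sup>2) (\<lambda>x. (norm (grad A (\<lambda>x. \<phi> x - F x) x))\<^sup>2)"
  proof (rule representsI)
    show "AE x in lborel. x \<in> A \<longrightarrow> (norm (grad A (\<lambda>x. \<phi> x - F x) x))\<^sup>2 = (norm (indicator A x *\<^sub>R gradient \<phi> x - g x))\<^sup>2"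
      using represents_AE[OF g] grad_unique[OF A weak_gradient_on_diff[OF A weak_gradient_on_smooth[OF \<phi> A] w]]
      by eventually_elim auto
    show "AE x in lborel. x \<notin> A \<longrightarrow> (norm (indicator A x *\<^sub>R gradient \<phi> x - g x))\<^sup>2 = 0"
      using represents_outside[OF g] by eventually_elim auto
  qed measurable
  show ?thesis unfolding H1_norm_def
    by (simp only: represents_integrable_integral(2)[OF Ab 1] represents_integrable_integral(2)[OF Ab 2])
qed

text \<open>Separates convergence in the norm into two L2 limits of functions extended by zero, the
  form used by \<open>L2_lim\<close>.\<close>

lemma H1_norm_tendsto_iff:
  assumes A: "open A" and w: "weak_gradient_on A F G" and f: "represents A f F" and g: "represents A g G"
    and \<phi>: "\<And>n. smooth (\<phi> n)"
  shows "(\<lambda>n. H1_norm A (\<lambda>x. \<phi> n x - F x)) \<longlonglongrightarrow> 0 \<longleftrightarrow>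
    (\<lambda>n. \<integral>x. (norm (indicator A x *\<^sub>R \<phi> n x - f x))\<^sup>2 \<partial>lborel) \<longlonglongrightarrow> 0 \<and>
    (\<lambda>n. \<integral>x. (norm (indicator A x *\<^sub>R gradient (\<phi> n) x - g x))\<^sup>2 \<partial>lborel) \<longlonglongrightarrow> 0"
proof -
  define a where "a n = (LBINT x. (norm (indicator A x *\<^sub>R \<phi> n x - f x))\<^sup>2)" for n
  define b where "b n = (LBINT x. (norm (indicator A x *\<^sub>R gradient (\<phi> n) x - g x))\<^sup>2)" for n
  have ab: "a n \<ge> 0" "b n \<ge> 0" for n by (simp_all add: a_def b_def)
  have eq: "H1_norm A (\<lambda>x. \<phi> n x - F x) = sqrt (a n + b n)" for n
    unfolding a_def b_def by (rule H1_norm_smooth_diff[OF A w f g \<phi>])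
  have "(\<lambda>n. sqrt (a n + b n)) \<longlonglongrightarrow> 0 \<longleftrightarrow> a \<longlonglongrightarrow> 0 \<and> b \<longlonglongrightarrow> 0"
  proof
    assume "(\<lambda>n. sqrt (a n + b n)) \<longlonglongrightarrow> 0"
    from tendsto_power[OF this, of 2] have s: "(\<lambda>n. a n + b n) \<longlonglongrightarrow> 0" using ab by simp
    have "a \<longlonglongrightarrow> 0" by (rule tendsto_sandwich[OF _ _ tendsto_const s]) (use ab in auto)
    moreover have "b \<longlonglongrightarrow> 0" by (rule tendsto_sandwich[OF _ _ tendsto_const s]) (use ab in auto)
    ultimately show "a \<longlonglongrightarrow> 0 \<and> b \<longlonglongrightarrow> 0" ..
  next
    assume "a \<longlonglongrightarrow> 0 \<and> b \<longlonglongrightarrow> 0"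
    then have "(\<lambda>n. sqrt (a n + b n)) \<longlonglongrightarrow> sqrt (0 + 0)" by (intro tendsto_intros) auto
    then show "(\<lambda>n. sqrt (a n + b n)) \<longlonglongrightarrow> 0" by simp
  qed
  then show ?thesis unfolding eq a_def b_def .
qed

lemma H1E:
  assumes A: "open A" and F: "F \<in> H1 A"
  obtains f g where "represents A f F" "represents A g (grad A F)" "L2 f" "L2 g" "weak_gradient_on A F (grad A F)"
proof -
  have Ab: "A \<in> sets borel" using A by simp
  obtain G where G: "weak_gradient_on A F G" "square_integrable_on G A" using F by (auto simp: H1_def)
  have sF: "square_integrable_on F A" using F by (simp add: H1_def)
  obtain f where f: "represents A f F" using represents_exists[OF Ab] sF by (auto simp: square_integrable_on_def)
  obtain g where g: "represents A g G" using represents_exists[OF Ab] G(2) by (auto simp: square_integrable_on_def)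
  have "represents A g (grad A F)"
  proof (rule representsI)
    show "g \<in> borel_measurable borel" using g by (simp add: represents_def)
    show "AE x in lborel. x \<in> A \<longrightarrow> grad A F x = g x"
      using grad_unique[OF A G(1)] represents_AE[OF g] by eventually_elim auto
  qed (rule represents_outside[OF g])
  moreover have "weak_gradient_on A F (grad A F)" unfolding grad_def by (rule someI[of _ G]) (rule G(1))
  ultimately show ?thesis
    using that f square_integrable_on_iff_L2[OF Ab f] square_integrable_on_iff_L2[OF Ab g] sF G(2) by blast
qed

lemma test_functions_indicator:
  fixes \<phi> :: "'a::euclidean_space \<Rightarrow> real"
  assumes "\<phi> \<in> test_functions A"
  shows "(\<lambda>x. indicator A x *\<^sub>R \<phi> x) = \<phi>" "(\<lambda>x. indicator A x *\<^sub>R gradient \<phi> x) = gradient \<phi>"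
proof -
  obtain S where S: "S \<subseteq> A" "\<And>x. x \<notin> S \<Longrightarrow> \<phi> x = 0" "\<And>x. x \<notin> S \<Longrightarrow> gradient \<phi> x = 0"
    using test_functions_support[OF assms] by metis
  have "indicator A x *\<^sub>R \<phi> x = \<phi> x" "indicator A x *\<^sub>R gradient \<phi> x = gradient \<phi> x" for x
    using S(1) S(2)[of x] S(3)[of x] by (cases "x \<in> S"; auto simp: indicator_def)+
  then show "(\<lambda>x. indicator A x *\<^sub>R \<phi> x) = \<phi>" "(\<lambda>x. indicator A x *\<^sub>R gradient \<phi> x) = gradient \<phi>" by auto
qed

lemma H1_norm_tendsto_test_iff:
  assumes A: "open A" and w: "weak_gradient_on A F G" and f: "represents A f F" and g: "represents A g G"
    and \<phi>: "\<And>n. \<phi> n \<in> test_functions A"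
  shows "(\<lambda>n. H1_norm A (\<lambda>x. \<phi> n x - F x)) \<longlonglongrightarrow> 0 \<longleftrightarrow>
    (\<lambda>n. \<integral>x. (norm (\<phi> n x - f x))\<^sup>2 \<partial>lborel) \<longlonglongrightarrow> 0 \<and>
    (\<lambda>n. \<integral>x. (norm (gradient (\<phi> n) x - g x))\<^sup>2 \<partial>lborel) \<longlonglongrightarrow> 0"
proof -
  have ind: "indicator A x *\<^sub>R \<phi> n x = \<phi> n x" "indicator A x *\<^sub>R gradient (\<phi> n) x = gradient (\<phi> n) x" for n x
    using test_functions_indicator[OF \<phi>, THEN fun_cong] by blast+
  show ?thesis
    using H1_norm_tendsto_iff[OF A w f g, of \<phi>, OF test_functions_smooth[OF \<phi>]] by (simp only: ind)
qed

text \<open>With its converse \<open>sobolev0_H10\<close>, this lets the variational arguments run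
  in \<open>sobolev0\<close>, while competitors can be returned to the original space.\<close>

lemma H10_sobolev0:
  assumes A: "open A" and F: "F \<in> H10 A"
  obtains f g where "sobolev0 A f g" "represents A f F" "represents A g (grad A F)"
proof -
  obtain f g where fg: "represents A f F" "represents A g (grad A F)" "L2 f" "L2 g" "weak_gradient_on A F (grad A F)"
    using H1E[OF A] F by (auto simp: H10_def)
  obtain \<phi> where \<phi>: "\<And>n. \<phi> n \<in> test_functions A" "(\<lambda>n. H1_norm A (\<lambda>x. \<phi> n x - F x)) \<longlonglongrightarrow> 0"
    using F by (auto simp: H10_def)
  have "L2_lim \<phi> f \<and> L2_lim (\<lambda>n. gradient (\<phi> n)) g"
    using H1_norm_tendsto_test_iff[OF A fg(5,1,2), of \<phi>, OF \<phi>(1)] \<phi>(2)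
      fg(3,4) L2_test[OF \<phi>(1)] L2_gradient_test[OF \<phi>(1)] unfolding L2_lim_def by blast
  then have "sobolev0 A f g" using \<phi>(1) unfolding sobolev0_def by blast
  then show ?thesis using that fg by blast
qed

lemma sobolev0_H10:
  assumes A: "open A" and f: "sobolev0 A f g" and eq: "AE x in lborel. x \<in> A \<longrightarrow> F x = f x"
  shows "F \<in> H10 A"
proof -
  have Ab: "A \<in> sets borel" using A by simp
  have out: "AE x in lborel. x \<notin> A \<longrightarrow> f x = 0" "AE x in lborel. x \<notin> A \<longrightarrow> g x = 0"
    using sobolev0_AE_outside[OF f] by (auto elim!: eventually_mono)
  have rf: "represents A f F" by (rule representsI[OF sobolev0_measurable(1)[OF f] eq out(1)])
  have rg: "represents A g g" by (rule representsI[OF sobolev0_measurable(2)[OF f] _ out(2)]) simp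
  note w = weak_gradient_on_sobolev0[OF A f eq]
  have "F \<in> H1 A"
    unfolding H1_def using square_integrable_on_iff_L2[OF Ab rf] square_integrable_on_iff_L2[OF Ab rg] sobolev0_L2[OF f] w
    by blast
  moreover obtain \<phi> where \<phi>: "\<And>n. \<phi> n \<in> test_functions A" "L2_lim \<phi> f" "L2_lim (\<lambda>n. gradient (\<phi> n)) g"
    using f unfolding sobolev0_def by blast
  have "(\<lambda>n. H1_norm A (\<lambda>x. \<phi> n x - F x)) \<longlonglongrightarrow> 0"
    using H1_norm_tendsto_test_iff[OF A w rf rg, of \<phi>, OF \<phi>(1)] \<phi>(2,3) unfolding L2_lim_def by blast
  ultimately show ?thesis using \<phi>(1) unfolding H10_def by blast
qed

section \<open>Traces on spheres\<close>

text \<open>Radial projection to the sphere, the map behind \<open>sphere_measure\<close>. It is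
  constant along rays from x0, and composition with it turns integrals over the sphere into
  integrals over the ball.\<close>

definition radial :: "'a::euclidean_space \<Rightarrow> real \<Rightarrow> 'a \<Rightarrow> 'a" where
  "radial x0 r x = x0 + r *\<^sub>R sgn (x - x0)"

lemma radial_measurable [measurable]: "radial x0 r \<in> borel_measurable borel"
  unfolding radial_def[abs_def] sgn_div_norm by measurable

lemma radial_in_cball: "r \<ge> 0 \<Longrightarrow> radial x0 r x \<in> cball x0 r"
  by (simp add: radial_def dist_norm norm_sgn)

lemma radial_affine: "c > 0 \<Longrightarrow> radial x0 r ((1 - c) *\<^sub>R x0 + c *\<^sub>R x) = radial x0 r x"
proof -
  assume c: "c > 0"
  have "((1 - c) *\<^sub>R x0 + c *\<^sub>R x) - x0 = c *\<^sub>R (x - x0)" by (simp add: algebra_simps)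
  then show ?thesis using c by (simp add: radial_def sgn_scaleR)
qed

lemma sphere_measure_eq:
  "sphere_measure x0 r = density (distr (lebesgue_on (ball x0 r)) borel (radial x0 r))
     (\<lambda>_. ennreal (real DIM('a) / r))" for x0 :: "'a::euclidean_space"
proof (rule measure_eqI)
  fix X assume "X \<in> sets (sphere_measure x0 r)"
  then have "X \<in> sets (distr (lebesgue_on (ball x0 r)) borel (radial x0 r))" by (simp add: sphere_measure_def)
  then show "emeasure (sphere_measure x0 r) X
     = emeasure (density (distr (lebesgue_on (ball x0 r)) borel (radial x0 r)) (\<lambda>_. ennreal (real DIM('a) / r))) X"
    by (subst emeasure_density_const) (simp_all add: sphere_measure_def radial_def[abs_def])
qed (simp add: sphere_measure_def)

lemma radial_measurable_lebesgue_on: "radial x0 r \<in> measurable (lebesgue_on A) borel"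
  by (rule measurable_restrict_space1, rule measurable_completion) simp

lemma sphere_integrable_integral:
  fixes x0 :: "'a::euclidean_space"
  assumes r: "r > 0" and h: "h \<in> borel_measurable borel"
  shows "integrable (sphere_measure x0 r) h \<longleftrightarrow> integrable lborel (\<lambda>x. indicator (ball x0 r) x * h (radial x0 r x))"
    and "(LINT x|sphere_measure x0 r. h x)
      = real DIM('a) / r * (LBINT x. indicator (ball x0 r) x * h (radial x0 r x))"
proof -
  let ?c = "real DIM('a) / r" and ?D = "distr (lebesgue_on (ball x0 r)) borel (radial x0 r)"
  have c: "?c > 0" using r by simp
  have hD: "h \<in> borel_measurable ?D" using h by simp
  note p = radial_measurable_lebesgue_on[of x0 r "ball x0 r"]
  have hp: "(\<lambda>x. h (radial x0 r x)) \<in> borel_measurable borel" using h by measurable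
  have rep: "represents (ball x0 r) (\<lambda>x. indicator (ball x0 r) x *\<^sub>R h (radial x0 r x)) (\<lambda>x. h (radial x0 r x))"
    by (rule represents_indicator[OF hp]) simp_all
  note R = represents_integrable_integral[OF _ rep]
  have "integrable (sphere_measure x0 r) h \<longleftrightarrow> integrable ?D (\<lambda>x. ?c *\<^sub>R h x)"
    unfolding sphere_measure_eq by (rule integrable_density) (use hD c in auto)
  also have "\<dots> \<longleftrightarrow> integrable ?D h"
  proof
    assume "integrable ?D (\<lambda>x. ?c *\<^sub>R h x)"
    then have "integrable ?D (\<lambda>x. (1 / ?c) *\<^sub>R ?c *\<^sub>R h x)" by (rule integrable_scaleR_right)
    moreover have "(1 / ?c) *\<^sub>R ?c *\<^sub>R h x = h x" for x using r by simp
    ultimately show "integrable ?D h" by (simp only:)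
  qed (rule integrable_scaleR_right)
  also have "\<dots> \<longleftrightarrow> integrable (lebesgue_on (ball x0 r)) (\<lambda>x. h (radial x0 r x))"
    by (rule integrable_distr_eq[OF p h])
  finally show "integrable (sphere_measure x0 r) h \<longleftrightarrow> integrable lborel (\<lambda>x. indicator (ball x0 r) x * h (radial x0 r x))"
    using R(1) by simp
  have "(LINT x|sphere_measure x0 r. h x) = (LINT x|?D. ?c *\<^sub>R h x)"
    unfolding sphere_measure_eq by (rule integral_density) (use hD c in auto)
  also have "\<dots> = ?c * (LINT x|?D. h x)" by simp
  also have "(LINT x|?D. h x) = (LINT x|lebesgue_on (ball x0 r). h (radial x0 r x))"
    by (rule integral_distr[OF p h])
  finally show "(LINT x|sphere_measure x0 r. h x) = ?c * (LBINT x. indicator (ball x0 r) x * h (radial x0 r x))"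
    using R(2) by simp
qed

text \<open>The Jacobian t^N of the dilation is at least 1.\<close>

lemma nn_integral_affine_le:
  fixes k :: "'a::euclidean_space \<Rightarrow> ennreal"
  assumes [measurable]: "k \<in> borel_measurable borel" and t: "t \<ge> 1"
  shows "(\<integral>\<^sup>+x. k (x0 + t *\<^sub>R (x - x0)) \<partial>lborel) \<le> (\<integral>\<^sup>+x. k x \<partial>lborel)"
proof -
  have eq: "(1 - t) *\<^sub>R x0 + t *\<^sub>R x = x0 + t *\<^sub>R (x - x0)" for x by (simp add: algebra_simps)
  have "(\<integral>\<^sup>+x. k x \<partial>lborel)
      = (\<integral>\<^sup>+x. k x \<partial>density (distr lborel borel (\<lambda>x. (1 - t) *\<^sub>R x0 + t *\<^sub>R x)) (\<lambda>_. ennreal (\<bar>t\<bar> ^ DIM('a))))"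
    using lborel_affine[of t "(1 - t) *\<^sub>R x0"] t by simp
  also have "\<dots> = ennreal (\<bar>t\<bar> ^ DIM('a)) * (\<integral>\<^sup>+x. k (x0 + t *\<^sub>R (x - x0)) \<partial>lborel)"
    by (subst nn_integral_density) (simp_all add: nn_integral_distr nn_integral_cmult eq)
  also have "\<dots> \<ge> 1 * (\<integral>\<^sup>+x. k (x0 + t *\<^sub>R (x - x0)) \<partial>lborel)"
    using t by (intro mult_right_mono) (auto simp: one_le_power)
  finally show ?thesis by simp
qed

text \<open>The ray is parametrized by the dilation factor t rather than by arc length: after the
  integrals are exchanged, a fixed t acts on the whole shell by one and the same dilation.\<close>

lemma radial_increment_sq_le:
  fixes \<psi> :: "'a::euclidean_space \<Rightarrow> real"
  assumes sm: "smooth \<psi>" and b: "b \<ge> 1"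
  shows "ennreal ((\<psi> (x0 + b *\<^sub>R y) - \<psi> (x0 + y))\<^sup>2)
    \<le> (\<integral>\<^sup>+t. indicator {1..b} t * ennreal ((b - 1) * (norm y)\<^sup>2 * (norm (gradient \<psi> (x0 + t *\<^sub>R y)))\<^sup>2) \<partial>lborel)"
proof (cases "b = 1")
  case False
  then have b1: "b - 1 > 0" using b by simp
  let ?f = "\<lambda>t. indicator {1..b} t * ennreal ((b - 1) * (norm y)\<^sup>2 * (norm (gradient \<psi> (x0 + t *\<^sub>R y)))\<^sup>2)"
  have "continuous_on UNIV (\<lambda>t::real. gradient \<psi> (x0 + t *\<^sub>R y))"
    by (intro continuous_on_compose2[OF smooth_gradient_continuous[OF sm, of UNIV]] continuous_intros) auto
  then have [measurable]: "(\<lambda>t::real. gradient \<psi> (x0 + t *\<^sub>R y)) \<in> borel_measurable borel"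
    by (rule borel_measurable_continuous_onI)
  have "ennreal ((\<psi> ((x0 + y) + (b - 1) *\<^sub>R y) - \<psi> (x0 + y))\<^sup>2)
     \<le> (\<integral>\<^sup>+s. indicator {0..1} s * ennreal ((norm ((b - 1) *\<^sub>R y))\<^sup>2 * (norm (gradient \<psi> ((x0 + y) + s *\<^sub>R (b - 1) *\<^sub>R y)))\<^sup>2) \<partial>lborel)"
    by (rule test_increment_sq_le[OF sm])
  also have "(x0 + y) + (b - 1) *\<^sub>R y = x0 + b *\<^sub>R y" by (simp add: algebra_simps)
  also have "(\<integral>\<^sup>+s. indicator {0..1} s * ennreal ((norm ((b - 1) *\<^sub>R y))\<^sup>2 * (norm (gradient \<psi> ((x0 + y) + s *\<^sub>R (b - 1) *\<^sub>R y)))\<^sup>2) \<partial>lborel)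
     = (\<integral>\<^sup>+s. ennreal (b - 1) * ?f (1 + (b - 1) * s) \<partial>lborel)"
  proof (rule nn_integral_cong)
    fix s :: real
    have i: "(1 + (b - 1) * s \<in> {1..b}) \<longleftrightarrow> s \<in> {0..1}"
    proof -
      have "(b - 1) * s \<le> b - 1 \<longleftrightarrow> s \<le> 1" using mult_le_cancel_left_pos[OF b1, of s 1] by simp
      moreover have "0 \<le> (b - 1) * s \<longleftrightarrow> 0 \<le> s" using mult_le_cancel_left_pos[OF b1, of 0 s] by simp
      ultimately show ?thesis unfolding atLeastAtMost_iff by linarith
    qed
    have v: "(x0 + y) + s *\<^sub>R (b - 1) *\<^sub>R y = x0 + (1 + (b - 1) * s) *\<^sub>R y" by (simp add: algebra_simps)
    show "indicator {0..1} s * ennreal ((norm ((b - 1) *\<^sub>R y))\<^sup>2 * (norm (gradient \<psi> ((x0 + y) + s *\<^sub>R (b - 1) *\<^sub>R y)))\<^sup>2)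
      = ennreal (b - 1) * ?f (1 + (b - 1) * s)"
    proof (cases "s \<in> {0..1}")
      case True
      then have "1 + (b - 1) * s \<in> {1..b}" using i by blast
      then show ?thesis unfolding v using True b1
        by (simp add: power_mult_distrib ennreal_mult'[symmetric] power2_eq_square mult_ac)
    next
      case False
      then have "1 + (b - 1) * s \<notin> {1..b}" using i by blast
      then show ?thesis using False by simp
    qed
  qed
  also have "\<dots> = ennreal (b - 1) * (\<integral>\<^sup>+s. ?f (1 + (b - 1) * s) \<partial>lborel)"
    by (rule nn_integral_cmult) measurable
  also have "\<dots> = (\<integral>\<^sup>+t. ?f t \<partial>lborel)"
    using nn_integral_real_affine[of ?f "b - 1" 1] b1 by simp
  finally show ?thesis .
qed simp

section \<open>Functions in a thin shell inside the sphere\<close>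

lemma AE_sphere: "AE x in lborel. x \<notin> sphere (x0::'a::euclidean_space) r"
proof -
  have "sphere x0 r \<in> null_sets lebesgue" using negligible_sphere[of x0 r] by (simp add: negligible_iff_null_sets)
  then have "AE x in lebesgue. x \<notin> sphere x0 r" by (rule AE_not_in)
  then show ?thesis by (simp only: AE_completion_iff)
qed

text \<open>The square of \<sigma> has two sources, both the length \<tau> - 1 \<le> 2 \<sigma> of
  the range of dilation factors: Cauchy-Schwarz along the ray gives one factor, and integration over
  t the other.\<close>

lemma shell_gradient_le:
  fixes x0 :: "'a::euclidean_space"
  assumes sm: "smooth \<psi>" and r: "r > 0" and \<sigma>: "0 < \<sigma>" "\<sigma> \<le> 1/2"
  defines "Sh \<equiv> ball x0 r - ball x0 ((1 - \<sigma>) * r)"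
  shows "(\<integral>\<^sup>+x. indicator Sh x * ennreal ((\<psi> (radial x0 r x) - \<psi> x)\<^sup>2) \<partial>lborel)
    \<le> ennreal (4 * \<sigma>\<^sup>2 * r\<^sup>2) * (\<integral>\<^sup>+x. indicator Sh x * ennreal ((norm (gradient \<psi> x))\<^sup>2) \<partial>lborel)"
proof -
  \<comment> \<open>The largest dilation factor that carries a point of the shell to the
    sphere.\<close>
  define \<tau> where "\<tau> = 1 / (1 - \<sigma>)"
  \<comment> \<open>Dilated points may land on the sphere itself; it is a null set and is discarded
    at the end.\<close>
  define Sh' where "Sh' = cball x0 r - ball x0 ((1 - \<sigma>) * r)"
  have \<tau>: "\<tau> \<ge> 1" "\<tau> - 1 \<le> 2 * \<sigma>" using \<sigma> by (auto simp: \<tau>_def field_simps)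
  define K where "K = (\<tau> - 1) * r\<^sup>2"
  have K: "K \<ge> 0" using \<tau> by (simp add: K_def)
  define G where "G x = ennreal ((norm (gradient \<psi> x))\<^sup>2)" for x
  define Cb where "Cb = cball x0 r"
  have [measurable]: "Sh \<in> sets borel" "Sh' \<in> sets borel" "Cb \<in> sets borel" unfolding Sh_def Sh'_def Cb_def by auto
  have [measurable]: "gradient \<psi> \<in> borel_measurable borel" "\<psi> \<in> borel_measurable borel"
    using gradient_borel_measurable[OF sm] smooth_borel_measurable[OF sm] by auto
  have [measurable]: "G \<in> borel_measurable borel" unfolding G_def[abs_def] by measurable
  have "continuous_on UNIV (\<lambda>p::real \<times> 'a. x0 + fst p *\<^sub>R (snd p - x0))" by (intro continuous_intros)
  then have [measurable]: "(\<lambda>p::real \<times> 'a. x0 + fst p *\<^sub>R (snd p - x0)) \<in> borel_measurable borel"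
    by (rule borel_measurable_continuous_onI)
  have [measurable]: "(\<lambda>p::real \<times> 'a. fst p) \<in> borel_measurable borel" "(\<lambda>p::real \<times> 'a. snd p) \<in> borel_measurable borel"
    by (intro borel_measurable_continuous_onI continuous_intros)+
  have pw: "ennreal ((\<psi> (radial x0 r x) - \<psi> x)\<^sup>2)
      \<le> ennreal K * (\<integral>\<^sup>+t. indicator {1..\<tau>} t * (indicator Cb (x0 + t *\<^sub>R (x - x0)) * G (x0 + t *\<^sub>R (x - x0))) \<partial>lborel)"
    if x: "x \<in> Sh" for x
  proof -
    define y where "y = x - x0"
    have y: "norm y < r" "(1 - \<sigma>) * r \<le> norm y"
      using x by (auto simp: Sh_def y_def dist_norm norm_minus_commute)
    have "(1 - \<sigma>) * r > 0" using \<sigma> r by simp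
    then have y0: "norm y > 0" using y(2) by linarith
    define b where "b = r / norm y"
    have b1: "b \<ge> 1" using y y0 by (simp add: b_def)
    have b2: "b \<le> \<tau>" using y y0 \<sigma> r by (simp add: b_def \<tau>_def field_simps)
    have rad: "radial x0 r x = x0 + b *\<^sub>R y" "x = x0 + y"
      by (simp_all add: radial_def b_def y_def sgn_div_norm divide_inverse)
    have "ennreal ((\<psi> (radial x0 r x) - \<psi> x)\<^sup>2)
      \<le> (\<integral>\<^sup>+t. indicator {1..b} t * ennreal ((b - 1) * (norm y)\<^sup>2 * (norm (gradient \<psi> (x0 + t *\<^sub>R y)))\<^sup>2) \<partial>lborel)"
      unfolding rad(1) using radial_increment_sq_le[OF sm b1, of x0 y] rad(2) by simp
    also have "\<dots> \<le> (\<integral>\<^sup>+t. ennreal K * (indicator {1..\<tau>} t * (indicator Cb (x0 + t *\<^sub>R y) * G (x0 + t *\<^sub>R y))) \<partial>lborel)"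
    proof (rule nn_integral_mono)
      fix t :: real
      show "indicator {1..b} t * ennreal ((b - 1) * (norm y)\<^sup>2 * (norm (gradient \<psi> (x0 + t *\<^sub>R y)))\<^sup>2)
        \<le> ennreal K * (indicator {1..\<tau>} t * (indicator Cb (x0 + t *\<^sub>R y) * G (x0 + t *\<^sub>R y)))"
      proof (cases "t \<in> {1..b}")
        case True
        have "t * norm y \<le> b * norm y" using True by (intro mult_right_mono) auto
        then have "t * norm y \<le> r" using y0 by (simp add: b_def)
        then have in_C: "x0 + t *\<^sub>R y \<in> Cb" using True by (simp add: Cb_def dist_norm)
        have "(b - 1) * (norm y)\<^sup>2 \<le> K" unfolding K_def
          using b1 b2 y by (intro mult_mono power_mono) auto
        then have "(b - 1) * (norm y)\<^sup>2 * (norm (gradient \<psi> (x0 + t *\<^sub>R y)))\<^sup>2 \<le> K * (norm (gradient \<psi> (x0 + t *\<^sub>R y)))\<^sup>2"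
          by (rule mult_right_mono) simp
        then have "ennreal ((b - 1) * (norm y)\<^sup>2 * (norm (gradient \<psi> (x0 + t *\<^sub>R y)))\<^sup>2)
          \<le> ennreal K * G (x0 + t *\<^sub>R y)"
          unfolding G_def ennreal_mult[OF K zero_le_power2, symmetric] by (rule ennreal_leI)
        then show ?thesis using True b2 in_C by simp
      qed simp
    qed
    also have "\<dots> = ennreal K * (\<integral>\<^sup>+t. indicator {1..\<tau>} t * (indicator Cb (x0 + t *\<^sub>R y) * G (x0 + t *\<^sub>R y)) \<partial>lborel)"
      by (rule nn_integral_cmult) measurable
    finally show ?thesis by (simp add: y_def)
  qed
  have "(\<integral>\<^sup>+x. indicator Sh x * ennreal ((\<psi> (radial x0 r x) - \<psi> x)\<^sup>2) \<partial>lborel)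
    \<le> (\<integral>\<^sup>+x. ennreal K * (\<integral>\<^sup>+t. indicator Sh x * (indicator {1..\<tau>} t * (indicator Cb (x0 + t *\<^sub>R (x - x0)) * G (x0 + t *\<^sub>R (x - x0)))) \<partial>lborel) \<partial>lborel)"
  proof (rule nn_integral_mono)
    fix x
    show "indicator Sh x * ennreal ((\<psi> (radial x0 r x) - \<psi> x)\<^sup>2)
      \<le> ennreal K * (\<integral>\<^sup>+t. indicator Sh x * (indicator {1..\<tau>} t * (indicator Cb (x0 + t *\<^sub>R (x - x0)) * G (x0 + t *\<^sub>R (x - x0)))) \<partial>lborel)"
      using pw[of x] by (cases "x \<in> Sh") auto
  qed
  also have "\<dots> = ennreal K * (\<integral>\<^sup>+x. (\<integral>\<^sup>+t. indicator Sh x * (indicator {1..\<tau>} t * (indicator Cb (x0 + t *\<^sub>R (x - x0)) * G (x0 + t *\<^sub>R (x - x0)))) \<partial>lborel) \<partial>lborel)"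
    by (rule nn_integral_cmult) measurable
  also have "(\<integral>\<^sup>+x. (\<integral>\<^sup>+t. indicator Sh x * (indicator {1..\<tau>} t * (indicator Cb (x0 + t *\<^sub>R (x - x0)) * G (x0 + t *\<^sub>R (x - x0)))) \<partial>lborel) \<partial>lborel)
    = (\<integral>\<^sup>+t. (\<integral>\<^sup>+x. indicator Sh x * (indicator {1..\<tau>} t * (indicator Cb (x0 + t *\<^sub>R (x - x0)) * G (x0 + t *\<^sub>R (x - x0)))) \<partial>lborel) \<partial>lborel)"
    by (rule lborel_pair.Fubini') (unfold lborel_prod case_prod_beta', measurable)
  also have "\<dots> \<le> (\<integral>\<^sup>+t. indicator {1..\<tau>} t * (\<integral>\<^sup>+x. indicator Sh' x * G x \<partial>lborel) \<partial>lborel)"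
  proof (rule nn_integral_mono)
    fix t :: real
    show "(\<integral>\<^sup>+x. indicator Sh x * (indicator {1..\<tau>} t * (indicator Cb (x0 + t *\<^sub>R (x - x0)) * G (x0 + t *\<^sub>R (x - x0)))) \<partial>lborel)
      \<le> indicator {1..\<tau>} t * (\<integral>\<^sup>+x. indicator Sh' x * G x \<partial>lborel)"
    proof (cases "t \<in> {1..\<tau>}")
      case True
      have "(\<integral>\<^sup>+x. indicator Sh x * (indicator Cb (x0 + t *\<^sub>R (x - x0)) * G (x0 + t *\<^sub>R (x - x0))) \<partial>lborel)
        \<le> (\<integral>\<^sup>+x. indicator Sh' (x0 + t *\<^sub>R (x - x0)) * G (x0 + t *\<^sub>R (x - x0)) \<partial>lborel)"
      proof (rule nn_integral_mono)
        fix x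
        have "x0 + t *\<^sub>R (x - x0) \<in> Sh'" if "x \<in> Sh" "x0 + t *\<^sub>R (x - x0) \<in> Cb"
        proof -
          have "(1 - \<sigma>) * r \<le> norm (x - x0)" using that(1) by (simp add: Sh_def dist_norm norm_minus_commute)
          also have "\<dots> \<le> t * norm (x - x0)" using True mult_right_mono[of 1 t "norm (x - x0)"] by simp
          finally show ?thesis using that(2) True by (simp add: Sh'_def Cb_def dist_norm)
        qed
        then show "indicator Sh x * (indicator Cb (x0 + t *\<^sub>R (x - x0)) * G (x0 + t *\<^sub>R (x - x0)))
          \<le> indicator Sh' (x0 + t *\<^sub>R (x - x0)) * G (x0 + t *\<^sub>R (x - x0))"
          by (auto simp: indicator_def)
      qed
      also have "\<dots> \<le> (\<integral>\<^sup>+x. indicator Sh' x * G x \<partial>lborel)"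
        by (rule nn_integral_affine_le[of "\<lambda>x. indicator Sh' x * G x"]) (use True in auto)
      finally show ?thesis using True by simp
    qed simp
  qed
  also have "\<dots> = ennreal (\<tau> - 1) * (\<integral>\<^sup>+x. indicator Sh' x * G x \<partial>lborel)"
    using \<tau>(1) by (simp add: nn_integral_multc)
  also have "(\<integral>\<^sup>+x. indicator Sh' x * G x \<partial>lborel) = (\<integral>\<^sup>+x. indicator Sh x * G x \<partial>lborel)"
  proof (rule nn_integral_cong_AE)
    show "AE x in lborel. indicator Sh' x * G x = indicator Sh x * G x"
      using AE_sphere[of x0 r]
      by eventually_elim (auto simp: Sh_def Sh'_def indicator_def)
  qed
  finally have "(\<integral>\<^sup>+x. indicator Sh x * ennreal ((\<psi> (radial x0 r x) - \<psi> x)\<^sup>2) \<partial>lborel)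
    \<le> ennreal K * (ennreal (\<tau> - 1) * (\<integral>\<^sup>+x. indicator Sh x * G x \<partial>lborel))"
    by (simp add: mult_left_mono)
  also have "\<dots> = ennreal (K * (\<tau> - 1)) * (\<integral>\<^sup>+x. indicator Sh x * G x \<partial>lborel)"
    using K \<tau> by (simp add: ennreal_mult mult.assoc)
  also have "\<dots> \<le> ennreal (4 * \<sigma>\<^sup>2 * r\<^sup>2) * (\<integral>\<^sup>+x. indicator Sh x * G x \<partial>lborel)"
  proof (intro mult_right_mono ennreal_leI)
    have "(\<tau> - 1)\<^sup>2 \<le> (2 * \<sigma>)\<^sup>2" using \<tau> by (intro power_mono) auto
    then have "(\<tau> - 1)\<^sup>2 * r\<^sup>2 \<le> (2 * \<sigma>)\<^sup>2 * r\<^sup>2" by (rule mult_right_mono) simp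
    then show "K * (\<tau> - 1) \<le> 4 * \<sigma>\<^sup>2 * r\<^sup>2" by (simp add: K_def power2_eq_square mult_ac)
  qed simp
  finally show ?thesis unfolding G_def .
qed


lemma integrable_indicator_bounded:
  fixes h :: "'a::euclidean_space \<Rightarrow> 'b::euclidean_space"
  assumes [measurable]: "h \<in> borel_measurable borel" "S \<in> sets borel"
    and S: "bounded S" and b: "\<And>x. x \<in> S \<Longrightarrow> norm (h x) \<le> C"
  shows "integrable lborel (\<lambda>x. indicator S x *\<^sub>R h x)"
proof (rule Bochner_Integration.integrable_bound)
  show "integrable lborel (\<lambda>x. C * indicator S x)"
    using emeasure_bounded_finite[OF S] by (intro integrable_mult_right integrable_real_indicator) auto
  show "AE x in lborel. norm (indicator S x *\<^sub>R h x) \<le> norm (C * indicator S x)"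
  proof (rule AE_I2)
    fix x show "norm (indicator S x *\<^sub>R h x) \<le> norm (C * indicator S x)"
      using b[of x] by (cases "x \<in> S") auto
  qed
qed measurable

lemma smooth_bounded_on_compact:
  assumes "smooth \<psi>" "compact C"
  obtains M where "\<And>x. x \<in> C \<Longrightarrow> \<bar>\<psi> x\<bar> \<le> M" "\<And>x. x \<in> C \<Longrightarrow> norm (gradient \<psi> x) \<le> M" "M \<ge> 0"
proof -
  have "bounded (\<psi> ` C)" "bounded (gradient \<psi> ` C)"
    by (intro compact_imp_bounded compact_continuous_image assms smooth_continuous smooth_gradient_continuous)+
  then obtain a b where ab: "\<forall>x\<in>C. norm (\<psi> x) \<le> a" "\<forall>x\<in>C. norm (gradient \<psi> x) \<le> b"
    unfolding bounded_iff by auto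
  show ?thesis by (rule that[of "\<bar>a\<bar> + \<bar>b\<bar>"]) (use ab in force)+
qed

text \<open>Inside the shell \<psi> is compared with its value at the radial projection. The latter
  is constant along rays, so the integral of its square over the shell is the fraction 1 - (1 -
  \<sigma>)^N \<le> N \<sigma> of that over the ball, which is r/N times the sphere
  integral.\<close>

lemma shell_estimate:
  fixes x0 :: "'a::euclidean_space"
  assumes sm: "smooth \<psi>" and r: "r > 0" and \<sigma>: "0 < \<sigma>" "\<sigma> \<le> 1/2"
  defines "Sh \<equiv> ball x0 r - ball x0 ((1 - \<sigma>) * r)"
  shows "(LBINT x. indicator Sh x * (\<psi> x)\<^sup>2)
    \<le> 2 * \<sigma> * r * (LINT x|sphere_measure x0 r. (\<psi> x)\<^sup>2)
      + 8 * \<sigma>\<^sup>2 * r\<^sup>2 * (LBINT x. indicator Sh x * (norm (gradient \<psi> x))\<^sup>2)"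
proof -
  define B where "B = ball x0 r"
  define B' where "B' = ball x0 ((1 - \<sigma>) * r)"
  have Sh: "Sh = B - B'" by (simp add: Sh_def B_def B'_def)
  have sub: "B' \<subseteq> B" unfolding B_def B'_def by (rule subset_ball) (use \<sigma> r in simp)
  have [measurable]: "B \<in> sets borel" "B' \<in> sets borel" "Sh \<in> sets borel" unfolding Sh by (auto simp: B_def B'_def)
  have bd: "bounded B" "bounded B'" "bounded Sh" by (auto simp: Sh B_def B'_def intro: bounded_diff)
  have [measurable]: "gradient \<psi> \<in> borel_measurable borel" "\<psi> \<in> borel_measurable borel"
    using gradient_borel_measurable[OF sm] smooth_borel_measurable[OF sm] by auto
  obtain M where M: "\<And>x. x \<in> cball x0 r \<Longrightarrow> \<bar>\<psi> x\<bar> \<le> M" "\<And>x. x \<in> cball x0 r \<Longrightarrow> norm (gradient \<psi> x) \<le> M" "M \<ge> 0"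
    by (rule smooth_bounded_on_compact[OF sm compact_cball[of x0 r]]) (rule that)
  have Mr: "\<bar>\<psi> (radial x0 r x)\<bar> \<le> M" for x
    using radial_in_cball[of r x0 x] r by (intro M(1)) auto
  have SC: "x \<in> cball x0 r" if "x \<in> Sh" for x using that by (auto simp: Sh B_def)
  define H where "H x = (\<psi> (radial x0 r x))\<^sup>2" for x
  have [measurable]: "H \<in> borel_measurable borel" unfolding H_def[abs_def] by measurable
  have Hb: "norm (H x) \<le> M\<^sup>2" for x
    using power_mono[OF Mr abs_ge_zero, of x 2] by (simp add: H_def)
  have iH: "integrable lborel (\<lambda>x. indicator S x * H x)" if "S \<in> sets borel" "bounded S" for S
    using integrable_indicator_bounded[of H S "M\<^sup>2"] that Hb by simp
  define d where "d x = (\<psi> (radial x0 r x) - \<psi> x)\<^sup>2" for x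
  have [measurable]: "d \<in> borel_measurable borel" unfolding d_def[abs_def] by measurable
  have db: "norm (d x) \<le> (2 * M)\<^sup>2" if "x \<in> Sh" for x
  proof -
    have "\<bar>\<psi> (radial x0 r x) - \<psi> x\<bar> \<le> 2 * M" using M(1)[OF SC[OF that]] Mr[of x] by linarith
    from power_mono[OF this abs_ge_zero, of 2] show ?thesis by (simp add: d_def)
  qed
  have id: "integrable lborel (\<lambda>x. indicator Sh x * d x)"
    using integrable_indicator_bounded[of d Sh "(2 * M)\<^sup>2"] bd db by simp
  have ig: "integrable lborel (\<lambda>x. indicator Sh x * (norm (gradient \<psi> x))\<^sup>2)"
    using integrable_indicator_bounded[of "\<lambda>x. (norm (gradient \<psi> x))\<^sup>2" Sh "M\<^sup>2"] bd M(2)[OF SC]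
    by (simp add: power_mono)
  have i\<psi>: "integrable lborel (\<lambda>x. indicator Sh x * (\<psi> x)\<^sup>2)"
    using integrable_indicator_bounded[of "\<lambda>x. (\<psi> x)\<^sup>2" Sh "M\<^sup>2"] bd power_mono[OF M(1)[OF SC] abs_ge_zero, of _ 2]
    by simp
  have dle: "(LBINT x. indicator Sh x * d x)
    \<le> 4 * \<sigma>\<^sup>2 * r\<^sup>2 * (LBINT x. indicator Sh x * (norm (gradient \<psi> x))\<^sup>2)"
  proof -
    have 1: "(\<integral>\<^sup>+x. indicator Sh x * ennreal (d x) \<partial>lborel) = ennreal (LBINT x. indicator Sh x * d x)"
      by (subst nn_integral_eq_integral[OF id, symmetric])
        (auto intro!: nn_integral_cong simp: d_def indicator_def)
    have 2: "(\<integral>\<^sup>+x. indicator Sh x * ennreal ((norm (gradient \<psi> x))\<^sup>2) \<partial>lborel)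
      = ennreal (LBINT x. indicator Sh x * (norm (gradient \<psi> x))\<^sup>2)"
      by (subst nn_integral_eq_integral[OF ig, symmetric])
        (auto intro!: nn_integral_cong simp: indicator_def)
    have pos: "0 \<le> (LBINT x. indicator Sh x * (norm (gradient \<psi> x))\<^sup>2)" by (rule Bochner_Integration.integral_nonneg) simp
    have "ennreal (LBINT x. indicator Sh x * d x)
      \<le> ennreal (4 * \<sigma>\<^sup>2 * r\<^sup>2) * ennreal (LBINT x. indicator Sh x * (norm (gradient \<psi> x))\<^sup>2)"
      using shell_gradient_le[OF sm r \<sigma>, of x0] unfolding Sh_def[symmetric] 1[unfolded d_def] 2 d_def .
    then have "ennreal (LBINT x. indicator Sh x * d x)
      \<le> ennreal (4 * \<sigma>\<^sup>2 * r\<^sup>2 * (LBINT x. indicator Sh x * (norm (gradient \<psi> x))\<^sup>2))"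
      using pos by (simp add: ennreal_mult)
    then show ?thesis by (rule ennreal_le_iff[THEN iffD1, rotated]) (use pos in simp)
  qed
  have H_le: "(LBINT x. indicator Sh x * H x) \<le> \<sigma> * r * (LINT x|sphere_measure x0 r. (\<psi> x)\<^sup>2)"
  proof -
    let ?I = "\<integral>x. indicator B x * H x \<partial>lborel"
    have I0: "?I \<ge> 0" by (rule Bochner_Integration.integral_nonneg) (simp add: H_def)
    have L: "(LINT x|sphere_measure x0 r. (\<psi> x)\<^sup>2) = real DIM('a) / r * ?I"
      unfolding B_def H_def by (rule sphere_integrable_integral(2)[OF r]) measurable
    have c: "1 - \<sigma> > 0" using \<sigma> by simp
    have mem: "(1 - (1 - \<sigma>)) *\<^sub>R x0 + (1 - \<sigma>) *\<^sub>R x \<in> B' \<longleftrightarrow> x \<in> B" for x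
    proof -
      have "(1 - (1 - \<sigma>)) *\<^sub>R x0 + (1 - \<sigma>) *\<^sub>R x = x0 + (1 - \<sigma>) *\<^sub>R (x - x0)" by (simp add: algebra_simps)
      then show ?thesis using c by (simp add: B_def B'_def dist_norm norm_minus_commute)
    qed
    have "(LBINT x. indicator B' x * H x)
      = (1 - \<sigma>) ^ DIM('a) * (LBINT x. indicator B' ((1 - (1 - \<sigma>)) *\<^sub>R x0 + (1 - \<sigma>) *\<^sub>R x)
            * H ((1 - (1 - \<sigma>)) *\<^sub>R x0 + (1 - \<sigma>) *\<^sub>R x))"
      by (rule integral_affine[OF _ c]) measurable
    also have "(\<lambda>x. indicator B' ((1 - (1 - \<sigma>)) *\<^sub>R x0 + (1 - \<sigma>) *\<^sub>R x) * H ((1 - (1 - \<sigma>)) *\<^sub>R x0 + (1 - \<sigma>) *\<^sub>R x))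
      = (\<lambda>x. indicator B x * H x)"
    proof
      fix x
      have "H ((1 - (1 - \<sigma>)) *\<^sub>R x0 + (1 - \<sigma>) *\<^sub>R x) = H x"
        unfolding H_def by (simp only: radial_affine[OF c])
      moreover have "indicator B' ((1 - (1 - \<sigma>)) *\<^sub>R x0 + (1 - \<sigma>) *\<^sub>R x) = (indicator B x :: real)"
        using mem[of x] by (simp only: indicator_def)
      ultimately show "indicator B' ((1 - (1 - \<sigma>)) *\<^sub>R x0 + (1 - \<sigma>) *\<^sub>R x) * H ((1 - (1 - \<sigma>)) *\<^sub>R x0 + (1 - \<sigma>) *\<^sub>R x)
        = indicator B x * H x" by simp
    qed
    finally have B': "(LBINT x. indicator B' x * H x) = (1 - \<sigma>) ^ DIM('a) * ?I" .
    have "indicator Sh x * H x = indicator B x * H x - indicator B' x * H x" for x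
      using sub by (auto simp: Sh indicator_def)
    then have "(LBINT x. indicator Sh x * H x) = ?I - (1 - \<sigma>) ^ DIM('a) * ?I"
      using iH bd by (simp add: B'[symmetric])
    also have "\<dots> = (1 - (1 - \<sigma>) ^ DIM('a)) * ?I" by (simp add: algebra_simps)
    also have "\<dots> \<le> (real DIM('a) * \<sigma>) * ?I"
      using Bernoulli_inequality[of "- \<sigma>" "DIM('a)"] \<sigma> I0 by (intro mult_right_mono) auto
    also have "\<dots> = \<sigma> * r * (LINT x|sphere_measure x0 r. (\<psi> x)\<^sup>2)" using r by (simp add: L)
    finally show ?thesis .
  qed
  have "(LBINT x. indicator Sh x * (\<psi> x)\<^sup>2) \<le> (LBINT x. 2 * (indicator Sh x * H x) + 2 * (indicator Sh x * d x))"
  proof (rule integral_mono)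
    show "integrable lborel (\<lambda>x. 2 * (indicator Sh x * H x) + 2 * (indicator Sh x * d x))"
      using id iH bd by simp
    fix x
    have "(\<psi> x)\<^sup>2 \<le> 2 * H x + 2 * d x"
      using norm_diff_sq_le[of "\<psi> (radial x0 r x)" "\<psi> (radial x0 r x) - \<psi> x"] by (simp add: H_def d_def)
    then show "indicator Sh x * (\<psi> x)\<^sup>2 \<le> 2 * (indicator Sh x * H x) + 2 * (indicator Sh x * d x)"
      by (simp add: indicator_def)
  qed (rule i\<psi>)
  also have "\<dots> = 2 * (LBINT x. indicator Sh x * H x) + 2 * (LBINT x. indicator Sh x * d x)"
    using id iH bd by simp
  finally show ?thesis using H_le dle by linarith
qed

text \<open>Equal to 1 for \<open>\<bar>x - x\<^sub>0\<bar> \<le> (1 - \<sigma>) r\<close>, equal to 0 near the sphere of radius \<open>r\<close>, with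
  gradient of size \<open>1 / (\<sigma> r)\<close>.\<close>

definition shell_cutoff :: "'a::euclidean_space \<Rightarrow> real \<Rightarrow> real \<Rightarrow> 'a \<Rightarrow> real" where
  "shell_cutoff x0 r \<sigma> x = smooth_step (2 / \<sigma> - 1 + (- 2 / (\<sigma> * r\<^sup>2)) * (norm (- x0 + 1 *\<^sub>R x))\<^sup>2)"

text \<open>All is read off from a = (2/\<sigma>) (1 - (|x - x0|/r)^2) - 1. On the inner ball 1 - (1
  - \<sigma>)^2 \<ge> 3 \<sigma>/2 forces a > 1, and off the ball a < 0. Using the square of the
  norm keeps a smooth at the centre.\<close>

lemma shell_cutoff_properties:
  assumes S': "\<And>t. (smooth_step has_real_derivative S' t) (at t)" "\<And>t. \<bar>S' t\<bar> \<le> B" "\<And>t. t < 0 \<or> t > 1 \<Longrightarrow> S' t = 0"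
    and r: "r > 0" and \<sigma>: "0 < \<sigma>" "\<sigma> \<le> 1/2"
  shows "shell_cutoff x0 r \<sigma> \<in> test_functions (ball x0 r)"
    and "x \<in> ball x0 ((1 - \<sigma>) * r) \<Longrightarrow> shell_cutoff x0 r \<sigma> x = 1"
    and "0 \<le> shell_cutoff x0 r \<sigma> x" "shell_cutoff x0 r \<sigma> x \<le> 1"
    and "norm (gradient (shell_cutoff x0 r \<sigma>) x)
      \<le> 4 * B / (\<sigma> * r) * indicator (ball x0 r - ball x0 ((1 - \<sigma>) * r)) x"
proof -
  define a where "a x = 2 / \<sigma> - 1 + (- 2 / (\<sigma> * r\<^sup>2)) * (norm (- x0 + 1 *\<^sub>R x))\<^sup>2" for x
  have cutoff_eq: "shell_cutoff x0 r \<sigma> = (\<lambda>x. smooth_step (a x))"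
    by (simp add: shell_cutoff_def[abs_def] a_def)
  have a_eq: "a x = 2 / \<sigma> * (1 - (norm (x - x0) / r)\<^sup>2) - 1" for x
    using \<sigma> r by (simp add: a_def field_simps power_divide)
  have sn: "smooth (\<lambda>x. (norm (- x0 + 1 *\<^sub>R x))\<^sup>2)" by (rule smooth_affine[OF smooth_norm_sq])
  have sa: "smooth a" unfolding a_def[abs_def] by (intro smooth_add smooth_mult smooth_const sn)
  have sm: "smooth (shell_cutoff x0 r \<sigma>)" unfolding cutoff_eq by (rule smooth_compose[OF smooth_smooth_step sa])
  have ga: "gradient a x = (- 2 / (\<sigma> * r\<^sup>2)) *\<^sub>R (2 *\<^sub>R (x - x0))"
  proof -
    have "gradient a x = gradient (\<lambda>x. (- 2 / (\<sigma> * r\<^sup>2)) * (norm (- x0 + 1 *\<^sub>R x))\<^sup>2) x"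
      unfolding a_def[abs_def]
      by (subst gradient_add[OF smooth_const smooth_mult[OF smooth_const sn]]) (simp add: gradient_const)
    also have "\<dots> = (- 2 / (\<sigma> * r\<^sup>2)) *\<^sub>R gradient (\<lambda>x. (norm (- x0 + 1 *\<^sub>R x))\<^sup>2) x" by (rule gradient_cmult[OF sn])
    also have "gradient (\<lambda>x. (norm (- x0 + 1 *\<^sub>R x))\<^sup>2) x = 2 *\<^sub>R (x - x0)"
      unfolding gradient_affine[OF smooth_norm_sq] by (simp add: gradient_norm_sq)
    finally show ?thesis .
  qed
  have gr: "gradient (shell_cutoff x0 r \<sigma>) x = S' (a x) *\<^sub>R gradient a x"
    unfolding cutoff_eq by (rule gradient_compose[OF sa S'(1)])
  have inner: "a x > 1" if "x \<in> ball x0 ((1 - \<sigma>) * r)" for x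
  proof -
    have "norm (x - x0) / r < 1 - \<sigma>" using that r by (simp add: dist_norm norm_minus_commute field_simps)
    then have "(norm (x - x0) / r)\<^sup>2 \<le> (1 - \<sigma>)\<^sup>2" using r by (intro power_mono) auto
    also have "(1 - \<sigma>)\<^sup>2 = 1 - \<sigma> * (2 - \<sigma>)" by (simp add: power2_eq_square algebra_simps)
    also have "\<dots> \<le> 1 - \<sigma> * (3/2)" using \<sigma> by (intro diff_left_mono mult_left_mono) auto
    finally have "2 / \<sigma> * (\<sigma> * (3/2)) \<le> 2 / \<sigma> * (1 - (norm (x - x0) / r)\<^sup>2)"
      using \<sigma> by (intro mult_left_mono) auto
    then show ?thesis using \<sigma> by (simp add: a_eq)
  qed
  have outer: "a x < 0" if "x \<notin> ball x0 r" for x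
  proof -
    have "1 \<le> norm (x - x0) / r" using that r by (simp add: dist_norm norm_minus_commute field_simps)
    then have "1 \<le> (norm (x - x0) / r)\<^sup>2" by simp
    then have "2 / \<sigma> * (1 - (norm (x - x0) / r)\<^sup>2) \<le> 0" using \<sigma> by (intro mult_nonneg_nonpos) auto
    then show ?thesis by (simp add: a_eq)
  qed
  show "x \<in> ball x0 ((1 - \<sigma>) * r) \<Longrightarrow> shell_cutoff x0 r \<sigma> x = 1"
    unfolding cutoff_eq by (rule smooth_step_1[OF less_imp_le[OF inner]])
  show "0 \<le> shell_cutoff x0 r \<sigma> x" "shell_cutoff x0 r \<sigma> x \<le> 1"
    unfolding cutoff_eq by (rule smooth_step_nonneg, rule smooth_step_le_1)
  show "norm (gradient (shell_cutoff x0 r \<sigma>) x)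
      \<le> 4 * B / (\<sigma> * r) * indicator (ball x0 r - ball x0 ((1 - \<sigma>) * r)) x"
  proof (cases "x \<in> ball x0 r - ball x0 ((1 - \<sigma>) * r)")
    case True
    then have n: "norm (x - x0) \<le> r" by (simp add: dist_norm norm_minus_commute)
    have "norm (gradient (shell_cutoff x0 r \<sigma>) x) = \<bar>S' (a x)\<bar> * (4 / (\<sigma> * r\<^sup>2) * norm (x - x0))"
      unfolding gr ga using \<sigma> by (simp add: abs_mult)
    also have "\<dots> \<le> B * (4 / (\<sigma> * r\<^sup>2) * r)"
      by (intro mult_mono S'(2) n order_refl) (use S'(2)[of 0] \<sigma> r in auto)
    also have "\<dots> = 4 * B / (\<sigma> * r)" using r by (simp add: power2_eq_square)
    finally show ?thesis using True by simp
  next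
    case False
    then have "a x < 0 \<or> a x > 1" using inner outer by blast
    then have "S' (a x) = 0" by (rule S'(3))
    then show ?thesis using False by (simp add: gr)
  qed
  show "shell_cutoff x0 r \<sigma> \<in> test_functions (ball x0 r)"
  \<comment> \<open>On the sphere of this radius a = 0, so the cutoff already vanishes before the
    boundary of the ball is reached.\<close>
  proof (rule test_functionsI[OF sm, of "cball x0 (sqrt (1 - \<sigma> / 2) * r)"])
    have "sqrt (1 - \<sigma> / 2) * r < 1 * r" using \<sigma> r by (intro mult_strict_right_mono) auto
    then show "cball x0 (sqrt (1 - \<sigma> / 2) * r) \<subseteq> ball x0 r" by auto
    fix x assume "x \<notin> cball x0 (sqrt (1 - \<sigma> / 2) * r)"
    then have "sqrt (1 - \<sigma> / 2) \<le> norm (x - x0) / r" using r by (simp add: dist_norm norm_minus_commute field_simps)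
    then have "(sqrt (1 - \<sigma> / 2))\<^sup>2 \<le> (norm (x - x0) / r)\<^sup>2" using \<sigma> by (intro power_mono) auto
    then have "1 - (norm (x - x0) / r)\<^sup>2 \<le> \<sigma> / 2" using \<sigma> by simp
    then have "2 / \<sigma> * (1 - (norm (x - x0) / r)\<^sup>2) \<le> 2 / \<sigma> * (\<sigma> / 2)" using \<sigma> by (intro mult_left_mono) auto
    then have "a x \<le> 0" using \<sigma> by (simp add: a_eq)
    then show "shell_cutoff x0 r \<sigma> x = 0" unfolding cutoff_eq by (rule smooth_step_0)
  qed simp
qed


section \<open>Vanishing trace and approximation by test functions\<close>

lemma L2_indicator_ball_smooth:
  fixes x0 :: "'a::euclidean_space"
  assumes sm: "smooth \<psi>"
  shows "L2 (\<lambda>x. indicator (ball x0 r) x *\<^sub>R \<psi> x)" "L2 (\<lambda>x. indicator (ball x0 r) x *\<^sub>R gradient \<psi> x)"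
proof -
  define B where "B = ball x0 r"
  have [measurable]: "B \<in> sets borel" by (simp add: B_def)
  have bd: "bounded B" by (simp add: B_def)
  have [measurable]: "gradient \<psi> \<in> borel_measurable borel" "\<psi> \<in> borel_measurable borel"
    using gradient_borel_measurable[OF sm] smooth_borel_measurable[OF sm] by auto
  obtain M where M: "\<And>x. x \<in> cball x0 r \<Longrightarrow> \<bar>\<psi> x\<bar> \<le> M" "\<And>x. x \<in> cball x0 r \<Longrightarrow> norm (gradient \<psi> x) \<le> M" "M \<ge> 0"
    by (rule smooth_bounded_on_compact[OF sm compact_cball[of x0 r]]) (rule that)
  have "(norm (\<psi> x))\<^sup>2 \<le> M\<^sup>2" "(norm (gradient \<psi> x))\<^sup>2 \<le> M\<^sup>2" if "x \<in> B" for x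
  proof -
    have "x \<in> cball x0 r" using that by (simp add: B_def)
    from M(1)[OF this] M(2)[OF this] show "(norm (\<psi> x))\<^sup>2 \<le> M\<^sup>2" "(norm (gradient \<psi> x))\<^sup>2 \<le> M\<^sup>2"
      by (auto intro!: power_mono simp del: power2_abs real_norm_def simp: real_norm_def[symmetric])
  qed
  then have "integrable lborel (\<lambda>x. indicator B x *\<^sub>R (norm (\<psi> x))\<^sup>2)"
    "integrable lborel (\<lambda>x. indicator B x *\<^sub>R (norm (gradient \<psi> x))\<^sup>2)"
    by (intro integrable_indicator_bounded[where C="M\<^sup>2"] bd; simp)+
  then show "L2 (\<lambda>x. indicator (ball x0 r) x *\<^sub>R \<psi> x)" "L2 (\<lambda>x. indicator (ball x0 r) x *\<^sub>R gradient \<psi> x)"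
    unfolding L2_def norm_indicator_sq B_def[symmetric] by (auto intro: measurable)
qed

text \<open>In the limit only the gradient term of the shell estimate survives. Its factor
  \<sigma>^2 will compensate the \<sigma>^(-2) from the squared gradient of the cutoff.\<close>

lemma shell_limit_estimate:
  fixes x0 :: "'a::euclidean_space"
  assumes sm: "\<And>n. smooth (\<psi> n)" and r: "r > 0" and \<sigma>: "0 < \<sigma>" "\<sigma> \<le> 1/2"
    and f: "L2_lim (\<lambda>n x. indicator (ball x0 r) x *\<^sub>R \<psi> n x) f"
    and g: "L2_lim (\<lambda>n x. indicator (ball x0 r) x *\<^sub>R gradient (\<psi> n) x) g"
    and tr: "(\<lambda>n. LINT x|sphere_measure x0 r. (\<psi> n x)\<^sup>2) \<longlonglongrightarrow> 0"
  defines "Sh \<equiv> ball x0 r - ball x0 ((1 - \<sigma>) * r)"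
  shows "(LBINT x. indicator Sh x * (f x)\<^sup>2) \<le> 8 * \<sigma>\<^sup>2 * r\<^sup>2 * (LBINT x. indicator Sh x * (norm (g x))\<^sup>2)"
proof -
  have Sb: "Sh \<in> sets borel" by (simp add: Sh_def)
  have ind: "indicator Sh x *\<^sub>R indicator (ball x0 r) x *\<^sub>R v = indicator Sh x *\<^sub>R v" for x and v :: "'c::real_vector"
    by (auto simp: Sh_def indicator_def)
  have 1: "(\<lambda>n. \<integral>x. indicator Sh x * (\<psi> n x)\<^sup>2 \<partial>lborel) \<longlonglongrightarrow> (LBINT x. indicator Sh x * (f x)\<^sup>2)"
    using L2_lim_integral_sq[OF L2_lim_indicator[OF f Sb]]
    unfolding ind norm_indicator_sq by simp
  have 2: "(\<lambda>n. \<integral>x. indicator Sh x * (norm (gradient (\<psi> n) x))\<^sup>2 \<partial>lborel)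
    \<longlonglongrightarrow> (LBINT x. indicator Sh x * (norm (g x))\<^sup>2)"
    using L2_lim_integral_sq[OF L2_lim_indicator[OF g Sb]]
    unfolding ind norm_indicator_sq .
  have "(\<lambda>n. 2 * \<sigma> * r * (LINT x|sphere_measure x0 r. (\<psi> n x)\<^sup>2)
      + 8 * \<sigma>\<^sup>2 * r\<^sup>2 * (LBINT x. indicator Sh x * (norm (gradient (\<psi> n) x))\<^sup>2))
    \<longlonglongrightarrow> 2 * \<sigma> * r * 0 + 8 * \<sigma>\<^sup>2 * r\<^sup>2 * (LBINT x. indicator Sh x * (norm (g x))\<^sup>2)"
    by (intro tendsto_add tendsto_mult_left tr 2)
  from LIMSEQ_le[OF 1 this]
  show ?thesis using shell_estimate[OF sm r \<sigma>, of x0] unfolding Sh_def by auto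
qed

text \<open>A compactly supported cutoff turns approximants that are only smooth up to the boundary
  into test functions of the ball.\<close>

lemma sobolev0_shell_cutoff:
  fixes x0 :: "'a::euclidean_space"
  assumes sm: "\<And>n. smooth (\<psi> n)" and \<eta>: "\<eta> \<in> test_functions (ball x0 r)"
    and f: "L2_lim (\<lambda>n x. indicator (ball x0 r) x *\<^sub>R \<psi> n x) f"
    and g: "L2_lim (\<lambda>n x. indicator (ball x0 r) x *\<^sub>R gradient (\<psi> n) x) g"
  shows "sobolev0 (ball x0 r) (\<lambda>x. \<eta> x * f x) (\<lambda>x. f x *\<^sub>R gradient \<eta> x + \<eta> x *\<^sub>R g x)"
proof -
  define B where "B = ball x0 r"
  obtain S where S: "S \<subseteq> B" "\<And>x. x \<notin> S \<Longrightarrow> \<eta> x = 0" "\<And>x. x \<notin> S \<Longrightarrow> gradient \<eta> x = 0"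
    using test_functions_support[OF \<eta>] unfolding B_def by metis
  have z: "\<eta> x * indicator B x = \<eta> x" "indicator B x *\<^sub>R gradient \<eta> x = gradient \<eta> x" for x
    using S(1) S(2,3)[of x] by (cases "x \<in> S"; auto simp: indicator_def)+
  note s\<eta> = test_functions_smooth[OF \<eta>]
  have m\<eta>: "\<eta> \<in> borel_measurable borel" by (rule smooth_borel_measurable[OF s\<eta>])
  have [measurable]: "gradient \<eta> \<in> borel_measurable borel" by (rule gradient_borel_measurable[OF s\<eta>])
  obtain C where C: "\<And>x. \<bar>\<eta> x\<bar> \<le> C" "\<And>x. norm (gradient \<eta> x) \<le> C"
    using test_functions_bounded[OF \<eta>] by metis
  have T: "(\<lambda>x. \<psi> n x * \<eta> x) \<in> test_functions (ball x0 r)" for n by (rule test_functions_mult[OF \<eta> sm])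
  have grT: "gradient (\<lambda>x. \<psi> n x * \<eta> x) = (\<lambda>x. \<psi> n x *\<^sub>R gradient \<eta> x + \<eta> x *\<^sub>R gradient (\<psi> n) x)" for n
    by (rule ext) (rule gradient_mult[OF sm s\<eta>])
  have e1: "\<eta> x *\<^sub>R indicator B x *\<^sub>R v = \<eta> x *\<^sub>R v" for x and v :: "'c::real_vector"
    using z(1)[of x] by simp
  have l1: "L2_lim (\<lambda>n x. \<psi> n x * \<eta> x) (\<lambda>x. \<eta> x * f x)"
    using L2_lim_mult_bounded[OF f m\<eta> C(1)] unfolding B_def[symmetric] e1 by (simp add: mult.commute)
  have l2: "L2_lim (\<lambda>n x. \<eta> x *\<^sub>R gradient (\<psi> n) x) (\<lambda>x. \<eta> x *\<^sub>R g x)"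
    using L2_lim_mult_bounded[OF g m\<eta> C(1)] unfolding B_def[symmetric] e1 .
  have e3: "(indicator B x *\<^sub>R \<psi> n x) *\<^sub>R gradient \<eta> x = \<psi> n x *\<^sub>R gradient \<eta> x" for n x
  proof -
    have "(indicator B x *\<^sub>R \<psi> n x) *\<^sub>R gradient \<eta> x = \<psi> n x *\<^sub>R (indicator B x *\<^sub>R gradient \<eta> x)"
      by (simp add: mult.commute)
    then show ?thesis by (simp only: z(2))
  qed
  have "L2_lim (\<lambda>n x. (indicator B x *\<^sub>R \<psi> n x) *\<^sub>R gradient \<eta> x) (\<lambda>x. f x *\<^sub>R gradient \<eta> x)"
  proof (rule L2_lim_bound[OF f[folded B_def], where C=C])
    have L: "L2 (\<lambda>x. k x *\<^sub>R gradient \<eta> x)" if k: "L2 k" for k :: "'a \<Rightarrow> real"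
    proof (rule L2_norm_bound[OF k, where C=C])
      have [measurable]: "k \<in> borel_measurable borel" by (rule L2_measurable[OF k])
      show "(\<lambda>x. k x *\<^sub>R gradient \<eta> x) \<in> borel_measurable borel" by measurable
      show "norm (k x *\<^sub>R gradient \<eta> x) \<le> C * norm (k x)" for x
        using mult_right_mono[OF C(2), of "norm (k x)" x] by (simp add: mult.commute)
    qed
    show "L2 (\<lambda>x. (indicator B x *\<^sub>R \<psi> n x) *\<^sub>R gradient \<eta> x)" for n by (rule L[OF L2_limD(1)[OF f[folded B_def]]])
    show "L2 (\<lambda>x. f x *\<^sub>R gradient \<eta> x)" by (rule L[OF L2_limD(2)[OF f]])
    show "norm ((indicator B x *\<^sub>R \<psi> n x) *\<^sub>R gradient \<eta> x - f x *\<^sub>R gradient \<eta> x) \<le> C * norm (indicator B x *\<^sub>R \<psi> n x - f x)" for n x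
      unfolding scaleR_diff_left[symmetric] norm_scaleR
      using mult_right_mono[OF C(2), of "norm (indicator B x *\<^sub>R \<psi> n x - f x)" x] by (simp add: mult.commute)
  qed
  then have l3: "L2_lim (\<lambda>n x. \<psi> n x *\<^sub>R gradient \<eta> x) (\<lambda>x. f x *\<^sub>R gradient \<eta> x)" unfolding e3 .
  show ?thesis
    unfolding sobolev0_def
    by (rule exI[of _ "\<lambda>n x. \<psi> n x * \<eta> x"]) (use T l1 L2_lim_add[OF l3 l2] in \<open>auto simp: grT\<close>)
qed

text \<open>The only dangerous term in the gradient of \<eta>_n f is f times the gradient of
  \<eta>_n, of size |f|/(\<sigma>_n r) on the shell. The shell estimate bounds its square integral
  by a constant times that of g over the shell, which tends to 0.\<close>

lemma sobolev0_of_zero_trace: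
  fixes x0 :: "'a::euclidean_space"
  assumes sm: "\<And>n. smooth (\<psi> n)" and r: "r > 0"
    and f: "L2_lim (\<lambda>n x. indicator (ball x0 r) x *\<^sub>R \<psi> n x) f"
    and g: "L2_lim (\<lambda>n x. indicator (ball x0 r) x *\<^sub>R gradient (\<psi> n) x) g"
    and tr: "(\<lambda>n. LINT x|sphere_measure x0 r. (\<psi> n x)\<^sup>2) \<longlonglongrightarrow> 0"
    and out: "AE x in lborel. x \<notin> ball x0 r \<longrightarrow> f x = 0" "AE x in lborel. x \<notin> ball x0 r \<longrightarrow> g x = 0"
  shows "sobolev0 (ball x0 r) f g"
proof -
  obtain S' B where S': "\<And>t. (smooth_step has_real_derivative S' t) (at t)" "\<And>t. \<bar>S' t\<bar> \<le> B"
    "\<And>t. t < 0 \<or> t > 1 \<Longrightarrow> S' t = 0" "B > 0" by (rule smooth_step_derivative) blast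
  define \<sigma> :: "nat \<Rightarrow> real" where "\<sigma> n = 1 / real (n + 2)" for n
  have \<sigma>: "0 < \<sigma> n" "\<sigma> n \<le> 1/2" for n by (auto simp: \<sigma>_def field_simps)
  have \<sigma>0: "\<sigma> \<longlonglongrightarrow> 0" unfolding \<sigma>_def by real_asymp
  define \<eta> where "\<eta> n = shell_cutoff x0 r (\<sigma> n)" for n
  define Sh where "Sh n = ball x0 r - ball x0 ((1 - \<sigma> n) * r)" for n
  have P: "\<eta> n \<in> test_functions (ball x0 r)" "x \<in> ball x0 ((1 - \<sigma> n) * r) \<Longrightarrow> \<eta> n x = 1"
    "0 \<le> \<eta> n x" "\<eta> n x \<le> 1" "norm (gradient (\<eta> n) x) \<le> 4 * B / (\<sigma> n * r) * indicator (Sh n) x" for n x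
    unfolding \<eta>_def Sh_def by (rule shell_cutoff_properties[OF S'(1-3) r \<sigma>]; assumption?)+
  have [measurable]: "\<eta> n \<in> borel_measurable borel" "gradient (\<eta> n) \<in> borel_measurable borel" "Sh n \<in> sets borel" for n
    using smooth_borel_measurable gradient_borel_measurable test_functions_smooth[OF P(1)]
    by (auto simp: Sh_def)
  have Lf: "L2 f" and Lg: "L2 g" using f g by (auto dest: L2_limD)
  have [measurable]: "f \<in> borel_measurable borel" "g \<in> borel_measurable borel" using Lf Lg by (auto simp: L2_def)
  have ev: "\<forall>\<^sub>F n in sequentially. x \<in> ball x0 ((1 - \<sigma> n) * r)" if "x \<in> ball x0 r" for x
  proof -
    have "(\<lambda>n. (1 - \<sigma> n) * r) \<longlonglongrightarrow> (1 - 0) * r" by (intro tendsto_mult tendsto_diff tendsto_const \<sigma>0)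
    then have "\<forall>\<^sub>F n in sequentially. dist x0 x < (1 - \<sigma> n) * r" by (rule order_tendstoD(1)) (use that in simp)
    then show ?thesis by simp
  qed
  have \<eta>1: "(\<lambda>n. \<eta> n x) \<longlonglongrightarrow> 1" if "x \<in> ball x0 r" for x
    by (rule tendsto_eventually) (use ev[OF that] P(2) in \<open>auto elim!: eventually_mono\<close>)
  have b: "\<bar>\<eta> n x\<bar> \<le> 1" for n x using P(3,4)[of n x] by simp
  have l1: "L2_lim (\<lambda>n x. \<eta> n x * f x) f"
  proof (rule L2_lim_dominated[OF _ _ Lf])
    show "norm (\<eta> n x * f x) \<le> norm (f x)" for n x
      using mult_right_mono[OF b, of "\<bar>f x\<bar>" n x] by (simp add: abs_mult)
    show "AE x in lborel. (\<lambda>n. \<eta> n x * f x) \<longlonglongrightarrow> f x" using out(1)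
    proof eventually_elim
      case (elim x)
      show ?case
      proof (cases "x \<in> ball x0 r")
        case True from tendsto_mult_right[OF \<eta>1[OF True], of "f x"] show ?thesis by simp
      qed (use elim in simp)
    qed
  qed auto
  have l2: "L2_lim (\<lambda>n x. \<eta> n x *\<^sub>R g x) g"
  proof (rule L2_lim_dominated[OF _ _ Lg])
    show "norm (\<eta> n x *\<^sub>R g x) \<le> norm (g x)" for n x
      using mult_right_mono[OF b, of "norm (g x)" n x] by simp
    show "AE x in lborel. (\<lambda>n. \<eta> n x *\<^sub>R g x) \<longlonglongrightarrow> g x" using out(2)
    proof eventually_elim
      case (elim x)
      show ?case
      proof (cases "x \<in> ball x0 r")
        case True from tendsto_scaleR[OF \<eta>1[OF True] tendsto_const, of "g x"] show ?thesis by simp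
      qed (use elim in simp)
    qed
  qed auto
  have l4: "L2_lim (\<lambda>n x. indicator (Sh n) x *\<^sub>R g x) (\<lambda>x. 0)"
  proof (rule L2_lim_dominated[OF _ _ Lg])
    show "norm (indicator (Sh n) x *\<^sub>R g x) \<le> norm (g x)" for n x by (simp add: indicator_def)
    show "AE x in lborel. (\<lambda>n. indicator (Sh n) x *\<^sub>R g x) \<longlonglongrightarrow> 0"
    proof (rule AE_I2)
      fix x
      have "\<forall>\<^sub>F n in sequentially. x \<notin> Sh n"
      proof (cases "x \<in> ball x0 r")
        case True from ev[OF True] show ?thesis by eventually_elim (simp add: Sh_def)
      qed (simp add: Sh_def)
      then show "(\<lambda>n. indicator (Sh n) x *\<^sub>R g x) \<longlonglongrightarrow> 0"
        by (intro tendsto_eventually) (auto elim!: eventually_mono)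
    qed
  qed auto
  have gr_le: "(norm (f x *\<^sub>R gradient (\<eta> n) x))\<^sup>2 \<le> (4 * B / (\<sigma> n * r))\<^sup>2 * (indicator (Sh n) x * (f x)\<^sup>2)" for n x
  proof -
    have "(norm (gradient (\<eta> n) x))\<^sup>2 \<le> (4 * B / (\<sigma> n * r) * indicator (Sh n) x)\<^sup>2"
      by (rule power_mono[OF P(5)]) simp
    also have "\<dots> = (4 * B / (\<sigma> n * r))\<^sup>2 * indicator (Sh n) x"
      by (simp add: indicator_def)
    finally have "(norm (gradient (\<eta> n) x))\<^sup>2 * (f x)\<^sup>2 \<le> (4 * B / (\<sigma> n * r))\<^sup>2 * indicator (Sh n) x * (f x)\<^sup>2"
      by (rule mult_right_mono) simp
    then show ?thesis by (simp add: power_mult_distrib mult_ac)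
  qed
  have if2: "integrable lborel (\<lambda>x. indicator (Sh n) x * (f x)\<^sup>2)" for n
    using L2_indicator_integrable[OF Lf, of "Sh n"] by simp
  have l3: "L2_lim (\<lambda>n x. f x *\<^sub>R gradient (\<eta> n) x) (\<lambda>x. 0)"
  \<comment> \<open>The constant 128 is 16 times 8: the square of 4 B/(\<sigma> r) meets the factor
    8 of the shell estimate, and the powers of \<sigma> and r cancel.\<close>
  proof (rule L2_limI[where e="\<lambda>n. 128 * B\<^sup>2 * (LBINT x. (norm (indicator (Sh n) x *\<^sub>R g x))\<^sup>2)"])
    show L: "L2 (\<lambda>x. f x *\<^sub>R gradient (\<eta> n) x)" for n
      by (rule L2_bound[OF integrable_mult_right[OF if2] _ gr_le]) simp
    show "L2 (\<lambda>x. 0)" by (rule L2_zero)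
    fix n
    have "(LBINT x. (norm (f x *\<^sub>R gradient (\<eta> n) x - 0))\<^sup>2)
      \<le> (LBINT x. (4 * B / (\<sigma> n * r))\<^sup>2 * (indicator (Sh n) x * (f x)\<^sup>2))"
      unfolding diff_0_right by (rule integral_mono[OF L2_integrable[OF L] integrable_mult_right[OF if2] gr_le])
    also have "\<dots> = (4 * B / (\<sigma> n * r))\<^sup>2 * (LBINT x. indicator (Sh n) x * (f x)\<^sup>2)" by simp
    also have "\<dots> \<le> (4 * B / (\<sigma> n * r))\<^sup>2 * (8 * (\<sigma> n)\<^sup>2 * r\<^sup>2 * (LBINT x. indicator (Sh n) x * (norm (g x))\<^sup>2))"
      by (rule mult_left_mono[OF shell_limit_estimate[OF sm r \<sigma> f g tr, folded Sh_def]]) simp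
    also have "\<dots> = 128 * B\<^sup>2 * (LBINT x. (norm (indicator (Sh n) x *\<^sub>R g x))\<^sup>2)"
      unfolding norm_indicator_sq using \<sigma>(1)[of n] r by (simp add: power_mult_distrib power_divide)
    finally show "(LBINT x. (norm (f x *\<^sub>R gradient (\<eta> n) x - 0))\<^sup>2) \<le> \<dots>" .
  next
    have "(\<lambda>n. 128 * B\<^sup>2 * (LBINT x. (norm (indicator (Sh n) x *\<^sub>R g x))\<^sup>2)) \<longlonglongrightarrow> 128 * B\<^sup>2 * (\<integral>x. (norm (0::'a))\<^sup>2 \<partial>(lborel::'a measure))"
      by (intro tendsto_mult_left L2_lim_integral_sq[OF l4])
    then show "(\<lambda>n. 128 * B\<^sup>2 * (LBINT x. (norm (indicator (Sh n) x *\<^sub>R g x))\<^sup>2)) \<longlonglongrightarrow> 0" by simp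
  qed
  have "L2_lim (\<lambda>n x. f x *\<^sub>R gradient (\<eta> n) x + \<eta> n x *\<^sub>R g x) g"
    using L2_lim_add[OF l3 l2] by simp
  then show ?thesis by (rule sobolev0_closed[OF sobolev0_shell_cutoff[OF sm P(1) f g] l1])
qed

lemma has_trace_smooth_limit:
  fixes x0 :: "'a::euclidean_space"
  assumes rf: "represents (ball x0 r) f F" and rg: "represents (ball x0 r) g G"
    and L: "L2 f" "L2 g" and w: "weak_gradient_on (ball x0 r) F G" and t: "has_trace x0 r F T"
  obtains \<phi> where "\<And>n. smooth (\<phi> n)" "L2_lim (\<lambda>n x. indicator (ball x0 r) x *\<^sub>R \<phi> n x) f"
    "L2_lim (\<lambda>n x. indicator (ball x0 r) x *\<^sub>R gradient (\<phi> n) x) g"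
    "(\<lambda>n. LINT x|sphere_measure x0 r. (\<phi> n x - T x)\<^sup>2) \<longlonglongrightarrow> 0"
proof -
  obtain \<phi> where \<phi>: "\<And>n. smooth (\<phi> n)" "(\<lambda>n. H1_norm (ball x0 r) (\<lambda>x. \<phi> n x - F x)) \<longlonglongrightarrow> 0"
    "(\<lambda>n. LINT x|sphere_measure x0 r. (\<phi> n x - T x)\<^sup>2) \<longlonglongrightarrow> 0"
    using t unfolding has_trace_def by blast
  have "L2_lim (\<lambda>n x. indicator (ball x0 r) x *\<^sub>R \<phi> n x) f \<and> L2_lim (\<lambda>n x. indicator (ball x0 r) x *\<^sub>R gradient (\<phi> n) x) g"
    using H1_norm_tendsto_iff[OF open_ball w rf rg, of \<phi>, OF \<phi>(1)] \<phi>(2) L L2_indicator_ball_smooth[OF \<phi>(1)]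
    unfolding L2_lim_def by blast
  then show ?thesis using that \<phi> by blast
qed

lemma sphere_sq_integrable:
  fixes x0 :: "'a::euclidean_space"
  assumes sm: "smooth \<phi>" and r: "r > 0"
    and T: "T \<in> borel_measurable borel" "integrable (sphere_measure x0 r) (\<lambda>x. (T x)\<^sup>2)"
  shows "integrable (sphere_measure x0 r) (\<lambda>x. (\<phi> x - T x)\<^sup>2)"
proof (rule Bochner_Integration.integrable_bound)
  have [measurable]: "\<phi> \<in> borel_measurable borel" by (rule smooth_borel_measurable[OF sm])
  obtain M where M: "\<And>x. x \<in> cball x0 r \<Longrightarrow> \<bar>\<phi> x\<bar> \<le> M" "\<And>x. x \<in> cball x0 r \<Longrightarrow> norm (gradient \<phi> x) \<le> M" "M \<ge> 0"
    by (rule smooth_bounded_on_compact[OF sm compact_cball[of x0 r]]) (rule that)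
  have b: "norm ((\<phi> (radial x0 r x))\<^sup>2) \<le> M\<^sup>2" for x
  proof -
    have "\<bar>\<phi> (radial x0 r x)\<bar> \<le> M" using radial_in_cball[of r x0 x] r by (intro M(1)) auto
    from power_mono[OF this abs_ge_zero, of 2] show ?thesis by simp
  qed
  have "integrable lborel (\<lambda>x. indicator (ball x0 r) x *\<^sub>R (\<phi> (radial x0 r x))\<^sup>2)"
    by (rule integrable_indicator_bounded[OF _ _ bounded_ball b]) measurable
  then have "integrable (sphere_measure x0 r) (\<lambda>x. (\<phi> x)\<^sup>2)"
    by (subst sphere_integrable_integral(1)[OF r]) auto
  then show "integrable (sphere_measure x0 r) (\<lambda>x. 2 * (\<phi> x)\<^sup>2 + 2 * (T x)\<^sup>2)" using T(2) by simp
  have [measurable]: "T \<in> borel_measurable (sphere_measure x0 r)" "\<phi> \<in> borel_measurable (sphere_measure x0 r)"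
    using T(1) by (auto simp: sphere_measure_eq)
  show "(\<lambda>x. (\<phi> x - T x)\<^sup>2) \<in> borel_measurable (sphere_measure x0 r)" by measurable
  show "AE x in sphere_measure x0 r. norm ((\<phi> x - T x)\<^sup>2) \<le> norm (2 * (\<phi> x)\<^sup>2 + 2 * (T x)\<^sup>2)"
    using norm_diff_sq_le[of "\<phi> _" "T _"] by (intro AE_I2) simp
qed

text \<open>Both approximating sequences tend to T on the sphere, so their differences are smooth
  functions whose boundary values tend to 0.\<close>

lemma same_trace_sobolev0:
  fixes x0 :: "'a::euclidean_space"
  assumes r: "r > 0"
    and F: "represents (ball x0 r) f F" "represents (ball x0 r) g G" "L2 f" "L2 g" "weak_gradient_on (ball x0 r) F G"
    and F': "represents (ball x0 r) f' F'" "represents (ball x0 r) g' G'" "L2 f'" "L2 g'" "weak_gradient_on (ball x0 r) F' G'"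
    and t: "has_trace x0 r F T" "has_trace x0 r F' T"
  shows "sobolev0 (ball x0 r) (\<lambda>x. f x - f' x) (\<lambda>x. g x - g' x)"
proof -
  obtain \<phi> where \<phi>: "\<And>n. smooth (\<phi> n)" "L2_lim (\<lambda>n x. indicator (ball x0 r) x *\<^sub>R \<phi> n x) f"
    "L2_lim (\<lambda>n x. indicator (ball x0 r) x *\<^sub>R gradient (\<phi> n) x) g"
    "(\<lambda>n. LINT x|sphere_measure x0 r. (\<phi> n x - T x)\<^sup>2) \<longlonglongrightarrow> 0"
    by (rule has_trace_smooth_limit[OF F t(1)]) blast
  obtain \<phi>' where \<phi>': "\<And>n. smooth (\<phi>' n)" "L2_lim (\<lambda>n x. indicator (ball x0 r) x *\<^sub>R \<phi>' n x) f'"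
    "L2_lim (\<lambda>n x. indicator (ball x0 r) x *\<^sub>R gradient (\<phi>' n) x) g'"
    "(\<lambda>n. LINT x|sphere_measure x0 r. (\<phi>' n x - T x)\<^sup>2) \<longlonglongrightarrow> 0"
    by (rule has_trace_smooth_limit[OF F' t(2)]) blast
  have T: "T \<in> borel_measurable borel" "integrable (sphere_measure x0 r) (\<lambda>x. (T x)\<^sup>2)"
    using t(1) by (auto simp: has_trace_def sphere_measure_eq)
  note I = sphere_sq_integrable[OF \<phi>(1) r T] and I' = sphere_sq_integrable[OF \<phi>'(1) r T]
  define \<psi> where "\<psi> n x = \<phi> n x - \<phi>' n x" for n x
  have s\<psi>: "smooth (\<psi> n)" for n unfolding \<psi>_def by (rule smooth_diff[OF \<phi>(1) \<phi>'(1)])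
  have g\<psi>: "gradient (\<psi> n) x = gradient (\<phi> n) x - gradient (\<phi>' n) x" for n x
    unfolding \<psi>_def by (rule gradient_diff[OF \<phi>(1) \<phi>'(1)])
  show ?thesis
  proof (rule sobolev0_of_zero_trace[OF s\<psi> r])
    show "L2_lim (\<lambda>n x. indicator (ball x0 r) x *\<^sub>R \<psi> n x) (\<lambda>x. f x - f' x)"
      unfolding \<psi>_def scaleR_diff_right by (rule L2_lim_diff[OF \<phi>(2) \<phi>'(2)])
    show "L2_lim (\<lambda>n x. indicator (ball x0 r) x *\<^sub>R gradient (\<psi> n) x) (\<lambda>x. g x - g' x)"
      unfolding g\<psi> scaleR_diff_right by (rule L2_lim_diff[OF \<phi>(3) \<phi>'(3)])
    show "AE x in lborel. x \<notin> ball x0 r \<longrightarrow> f x - f' x = 0"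
      using represents_outside[OF F(1)] represents_outside[OF F'(1)] by eventually_elim auto
    show "AE x in lborel. x \<notin> ball x0 r \<longrightarrow> g x - g' x = 0"
      using represents_outside[OF F(2)] represents_outside[OF F'(2)] by eventually_elim auto
    show "(\<lambda>n. LINT x|sphere_measure x0 r. (\<psi> n x)\<^sup>2) \<longlonglongrightarrow> 0"
    proof (rule tendsto_sandwich[OF _ _ tendsto_const])
      show "\<forall>\<^sub>F n in sequentially. 0 \<le> (LINT x|sphere_measure x0 r. (\<psi> n x)\<^sup>2)"
        by (intro always_eventually allI Bochner_Integration.integral_nonneg) simp
      show "(\<lambda>n. 2 * (LINT x|sphere_measure x0 r. (\<phi> n x - T x)\<^sup>2) + 2 * (LINT x|sphere_measure x0 r. (\<phi>' n x - T x)\<^sup>2)) \<longlonglongrightarrow> 0"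
        using tendsto_add[OF tendsto_mult_left[OF \<phi>(4), of 2] tendsto_mult_left[OF \<phi>'(4), of 2]] by simp
      have "(LINT x|sphere_measure x0 r. (\<psi> n x)\<^sup>2)
        \<le> (LINT x|sphere_measure x0 r. 2 * (\<phi> n x - T x)\<^sup>2 + 2 * (\<phi>' n x - T x)\<^sup>2)" for n
      proof (rule integral_mono)
        show "integrable (sphere_measure x0 r) (\<lambda>x. (\<psi> n x)\<^sup>2)"
          using sphere_sq_integrable[OF s\<psi> r, of "\<lambda>x. 0"] by simp
        show "integrable (sphere_measure x0 r) (\<lambda>x. 2 * (\<phi> n x - T x)\<^sup>2 + 2 * (\<phi>' n x - T x)\<^sup>2)"
          using I I' by simp
        show "(\<psi> n x)\<^sup>2 \<le> 2 * (\<phi> n x - T x)\<^sup>2 + 2 * (\<phi>' n x - T x)\<^sup>2" for x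
          using norm_diff_sq_le[of "\<phi> n x - T x" "\<phi>' n x - T x"] by (simp add: \<psi>_def)
      qed
      then show "\<forall>\<^sub>F n in sequentially. (LINT x|sphere_measure x0 r. (\<psi> n x)\<^sup>2)
        \<le> 2 * (LINT x|sphere_measure x0 r. (\<phi> n x - T x)\<^sup>2) + 2 * (LINT x|sphere_measure x0 r. (\<phi>' n x - T x)\<^sup>2)"
        using I I' by simp
    qed
  qed
qed

section \<open>Almost minimality\<close>

text \<open>Cauchy-Schwarz against the indicator of the ball gives the factor r^N, and the Poincare
  inequality the factor r^2.\<close>

lemma integral_abs_ball_le:
  fixes x0 :: "'a::euclidean_space"
  assumes D: "sobolev0 (ball x0 r) D G" and r: "r > 0"
  shows "(LBINT x. \<bar>D x\<bar>)\<^sup>2 \<le> 4 * unit_ball_vol (DIM('a)) * r ^ (DIM('a) + 2) * (LBINT x. (norm (G x))\<^sup>2)"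
proof -
  define B where "B = ball x0 r"
  have [measurable]: "B \<in> sets borel" by (simp add: B_def)
  have mB: "measure lborel B = unit_ball_vol (DIM('a)) * r ^ DIM('a)" unfolding B_def by (rule content_ball) (use r in simp)
  have iB: "integrable lborel (indicator B :: 'a \<Rightarrow> real)"
    using emeasure_bounded_finite[OF bounded_ball[of x0 r]] by (intro integrable_real_indicator) (auto simp: B_def)
  have sq: "(norm (indicator B x :: real))\<^sup>2 = indicator B x" for x by (simp add: indicator_def)
  have LB: "L2 (indicator B :: 'a \<Rightarrow> real)" unfolding L2_def sq using iB by simp
  have LD: "L2 (\<lambda>x. \<bar>D x\<bar>)" using L2_norm[OF sobolev0_L2(1)[OF D]] by simp
  have [measurable]: "D \<in> borel_measurable borel" by (rule sobolev0_measurable(1)[OF D])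
  have "(LBINT x. \<bar>D x\<bar>) = (LBINT x. indicator B x \<bullet> \<bar>D x\<bar>)"
  proof (rule integral_cong_AE)
    show "AE x in lborel. \<bar>D x\<bar> = indicator B x \<bullet> \<bar>D x\<bar>"
      using sobolev0_AE_outside[OF D] by eventually_elim (auto simp: B_def indicator_def)
  qed measurable
  then have "(LBINT x. \<bar>D x\<bar>)\<^sup>2 \<le> (LBINT x. (norm (indicator B x :: real))\<^sup>2) * (LBINT x. (norm \<bar>D x\<bar>)\<^sup>2)"
    using L2_Cauchy_Schwarz[OF LB LD] by simp
  also have "\<dots> = unit_ball_vol (DIM('a)) * r ^ DIM('a) * (LBINT x. (D x)\<^sup>2)"
    unfolding sq using mB by simp
  also have "\<dots> \<le> unit_ball_vol (DIM('a)) * r ^ DIM('a) * (4 * r\<^sup>2 * (LBINT x. (norm (G x))\<^sup>2))"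
    using r by (intro mult_left_mono sobolev0_poincare[OF D r]) auto
  finally show ?thesis by (simp add: power_add power2_eq_square mult_ac)
qed

context segregated_minimizer
begin

text \<open>The mass lost or gained by the perturbation \<open>D\<close> on the ball is compensated by a multiple of
  \<open>\<phi>\<close> far from the ball; taking absolute values makes the competitor admissible without any
  smallness condition.\<close>

lemma competitor_energy_le:
  fixes D \<phi> :: "'b \<Rightarrow> 'a \<Rightarrow> real" and x0 r
  defines "B \<equiv> ball x0 r"
  defines "\<delta> \<equiv> \<lambda>i. (LBINT x. \<bar>u i x + D i x\<bar> - u i x)"
  assumes B: "B \<subseteq> \<Omega>"
    and D: "\<And>i. sobolev0 B (D i) (G i)"
    and seg: "\<And>i j. i \<noteq> j \<Longrightarrow> AE x in lborel. x \<in> B \<longrightarrow> u i x + D i x = 0 \<or> u j x + D j x = 0"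
    and \<phi>: "\<And>i. \<phi> i \<in> test_functions {x \<in> \<Omega>. u i x > 0}" "\<And>i x. 0 \<le> \<phi> i x"
      "\<And>i. (LBINT x. \<phi> i x) = 1" "\<And>i x. x \<in> B \<Longrightarrow> \<phi> i x = 0"
  shows "(\<Sum>i\<in>UNIV. energy i) \<le> (\<Sum>i\<in>UNIV. \<integral>x. (norm (g i x + G i x - \<delta> i *\<^sub>R gradient (\<phi> i) x))\<^sup>2 \<partial>lborel)"
proof -
  define w where "w i x = u i x + D i x - \<delta> i * \<phi> i x" for i x
  define k where "k i x = g i x + G i x - \<delta> i *\<^sub>R gradient (\<phi> i) x" for i x
  have test: "\<phi> i \<in> test_functions \<Omega>" for i by (rule test_functions_mono[OF _ \<phi>(1)]) auto
  have SD: "sobolev0 \<Omega> (D i) (G i)" for i by (rule sobolev0_mono[OF D B])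
  have SW: "sobolev0 \<Omega> (\<lambda>x. u i x + D i x) (\<lambda>x. g i x + G i x)" for i by (rule sobolev0_add[OF sobolev SD])
  have Sw: "sobolev0 \<Omega> (w i) (k i)" for i
    unfolding w_def k_def by (rule sobolev0_diff[OF SW sobolev0_cmult[OF sobolev0_test[OF test]]])
  note Sv = sobolev0_abs[OF Sw]
  have \<phi>z: "\<phi> i x = 0" if "\<not> u i x > 0" for i x
  proof -
    obtain S where S: "S \<subseteq> {x \<in> \<Omega>. u i x > 0}" "\<And>x. x \<notin> S \<Longrightarrow> \<phi> i x = 0"
      using test_functions_support[OF \<phi>(1)] by metis
    show ?thesis by (rule S(2)) (use S(1) that in blast)
  qed
  have "(\<Sum>i\<in>UNIV. energy i) \<le> (\<Sum>i\<in>UNIV. (LBINT x. (norm (sgn (w i x) *\<^sub>R k i x))\<^sup>2) / 1\<^sup>2)"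
  proof (rule minimal_scaled[OF Sv])
    fix i :: 'b
    show "AE x in lborel. 0 \<le> \<bar>w i x\<bar>" by simp
    show "1 \<le> (LBINT x. \<bar>w i x\<bar>)"
    proof -
      have iW: "integrable lborel (\<lambda>x. \<bar>u i x + D i x\<bar>)" using sobolev0_integrable[OF bounded_\<Omega> SW] by (rule integrable_abs)
      have iu: "integrable lborel (u i)" by (rule sobolev0_integrable[OF bounded_\<Omega> sobolev])
      have i\<phi>: "integrable lborel (\<phi> i)" by (rule sobolev0_integrable[OF bounded_\<Omega> sobolev0_test[OF test]])
      have "1 = (LBINT x. \<bar>u i x + D i x\<bar> - \<delta> i * \<phi> i x)"
        using iW iu i\<phi> mass[of i] \<phi>(3)[of i] by (simp add: \<delta>_def)
      also have "\<dots> \<le> (LBINT x. \<bar>w i x\<bar>)"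
      proof (rule integral_mono_AE)
        show "integrable lborel (\<lambda>x. \<bar>u i x + D i x\<bar> - \<delta> i * \<phi> i x)" using iW i\<phi> by simp
        show "integrable lborel (\<lambda>x. \<bar>w i x\<bar>)" using sobolev0_integrable[OF bounded_\<Omega> Sw] by (rule integrable_abs)
        \<comment> \<open>In the ball \<phi> vanishes and equality holds; elsewhere D vanishes and u
          \<ge> 0, so the left-hand side is w itself.\<close>
        show "AE x in lborel. \<bar>u i x + D i x\<bar> - \<delta> i * \<phi> i x \<le> \<bar>w i x\<bar>"
          using sobolev0_AE_outside[OF D[of i]]
        proof eventually_elim
          case (elim x)
          show ?case
          proof (cases "x \<in> B")
            case True then show ?thesis using \<phi>(4) by (simp add: w_def)
          next
            case False
            then have "D i x = 0" using elim by blast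
            then show ?thesis using nonneg[of i x] by (simp add: w_def)
          qed
        qed
      qed
      finally show ?thesis .
    qed
  next
    fix i j :: 'b assume ij: "i \<noteq> j"
    show "AE x in lborel. \<bar>w i x\<bar> = 0 \<or> \<bar>w j x\<bar> = 0"
      using seg[OF ij] sobolev0_AE_outside[OF D[of i]] sobolev0_AE_outside[OF D[of j]]
    proof eventually_elim
      case (elim x)
      show ?case
      proof (cases "x \<in> B")
        case True then show ?thesis using elim(1) \<phi>(4) by (simp add: w_def)
      next
        case False
        then have "D i x = 0" "D j x = 0" using elim(2,3) by blast+
        then show ?thesis using segregated[OF ij, of x] \<phi>z[of i x] \<phi>z[of j x] by (auto simp: w_def)
      qed
    qed
  qed simp
  also have "\<dots> \<le> (\<Sum>i\<in>UNIV. \<integral>x. (norm (k i x))\<^sup>2 \<partial>lborel)"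
  proof (rule sum_mono)
    fix i
    have "(LBINT x. (norm (sgn (w i x) *\<^sub>R k i x))\<^sup>2) \<le> (LBINT x. (norm (k i x))\<^sup>2)"
    proof (rule integral_mono)
      show "integrable lborel (\<lambda>x. (norm (sgn (w i x) *\<^sub>R k i x))\<^sup>2)" by (rule L2_integrable[OF sobolev0_L2(2)[OF Sv]])
      show "integrable lborel (\<lambda>x. (norm (k i x))\<^sup>2)" by (rule L2_integrable[OF sobolev0_L2(2)[OF Sw]])
      show "(norm (sgn (w i x) *\<^sub>R k i x))\<^sup>2 \<le> (norm (k i x))\<^sup>2" for x
        by (cases "w i x = 0") (auto simp: abs_sgn_eq)
    qed
    then show "(LBINT x. (norm (sgn (w i x) *\<^sub>R k i x))\<^sup>2) / 1\<^sup>2 \<le> (LBINT x. (norm (k i x))\<^sup>2)" by simp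
  qed
  finally show ?thesis unfolding k_def .
qed

text \<open>The corrections by \<phi>_i and the perturbation D_i live on disjoint sets, so the
  squares separate. The linear effect of the correction is -2 \<delta>_i E_i, and replacing
  \<delta>_i by the smaller integral of D_i only enlarges the right-hand side.\<close>

lemma competitor_local:
  fixes D \<phi> :: "'b \<Rightarrow> 'a \<Rightarrow> real" and x0 r
  defines "B \<equiv> ball x0 r"
  assumes B: "B \<subseteq> \<Omega>"
    and D: "\<And>i. sobolev0 B (D i) (G i)"
    and seg: "\<And>i j. i \<noteq> j \<Longrightarrow> AE x in lborel. x \<in> B \<longrightarrow> u i x + D i x = 0 \<or> u j x + D j x = 0"
    and \<phi>: "\<And>i. \<phi> i \<in> test_functions {x \<in> \<Omega>. u i x > 0}" "\<And>i x. 0 \<le> \<phi> i x"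
      "\<And>i. (LBINT x. \<phi> i x) = 1" "\<And>i x. x \<in> B \<Longrightarrow> \<phi> i x = 0"
  shows "(\<Sum>i\<in>UNIV. \<integral>x. indicator B x * (norm (g i x))\<^sup>2 \<partial>lborel)
    \<le> (\<Sum>i\<in>UNIV. (LBINT x. indicator B x * (norm (g i x + G i x))\<^sup>2) - 2 * energy i * (LBINT x. D i x)
        + (LBINT x. (norm (gradient (\<phi> i) x))\<^sup>2) * (LBINT x. \<bar>D i x\<bar>)\<^sup>2)"
proof -
  define \<delta> where "\<delta> i = (LBINT x. \<bar>u i x + D i x\<bar> - u i x)" for i
  have Bb: "B \<in> sets borel" "open B" by (simp_all add: B_def)
  have test: "\<phi> i \<in> test_functions \<Omega>" for i by (rule test_functions_mono[OF _ \<phi>(1)]) auto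
  have SD: "sobolev0 \<Omega> (D i) (G i)" for i by (rule sobolev0_mono[OF D B])
  have \<phi>z: "\<phi> i x = 0" if "u i x = 0" for i x
  proof -
    obtain S where S: "S \<subseteq> {x \<in> \<Omega>. u i x > 0}" "\<And>x. x \<notin> S \<Longrightarrow> \<phi> i x = 0"
      using test_functions_support[OF \<phi>(1)] by metis
    show ?thesis by (rule S(2)) (use S(1) that in force)
  qed
  have gz: "gradient (\<phi> i) x = 0" if "x \<in> B" for i x
  proof (rule gradient_eqI)
    have "((\<lambda>_. 0) has_derivative (\<lambda>h. 0)) (at x within B)" by simp
    then have "(\<phi> i has_derivative (\<lambda>h. 0)) (at x within B)"
      by (rule has_derivative_transform[OF that, rotated]) (rule \<phi>(4))
    then show "(\<phi> i has_derivative (\<lambda>h. 0 \<bullet> h)) (at x)" using at_within_open[OF that Bb(2)] by simp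
  qed
  have Lg: "L2 (g i)" "L2 (G i)" "L2 (\<lambda>x. g i x + G i x)" "L2 (gradient (\<phi> i))" for i
    using sobolev0_L2(2)[OF sobolev] sobolev0_L2(2)[OF D] L2_gradient_test[OF test] by (auto intro: L2_add)
  have Ei: "(LBINT x. (norm (g i x + G i x - \<delta> i *\<^sub>R gradient (\<phi> i) x))\<^sup>2)
    = energy i - (LBINT x. indicator B x * (norm (g i x))\<^sup>2) + (LBINT x. indicator B x * (norm (g i x + G i x))\<^sup>2)
      - 2 * \<delta> i * energy i + (\<delta> i)\<^sup>2 * (LBINT x. (norm (gradient (\<phi> i) x))\<^sup>2)" for i
  proof -
    have [measurable]: "g i \<in> borel_measurable borel" "G i \<in> borel_measurable borel" "gradient (\<phi> i) \<in> borel_measurable borel"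
      "B \<in> sets borel" using Lg[of i] Bb by (auto simp: L2_def)
    have I: "integrable lborel (\<lambda>x. (norm (g i x))\<^sup>2)" "integrable lborel (\<lambda>x. indicator B x * (norm (g i x))\<^sup>2)"
      "integrable lborel (\<lambda>x. indicator B x * (norm (g i x + G i x))\<^sup>2)" "integrable lborel (\<lambda>x. g i x \<bullet> gradient (\<phi> i) x)"
      "integrable lborel (\<lambda>x. (norm (gradient (\<phi> i) x))\<^sup>2)"
      using Lg[of i] Bb by (auto intro: L2_integrable L2_indicator_integrable L2_inner_integrable)
    \<comment> \<open>Here the unit mass of \<phi>_i enters: the pairing is exactly E_i.\<close>
    have EL: "(LBINT x. g i x \<bullet> gradient (\<phi> i) x) = energy i"
      using euler_lagrange[OF sobolev0_test[OF test[of i]], of i] \<phi>(2,3)[of i] \<phi>z[of i] by simp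
    have "(LBINT x. (norm (g i x + G i x - \<delta> i *\<^sub>R gradient (\<phi> i) x))\<^sup>2)
      = (LBINT x. (norm (g i x))\<^sup>2 - indicator B x * (norm (g i x))\<^sup>2 + indicator B x * (norm (g i x + G i x))\<^sup>2
         - 2 * \<delta> i * (g i x \<bullet> gradient (\<phi> i) x) + (\<delta> i)\<^sup>2 * (norm (gradient (\<phi> i) x))\<^sup>2)"
    proof (rule integral_cong_AE)
      show "AE x in lborel. (norm (g i x + G i x - \<delta> i *\<^sub>R gradient (\<phi> i) x))\<^sup>2
        = (norm (g i x))\<^sup>2 - indicator B x * (norm (g i x))\<^sup>2 + indicator B x * (norm (g i x + G i x))\<^sup>2
         - 2 * \<delta> i * (g i x \<bullet> gradient (\<phi> i) x) + (\<delta> i)\<^sup>2 * (norm (gradient (\<phi> i) x))\<^sup>2"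
        using sobolev0_AE_outside[OF D[of i]]
      proof eventually_elim
        case (elim x)
        show ?case
        proof (cases "x \<in> B")
          case True then show ?thesis by (simp add: gz)
        next
          case False
          then have "G i x = 0" using elim by blast
          then show ?thesis using False unfolding power2_norm_eq_inner
            by (simp add: inner_diff_left inner_diff_right inner_commute power2_eq_square)
        qed
      qed
    qed measurable
    also have "\<dots> = energy i - (LBINT x. indicator B x * (norm (g i x))\<^sup>2) + (LBINT x. indicator B x * (norm (g i x + G i x))\<^sup>2)
      - 2 * \<delta> i * energy i + (\<delta> i)\<^sup>2 * (LBINT x. (norm (gradient (\<phi> i) x))\<^sup>2)"
      using I EL by (simp add: energy_def)
    finally show ?thesis .
  qed
  have iD: "integrable lborel (D i)" "integrable lborel (u i)" for i
    by (rule sobolev0_integrable[OF bounded_\<Omega> SD], rule sobolev0_integrable[OF bounded_\<Omega> sobolev])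
  have i\<delta>: "integrable lborel (\<lambda>x. \<bar>u i x + D i x\<bar> - u i x)" for i using iD[of i] by simp
  have \<delta>_ge: "(LBINT x. D i x) \<le> \<delta> i" for i
    unfolding \<delta>_def by (rule integral_mono[OF iD(1) i\<delta>]) simp
  have "\<bar>\<delta> i\<bar> \<le> (LBINT x. \<bar>D i x\<bar>)" for i
  proof -
    have "\<bar>\<delta> i\<bar> \<le> (LBINT x. \<bar>\<bar>u i x + D i x\<bar> - u i x\<bar>)" unfolding \<delta>_def by (rule integral_abs_bound)
    also have "\<dots> \<le> (LBINT x. \<bar>D i x\<bar>)"
    proof (rule integral_mono[OF integrable_abs[OF i\<delta>] integrable_abs[OF iD(1)]])
      show "\<bar>\<bar>u i x + D i x\<bar> - u i x\<bar> \<le> \<bar>D i x\<bar>" for x using nonneg[of i x] by linarith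
    qed
    finally show ?thesis .
  qed
  from power_mono[OF this abs_ge_zero, where n=2] have \<delta>_sq: "(\<delta> i)\<^sup>2 \<le> (LBINT x. \<bar>D i x\<bar>)\<^sup>2" for i by simp
  define a where "a i = (LBINT x. indicator B x * (norm (g i x))\<^sup>2)" for i
  define b where "b i = (LBINT x. indicator B x * (norm (g i x + G i x))\<^sup>2)" for i
  define m where "m i = (LBINT x. (norm (gradient (\<phi> i) x))\<^sup>2)" for i
  have m0: "m i \<ge> 0" for i unfolding m_def by (rule Bochner_Integration.integral_nonneg) simp
  have "(\<Sum>i\<in>UNIV. energy i) \<le> (\<Sum>i\<in>UNIV. energy i - a i + b i - 2 * \<delta> i * energy i + (\<delta> i)\<^sup>2 * m i)"
    using competitor_energy_le[OF B[unfolded B_def] D[unfolded B_def] seg[unfolded B_def] \<phi>[unfolded B_def]]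
    unfolding \<delta>_def[symmetric] Ei a_def b_def m_def by simp
  then have "(\<Sum>i\<in>UNIV. a i) \<le> (\<Sum>i\<in>UNIV. b i - 2 * \<delta> i * energy i + (\<delta> i)\<^sup>2 * m i)"
    by (simp add: sum.distrib sum_subtractf)
  also have "\<dots> \<le> (\<Sum>i\<in>UNIV. b i - 2 * energy i * (LBINT x. D i x) + m i * (LBINT x. \<bar>D i x\<bar>)\<^sup>2)"
  proof (rule sum_mono)
    fix i
    have "energy i * (LBINT x. D i x) \<le> energy i * \<delta> i" by (rule mult_left_mono[OF \<delta>_ge energy_nonneg])
    moreover have "m i * (\<delta> i)\<^sup>2 \<le> m i * (LBINT x. \<bar>D i x\<bar>)\<^sup>2" by (rule mult_left_mono[OF \<delta>_sq m0])
    ultimately show "b i - 2 * \<delta> i * energy i + (\<delta> i)\<^sup>2 * m i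
      \<le> b i - 2 * energy i * (LBINT x. D i x) + m i * (LBINT x. \<bar>D i x\<bar>)\<^sup>2"
      by (simp add: mult_ac)
  qed
  finally show ?thesis unfolding a_def b_def m_def .
qed

text \<open>Unit mass provides a point where u_i > 0, and continuity a closed ball about it inside
  the positivity set.\<close>

lemma normalized_test_function:
  obtains \<phi> S where "\<phi> \<in> test_functions {x \<in> \<Omega>. u i x > 0}" "\<And>x. 0 \<le> \<phi> x" "(LBINT x. \<phi> x) = 1"
    "compact S" "S \<subseteq> {x \<in> \<Omega>. u i x > 0}" "\<And>x. x \<notin> S \<Longrightarrow> \<phi> x = 0"
proof -
  let ?P = "{x \<in> \<Omega>. u i x > 0}"
  have "\<exists>p. u i p > 0"
  proof (rule ccontr)
    assume "\<nexists>p. u i p > 0"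
    then have "u i x = 0" for x using nonneg[of i x] by (simp add: not_less order_antisym)
    then show False using mass[of i] by simp
  qed
  then obtain p where p: "u i p > 0" ..
  have "p \<in> \<Omega>" using outside[of p i] p by force
  have "?P = \<Omega> \<inter> u i -` {0<..}" by auto
  then have "open ?P" using continuous_open_preimage[OF cont open_\<Omega> open_greaterThan] by metis
  moreover have "p \<in> ?P" using p \<open>p \<in> \<Omega>\<close> by simp
  ultimately obtain s where s: "s > 0" "cball p s \<subseteq> ?P" using open_contains_cball by metis
  define b where "b x = bump ((1 / s) *\<^sub>R (x - p))" for x
  have b: "b \<in> test_functions ?P" unfolding b_def[abs_def] by (rule bump_scaled_test[OF s])
  have bpos: "0 \<le> b x" for x by (simp add: b_def bump_nonneg)
  have "(LBINT x. b x) = s ^ DIM('a) * (LBINT x. bump (x::'a))"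
    unfolding b_def by (rule integral_scaled) (use smooth_borel_measurable[OF smooth_bump] s in auto)
  moreover have "(LBINT x. bump (x::'a)) > 0"
  proof -
    have ib: "integrable lborel (bump :: 'a \<Rightarrow> real)" by (rule test_functions_integrable[OF bump_test])
    have "\<not> (AE x in (lborel :: 'a measure). bump x = 0)"
    proof
      assume "AE x in (lborel :: 'a measure). bump x = 0"
      then have "AE x in (lborel :: 'a measure). x \<notin> ball 0 1"
        by eventually_elim (use bump_pos in force)
      then have "ball (0::'a) 1 \<in> null_sets lborel" by (subst AE_iff_null_sets) auto
      then show False using content_ball_pos[of 1 "0::'a"] by (auto simp: measure_def)
    qed
    then have "(LBINT x. bump (x::'a)) \<noteq> 0"
      using integral_nonneg_eq_0_iff_AE[OF ib] by (simp add: bump_nonneg)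
    moreover have "(LBINT x. bump (x::'a)) \<ge> 0" by (rule Bochner_Integration.integral_nonneg) (rule bump_nonneg)
    ultimately show ?thesis by simp
  qed
  ultimately have m: "(LBINT x. b x) > 0" using s by simp
  show ?thesis
  proof (rule that[of "\<lambda>x. (1 / (LBINT x. b x)) * b x" "cball p s"])
    show "(\<lambda>x. (1 / (LBINT x. b x)) * b x) \<in> test_functions ?P" by (rule test_functions_cmult[OF b])
    show "0 \<le> (1 / (LBINT x. b x)) * b x" for x using bpos m by simp
    show "(LBINT x. (1 / (LBINT x. b x)) * b x) = 1" using m by simp
    show "cball p s \<subseteq> ?P" by (rule s)
    fix x assume "x \<notin> cball p s"
    then have "x \<notin> ball p s" by auto
    then have "b x = 0" unfolding b_def by (rule bump_scaled_zero[OF s(1)])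
    then show "(1 / (LBINT x. b x)) * b x = 0" by simp
  qed simp
qed


theorem almost_minimality:
  assumes K: "compact K" "K \<subseteq> \<Omega>"
  shows "\<exists>C>0. \<exists>r0>0. \<forall>x0\<in>K. \<forall>r D G. (\<forall>i. u i x0 = 0) \<longrightarrow> 0 < r \<longrightarrow> r < r0 \<longrightarrow>
    (\<forall>i. sobolev0 (ball x0 r) (D i) (G i)) \<longrightarrow>
    (\<forall>i j. i \<noteq> j \<longrightarrow> (AE x in lborel. x \<in> ball x0 r \<longrightarrow> u i x + D i x = 0 \<or> u j x + D j x = 0)) \<longrightarrow>
    cball x0 r \<subseteq> \<Omega> \<and>
    (\<Sum>i\<in>UNIV. \<integral>x. indicator (ball x0 r) x * (norm (g i x))\<^sup>2 \<partial>lborel)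
    \<le> (\<Sum>i\<in>UNIV. (LBINT x. indicator (ball x0 r) x * (norm (g i x + G i x))\<^sup>2) - 2 * energy i * (LBINT x. D i x))
      + C * r ^ (2 * DIM('a) + 1)"
proof -
  define test where "test i p S \<longleftrightarrow> p \<in> test_functions {x \<in> \<Omega>. u i x > 0} \<and> (\<forall>x. 0 \<le> p x) \<and> (LBINT x. p x) = 1 \<and>
    compact S \<and> S \<subseteq> {x \<in> \<Omega>. u i x > 0} \<and> (\<forall>x. x \<notin> S \<longrightarrow> p x = 0)" for i p S
  have "\<exists>p S. test i p S" for i
    unfolding test_def by (rule normalized_test_function[of i]) blast
  then obtain \<phi> S where "\<And>i. test i (\<phi> i) (S i)" by metis
  then have \<phi>: "\<phi> i \<in> test_functions {x \<in> \<Omega>. u i x > 0}" "0 \<le> \<phi> i x" "(LBINT x. \<phi> i x) = 1"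
    "compact (S i)" "S i \<subseteq> {x \<in> \<Omega>. u i x > 0}" "x \<notin> S i \<Longrightarrow> \<phi> i x = 0" for i x
    unfolding test_def by blast+
  define Z where "Z = {x \<in> K. \<forall>i. u i x = 0}"
  have "Z = K \<inter> (\<Inter>i. K \<inter> u i -` {0})" by (auto simp: Z_def)
  moreover have "closed (K \<inter> u i -` {0})" for i
    by (rule continuous_closed_preimage[OF continuous_on_subset[OF cont K(2)] compact_imp_closed[OF K(1)] closed_singleton])
  then have "closed (\<Inter>i. K \<inter> u i -` {0})" by (intro closed_INT ballI)
  ultimately have "compact Z" using compact_Int_closed[OF K(1)] by metis
  moreover have "closed (\<Union>i. S i)" by (intro closed_UN finite ballI compact_imp_closed \<phi>(4))
  moreover have "Z \<inter> (\<Union>i. S i) = {}" using \<phi>(5) by (force simp: Z_def)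
  \<comment> \<open>The zeros in K form a compact set disjoint from the supports S i, so one radius
    keeps every ball away from the correcting test functions.\<close>
  ultimately have "\<exists>d>0. \<forall>x\<in>Z. \<forall>y\<in>(\<Union>i. S i). d \<le> dist x y" by (rule separate_compact_closed)
  then obtain d1 where d1: "d1 > 0" "\<And>x y i. x \<in> Z \<Longrightarrow> y \<in> S i \<Longrightarrow> d1 \<le> dist x y" by blast
  have "closed (- \<Omega>)" "K \<inter> - \<Omega> = {}" using open_\<Omega> K(2) by auto
  with K(1) have "\<exists>d>0. \<forall>x\<in>K. \<forall>y\<in>-\<Omega>. d \<le> dist x y" by (rule separate_compact_closed)
  then obtain d2 where d2: "d2 > 0" "\<And>x y. x \<in> K \<Longrightarrow> y \<in> - \<Omega> \<Longrightarrow> d2 \<le> dist x y" by blast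
  obtain Ce re where Ce: "Ce > 0" "re > 0" "\<And>x0 r i. x0 \<in> K \<Longrightarrow> (\<And>i. u i x0 = 0) \<Longrightarrow> 0 < r \<Longrightarrow> r < re \<Longrightarrow>
       r\<^sup>2 * (LBINT x. indicator (ball x0 r) x * (norm (g i x))\<^sup>2) \<le> Ce * r ^ (DIM('a) + 1)"
    using energy_decay_at_zero[OF K] by blast
  define L where "L = (\<Sum>i\<in>UNIV. energy i)"
  have L: "energy i \<le> L" "0 \<le> energy i" for i
    unfolding L_def by (rule member_le_sum) (auto simp: energy_nonneg)
  define M where "M = (\<Sum>i\<in>UNIV. \<integral>x. (norm (gradient (\<phi> i) x))\<^sup>2 \<partial>lborel)"
  have M: "(LBINT x. (norm (gradient (\<phi> i) x))\<^sup>2) \<le> M" for i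
    unfolding M_def by (rule member_le_sum) (auto intro: Bochner_Integration.integral_nonneg)
  have M0: "M \<ge> 0" unfolding M_def by (intro sum_nonneg Bochner_Integration.integral_nonneg) simp
  have L0: "L \<ge> 0" using L(1,2) order_trans by blast
  define c where "c = 4 * unit_ball_vol (real DIM('a))"
  have c: "c > 0" by (simp add: c_def)
  define q where "q = real CARD('b)"
  have q: "q \<ge> 0" by (simp add: q_def)
  \<comment> \<open>M bounds the cost of the mass correction and c comes from the Poincare estimate.
    In the bracket, 8 q Ce stems from the energy decay at zeros and 16 q L^2 c from the mass term;
    the final 1 makes C positive.\<close>
  define C where "C = M * c * (8 * q * Ce + 16 * q * L\<^sup>2 * c) + 1"
  have C: "C > 0" unfolding C_def using M0 c q Ce(1) by (intro add_nonneg_pos) auto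
  define r0 where "r0 = min (min d1 d2) (min re 1)"
  have r0: "r0 > 0" using d1 d2 Ce by (simp add: r0_def)
  have main: "cball x0 r \<subseteq> \<Omega> \<and> (\<Sum>i\<in>UNIV. \<integral>x. indicator (ball x0 r) x * (norm (g i x))\<^sup>2 \<partial>lborel)
    \<le> (\<Sum>i\<in>UNIV. (LBINT x. indicator (ball x0 r) x * (norm (g i x + G i x))\<^sup>2) - 2 * energy i * (LBINT x. D i x))
      + C * r ^ (2 * DIM('a) + 1)"
    if x0: "x0 \<in> K" "\<And>i. u i x0 = 0" and r: "0 < r" "r < r0" and D: "\<And>i. sobolev0 (ball x0 r) (D i) (G i)"
      and seg: "\<And>i j. i \<noteq> j \<Longrightarrow> AE x in lborel. x \<in> ball x0 r \<longrightarrow> u i x + D i x = 0 \<or> u j x + D j x = 0"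
    for x0 r and D :: "'b \<Rightarrow> 'a \<Rightarrow> real" and G
  proof
    have r': "r < d1" "r < d2" "r < re" "r < 1" using r(2) by (auto simp: r0_def)
    show sub: "cball x0 r \<subseteq> \<Omega>" using d2(2)[OF x0(1)] r'(2) by force
    define B where "B = ball x0 r"
    have BO: "B \<subseteq> \<Omega>" using sub by (auto simp: B_def)
    have Bb: "B \<in> sets borel" by (simp add: B_def)
    define a where "a i = (LBINT x. indicator B x * (norm (g i x))\<^sup>2)" for i
    define b where "b i = (LBINT x. indicator B x * (norm (g i x + G i x))\<^sup>2)" for i
    define m where "m i = (LBINT x. D i x)" for i
    define d where "d i = (LBINT x. \<bar>D i x\<bar>)" for i
    define X where "X i = (LBINT x. (norm (G i x))\<^sup>2)" for i
    have d0: "0 \<le> d i" for i unfolding d_def by (rule Bochner_Integration.integral_nonneg) simp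
    have md: "m i \<le> d i" for i
      unfolding m_def d_def using integral_abs_bound[of lborel "D i"] by linarith
    define A where "A = c * r ^ (DIM('a) + 2)"
    have A: "A > 0" using c r by (simp add: A_def)
    have dX: "(d i)\<^sup>2 \<le> A * X i" for i
      using integral_abs_ball_le[OF D r(1), of i] unfolding d_def A_def X_def c_def by (simp add: mult_ac)
    have fz: "\<phi> i x = 0" if "x \<in> ball x0 r" for i x
    proof (rule \<phi>(6), rule notI)
      assume "x \<in> S i"
      moreover have "x0 \<in> Z" using x0 by (simp add: Z_def)
      ultimately have "d1 \<le> dist x0 x" by (intro d1(2))
      then show False using that r'(1) by simp
    qed
    have "(\<Sum>i\<in>UNIV. a i) \<le> (\<Sum>i\<in>UNIV. b i - 2 * energy i * m i + (LBINT x. (norm (gradient (\<phi> i) x))\<^sup>2) * (d i)\<^sup>2)"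
      using competitor_local[OF BO[unfolded B_def] D seg \<phi>(1-3) fz] unfolding a_def b_def m_def d_def B_def .
    also have "\<dots> \<le> (\<Sum>i\<in>UNIV. b i - 2 * energy i * m i + M * (A * X i))"
      by (intro sum_mono add_left_mono mult_mono M dX M0 zero_le_power2)
    also have "\<dots> = (\<Sum>i\<in>UNIV. b i - 2 * energy i * m i) + M * A * (\<Sum>i\<in>UNIV. X i)"
      by (simp add: sum.distrib sum_distrib_left mult.assoc)
    finally have step1: "(\<Sum>i\<in>UNIV. a i) \<le> (\<Sum>i\<in>UNIV. b i - 2 * energy i * m i) + M * A * (\<Sum>i\<in>UNIV. X i)" .
    have "(\<Sum>i\<in>UNIV. a i) \<le> (\<Sum>i\<in>UNIV. b i - 2 * energy i * m i) + C * r ^ (2 * DIM('a) + 1)"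
    \<comment> \<open>If the competitor does not beat u in the localized functional, the claim is
      immediate; otherwise its energy is controlled by that of u.\<close>
    proof (cases "(\<Sum>i\<in>UNIV. a i) \<le> (\<Sum>i\<in>UNIV. b i - 2 * energy i * m i)")
      case True
      moreover have "0 \<le> C * r ^ (2 * DIM('a) + 1)" using C r by simp
      ultimately show ?thesis by linarith
    next
      case False
      have "X i \<le> 2 * b i + 2 * a i" for i
      proof -
        have L2s: "L2 (g i)" "L2 (G i)" "L2 (\<lambda>x. g i x + G i x)"
          using sobolev0_L2(2)[OF sobolev] sobolev0_L2(2)[OF D] by (auto intro: L2_add)
        have "X i \<le> (LBINT x. 2 * (indicator B x * (norm (g i x + G i x))\<^sup>2) + 2 * (indicator B x * (norm (g i x))\<^sup>2))"
          unfolding X_def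
        proof (rule integral_mono_AE)
          show "integrable lborel (\<lambda>x. (norm (G i x))\<^sup>2)" by (rule L2_integrable[OF L2s(2)])
          show "integrable lborel (\<lambda>x. 2 * (indicator B x * (norm (g i x + G i x))\<^sup>2) + 2 * (indicator B x * (norm (g i x))\<^sup>2))"
            using L2_indicator_integrable[OF L2s(3) Bb] L2_indicator_integrable[OF L2s(1) Bb] by simp
          show "AE x in lborel. (norm (G i x))\<^sup>2
            \<le> 2 * (indicator B x * (norm (g i x + G i x))\<^sup>2) + 2 * (indicator B x * (norm (g i x))\<^sup>2)"
            using sobolev0_AE_outside[OF D[of i]]
          proof eventually_elim
            case (elim x)
            show ?case
            proof (cases "x \<in> B")
              case True then show ?thesis using norm_diff_sq_le[of "g i x + G i x" "g i x"] by simp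
            next
              case False
              then have "G i x = 0" using elim unfolding B_def by blast
              then show ?thesis by simp
            qed
          qed
        qed
        also have "\<dots> = 2 * b i + 2 * a i" unfolding a_def b_def
          using L2_indicator_integrable[OF L2s(3) Bb] L2_indicator_integrable[OF L2s(1) Bb] by simp
        finally show ?thesis .
      qed
      then have "(\<Sum>i\<in>UNIV. X i) \<le> (\<Sum>i\<in>UNIV. 2 * b i + 2 * a i)" by (rule sum_mono)
      also have "\<dots> = 2 * (\<Sum>i\<in>UNIV. b i - 2 * energy i * m i) + 4 * (\<Sum>i\<in>UNIV. energy i * m i) + 2 * (\<Sum>i\<in>UNIV. a i)"
        by (simp add: sum.distrib sum_subtractf sum_distrib_left mult.assoc)
      also have "\<dots> \<le> 4 * (\<Sum>i\<in>UNIV. a i) + 4 * (\<Sum>i\<in>UNIV. energy i * m i)" using False by linarith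
      \<comment> \<open>Young's inequality, weighted with A because (d i)^2 \<le> A X i, leaves half
        of the Dirichlet integral X i to be absorbed on the left.\<close>
      also have "4 * (\<Sum>i\<in>UNIV. energy i * m i) \<le> (\<Sum>i\<in>UNIV. 8 * L\<^sup>2 * A + X i / 2)"
        unfolding sum_distrib_left
      proof (rule sum_mono)
        fix i
        have "energy i * m i \<le> L * d i"
          by (rule order_trans[OF mult_left_mono[OF md L(2)] mult_right_mono[OF L(1) d0]])
        moreover have "8 * A * (L * d i) \<le> 16 * L\<^sup>2 * A\<^sup>2 + (d i)\<^sup>2"
          using zero_le_power2[of "4 * L * A - d i"] by (simp add: power2_diff power_mult_distrib mult_ac)
        then have "2 * A * (4 * (L * d i)) \<le> 2 * A * (8 * L\<^sup>2 * A + X i / 2)"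
          using dX[of i] by (simp add: algebra_simps power2_eq_square)
        then have "4 * (L * d i) \<le> 8 * L\<^sup>2 * A + X i / 2" using A by simp
        ultimately show "4 * (energy i * m i) \<le> 8 * L\<^sup>2 * A + X i / 2" by linarith
      qed
      also have "(\<Sum>i\<in>(UNIV::'b set). 8 * L\<^sup>2 * A + X i / 2) = q * (8 * L\<^sup>2 * A) + (\<Sum>i\<in>UNIV. X i) / 2"
        by (simp add: sum.distrib sum_divide_distrib q_def)
      finally have XL: "(\<Sum>i\<in>UNIV. X i) \<le> 8 * (\<Sum>i\<in>UNIV. a i) + 16 * q * L\<^sup>2 * A" by simp
      have "r\<^sup>2 * (\<Sum>i\<in>UNIV. a i) \<le> q * (Ce * r ^ (DIM('a) + 1))"
      proof -
        have "(\<Sum>i\<in>UNIV. r\<^sup>2 * a i) \<le> (\<Sum>i\<in>(UNIV::'b set). Ce * r ^ (DIM('a) + 1))"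
          unfolding a_def B_def by (intro sum_mono Ce(3) x0 r r')
        then show ?thesis by (simp add: sum_distrib_left q_def)
      qed
      then have "r ^ DIM('a) * (r\<^sup>2 * (\<Sum>i\<in>UNIV. a i)) \<le> r ^ DIM('a) * (q * (Ce * r ^ (DIM('a) + 1)))"
        using r by (intro mult_left_mono) auto
      moreover have rN: "r ^ (2 * DIM('a) + 1) = r ^ DIM('a) * r ^ (DIM('a) + 1)"
        unfolding power_add[symmetric] by (rule arg_cong[where f="power r"]) simp
      ultimately have e1: "A * (8 * (\<Sum>i\<in>UNIV. a i)) \<le> c * (8 * q * Ce) * r ^ (2 * DIM('a) + 1)"
        unfolding rN using c by (simp add: A_def power_add power2_eq_square mult_ac)
      \<comment> \<open>The contribution of the mass term is of higher order, and r < 1 reduces it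
        to the required power.\<close>
      have "r ^ (2 * DIM('a) + 4) \<le> r ^ (2 * DIM('a) + 1)" by (rule power_decreasing) (use r r' in auto)
      then have "c * (16 * q * L\<^sup>2 * c) * r ^ (2 * DIM('a) + 4) \<le> c * (16 * q * L\<^sup>2 * c) * r ^ (2 * DIM('a) + 1)"
        using c q by (intro mult_left_mono) auto
      moreover have "A * (16 * q * L\<^sup>2 * A) = c * (16 * q * L\<^sup>2 * c) * r ^ (2 * DIM('a) + 4)"
      proof -
        have "r ^ (2 * DIM('a) + 4) = r ^ (DIM('a) + 2) * r ^ (DIM('a) + 2)"
          unfolding power_add[symmetric] by (rule arg_cong[where f="power r"]) simp
        then show ?thesis by (simp add: A_def mult_ac)
      qed
      ultimately have e2: "A * (16 * q * L\<^sup>2 * A) \<le> c * (16 * q * L\<^sup>2 * c) * r ^ (2 * DIM('a) + 1)" by (simp only:)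
      have "A * (\<Sum>i\<in>UNIV. X i) \<le> A * (8 * (\<Sum>i\<in>UNIV. a i) + 16 * q * L\<^sup>2 * A)"
        by (rule mult_left_mono[OF XL]) (use A in simp)
      also have "\<dots> \<le> c * (8 * q * Ce + 16 * q * L\<^sup>2 * c) * r ^ (2 * DIM('a) + 1)"
        using e1 e2 by (simp add: distrib_left distrib_right)
      finally have "M * (A * (\<Sum>i\<in>UNIV. X i)) \<le> M * (c * (8 * q * Ce + 16 * q * L\<^sup>2 * c) * r ^ (2 * DIM('a) + 1))"
        by (rule mult_left_mono[OF _ M0])
      also have "\<dots> \<le> C * r ^ (2 * DIM('a) + 1)" using r by (simp add: C_def distrib_right mult.assoc)
      finally show ?thesis using step1 by (simp add: mult.assoc)
    qed
    then show "(\<Sum>i\<in>UNIV. \<integral>x. indicator (ball x0 r) x * (norm (g i x))\<^sup>2 \<partial>lborel)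
    \<le> (\<Sum>i\<in>UNIV. (LBINT x. indicator (ball x0 r) x * (norm (g i x + G i x))\<^sup>2) - 2 * energy i * (LBINT x. D i x))
      + C * r ^ (2 * DIM('a) + 1)"
      unfolding a_def b_def m_def B_def .
  qed
  show ?thesis by (rule exI[of _ C], rule conjI[OF C], rule exI[of _ r0], rule conjI[OF r0], intro ballI allI impI, rule main) blast+
qed

end

section \<open>The minimization problem\<close>

lemma AE_lebesgue_on_iff:
  "A \<in> sets borel \<Longrightarrow> (AE x in lebesgue_on A. P x) \<longleftrightarrow> (AE x in lborel. x \<in> A \<longrightarrow> P x)"
  by (subst AE_restrict_space_iff) (auto simp: AE_completion_iff)

text \<open>A nonempty open set is not negligible. For a continuous u this upgrades sign and
  segregation from almost every point to every point.\<close>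

lemma open_AE_empty:
  fixes S :: "'a::euclidean_space set"
  assumes S: "open S" and ae: "AE x in lborel. x \<notin> S"
  shows "S = {}"
proof (rule ccontr)
  assume "S \<noteq> {}"
  have "AE x in lebesgue. x \<notin> S" using ae by (simp only: AE_completion_iff)
  then have "S \<in> null_sets lebesgue" using S by (subst AE_iff_null_sets) auto
  then have "negligible S" by (simp add: negligible_iff_null_sets)
  then show False using open_not_negligible[OF S \<open>S \<noteq> {}\<close>] by simp
qed

lemma Sigma_k_iff: "\<xi> \<in> Sigma_k \<longleftrightarrow> (\<forall>i j. i \<noteq> j \<longrightarrow> \<xi> $ i = 0 \<or> \<xi> $ j = 0)"
proof -
  have "\<xi> \<in> Sigma_k \<longleftrightarrow> (\<forall>p\<in>{(i, j). i \<noteq> j}. (case p of (i, j) \<Rightarrow> (\<xi> $ i)\<^sup>2 * (\<xi> $ j)\<^sup>2) = 0)"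
    unfolding Sigma_k_def mem_Collect_eq by (rule sum_nonneg_eq_0_iff) auto
  then show ?thesis by auto
qed

lemma represents_comp:
  assumes "represents A f F" "k \<in> borel_measurable borel" "k 0 = 0"
  shows "represents A (\<lambda>x. k (f x)) (\<lambda>x. k (F x))"
proof -
  have [measurable]: "f \<in> borel_measurable borel" "k \<in> borel_measurable borel" using assms by (auto simp: represents_def)
  have "AE x in lborel. k (f x) = (if x \<in> A then k (F x) else 0)"
    using assms(1,3) by (auto simp: represents_def elim!: eventually_mono)
  then show ?thesis unfolding represents_def by simp
qed

lemma represents_sum:
  assumes "\<And>i. i \<in> I \<Longrightarrow> represents A (f i) (F i)" "finite I"
  shows "represents A (\<lambda>x. \<Sum>i\<in>I. f i x) (\<lambda>x. \<Sum>i\<in>I. F i x)"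
proof -
  have "AE x in lborel. \<forall>i\<in>I. f i x = (if x \<in> A then F i x else 0)"
    by (rule AE_finite_allI[OF assms(2)]) (use assms(1) in \<open>simp add: represents_def\<close>)
  then have "AE x in lborel. (\<Sum>i\<in>I. f i x) = (if x \<in> A then (\<Sum>i\<in>I. F i x) else 0)"
    by eventually_elim simp
  moreover have "(\<lambda>x. \<Sum>i\<in>I. f i x) \<in> borel_measurable borel"
    using assms(1) by (intro borel_measurable_sum) (simp add: represents_def)
  ultimately show ?thesis unfolding represents_def by blast
qed

lemma represents_norm_sq:
  "represents A f F \<Longrightarrow> represents A (\<lambda>x. (norm (f x))\<^sup>2) (\<lambda>x. (norm (F x))\<^sup>2)"
  by (rule represents_comp) auto

lemma represents_grad_sq:
  assumes "\<And>i. represents A (h i) (grad A (\<lambda>x. v x $ i))"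
  shows "represents A (\<lambda>x. \<Sum>i\<in>UNIV. (norm (h i x))\<^sup>2) (grad_sq A v)"
  unfolding grad_sq_def[abs_def] by (rule represents_sum) (auto intro: represents_norm_sq assms)

lemma sobolev0_represents:
  assumes A: "open A" and f: "sobolev0 A f g" and eq: "AE x in lborel. x \<in> A \<longrightarrow> F x = f x"
  shows "represents A f F" "represents A g (grad A F)"
proof -
  have out: "AE x in lborel. x \<notin> A \<longrightarrow> f x = 0" "AE x in lborel. x \<notin> A \<longrightarrow> g x = 0"
    using sobolev0_AE_outside[OF f] by (auto elim!: eventually_mono)
  show "represents A f F" by (rule representsI[OF sobolev0_measurable(1)[OF f] eq out(1)])
  show "represents A g (grad A F)"
    by (rule representsI[OF sobolev0_measurable(2)[OF f] grad_sobolev0[OF A f eq] out(2)])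
qed

lemma AE_abs_eq: "AE x in M. 0 \<le> f x \<Longrightarrow> AE x in M. \<bar>f x\<bar> = (f x :: real)"
  by (auto elim!: eventually_mono)

text \<open>The Borel version of each component is u_i itself extended by zero, so that pointwise
  statements survive. Conversely, the competitors of the locale are assembled into one vector-valued
  map and shown to be admissible for (P).\<close>

lemma minimizer_segregated_minimizer:
  fixes \<Omega> :: "'a::euclidean_space set" and u :: "'a \<Rightarrow> real ^ 'k"
  assumes \<Omega>: "open \<Omega>" "bounded \<Omega>" and u: "minimizer_P \<Omega> u" and cont: "continuous_on \<Omega> u"
  defines "U \<equiv> \<lambda>i x. indicator \<Omega> x *\<^sub>R (u x $ i)"
  obtains g where "segregated_minimizer \<Omega> U g" "\<And>i. represents \<Omega> (g i) (grad \<Omega> (\<lambda>x. u x $ i))"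
proof -
  have \<Omega>b: "\<Omega> \<in> sets borel" using \<Omega>(1) by simp
  have ad: "\<And>i. (\<lambda>x. u x $ i) \<in> H10 \<Omega>" "AE x in lebesgue_on \<Omega>. u x \<in> Sigma_k"
    "\<And>i. AE x in lebesgue_on \<Omega>. 0 \<le> u x $ i" "\<And>i. (LINT x|lebesgue_on \<Omega>. \<bar>u x $ i\<bar>) = 1"
    using u by (auto simp: minimizer_P_def admissible_P_def H10_Sigma_def)
  have minu: "(LINT x|lebesgue_on \<Omega>. grad_sq \<Omega> u x) \<le> (LINT x|lebesgue_on \<Omega>. grad_sq \<Omega> v x)"
    if "v \<in> admissible_P \<Omega>" for v :: "'a \<Rightarrow> real ^ 'k"
    using u that by (auto simp: minimizer_P_def)
  have cu: "continuous_on \<Omega> (\<lambda>x. u x $ i)" for i by (intro continuous_on_component cont)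
  have Um: "U i \<in> borel_measurable borel" for i
    unfolding U_def by (rule borel_measurable_continuous_on_indicator[OF \<Omega>b cu])
  have "\<exists>f g. sobolev0 \<Omega> f g \<and> represents \<Omega> f (\<lambda>x. u x $ i) \<and> represents \<Omega> g (grad \<Omega> (\<lambda>x. u x $ i))" for i
    by (rule H10_sobolev0[OF \<Omega>(1) ad(1)]) blast
  then have "\<exists>g. sobolev0 \<Omega> (U i) g \<and> represents \<Omega> g (grad \<Omega> (\<lambda>x. u x $ i))" for i
  proof -
    obtain f g where fg: "sobolev0 \<Omega> f g" "represents \<Omega> f (\<lambda>x. u x $ i)" "represents \<Omega> g (grad \<Omega> (\<lambda>x. u x $ i))"
      using \<open>\<And>i. \<exists>f g. sobolev0 \<Omega> f g \<and> represents \<Omega> f (\<lambda>x. u x $ i) \<and> represents \<Omega> g (grad \<Omega> (\<lambda>x. u x $ i))\<close>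
      by blast
    have "AE x in lborel. f x = U i x"
      using represents_AE[OF fg(2)] represents_outside[OF fg(2)]
    proof eventually_elim
      case (elim x) then show ?case by (cases "x \<in> \<Omega>") (auto simp: U_def)
    qed
    then show ?thesis using sobolev0_cong_fun[OF fg(1) Um] fg(3) by blast
  qed
  then obtain g where g: "\<And>i. sobolev0 \<Omega> (U i) (g i)" "\<And>i. represents \<Omega> (g i) (grad \<Omega> (\<lambda>x. u x $ i))"
    by metis
  have nn: "0 \<le> u x $ i" if x: "x \<in> \<Omega>" for x i
  proof -
    have "open {x \<in> \<Omega>. u x $ i < 0}"
      using continuous_open_preimage[OF cu[of i] \<Omega>(1) open_lessThan[of 0]] by (simp add: vimage_def Int_def)
    moreover have "AE x in lborel. x \<notin> {x \<in> \<Omega>. u x $ i < 0}"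
      using ad(3)[of i] unfolding AE_lebesgue_on_iff[OF \<Omega>b] by eventually_elim auto
    ultimately have "{x \<in> \<Omega>. u x $ i < 0} = {}" by (rule open_AE_empty)
    then show ?thesis using x by force
  qed
  have seg: "u x $ i = 0 \<or> u x $ j = 0" if x: "x \<in> \<Omega>" and ij: "i \<noteq> j" for x i j
  proof -
    have "open {x \<in> \<Omega>. u x $ i * u x $ j \<in> - {0}}"
      using continuous_open_preimage[OF continuous_on_mult[OF cu[of i] cu[of j]] \<Omega>(1), of "- {0}"]
      by (simp add: vimage_def Int_def open_Compl)
    moreover have "AE x in lborel. x \<notin> {x \<in> \<Omega>. u x $ i * u x $ j \<in> - {0}}"
      using ad(2) unfolding AE_lebesgue_on_iff[OF \<Omega>b] by eventually_elim (use ij in \<open>auto simp: Sigma_k_iff\<close>)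
    ultimately have "{x \<in> \<Omega>. u x $ i * u x $ j \<in> - {0}} = {}" by (rule open_AE_empty)
    then show ?thesis using x by auto
  qed
  have "segregated_minimizer \<Omega> U g"
  proof
    show "open \<Omega>" "bounded \<Omega>" by (rule \<Omega>)+
    show "sobolev0 \<Omega> (U i) (g i)" for i by (rule g)
    show "continuous_on \<Omega> (U i)" for i
      by (rule continuous_on_eq[OF cu]) (simp add: U_def)
    show "0 \<le> U i x" for i x using nn by (simp add: U_def indicator_def)
    show "x \<notin> \<Omega> \<Longrightarrow> U i x = 0" for i x by (simp add: U_def)
    show "i \<noteq> j \<Longrightarrow> U i x = 0 \<or> U j x = 0" for i j x using seg[of x i j] by (auto simp: U_def indicator_def)
    show "(LBINT x. U i x) = 1" for i
    proof -
      have "represents \<Omega> (U i) (\<lambda>x. \<bar>u x $ i\<bar>)"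
        by (rule representsI[OF Um]) (auto simp: U_def nn)
      from represents_integrable_integral(2)[OF \<Omega>b this] show ?thesis using ad(4)[of i] by simp
    qed
    fix v :: "'k \<Rightarrow> 'a \<Rightarrow> real" and h
    assume v: "\<And>i. sobolev0 \<Omega> (v i) (h i)" "\<And>i. AE x in lborel. 0 \<le> v i x"
      "\<And>i j. i \<noteq> j \<Longrightarrow> AE x in lborel. v i x = 0 \<or> v j x = 0" "\<And>i. (LBINT x. v i x) = 1"
    define V where "V x = (\<chi> i. v i x)" for x
    have V: "(\<lambda>x. V x $ i) = v i" for i by (simp add: V_def)
    note R = sobolev0_represents[OF \<Omega>(1) v(1), of "v _", simplified]
    have "V \<in> admissible_P \<Omega>"
      unfolding admissible_P_def H10_Sigma_def mem_Collect_eq AE_lebesgue_on_iff[OF \<Omega>b] V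
    proof (intro conjI allI)
      show "v i \<in> H10 \<Omega>" for i by (rule sobolev0_H10[OF \<Omega>(1) v(1)[of i]]) simp
      have "AE x in lborel. \<forall>p\<in>{(i, j). i \<noteq> j}. v (fst p) x = 0 \<or> v (snd p) x = 0"
        by (rule AE_finite_allI) (auto intro: v(3))
      then show "AE x in lborel. x \<in> \<Omega> \<longrightarrow> V x \<in> Sigma_k"
        by eventually_elim (auto simp: Sigma_k_iff V_def)
      show "AE x in lborel. x \<in> \<Omega> \<longrightarrow> 0 \<le> V x $ i" for i
        using v(2)[of i] by eventually_elim (simp add: V_def)
      show "(LINT x|lebesgue_on \<Omega>. \<bar>V x $ i\<bar>) = 1" for i
      proof -
        have "represents \<Omega> (\<lambda>x. \<bar>v i x\<bar>) (\<lambda>x. \<bar>V x $ i\<bar>)"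
          unfolding V_def using represents_comp[OF R(1), where k=abs] by simp
        from represents_integrable_integral(2)[OF \<Omega>b this]
        have "(LINT x|lebesgue_on \<Omega>. \<bar>V x $ i\<bar>) = (LBINT x. \<bar>v i x\<bar>)" .
        also have "\<dots> = (LBINT x. v i x)"
          by (rule integral_cong_AE) (use AE_abs_eq[OF v(2)] sobolev0_measurable(1)[OF v(1)] in auto)
        finally show ?thesis using v(4) by simp
      qed
    qed
    from minu[OF this]
    have "(LBINT x. (\<Sum>i\<in>UNIV. (norm (g i x))\<^sup>2)) \<le> (LBINT x. (\<Sum>i\<in>UNIV. (norm (h i x))\<^sup>2))"
      using represents_integrable_integral(2)[OF \<Omega>b represents_grad_sq[where v=u, OF g(2)]]
        represents_integrable_integral(2)[OF \<Omega>b represents_grad_sq[where v=V and h=h]] R(2) unfolding V by simp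
    then show "(\<Sum>i\<in>UNIV. \<integral>x. (norm (g i x))\<^sup>2 \<partial>lborel) \<le> (\<Sum>i\<in>UNIV. \<integral>x. (norm (h i x))\<^sup>2 \<partial>lborel)"
      using L2_integrable[OF sobolev0_L2(2)[OF g(1)]] L2_integrable[OF sobolev0_L2(2)[OF v(1)]] by simp
  qed
  then show ?thesis using that g(2) by blast
qed

text \<open>The infimum is attained at u_i, because u_i lies in the Sobolev space of its own
  positivity set; minimality in (P) gives the matching lower bound.\<close>

lemma (in segregated_minimizer) lambda21_eq_energy: "lambda21 {x \<in> \<Omega>. u i x > 0} = energy i"
proof -
  let ?P = "{x \<in> \<Omega>. u i x > 0}"
  have "?P = \<Omega> \<inter> u i -` {0<..}" by auto
  then have P: "open ?P" using continuous_open_preimage[OF cont open_\<Omega> open_greaterThan] by metis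
  then have Pb: "?P \<in> sets borel" by simp
  note S = sobolev_positivity_set[of i]
  note R = sobolev0_represents[OF P S, of "u i", simplified]
  show ?thesis unfolding lambda21_def
  proof (rule cInf_eq_minimum)
    have "u i \<in> H10 ?P" by (rule sobolev0_H10[OF P S]) simp
    moreover have "(LINT x|lebesgue_on ?P. \<bar>u i x\<bar>) = 1"
      using represents_integrable_integral(2)[OF Pb represents_comp[OF R(1), where k=abs]] mass[of i] nonneg[of i] by simp
    moreover have "energy i = (LINT x|lebesgue_on ?P. (norm (grad ?P (u i) x))\<^sup>2)"
      unfolding energy_def using represents_integrable_integral(2)[OF Pb represents_norm_sq[OF R(2)]] by simp
    ultimately show "energy i \<in> {LINT x|lebesgue_on ?P. (norm (grad ?P v x))\<^sup>2 |v.
            v \<in> H10 ?P \<and> (LINT x|lebesgue_on ?P. \<bar>v x\<bar>) = 1}" by blast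
    fix e assume "e \<in> {LINT x|lebesgue_on ?P. (norm (grad ?P v x))\<^sup>2 |v.
            v \<in> H10 ?P \<and> (LINT x|lebesgue_on ?P. \<bar>v x\<bar>) = 1}"
    then obtain v where v: "e = (LINT x|lebesgue_on ?P. (norm (grad ?P v x))\<^sup>2)" "v \<in> H10 ?P"
      "(LINT x|lebesgue_on ?P. \<bar>v x\<bar>) = 1" by blast
    obtain f h where fh: "sobolev0 ?P f h" "represents ?P f v" "represents ?P h (grad ?P v)"
      by (rule H10_sobolev0[OF P v(2)])
    have "(LBINT x. \<bar>f x\<bar>) = 1"
      using represents_integrable_integral(2)[OF Pb represents_comp[OF fh(2), where k=abs]] v(3) by simp
    from energy_le[OF fh(1) this] show "energy i \<le> e"
      unfolding v(1) using represents_integrable_integral(2)[OF Pb represents_norm_sq[OF fh(3)]] by simp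
  qed
qed


text \<open>The perturbation is w - u on the ball, extended by zero; equality of traces places its
  components in \<open>sobolev0\<close>. Since \<Lambda> consists of the energies, almost minimality
  then gives the estimate once the integrals over the ball are rewritten with Borel
  representatives.\<close>

theorem proposition1p6:
  fixes \<Omega> K :: "(real ^ 'n) set"
    and u :: "real ^ 'n \<Rightarrow> real ^ 'k"
    and \<Lambda> :: "real ^ 'k"
  assumes dim: "CARD('n) \<ge> 2"
    and domain: "bounded_smooth_domain \<Omega>"
    and minimizer: "minimizer_P \<Omega> u"
    and continuous_representative: "continuous_on \<Omega> u"
    and Lambda: "\<Lambda> = (\<chi> i. lambda21 {x \<in> \<Omega>. u x $ i > 0})"
    and K: "compact K" "K \<subseteq> \<Omega>"
  shows "\<exists>C>0. \<exists>r0>0. \<forall>x0 \<in> zero_set \<Omega> u \<inter> K. \<forall>r. 0 < r \<and> r < r0 \<longrightarrow>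
           (\<forall>w \<in> H1_Sigma (ball x0 r). same_trace x0 r w u \<longrightarrow>
              (LINT x|lebesgue_on (ball x0 r). grad_sq \<Omega> u x - 2 * (\<Lambda> \<bullet> u x))
              \<le> (LINT x|lebesgue_on (ball x0 r). grad_sq (ball x0 r) w x - 2 * (\<Lambda> \<bullet> w x))
                + C * r ^ (2 * CARD('n) + 1))"
proof -
  have \<Omega>: "open \<Omega>" "bounded \<Omega>" using domain by (auto simp: bounded_smooth_domain_def)
  define U where "U i x = indicator \<Omega> x *\<^sub>R (u x $ i)" for i x
  obtain g where sm: "segregated_minimizer \<Omega> U g" and rg: "\<And>i. represents \<Omega> (g i) (grad \<Omega> (\<lambda>x. u x $ i))"
    using minimizer_segregated_minimizer[OF \<Omega> minimizer continuous_representative] unfolding U_def by blast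
  interpret segregated_minimizer \<Omega> U g by (rule sm)
  have "{x \<in> \<Omega>. u x $ i > 0} = {x \<in> \<Omega>. U i x > 0}" for i by (auto simp: U_def)
  then have \<Lambda>: "\<Lambda> $ i = energy i" for i using lambda21_eq_energy[of i] by (simp add: Lambda)
  have \<Lambda>_inner: "2 * (\<Lambda> \<bullet> v) = (\<Sum>i\<in>UNIV. 2 * energy i * v $ i)" for v
    by (simp add: inner_vec_def \<Lambda> sum_distrib_left mult.assoc)
  define Q where "Q C r0 x0 r D G \<longleftrightarrow> (\<forall>i. U i x0 = 0) \<longrightarrow> 0 < r \<longrightarrow> r < r0 \<longrightarrow>
      (\<forall>i. sobolev0 (ball x0 r) (D i) (G i)) \<longrightarrow>
      (\<forall>i j. i \<noteq> j \<longrightarrow> (AE x in lborel. x \<in> ball x0 r \<longrightarrow> U i x + D i x = 0 \<or> U j x + D j x = 0)) \<longrightarrow>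
      cball x0 r \<subseteq> \<Omega> \<and>
      (\<Sum>i\<in>UNIV. \<integral>x. indicator (ball x0 r) x * (norm (g i x))\<^sup>2 \<partial>lborel)
      \<le> (\<Sum>i\<in>UNIV. (LBINT x. indicator (ball x0 r) x * (norm (g i x + G i x))\<^sup>2) - 2 * energy i * (LBINT x. D i x))
        + C * r ^ (2 * DIM(real ^ 'n) + 1)" for C r0 x0 r D G
  have "\<exists>C>0. \<exists>r0>0. \<forall>x0\<in>K. \<forall>r D G. Q C r0 x0 r D G"
    unfolding Q_def by (rule almost_minimality[OF K])
  then obtain C r0 where C: "C > 0" "r0 > 0" and am: "\<And>x0 r D G. x0 \<in> K \<Longrightarrow> Q C r0 x0 r D G" by blast
  have main: "(LINT x|lebesgue_on (ball x0 r). grad_sq \<Omega> u x - 2 * (\<Lambda> \<bullet> u x))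
              \<le> (LINT x|lebesgue_on (ball x0 r). grad_sq (ball x0 r) w x - 2 * (\<Lambda> \<bullet> w x))
                + C * r ^ (2 * CARD('n) + 1)"
    if x0: "x0 \<in> zero_set \<Omega> u \<inter> K" and r: "0 < r" "r < r0" and w: "w \<in> H1_Sigma (ball x0 r)" and tr: "same_trace x0 r w u"
    for x0 r and w :: "real ^ 'n \<Rightarrow> real ^ 'k"
  proof -
    define B where "B = ball x0 r"
    have B: "open B" "B \<in> sets borel" by (simp_all add: B_def)
    have x0': "x0 \<in> K" "\<forall>i. U i x0 = 0" using x0 by (auto simp: zero_set_def U_def)
    \<comment> \<open>The zero perturbation serves to read off the inclusion of the ball before w is
      considered.\<close>
    have "cball x0 r \<subseteq> \<Omega>"
      using am[OF x0'(1), of r "\<lambda>i x. 0" "\<lambda>i x. 0"] x0'(2) r segregated by (simp add: Q_def sobolev0_zero)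
    then have B\<Omega>: "B \<subseteq> \<Omega>" by (auto simp: B_def)
    have wi: "(\<lambda>x. w x $ i) \<in> H1 B" for i using w by (simp add: H1_Sigma_def B_def)
    have "\<exists>f h. represents B f (\<lambda>x. w x $ i) \<and> represents B h (grad B (\<lambda>x. w x $ i)) \<and> L2 f \<and> L2 h
      \<and> weak_gradient_on B (\<lambda>x. w x $ i) (grad B (\<lambda>x. w x $ i))" for i
      by (rule H1E[OF B(1) wi[of i]]) blast
    then obtain f h where fh: "\<And>i. represents B (f i) (\<lambda>x. w x $ i)" "\<And>i. represents B (h i) (grad B (\<lambda>x. w x $ i))"
      "\<And>i. L2 (f i)" "\<And>i. L2 (h i)" "\<And>i. weak_gradient_on B (\<lambda>x. w x $ i) (grad B (\<lambda>x. w x $ i))"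
      by metis
    define f' where "f' i x = indicator B x *\<^sub>R U i x" for i x
    define h' where "h' i x = indicator B x *\<^sub>R g i x" for i x
    have uU: "AE x in lborel. x \<in> B \<longrightarrow> u x $ i = U i x" for i
      by (rule AE_I2) (use B\<Omega> in \<open>auto simp: U_def indicator_def\<close>)
    have LU: "L2 (U i)" "L2 (g i)" for i by (rule sobolev0_L2[OF sobolev])+
    have f': "represents B (f' i) (\<lambda>x. u x $ i)" for i
      unfolding f'_def by (rule represents_indicator[OF L2_measurable[OF LU(1)] B(2) uU])
    have h': "represents B (h' i) (g i)" for i
      unfolding h'_def by (rule represents_indicator[OF L2_measurable[OF LU(2)] B(2)]) simp
    have L': "L2 (f' i)" "L2 (h' i)" for i
      unfolding f'_def h'_def by (rule L2_indicator[OF LU(1) B(2)], rule L2_indicator[OF LU(2) B(2)])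
    \<comment> \<open>The gradient of u is taken with respect to \<Omega> and that of w with respect
      to the ball; g i is a weak gradient of u_i on both sets.\<close>
    have wu: "weak_gradient_on B (\<lambda>x. u x $ i) (g i)" for i
      by (rule weak_gradient_on_sobolev0[OF B(1) sobolev uU])
    define D where "D i x = f i x - f' i x" for i x
    define G where "G i x = h i x - h' i x" for i x
    have D: "sobolev0 B (D i) (G i)" for i
    proof -
      obtain T where T: "has_trace x0 r (\<lambda>x. w x $ i) T" "has_trace x0 r (\<lambda>x. u x $ i) T"
        using tr unfolding same_trace_def by blast
      show ?thesis unfolding D_def G_def B_def
        by (rule same_trace_sobolev0[OF r(1) fh(1-5)[of i, unfolded B_def] f'[of i, unfolded B_def] h'[of i, unfolded B_def]
              L'[of i] wu[of i, unfolded B_def] T])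
    qed
    have seg: "AE x in lborel. x \<in> B \<longrightarrow> U i x + D i x = 0 \<or> U j x + D j x = 0" if ij: "i \<noteq> j" for i j
    proof -
      have "AE x in lborel. x \<in> B \<longrightarrow> w x \<in> Sigma_k"
        using w unfolding H1_Sigma_def mem_Collect_eq B_def by (subst AE_lebesgue_on_iff[symmetric]) auto
      then show ?thesis using represents_AE[OF fh(1)[of i]] represents_AE[OF fh(1)[of j]]
      proof eventually_elim
        case (elim x)
        show ?case
        proof
          assume x: "x \<in> B"
          then have "w x $ i = 0 \<or> w x $ j = 0" using elim(1) ij unfolding Sigma_k_iff by blast
          then show "U i x + D i x = 0 \<or> U j x + D j x = 0" using elim(2,3) x by (auto simp: D_def f'_def)
        qed
      qed
    qed
    have I: "integrable lborel (\<lambda>x. indicator B x * (norm (g i x))\<^sup>2)"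
      "integrable lborel (\<lambda>x. indicator B x * (norm (g i x + G i x))\<^sup>2)"
      "integrable lborel (f' i)" "integrable lborel (D i)" for i
    proof -
      have "L2 (\<lambda>x. g i x + G i x)" by (rule L2_add[OF LU(2) sobolev0_L2(2)[OF D]])
      then show "integrable lborel (\<lambda>x. indicator B x * (norm (g i x + G i x))\<^sup>2)"
        by (rule L2_indicator_integrable[OF _ B(2)])
      show "integrable lborel (\<lambda>x. indicator B x * (norm (g i x))\<^sup>2)" by (rule L2_indicator_integrable[OF LU(2) B(2)])
      have "integrable lborel (U i)" by (rule sobolev0_integrable[OF \<Omega>(2) sobolev])
      then show "integrable lborel (f' i)" unfolding f'_def by (rule integrable_mult_indicator[rotated]) (use B(2) in simp)
      show "integrable lborel (D i)" by (rule sobolev0_integrable[OF _ D]) (simp add: B_def)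
    qed
    have Dm: "D i \<in> borel_measurable borel" "G i \<in> borel_measurable borel" "f' i \<in> borel_measurable borel"
      "g i \<in> borel_measurable borel" for i
      using L'[of i] LU[of i] sobolev0_measurable[OF D[of i]] by (auto simp: L2_def)
    have ru: "represents B (\<lambda>x. \<Sum>i\<in>UNIV. indicator B x * (norm (g i x))\<^sup>2 - 2 * energy i * f' i x)
      (\<lambda>x. \<Sum>i\<in>UNIV. (norm (grad \<Omega> (\<lambda>x. u x $ i) x))\<^sup>2 - 2 * energy i * u x $ i)"
    proof (rule represents_sum[OF representsI])
      fix i
      note [measurable] = Dm[of i] B(2)
      show "(\<lambda>x. indicator B x * (norm (g i x))\<^sup>2 - 2 * energy i * f' i x) \<in> borel_measurable borel" by measurable
      show "AE x in lborel. x \<in> B \<longrightarrow> (norm (grad \<Omega> (\<lambda>x. u x $ i) x))\<^sup>2 - 2 * energy i * u x $ i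
        = indicator B x * (norm (g i x))\<^sup>2 - 2 * energy i * f' i x"
        using represents_AE[OF rg[of i]] uU[of i] by eventually_elim (use B\<Omega> in \<open>auto simp: f'_def\<close>)
    qed (auto simp: f'_def)
    have rw: "represents B (\<lambda>x. \<Sum>i\<in>UNIV. indicator B x * (norm (g i x + G i x))\<^sup>2 - 2 * energy i * (f' i x + D i x))
      (\<lambda>x. \<Sum>i\<in>UNIV. (norm (grad B (\<lambda>x. w x $ i) x))\<^sup>2 - 2 * energy i * w x $ i)"
    proof (rule represents_sum[OF representsI])
      fix i
      note [measurable] = Dm[of i] B(2)
      show "(\<lambda>x. indicator B x * (norm (g i x + G i x))\<^sup>2 - 2 * energy i * (f' i x + D i x)) \<in> borel_measurable borel"
        by measurable
      show "AE x in lborel. x \<in> B \<longrightarrow> (norm (grad B (\<lambda>x. w x $ i) x))\<^sup>2 - 2 * energy i * w x $ i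
        = indicator B x * (norm (g i x + G i x))\<^sup>2 - 2 * energy i * (f' i x + D i x)"
        using represents_AE[OF fh(2)[of i]] represents_AE[OF fh(1)[of i]]
        by eventually_elim (auto simp: D_def G_def h'_def)
      show "AE x in lborel. x \<notin> B \<longrightarrow> indicator B x * (norm (g i x + G i x))\<^sup>2 - 2 * energy i * (f' i x + D i x) = 0"
        using represents_outside[OF fh(1)[of i]] by eventually_elim (auto simp: D_def f'_def)
    qed simp
    have "(LINT x|lebesgue_on B. grad_sq \<Omega> u x - 2 * (\<Lambda> \<bullet> u x))
      = (\<Sum>i\<in>UNIV. (LBINT x. indicator B x * (norm (g i x))\<^sup>2) - 2 * energy i * (LBINT x. f' i x))"
      using represents_integrable_integral(2)[OF B(2) ru] I
      unfolding grad_sq_def \<Lambda>_inner sum_subtractf[symmetric] by simp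
    moreover have "(LINT x|lebesgue_on B. grad_sq B w x - 2 * (\<Lambda> \<bullet> w x))
      = (\<Sum>i\<in>UNIV. (LBINT x. indicator B x * (norm (g i x + G i x))\<^sup>2)
          - 2 * energy i * ((LBINT x. f' i x) + (LBINT x. D i x)))"
      using represents_integrable_integral(2)[OF B(2) rw] I
      unfolding grad_sq_def \<Lambda>_inner sum_subtractf[symmetric] by simp
    moreover have "(\<Sum>i\<in>UNIV. \<integral>x. indicator B x * (norm (g i x))\<^sup>2 \<partial>lborel)
      \<le> (\<Sum>i\<in>UNIV. (LBINT x. indicator B x * (norm (g i x + G i x))\<^sup>2) - 2 * energy i * (LBINT x. D i x))
        + C * r ^ (2 * CARD('n) + 1)"
      using am[OF x0'(1), of r D G] x0'(2) r D seg by (simp add: Q_def B_def)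
    ultimately show ?thesis unfolding B_def[symmetric]
      by (simp add: sum_subtractf distrib_left sum.distrib)
  qed
  show ?thesis by (rule exI[of _ C], rule conjI[OF C(1)], rule exI[of _ r0], rule conjI[OF C(2)], intro ballI allI impI, rule main) blast+
qed

end
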